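(* A non-trivial finite-dimensional real Lie algebra $\mathfrak g$ with derived algebra $\mathfrak k=\mathfrak g'=[\mathfrak g,\mathfrak g]$ is $(2,3)$-trivial if and only if $\mathfrak g$ is solvable, $\mathfrak k$ is nilpotent of codimension $1$ in $\mathfrak g$, and $H^1(\mathfrak k)^{\mathfrak g}=\{0\}=H^2(\mathfrak k)^{\mathfrak g}=H^3(\mathfrak k)^{\mathfrak g}$.
   Context: $H^n(\cdot)$ is Lie algebra cohomology with trivial real coefficients and $b_n=\dim H^n$. A Lie algebra $\mathfrak g$ is $(2,3)$-trivial if $b_2(\mathfrak g)=0=b_3(\mathfrak g)$. Since $\mathfrak k$ is an ideal of $\mathfrak g$, $\mathfrak g$ acts on $H^i(\mathfrak k)$ (with $\mathfrak k$ acting trivially); $H^i(\mathfrak k)^{\mathfrak g}$ denotes the subspace of elements annihilated by this action of $\mathfrak g$. *)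

theory Defs
  imports "HOL-Analysis.Analysis" "HOL-Library.Function_Algebras"
begin

text \<open>Pointwise real vector space structure on functions; addition comes from
  \<^theory>\<open>HOL-Library.Function_Algebras\<close>. Cochains are elements of such a function space.\<close>

instantiation "fun" :: (type, real_vector) real_vector
begin

definition scaleR_fun :: "real \<Rightarrow> ('a \<Rightarrow> 'b) \<Rightarrow> 'a \<Rightarrow> 'b"
  where "scaleR_fun r f = (\<lambda>x. r *\<^sub>R f x)"

instance
  by standard (auto simp: scaleR_fun_def fun_eq_iff algebra_simps)

end

definition affine_coset :: "'v::real_vector set \<Rightarrow> 'v \<Rightarrow> 'v set"
  where "affine_coset W v = (+) v ` W"

definition quotient_space :: "'v::real_vector set \<Rightarrow> 'v set \<Rightarrow> 'v set set"
  where "quotient_space V W = affine_coset W ` V"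

text \<open>The dimension of the quotient of \<open>V\<close> by \<open>W\<close> is the least size of a spanning set of it,
  the spanning sets being given by representatives in \<open>V\<close>: the cosets of the elements of
  \<open>span S\<close> are the linear combinations of the cosets of the elements of \<open>S\<close>.
  Meaningful only if the quotient is finite-dimensional.\<close>

definition quotient_dim :: "'v::real_vector set \<Rightarrow> 'v set \<Rightarrow> nat"
  where "quotient_dim V W =
    (LEAST n. \<exists>S. S \<subseteq> V \<and> finite S \<and> card S = n \<and> affine_coset W ` span S = quotient_space V W)"

text \<open>A real Lie algebra is a subspace \<open>g\<close> of an ambient real vector space; only the
  values of \<open>br\<close> on \<open>g\<close> matter.\<close>

locale real_lie_algebra =
  fixes g :: "'a::real_vector set"
    and br :: "'a \<Rightarrow> 'a \<Rightarrow> 'a"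
  assumes subspace: "subspace g"
    and closed: "\<lbrakk>x \<in> g; y \<in> g\<rbrakk> \<Longrightarrow> br x y \<in> g"
    and add_left: "\<lbrakk>x \<in> g; y \<in> g; z \<in> g\<rbrakk> \<Longrightarrow> br (x + y) z = br x z + br y z"
    and add_right: "\<lbrakk>x \<in> g; y \<in> g; z \<in> g\<rbrakk> \<Longrightarrow> br x (y + z) = br x y + br x z"
    and scale_left: "\<lbrakk>x \<in> g; y \<in> g\<rbrakk> \<Longrightarrow> br (r *\<^sub>R x) y = r *\<^sub>R br x y"
    and scale_right: "\<lbrakk>x \<in> g; y \<in> g\<rbrakk> \<Longrightarrow> br x (r *\<^sub>R y) = r *\<^sub>R br x y"
    and alternating: "x \<in> g \<Longrightarrow> br x x = 0"
    and jacobi: "\<lbrakk>x \<in> g; y \<in> g; z \<in> g\<rbrakk> \<Longrightarrow>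
      br x (br y z) + br y (br z x) + br z (br x y) = 0"

definition finite_dimensional :: "'v::real_vector set \<Rightarrow> bool"
  where "finite_dimensional V \<longleftrightarrow> (\<exists>B. finite B \<and> span B = V)"

definition bracket_span :: "('a::real_vector \<Rightarrow> 'a \<Rightarrow> 'a) \<Rightarrow> 'a set \<Rightarrow> 'a set \<Rightarrow> 'a set"
  where "bracket_span br A B = span {br x y | x y. x \<in> A \<and> y \<in> B}"

definition derived_algebra :: "('a::real_vector \<Rightarrow> 'a \<Rightarrow> 'a) \<Rightarrow> 'a set \<Rightarrow> 'a set"
  where "derived_algebra br h = bracket_span br h h"

definition solvable_lie :: "('a::real_vector \<Rightarrow> 'a \<Rightarrow> 'a) \<Rightarrow> 'a set \<Rightarrow> bool"
  where "solvable_lie br h \<longleftrightarrow> (\<exists>n. (derived_algebra br ^^ n) h = {0})"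

definition nilpotent_lie :: "('a::real_vector \<Rightarrow> 'a \<Rightarrow> 'a) \<Rightarrow> 'a set \<Rightarrow> bool"
  where "nilpotent_lie br h \<longleftrightarrow> (\<exists>n. (bracket_span br h ^^ n) h = {0})"

text \<open>Alternating \<open>n\<close>-linear forms on \<open>h\<close>. The arguments of a form are collected in a list,
  and a form is extended by 0 to lists that are not \<open>n\<close>-tuples of elements of \<open>h\<close>,
  so that equality of forms is equality of functions.\<close>

definition cochains :: "'a::real_vector set \<Rightarrow> nat \<Rightarrow> ('a list \<Rightarrow> real) set"
  where "cochains h n = {\<omega>.
    (\<forall>xs. \<not> (length xs = n \<and> set xs \<subseteq> h) \<longrightarrow> \<omega> xs = 0) \<and>
    (\<forall>xs i u v. length xs = n \<and> set xs \<subseteq> h \<and> i < n \<and> u \<in> h \<and> v \<in> h \<longrightarrow>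
      \<omega> (xs[i := u + v]) = \<omega> (xs[i := u]) + \<omega> (xs[i := v])) \<and>
    (\<forall>xs i u r. length xs = n \<and> set xs \<subseteq> h \<and> i < n \<and> u \<in> h \<longrightarrow>
      \<omega> (xs[i := r *\<^sub>R u]) = r * \<omega> (xs[i := u])) \<and>
    (\<forall>xs i j. length xs = n \<and> set xs \<subseteq> h \<and> i < j \<and> j < n \<and> xs ! i = xs ! j \<longrightarrow>
      \<omega> xs = 0)}"

text \<open>Chevalley--Eilenberg differential for trivial real coefficients:
  \<open>nths xs (- {i, j})\<close> is the list \<open>xs\<close> with entries \<open>i\<close> and \<open>j\<close> omitted. On 0-cochains
  (and on degenerate argument lists) the sum is empty and the differential is 0.\<close>

definition ce_diff ::
  "('a::real_vector \<Rightarrow> 'a \<Rightarrow> 'a) \<Rightarrow> 'a set \<Rightarrow> ('a list \<Rightarrow> real) \<Rightarrow> ('a list \<Rightarrow> real)"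
  where "ce_diff br h \<omega> = (\<lambda>xs. if set xs \<subseteq> h
    then \<Sum>j<length xs. \<Sum>i<j. (-1) ^ (i + j) * \<omega> (br (xs ! i) (xs ! j) # nths xs (- {i, j}))
    else 0)"

definition cocycles :: "('a::real_vector \<Rightarrow> 'a \<Rightarrow> 'a) \<Rightarrow> 'a set \<Rightarrow> nat \<Rightarrow> ('a list \<Rightarrow> real) set"
  where "cocycles br h n = {\<omega> \<in> cochains h n. ce_diff br h \<omega> = 0}"

fun coboundaries :: "('a::real_vector \<Rightarrow> 'a \<Rightarrow> 'a) \<Rightarrow> 'a set \<Rightarrow> nat \<Rightarrow> ('a list \<Rightarrow> real) set"
  where
    "coboundaries br h 0 = {0}"
  | "coboundaries br h (Suc n) = ce_diff br h ` cochains h n"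

definition cohomology ::
  "('a::real_vector \<Rightarrow> 'a \<Rightarrow> 'a) \<Rightarrow> 'a set \<Rightarrow> nat \<Rightarrow> ('a list \<Rightarrow> real) set set"
  where "cohomology br h n = quotient_space (cocycles br h n) (coboundaries br h n)"

definition betti :: "('a::real_vector \<Rightarrow> 'a \<Rightarrow> 'a) \<Rightarrow> 'a set \<Rightarrow> nat \<Rightarrow> nat"
  where "betti br h n = quotient_dim (cocycles br h n) (coboundaries br h n)"

definition two_three_trivial :: "('a::real_vector \<Rightarrow> 'a \<Rightarrow> 'a) \<Rightarrow> 'a set \<Rightarrow> bool"
  where "two_three_trivial br g \<longleftrightarrow> betti br g 2 = 0 \<and> betti br g 3 = 0"

text \<open>The action of \<open>X\<close> in \<open>g\<close> on forms on an ideal \<open>k\<close> of \<open>g\<close> induced by \<open>ad X\<close>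
  (the Lie derivative), and the induced action on cohomology classes.\<close>

definition form_action ::
  "('a::real_vector \<Rightarrow> 'a \<Rightarrow> 'a) \<Rightarrow> 'a set \<Rightarrow> 'a \<Rightarrow> ('a list \<Rightarrow> real) \<Rightarrow> ('a list \<Rightarrow> real)"
  where "form_action br k X \<omega> = (\<lambda>xs. if set xs \<subseteq> k
    then - (\<Sum>i<length xs. \<omega> (xs[i := br X (xs ! i)]))
    else 0)"

definition class_action ::
  "('a::real_vector \<Rightarrow> 'a \<Rightarrow> 'a) \<Rightarrow> 'a set \<Rightarrow> nat \<Rightarrow> 'a \<Rightarrow> ('a list \<Rightarrow> real) set \<Rightarrow> ('a list \<Rightarrow> real) set"
  where "class_action br k n X c = (\<Union>\<omega>\<in>c. affine_coset (coboundaries br k n) (form_action br k X \<omega>))"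

definition null_class ::
  "('a::real_vector \<Rightarrow> 'a \<Rightarrow> 'a) \<Rightarrow> 'a set \<Rightarrow> nat \<Rightarrow> ('a list \<Rightarrow> real) set"
  where "null_class br k n = affine_coset (coboundaries br k n) 0"

definition invariant_cohomology ::
  "('a::real_vector \<Rightarrow> 'a \<Rightarrow> 'a) \<Rightarrow> 'a set \<Rightarrow> 'a set \<Rightarrow> nat \<Rightarrow> ('a list \<Rightarrow> real) set set"
  where "invariant_cohomology br g k n =
    {c \<in> cohomology br k n. \<forall>X\<in>g. class_action br k n X c = null_class br k n}"

end

theory Submission
  imports Defs "HOL-Computational_Algebra.Fundamental_Theorem_Algebra"
begin

text \<open>If \<open>k\<close> is an ideal of codimension 1 containing \<open>[g, g]\<close> and \<open>A\<close> is not in \<open>k\<close>, a form on \<open>g\<close>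
  is a pair of forms on \<open>k\<close>, and there are exact sequences
  \<open>0 \<rightarrow> coker (A on H\<^sup>i\<^sup>-\<^sup>1(k)) \<rightarrow> H\<^sup>i(g) \<rightarrow> ker (A on H\<^sup>i(k)) \<rightarrow> 0\<close>. An endomorphism of a finite-dimensional
  space is injective iff it is surjective, so \<open>b\<^sub>2 = b\<^sub>3 = 0\<close> iff \<open>A\<close> is injective on \<open>H\<^sup>1(k)\<close>, \<open>H\<^sup>2(k)\<close>
  and \<open>H\<^sup>3(k)\<close>; injectivity on \<open>H\<^sup>1(k)\<close> forces \<open>k = [g, g]\<close>. This leaves the solvability of \<open>g\<close>,
  which follows from \<open>b\<^sub>3 = 0\<close>. Otherwise let \<open>s\<close> be a minimal nonsolvable subalgebra. Its Killing form
  is nondegenerate: else a minimal abelian ideal of \<open>s\<close> would have a complementary subalgebra by a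
  Casimir argument. The form \<open>B([x, y], z)\<close>, with \<open>B\<close> the Killing form of \<open>g\<close>, is exact on \<open>g\<close>, hence on \<open>s\<close>.
  Then a derivation argument shows that \<open>B\<close> vanishes on \<open>s\<close>, contradicting Cartan's criterion.\<close>

section \<open>Linear algebra over finite-dimensional subspaces\<close>

text \<open>Degree bookkeeping: b_2 = 0 makes A onto on H^1(k) and injective on H^2(k), and b_3 = 0
  makes it onto on H^2(k) and injective on H^3(k). Finite dimension is therefore called for in
  degree 1 on the way to H^1(k)^g = 0, and in degrees 1 and 2 on the way back. Elements of k act
  trivially on H^i(k), so invariance under g is invariance under A. Solvability has to come first:
  an ideal of codimension 1 containing [g, g] exists only if g is not perfect, and solvability of g
  makes k nilpotent. Minimality takes the place of the Levi decomposition. A proper subalgebra of s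
  that together with an abelian ideal spans s would be solvable, and then so would be s; the Casimir
  operators only serve to produce such a subalgebra. The 3-form is built from the Killing form of g,
  although the algebra of interest is s, because exactness is known for closed forms on g, and a
  closed form on s need not be the restriction of one. Cartan's criterion enters for perfect
  algebras only, and its eigenvalue argument is the one place where complex numbers appear.\<close>

lemma finite_dimensional_imp_subspace: "finite_dimensional V \<Longrightarrow> subspace V"
  by (auto simp: finite_dimensional_def)

lemma span_eqI: "B \<subseteq> V \<Longrightarrow> V \<subseteq> span B \<Longrightarrow> subspace V \<Longrightarrow> span B = V"
  by (simp add: span_minimal subset_antisym)

lemma finite_dimensional_basis:
  assumes "finite_dimensional V"
  obtains B where "finite B" "independent B" "span B = V" "card B = dim V"
proof -
  obtain C where C: "finite C" "span C = V" using assms by (auto simp: finite_dimensional_def)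
  obtain B where B: "B \<subseteq> V" "independent B" "V \<subseteq> span B" "card B = dim V"
    by (rule basis_exists)
  have "span B = V"
    using B(1,3) C(2) subspace_span[of C] by (intro span_eqI) auto
  moreover have "finite B"
    using B(1,2) C independent_span_bound[of C B] by simp
  ultimately show ?thesis using that B by blast
qed

lemma subset_finite_dimensional_basis:
  assumes "subspace U" "U \<subseteq> V" "finite_dimensional V"
  obtains B C where "finite C" "B \<subseteq> C" "independent C" "span B = U" "span C = V"
    "card B = dim U" "card C = dim V"
proof -
  obtain B where B: "B \<subseteq> U" "independent B" "U \<subseteq> span B" "card B = dim U"
    by (rule basis_exists)
  have sB: "span B = U" using B(1,3) assms(1) by (rule span_eqI)
  obtain C where C: "B \<subseteq> C" "C \<subseteq> V" "independent C" "V \<subseteq> span C"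
    by (rule maximal_independent_subset_extend[OF subset_trans[OF B(1) assms(2)] B(2)])
  have sC: "span C = V"
    using C(2,4) finite_dimensional_imp_subspace[OF assms(3)] by (rule span_eqI)
  obtain D where D: "finite D" "span D = V" using assms by (auto simp: finite_dimensional_def)
  have "finite C" using D C(2,3) independent_span_bound[of D C] by simp
  moreover have "card C = dim V" using dim_unique[OF C(2,4,3)] by simp
  ultimately show ?thesis using that B C sB sC by blast
qed

lemma finite_dimensional_subset:
  assumes "subspace U" "U \<subseteq> V" "finite_dimensional V"
  shows "finite_dimensional U"
  by (rule subset_finite_dimensional_basis[OF assms])
    (auto simp: finite_dimensional_def intro: finite_subset)

lemma finite_dimensional_dim_mono:
  assumes "subspace U" "U \<subseteq> V" "finite_dimensional V"
  shows "dim U \<le> dim V"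
  by (rule subset_finite_dimensional_basis[OF assms]) (metis card_mono)

lemma finite_dimensional_dim_eq:
  assumes "subspace U" "U \<subseteq> V" "finite_dimensional V" "dim V \<le> dim U"
  shows "U = V"
  by (rule subset_finite_dimensional_basis[OF assms(1-3)]) (metis assms(4) card_seteq)

lemma finite_dimensional_dim_strict_mono:
  assumes "subspace U" "U \<subset> V" "finite_dimensional V"
  shows "dim U < dim V"
  using finite_dimensional_dim_eq[of U V] assms by (metis leI psubset_eq)

lemma finite_dimensional_image:
  assumes "linear f" "finite_dimensional V"
  shows "finite_dimensional (f ` V)"
proof -
  obtain B where "finite B" "span B = V" using assms by (auto simp: finite_dimensional_def)
  then show ?thesis
    using linear_span_image[OF assms(1), of B] unfolding finite_dimensional_def by blast
qed

lemma linear_inj_imp_surj_on: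
  assumes "linear f" "finite_dimensional V" "f ` V \<subseteq> V" "\<And>v. v \<in> V \<Longrightarrow> f v = 0 \<Longrightarrow> v = 0"
  shows "f ` V = V"
proof -
  obtain B where B: "finite B" "independent B" "span B = V" "card B = dim V"
    using finite_dimensional_basis[OF assms(2)] .
  have inj: "inj_on f (span B)"
    unfolding B(3) using linear_inj_on_iff_eq_0[OF assms(1), of V]
      finite_dimensional_imp_subspace[OF assms(2)] assms(4) by blast
  have ind: "independent (f ` B)"
    using linear_independent_injective_image[OF assms(1) B(2) inj] .
  have sp: "span (f ` B) = f ` V" using linear_span_image[OF assms(1)] B by metis
  have "card (f ` B) = card B"
    using card_image[OF inj_on_subset[OF inj span_superset]] .
  then have "dim (f ` V) = dim V"
    using dim_span_eq_card_independent[OF ind] sp B(4) by simp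
  then show ?thesis
    using finite_dimensional_dim_eq[of "f ` V" V] assms(2,3)
      linear_subspace_image[OF assms(1) finite_dimensional_imp_subspace[OF assms(2)]] by simp
qed

text \<open>Projections, inverses on a Fitting component and operators that represent a bilinear
  form are first defined on a subspace only, by \<open>THE\<close> or by a sum over a basis. The
  results on traces and on injectivity assume \<open>linear\<close> on the whole type, and the
  extension supplies it.\<close>

lemma linear_extension_on:
  fixes f :: "'a::real_vector \<Rightarrow> 'b::real_vector"
  assumes "subspace V" "\<And>u v. u \<in> V \<Longrightarrow> v \<in> V \<Longrightarrow> f (u + v) = f u + f v"
    "\<And>c v. v \<in> V \<Longrightarrow> f (c *\<^sub>R v) = c *\<^sub>R f v"
  obtains h where "linear h" "\<And>v. v \<in> V \<Longrightarrow> h v = f v"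
proof -
  obtain B where B: "B \<subseteq> V" "independent B" "V \<subseteq> span B" "card B = dim V"
    by (rule basis_exists)
  obtain h where h: "linear h" "\<forall>b\<in>B. h b = f b"
    using linear_independent_extend[OF B(2)] by blast
  have f0: "f 0 = 0" using assms(3)[of 0 0] assms(1) by (simp add: subspace_0)
  have "v \<in> V \<and> h v = f v" if "v \<in> span B" for v
    using that
  proof (induction rule: span_induct_alt)
    case base then show ?case using f0 h assms(1) by (simp add: linear_0 subspace_0)
  next
    case (step c x y)
    then show ?case using assms B h
      by (auto simp: linear_add linear_scale subspace_add subspace_scale)
  qed
  then show ?thesis using that h B by blast
qed

text \<open>A linear right inverse \<open>g\<close>, chosen on a basis, is injective and hence onto
  V. So v = g w for some w, and applying f gives w = f v = 0.\<close>

lemma linear_surj_imp_inj_on: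
  assumes "linear f" "finite_dimensional V" "f ` V = V" "v \<in> V" "f v = 0"
  shows "v = 0"
proof -
  obtain B where B: "finite B" "independent B" "span B = V" "card B = dim V"
    using finite_dimensional_basis[OF assms(2)] .
  have "\<forall>b. \<exists>u. b \<in> B \<longrightarrow> u \<in> V \<and> f u = b"
  proof (intro allI)
    fix b
    show "\<exists>u. b \<in> B \<longrightarrow> u \<in> V \<and> f u = b"
    proof (cases "b \<in> B")
      case True
      then have "b \<in> f ` V" using B(3) span_base[of b B] assms(3) by simp
      then show ?thesis by auto
    qed auto
  qed
  then obtain r where r: "\<And>b. b \<in> B \<Longrightarrow> r b \<in> V \<and> f (r b) = b" by metis
  obtain g where g: "linear g" "\<forall>b\<in>B. g b = r b"
    using linear_independent_extend[OF B(2)] by blast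
  have sV: "subspace V" using finite_dimensional_imp_subspace assms by blast
  have gV: "g u \<in> V \<and> f (g u) = u" if "u \<in> V" for u
    using that unfolding B(3)[symmetric]
  proof (induction rule: span_induct_alt)
    case base then show ?case using g assms sV by (simp add: linear_0 subspace_0 B)
  next
    case (step c x y)
    then show ?case using r g assms sV B(3)
      by (auto simp: linear_add linear_scale subspace_add subspace_scale)
  qed
  have "g ` V = V"
  proof (rule linear_inj_imp_surj_on[OF g(1) assms(2)])
    show "u = 0" if "u \<in> V" "g u = 0" for u
      using gV[OF that(1)] that(2) linear_0[OF assms(1)] by simp
    show "g ` V \<subseteq> V" using gV by blast
  qed
  then obtain w where "w \<in> V" "g w = v" using assms(4) by (metis imageE)
  then show ?thesis using gV[of w] assms(5) linear_0[OF g(1)] by simp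
qed

text \<open>Quotients are realized on complements: \<open>U\<close> stands for V/W and
  \<open>p\<close> for the quotient map, so that induction on the dimension stays among subspaces of
  one type.\<close>

lemma complement_projection:
  assumes "subspace W" "W \<subseteq> V" "subspace V"
  obtains U p where "subspace U" "U \<subseteq> V" "linear p" "\<And>w. w \<in> W \<Longrightarrow> p w = 0"
    "\<And>u. u \<in> U \<Longrightarrow> p u = u" "\<And>v. v \<in> V \<Longrightarrow> p v \<in> U" "\<And>v. v \<in> V \<Longrightarrow> v - p v \<in> W"
proof -
  obtain B where B: "B \<subseteq> W" "independent B" "W \<subseteq> span B" "card B = dim W"
    by (rule basis_exists)
  obtain C where C: "B \<subseteq> C" "C \<subseteq> V" "independent C" "V \<subseteq> span C"
    by (rule maximal_independent_subset_extend[OF subset_trans[OF B(1) assms(2)] B(2)])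
  obtain p where p: "linear p" "\<forall>c\<in>C. p c = (if c \<in> B then 0 else c)"
    using linear_independent_extend[OF C(3), of "\<lambda>c. if c \<in> B then 0 else c"] by blast
  have 1: "p w = 0" if "w \<in> span B" for w
    using that
    by (induction rule: span_induct_alt) (use p C in \<open>auto simp: linear_0 linear_add linear_scale\<close>)
  have 2: "p u = u" if "u \<in> span (C - B)" for u
    using that
    by (induction rule: span_induct_alt) (use p C in \<open>auto simp: linear_0 linear_add linear_scale\<close>)
  have 3: "p v \<in> span (C - B) \<and> v - p v \<in> span B" if "v \<in> span C" for v
    using that
  proof (induction rule: span_induct_alt)
    case base then show ?case using p by (simp add: linear_0 span_0)
  next
    case (step c x y)
    have eq: "p (c *\<^sub>R x + y) = c *\<^sub>R p x + p y"
      "c *\<^sub>R x + y - (c *\<^sub>R p x + p y) = c *\<^sub>R (x - p x) + (y - p y)"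
      using p by (auto simp: linear_add linear_scale algebra_simps)
    have "p x \<in> span (C - B)" "x - p x \<in> span B"
      using p step by (auto simp: span_0 span_base)
    then show ?case unfolding eq using step(2) by (metis span_add span_scale)
  qed
  have sB: "span B = W" using B(1,3) assms(1) by (rule span_eqI)
  have sC: "span C = V" using C(2,4) assms(3) by (rule span_eqI)
  have "span (C - B) \<subseteq> V" unfolding sC[symmetric] by (intro span_mono) auto
  then show ?thesis
    using that[OF subspace_span[of "C - B"] _ p(1)] 1 2 3 sB sC by simp
qed

lemma complement_dim:
  assumes "finite_dimensional V" "subspace W" "W \<subseteq> V" "W \<noteq> {0}" "subspace U" "U \<subseteq> V"
    "\<And>w. w \<in> W \<Longrightarrow> p w = 0" "\<And>u. u \<in> U \<Longrightarrow> p u = u"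
  shows "dim U < dim V"
proof -
  obtain w where w: "w \<in> W" "w \<noteq> 0" using assms subspace_0 by blast
  then have "U \<subset> V" using assms by force
  then show ?thesis using finite_dimensional_dim_strict_mono assms by blast
qed

section \<open>Traces of operators on a subspace\<close>

definition trace_on :: "'v::real_vector set \<Rightarrow> ('v \<Rightarrow> 'v) \<Rightarrow> real"
  where "trace_on V f = (let B = SOME B. independent B \<and> span B = V in
    \<Sum>b\<in>B. representation B (f b) b)"

lemma span_image_base: "span B = V \<Longrightarrow> f ` V \<subseteq> V \<Longrightarrow> b \<in> B \<Longrightarrow> f b \<in> span B"
  using span_base[of b B] by auto

lemma representation_linear_image:
  fixes k :: "'w::real_vector \<Rightarrow> 'v::real_vector"
  assumes "finite B" "independent B" "span B = V" "finite C" "independent C" "span C = W"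
    "u \<in> W" "linear k" "k ` W \<subseteq> V"
  shows "representation B (k u) b = (\<Sum>c\<in>C. representation C u c * representation B (k c) b)"
proof -
  have CW: "C \<subseteq> W" using assms(6) span_superset[of C] by auto
  have u: "u = (\<Sum>b\<in>C. representation C u b *\<^sub>R b)"
    using real_vector.sum_representation_eq[of C u C] assms by simp
  have "k u = (\<Sum>b\<in>C. representation C u b *\<^sub>R k b)"
    by (subst u) (simp add: linear_sum[OF assms(8)] linear_scale[OF assms(8)])
  moreover have "representation B (\<Sum>b\<in>C. representation C u b *\<^sub>R k b) =
      (\<lambda>c. \<Sum>b\<in>C. representation B (representation C u b *\<^sub>R k b) c)"
    by (rule real_vector.representation_sum) (use assms CW in \<open>auto intro!: span_scale\<close>)
  moreover have "representation B (r *\<^sub>R k c) b = r * representation B (k c) b" if "c \<in> C" for r c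
    using real_vector.representation_scale[of B "k c" r] assms(2,3,9) CW that
    by (simp add: image_subset_iff subset_iff)
  ultimately show ?thesis by simp
qed

text \<open>The usual double sum, for maps back and forth between two spaces. With the identity as
  one of the maps it also gives the independence of the trace from the basis.\<close>

lemma sum_trace_comm:
  fixes f :: "'w::real_vector \<Rightarrow> 'v::real_vector"
  assumes B: "finite B" "independent B" "span B = V" and C: "finite C" "independent C" "span C = W"
    and fh: "linear f" "linear h" "f ` W \<subseteq> V" "h ` V \<subseteq> W"
  shows "(\<Sum>b\<in>B. representation B (f (h b)) b) = (\<Sum>c\<in>C. representation C (h (f c)) c)"
proof -
  have sub: "B \<subseteq> V" "C \<subseteq> W" using B(3) C(3) span_superset[of B] span_superset[of C] by auto
  have "(\<Sum>b\<in>B. representation B (f (h b)) b) =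
      (\<Sum>b\<in>B. \<Sum>c\<in>C. representation C (h b) c * representation B (f c) b)"
    using sub fh(4) by (intro sum.cong refl representation_linear_image[OF B C _ fh(1,3)]) auto
  also have "\<dots> = (\<Sum>c\<in>C. \<Sum>b\<in>B. representation B (f c) b * representation C (h b) c)"
    by (subst sum.swap) (simp add: mult.commute)
  also have "\<dots> = (\<Sum>c\<in>C. representation C (h (f c)) c)"
    using sub fh(3) by (intro sum.cong refl representation_linear_image[OF C B _ fh(2,4), symmetric]) auto
  finally show ?thesis .
qed

lemma trace_on_basis:
  assumes "finite B" "independent B" "span B = V" "linear f" "f ` V \<subseteq> V"
  shows "trace_on V f = (\<Sum>b\<in>B. representation B (f b) b)"
proof -
  let ?C = "SOME B. independent B \<and> span B = V"
  have C: "independent ?C \<and> span ?C = V"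
    using someI[of "\<lambda>B. independent B \<and> span B = V" B] assms by blast
  then have fC: "finite ?C" using assms(1,3) independent_span_bound[of B ?C] span_superset[of ?C] by simp
  then show ?thesis
    unfolding trace_on_def Let_def
    using sum_trace_comm[OF fC _ _ assms(1-4) linear_ident assms(5)] C by simp
qed

lemma trace_on_cong:
  assumes "finite_dimensional V" "linear f" "f ` V \<subseteq> V" "linear h" "\<And>v. v \<in> V \<Longrightarrow> f v = h v"
  shows "trace_on V f = trace_on V h"
proof -
  obtain B where B: "finite B" "independent B" "span B = V"
    using finite_dimensional_basis[OF assms(1)] by metis
  have hV: "h ` V \<subseteq> V" using assms(3,5) by force
  have "B \<subseteq> V" using B(3) span_superset[of B] by simp
  then show ?thesis
    unfolding trace_on_basis[OF B assms(2,3)] trace_on_basis[OF B assms(4) hV]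
    using assms(5) by (intro sum.cong) auto
qed

lemma trace_on_comm_between:
  fixes f :: "'w::real_vector \<Rightarrow> 'v::real_vector"
  assumes "finite_dimensional V" "finite_dimensional W" "linear f" "f ` W \<subseteq> V" "linear h" "h ` V \<subseteq> W"
  shows "trace_on V (\<lambda>v. f (h v)) = trace_on W (\<lambda>w. h (f w))"
proof -
  obtain B where B: "finite B" "independent B" "span B = V"
    using finite_dimensional_basis[OF assms(1)] by metis
  obtain C where C: "finite C" "independent C" "span C = W"
    using finite_dimensional_basis[OF assms(2)] by metis
  have l: "linear (\<lambda>v. f (h v))" "linear (\<lambda>v. h (f v))"
    using linear_compose[OF assms(5,3)] linear_compose[OF assms(3,5)] by (simp_all add: o_def)
  have s: "(\<lambda>v. f (h v)) ` V \<subseteq> V" "(\<lambda>v. h (f v)) ` W \<subseteq> W" using assms(4,6) by auto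
  show ?thesis
    using trace_on_basis[OF B l(1) s(1)] trace_on_basis[OF C l(2) s(2)]
      sum_trace_comm[OF B C assms(3,5,4,6)] by simp
qed

lemma trace_on_comm:
  assumes "finite_dimensional V" "linear f" "f ` V \<subseteq> V" "linear h" "h ` V \<subseteq> V"
  shows "trace_on V (\<lambda>v. f (h v)) = trace_on V (\<lambda>v. h (f v))"
  using trace_on_comm_between[OF assms(1,1-5)] .

lemma trace_on_add:
  assumes "finite_dimensional V" "linear f" "f ` V \<subseteq> V" "linear h" "h ` V \<subseteq> V"
  shows "trace_on V (\<lambda>v. f v + h v) = trace_on V f + trace_on V h"
proof -
  obtain B where B: "finite B" "independent B" "span B = V"
    using finite_dimensional_basis[OF assms(1)] by metis
  have s: "(\<lambda>v. f v + h v) ` V \<subseteq> V"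
    using assms finite_dimensional_imp_subspace by (auto intro!: subspace_add)
  have r: "representation B (f b + h b) = (\<lambda>c. representation B (f b) c + representation B (h b) c)"
    if "b \<in> B" for b
    by (rule real_vector.representation_add) (use B that assms in \<open>auto intro: span_image_base\<close>)
  show ?thesis
    unfolding trace_on_basis[OF B linear_compose_add[OF assms(2,4)] s]
      trace_on_basis[OF B assms(2,3)] trace_on_basis[OF B assms(4,5)]
    by (simp add: r sum.distrib cong: sum.cong)
qed

lemma trace_on_scale:
  assumes "finite_dimensional V" "linear f" "f ` V \<subseteq> V"
  shows "trace_on V (\<lambda>v. c *\<^sub>R f v) = c * trace_on V f"
proof -
  obtain B where B: "finite B" "independent B" "span B = V"
    using finite_dimensional_basis[OF assms(1)] by metis
  have s: "(\<lambda>v. c *\<^sub>R f v) ` V \<subseteq> V"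
    using assms finite_dimensional_imp_subspace by (auto intro!: subspace_scale)
  have r: "representation B (c *\<^sub>R f b) = (\<lambda>d. c * representation B (f b) d)"
    if "b \<in> B" for b
    by (rule real_vector.representation_scale) (use B that assms in \<open>auto intro: span_image_base\<close>)
  show ?thesis
    unfolding trace_on_basis[OF B linear_compose_scale_right[OF assms(2)] s]
      trace_on_basis[OF B assms(2,3)]
    by (simp add: r sum_distrib_left cong: sum.cong)
qed

lemma trace_on_diff:
  assumes "finite_dimensional V" "linear f" "f ` V \<subseteq> V" "linear h" "h ` V \<subseteq> V"
  shows "trace_on V (\<lambda>v. f v - h v) = trace_on V f - trace_on V h"
proof -
  have "linear (\<lambda>v. (-1) *\<^sub>R h v)" "(\<lambda>v. (-1) *\<^sub>R h v) ` V \<subseteq> V"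
    using assms linear_compose_scale_right[of h "-1"] finite_dimensional_imp_subspace
    by (auto intro!: subspace_neg)
  then show ?thesis
    using trace_on_add[of V f "\<lambda>v. (-1) *\<^sub>R h v"] trace_on_scale[of V h "-1"] assms by simp
qed

lemma trace_on_zero: "trace_on V (\<lambda>v. 0) = 0"
  by (simp add: trace_on_def Let_def real_vector.representation_zero)

lemma trace_on_ident:
  assumes "finite_dimensional V"
  shows "trace_on V (\<lambda>v. v) = dim V"
proof -
  obtain B where B: "finite B" "independent B" "span B = V" "card B = dim V"
    using finite_dimensional_basis[OF assms(1)] by metis
  show ?thesis
    using trace_on_basis[OF B(1-3) linear_ident] B by (simp add: real_vector.representation_basis)
qed

text \<open>In a basis of V that extends one of W, the vectors outside W have diagonal entry 0,
  because f maps into W.\<close>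

lemma trace_on_range:
  assumes "finite_dimensional V" "linear f" "f ` V \<subseteq> W" "subspace W" "W \<subseteq> V"
  shows "trace_on V f = trace_on W f"
proof -
  obtain B C where BC: "finite C" "B \<subseteq> C" "independent C" "span B = W" "span C = V"
    using subset_finite_dimensional_basis[OF assms(4,5,1)] by metis
  have B: "independent B" "finite B"
    using BC(1-3) independent_mono finite_subset by auto
  have CV: "C \<subseteq> V" using BC(5) span_superset[of C] by simp
  have rep: "representation C (f c) = representation B (f c)" if "c \<in> C" for c
    using real_vector.representation_extend[of C "f c" B] BC(2-4) that assms(3) CV
    by (simp add: image_subset_iff subset_iff)
  have z: "representation B (f c) c = 0" if "c \<in> C - B" for c
    using real_vector.representation_ne_zero[of B "f c" c] that by blast
  have "trace_on V f = (\<Sum>c\<in>C. representation C (f c) c)"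
    using trace_on_basis[OF BC(1,3,5) assms(2)] assms(3,5) by simp
  also have "\<dots> = (\<Sum>c\<in>C. representation B (f c) c)" using rep by simp
  also have "\<dots> = (\<Sum>c\<in>B. representation B (f c) c)"
    using z BC by (intro sum.mono_neutral_right) auto
  also have "\<dots> = trace_on W f"
    using trace_on_basis[OF B(2,1) BC(4) assms(2)] assms(3,5) by (simp add: subset_trans[OF image_mono])
  finally show ?thesis .
qed

lemma linear_funpow:
  fixes f :: "'a::real_vector \<Rightarrow> 'a"
  shows "linear f \<Longrightarrow> linear (f ^^ n)"
proof (induction n)
  case 0
  then show ?case by (simp add: id_def linear_ident)
next
  case (Suc n)
  then show ?case using linear_compose[of "f ^^ n" f] by (simp only: funpow.simps)
qed

lemma funpow_image_subset: "f ` V \<subseteq> V \<Longrightarrow> (f ^^ n) ` V \<subseteq> V"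
  by (induction n) auto

text \<open>The trace does not change on passing from V to the image of f, where a smaller power of
  f already vanishes; no triangular basis is constructed.\<close>

lemma trace_on_nilpotent:
  assumes "finite_dimensional V" "linear f" "f ` V \<subseteq> V" "\<And>v. v \<in> V \<Longrightarrow> (f ^^ n) v = 0"
  shows "trace_on V f = 0"
  using assms
proof (induction n arbitrary: V)
  case 0
  then have "V = {0}" using finite_dimensional_imp_subspace subspace_0 by fastforce
  then show ?case using trace_on_cong[of V f "\<lambda>v. 0"] 0 trace_on_zero[of V]
    by (simp add: linear_0 linear_zero)
next
  case (Suc n)
  have s: "subspace (f ` V)"
    using Suc linear_subspace_image finite_dimensional_imp_subspace by blast
  have "trace_on V f = trace_on (f ` V) f" using trace_on_range[OF Suc(2,3) order_refl s] Suc by auto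
  also have "\<dots> = 0"
  proof (rule Suc.IH)
    show "finite_dimensional (f ` V)" using finite_dimensional_image Suc by blast
    show "f ` f ` V \<subseteq> f ` V" using Suc by auto
    show "(f ^^ n) v = 0" if "v \<in> f ` V" for v
      using that Suc.prems(4) by (auto simp: funpow_swap1)
  qed (rule Suc)
  finally show ?case .
qed

lemma direct_sum_projection:
  assumes "subspace V" "subspace U" "subspace W" "U \<subseteq> V" "W \<subseteq> V"
    "\<And>v. v \<in> V \<Longrightarrow> \<exists>u\<in>U. \<exists>w\<in>W. v = u + w" "U \<inter> W = {0}"
  obtains h where "linear h" "\<And>v. v \<in> V \<Longrightarrow> h v \<in> U" "\<And>v. v \<in> V \<Longrightarrow> v - h v \<in> W"
    "\<And>u. u \<in> U \<Longrightarrow> h u = u" "\<And>w. w \<in> W \<Longrightarrow> h w = 0"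
proof -
  define q where "q v = (THE u. u \<in> U \<and> v - u \<in> W)" for v
  have uni: "u = u'" if "u \<in> U" "v - u \<in> W" "u' \<in> U" "v - u' \<in> W" for u u' v
  proof -
    have "u - u' \<in> U" using that(1,3) assms(2) by (simp add: subspace_diff)
    moreover have "u - u' \<in> W" using subspace_diff[OF assms(3) that(4,2)] by simp
    ultimately have "u - u' \<in> {0}" using assms(7) by blast
    then show ?thesis by simp
  qed
  have q: "q v \<in> U \<and> v - q v \<in> W" if "v \<in> V" for v
  proof -
    obtain u w where "u \<in> U" "w \<in> W" "v = u + w" using assms(6)[OF \<open>v \<in> V\<close>] by blast
    then have "u \<in> U \<and> v - u \<in> W" by simp
    then show ?thesis unfolding q_def by (rule theI[where a=u]) (use uni \<open>u \<in> U \<and> v - u \<in> W\<close> in metis)+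
  qed
  have qu: "q v = u" if "v \<in> V" "u \<in> U" "v - u \<in> W" for u v
    using q[OF that(1)] uni that(2,3) by metis
  have add: "q (u + v) = q u + q v" if "u \<in> V" "v \<in> V" for u v
  proof (rule qu)
    have "u + v - (q u + q v) = (u - q u) + (v - q v)" by simp
    then show "u + v - (q u + q v) \<in> W"
      using q[OF that(1)] q[OF that(2)] subspace_add[OF assms(3)] by metis
    show "u + v \<in> V" using that assms(1) by (simp add: subspace_add)
    show "q u + q v \<in> U" using q[OF that(1)] q[OF that(2)] assms(2) by (simp add: subspace_add)
  qed
  have scale: "q (c *\<^sub>R v) = c *\<^sub>R q v" if "v \<in> V" for c v
  proof (rule qu)
    have "c *\<^sub>R v - c *\<^sub>R q v = c *\<^sub>R (v - q v)" by (simp add: algebra_simps)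
    then show "c *\<^sub>R v - c *\<^sub>R q v \<in> W" using q[OF that] subspace_scale[OF assms(3)] by metis
    show "c *\<^sub>R v \<in> V" using that assms(1) by (simp add: subspace_scale)
    show "c *\<^sub>R q v \<in> U" using q[OF that] assms(2) by (simp add: subspace_scale)
  qed
  obtain h where h: "linear h" "\<And>v. v \<in> V \<Longrightarrow> h v = q v"
    using linear_extension_on[of V q, OF assms(1) add scale] by blast
  have h': "\<And>v. v \<in> V \<Longrightarrow> h v \<in> U" "\<And>v. v \<in> V \<Longrightarrow> v - h v \<in> W"
    "\<And>u. u \<in> U \<Longrightarrow> h u = u" "\<And>w. w \<in> W \<Longrightarrow> h w = 0"
  proof -
    show "h v \<in> U" "v - h v \<in> W" if "v \<in> V" for v using h(2)[OF that] q[OF that] by auto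
    show "h u = u" if "u \<in> U" for u
      using h(2)[of u] qu[of u u] that assms(3,4) by (auto simp: subspace_0)
    show "h w = 0" if "w \<in> W" for w
      using h(2)[of w] qu[of w 0] that assms(2,5) by (auto simp: subspace_0)
  qed
  show ?thesis using that[OF h(1) h'] .
qed

text \<open>The projection \<open>h\<close> onto U along W splits f as f h + f (1 - h), and the two
  pieces map into U and into W.\<close>

lemma trace_on_direct_sum:
  assumes "finite_dimensional V" "linear f" "subspace U" "subspace W" "U \<subseteq> V" "W \<subseteq> V"
    "f ` U \<subseteq> U" "f ` W \<subseteq> W" "\<And>v. v \<in> V \<Longrightarrow> \<exists>u\<in>U. \<exists>w\<in>W. v = u + w" "U \<inter> W = {0}"
  shows "trace_on V f = trace_on U f + trace_on W f"
proof -
  have sV: "subspace V" using assms(1) by (rule finite_dimensional_imp_subspace)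
  obtain h where h: "linear h" and h': "\<And>v. v \<in> V \<Longrightarrow> h v \<in> U" "\<And>v. v \<in> V \<Longrightarrow> v - h v \<in> W"
    "\<And>u. u \<in> U \<Longrightarrow> h u = u" "\<And>w. w \<in> W \<Longrightarrow> h w = 0"
    by (rule direct_sum_projection[OF sV assms(3-6,9,10)]) blast+
  have l1: "linear (\<lambda>v. f (h v))" using linear_compose[OF h assms(2)] by (simp add: o_def)
  have "linear (\<lambda>v. v - h v)" using linear_compose_sub[OF linear_ident h] .
  then have l2: "linear (\<lambda>v. f (v - h v))" using linear_compose[of "\<lambda>v. v - h v" f] assms(2) by (simp add: o_def)
  have r1: "(\<lambda>v. f (h v)) ` V \<subseteq> U" and r2: "(\<lambda>v. f (v - h v)) ` V \<subseteq> W"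
    using h'(1,2) assms(7,8) by auto
  have "trace_on V f = trace_on V (\<lambda>v. f (h v) + f (v - h v))"
    by (rule arg_cong[where f="trace_on V"]) (auto simp: fun_eq_iff linear_add[OF assms(2), symmetric])
  also have "\<dots> = trace_on V (\<lambda>v. f (h v)) + trace_on V (\<lambda>v. f (v - h v))"
    using r1 r2 assms(1,5,6) by (intro trace_on_add l1 l2) auto
  also have "trace_on V (\<lambda>v. f (h v)) = trace_on U (\<lambda>v. f (h v))"
    using trace_on_range[OF assms(1) l1 r1] assms(3,5) by simp
  also have "\<dots> = trace_on U f"
    using trace_on_cong[OF finite_dimensional_subset[OF assms(3,5,1)] assms(2,7) l1] h'(3) by simp
  also have "trace_on V (\<lambda>v. f (v - h v)) = trace_on W (\<lambda>v. f (v - h v))"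
    using trace_on_range[OF assms(1) l2 r2] assms(4,6) by simp
  also have "\<dots> = trace_on W f"
    using trace_on_cong[OF finite_dimensional_subset[OF assms(4,6,1)] assms(2,8) l2] h'(4) by simp
  finally show ?thesis .
qed

text \<open>\<open>N\<close> minimizes the dimension of the image of f^N, so the descending chain of
  images is constant from there on. Then f is onto, hence injective, on the last image, the Fitting
  one-component.\<close>

lemma Fitting:
  assumes "finite_dimensional V" "linear f" "f ` V \<subseteq> V"
  obtains N where "\<And>n. n \<ge> N \<Longrightarrow> (f ^^ n) ` V = (f ^^ N) ` V"
    "f ` (f ^^ N) ` V = (f ^^ N) ` V"
    "\<And>v. v \<in> (f ^^ N) ` V \<Longrightarrow> f v = 0 \<Longrightarrow> v = 0"
proof -
  define N where "N = (ARG_MIN (\<lambda>n. dim ((f ^^ n) ` V)) n. True)"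
  have min: "dim ((f ^^ N) ` V) \<le> dim ((f ^^ n) ` V)" for n
    unfolding N_def using arg_min_nat_lemma[of "\<lambda>_. True" 0 "\<lambda>n. dim ((f ^^ n) ` V)"] by simp
  have sub: "subspace ((f ^^ n) ` V)" for n
    using assms finite_dimensional_imp_subspace linear_subspace_image linear_funpow by blast
  have fd: "finite_dimensional ((f ^^ n) ` V)" for n
    using assms finite_dimensional_image linear_funpow by blast
  have fN: "(f ^^ n) ` V = (f ^^ N) ` V" if "n \<ge> N" for n
  proof (rule finite_dimensional_dim_eq[OF sub _ fd min])
    have "(f ^^ n) ` V = (f ^^ N) ` (f ^^ (n - N)) ` V"
      using that by (simp add: image_comp funpow_add[symmetric])
    then show "(f ^^ n) ` V \<subseteq> (f ^^ N) ` V"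
      using image_mono[OF funpow_image_subset[OF assms(3), of "n - N"]] by simp
  qed
  have f: "f ` (f ^^ N) ` V = (f ^^ N) ` V" using fN[of "Suc N"] by (simp add: image_comp)
  show ?thesis
    using that[OF fN f] linear_surj_imp_inj_on[OF assms(2) fd f] by blast
qed

lemma linear_inj_on_funpow:
  assumes "f ` V \<subseteq> V" "\<And>v. v \<in> V \<Longrightarrow> f v = 0 \<Longrightarrow> v = 0" "v \<in> V" "(f ^^ n) v = (0::'a::real_vector)"
  shows "v = 0"
  using assms(4)
proof (induction n)
  case (Suc n)
  have "(f ^^ n) v \<in> V" using funpow_image_subset[OF assms(1)] assms(3) by blast
  then show ?case using Suc assms(2) by simp
qed simp

text \<open>On the Fitting one-component \<open>I\<close> the operator \<open>w\<close> inverts z,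
  on the null component it is 0. Both are expressed by the single equation z^(N+1) (w v) = z^N v
  with w v in \<open>I\<close>, which every operator commuting with z respects. The trace of z w is
  the dimension of \<open>I\<close>, so if it vanishes then z is nilpotent.\<close>

lemma Fitting_inverse:
  fixes z :: "'v::real_vector \<Rightarrow> 'v"
  assumes "finite_dimensional V" "linear z" "z ` V \<subseteq> V"
  obtains w where "linear w" "w ` V \<subseteq> V"
    "\<And>y v. linear y \<Longrightarrow> y ` V \<subseteq> V \<Longrightarrow> (\<And>u. u \<in> V \<Longrightarrow> y (z u) = z (y u)) \<Longrightarrow> v \<in> V \<Longrightarrow> y (w v) = w (y v)"
    "trace_on V (\<lambda>v. z (w v)) = 0 \<Longrightarrow> \<exists>n. \<forall>v\<in>V. (z ^^ n) v = 0"
proof -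
  obtain N where N: "\<And>n. n \<ge> N \<Longrightarrow> (z ^^ n) ` V = (z ^^ N) ` V"
    "z ` (z ^^ N) ` V = (z ^^ N) ` V" "\<And>v. v \<in> (z ^^ N) ` V \<Longrightarrow> z v = 0 \<Longrightarrow> v = 0"
    using Fitting[OF assms] by metis
  define I where "I = (z ^^ N) ` V"
  have lz: "linear (z ^^ n)" for n using linear_funpow[OF assms(2)] .
  have sV: "subspace V" using finite_dimensional_imp_subspace[OF assms(1)] .
  have sI: "subspace I" unfolding I_def using linear_subspace_image[OF lz sV] .
  have IV: "I \<subseteq> V" unfolding I_def using funpow_image_subset[OF assms(3)] .
  have zI: "z ` I \<subseteq> I" unfolding I_def using N(2) by simp
  have inj: "v = 0" if "v \<in> I" "(z ^^ n) v = 0" for v n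
    using linear_inj_on_funpow[OF zI _ that] N(3) by (simp add: I_def)
  have inj2: "u = v" if "u \<in> I" "v \<in> I" "(z ^^ n) u = (z ^^ n) v" for u v n
    using inj[of "u - v" n] that sI linear_diff[OF lz] by (simp add: subspace_diff)
  have surj: "\<exists>u\<in>I. (z ^^ n) u = v" if "v \<in> I" for v n
  proof -
    have "(z ^^ n) ` I = I"
      using N(1)[of "n + N"] by (simp add: I_def image_image funpow_add)
    then show ?thesis using that by (metis imageE)
  qed
  define w where "w v = (THE u. u \<in> I \<and> (z ^^ Suc N) u = (z ^^ N) v)" for v
  have w: "w v \<in> I \<and> (z ^^ Suc N) (w v) = (z ^^ N) v" if v: "v \<in> V" for v
  proof -
    have "(z ^^ N) v \<in> I" using v by (simp add: I_def)
    then obtain u where u: "u \<in> I \<and> (z ^^ Suc N) u = (z ^^ N) v" using surj[of "(z ^^ N) v" "Suc N"] by metis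
    show ?thesis unfolding w_def by (rule theI[where a=u]) (use u inj2 in metis)+
  qed
  have wI: "w v = u" if "v \<in> V" "u \<in> I" "(z ^^ Suc N) u = (z ^^ N) v" for u v
    using w[OF that(1)] that(2,3) inj2 by metis
  have add: "w (u + v) = w u + w v" if "u \<in> V" "v \<in> V" for u v
    using w[OF that(1)] w[OF that(2)]
    by (intro wI subspace_add[OF sV that]) (simp_all only: subspace_add[OF sI] linear_add[OF lz])
  have scale: "w (c *\<^sub>R v) = c *\<^sub>R w v" if "v \<in> V" for c v
    using w[OF that(1)]
    by (intro wI subspace_scale[OF sV that]) (simp_all only: subspace_scale[OF sI] linear_scale[OF lz])
  obtain h where h: "linear h" "\<And>v. v \<in> V \<Longrightarrow> h v = w v"
    using linear_extension_on[of V w, OF sV add scale] by blast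
  have hV: "h v \<in> I" if "v \<in> V" for v using h(2)[OF that] w[OF that] by simp
  have comm: "y (h v) = h (y v)"
    if y: "linear y" "y ` V \<subseteq> V" "\<And>u. u \<in> V \<Longrightarrow> y (z u) = z (y u)" and v: "v \<in> V" for y v
  proof -
    have yn: "y ((z ^^ n) u) = (z ^^ n) (y u)" if "u \<in> V" for u n
    proof (induction n)
      case (Suc n)
      have "(z ^^ n) u \<in> V" using funpow_image_subset[OF assms(3)] that by blast
      then show ?case using Suc y(3) by simp
    qed simp
    have yv: "y v \<in> V" using y(2) v by blast
    obtain u where u: "u \<in> V" "w v = (z ^^ N) u" using w[OF v] by (auto simp: I_def)
    have yw: "y (w v) \<in> I" unfolding I_def u(2) yn[OF u(1)] using y(2) u(1) by blast
    have wV: "w v \<in> V" using w[OF v] IV by blast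
    have "(z ^^ Suc N) (y (w v)) = y ((z ^^ Suc N) (w v))" using yn[OF wV, of "Suc N"] by (rule sym)
    also have "\<dots> = (z ^^ N) (y v)" using w[OF v] yn[OF v] by simp
    finally have "w (y v) = y (w v)" using wI[OF yv yw] by simp
    then show ?thesis using h(2) v yv by simp
  qed
  have zh: "z (h v) = v" if "v \<in> I" for v
  proof -
    have v: "v \<in> V" using that IV by blast
    have zwI: "z (w v) \<in> I" using w[OF v] zI by blast
    have "(z ^^ N) (z (w v)) = (z ^^ N) v" using w[OF v] by (simp add: funpow_swap1)
    then show ?thesis using inj2[OF zwI that] h(2)[OF v] by simp
  qed
  have nil: "\<exists>n. \<forall>v\<in>V. (z ^^ n) v = 0" if "trace_on V (\<lambda>v. z (h v)) = 0"
  proof -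
    have l: "linear (\<lambda>v. z (h v))" using linear_compose[OF h(1) assms(2)] by (simp add: o_def)
    have r: "(\<lambda>v. z (h v)) ` V \<subseteq> I" using hV zI by blast
    have fI: "finite_dimensional I" using finite_dimensional_subset[OF sI IV assms(1)] .
    have "trace_on V (\<lambda>v. z (h v)) = trace_on I (\<lambda>v. z (h v))"
      using trace_on_range[OF assms(1) l r sI IV] .
    also have "\<dots> = trace_on I (\<lambda>v. v)"
      using trace_on_cong[OF fI l _ linear_ident zh] r IV by blast
    also have "\<dots> = dim I" using trace_on_ident[OF fI] .
    finally have "dim I = 0" using that by simp
    then have "I = {0}"
      using finite_dimensional_dim_eq[OF subspace_single_0 _ fI] subspace_0[OF sI] by force
    then show ?thesis unfolding I_def by blast
  qed
  show ?thesis using that[OF h(1) _ comm nil] hV IV by blast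
qed

section \<open>Lie algebras, representations and solvability\<close>

text \<open>Bilinearity on the whole type, and not only on g, turns every ad x into a map to which
  the linear algebra above applies. The general case is reduced to this one by
  \<open>bilinear_bracket_exists\<close>.\<close>

locale fd_lie = real_lie_algebra g br
  for g :: "'a::real_vector set" and br :: "'a \<Rightarrow> 'a \<Rightarrow> 'a" +
  assumes fd: "finite_dimensional g"
    and linear_left: "linear (\<lambda>x. br x y)"
    and linear_right: "linear (br x)"
begin

lemma bracket_simps [simp]:
  "br (x + y) z = br x z + br y z" "br x (y + z) = br x y + br x z"
  "br (x - y) z = br x z - br y z" "br x (y - z) = br x y - br x z"
  "br (- x) z = - br x z" "br x (- z) = - br x z"
  "br (c *\<^sub>R x) z = c *\<^sub>R br x z" "br x (c *\<^sub>R z) = c *\<^sub>R br x z"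
  "br 0 z = 0" "br x 0 = 0"
  using linear_add[OF linear_left[of z]] linear_add[OF linear_right[of x]]
    linear_diff[OF linear_left[of z]] linear_diff[OF linear_right[of x]]
    linear_neg[OF linear_left[of z]] linear_neg[OF linear_right[of x]]
    linear_scale[OF linear_left[of z]] linear_scale[OF linear_right[of x]]
    linear_0[OF linear_left[of z]] linear_0[OF linear_right[of x]]
  by simp_all

lemma bracket_sum_right: "br z (\<Sum>i\<in>A. f i) = (\<Sum>i\<in>A. br z (f i))"
  using linear_sum[OF linear_right] .

lemma antisym: "x \<in> g \<Longrightarrow> y \<in> g \<Longrightarrow> br x y = - br y x"
proof -
  assume x: "x \<in> g" and y: "y \<in> g"
  then have "br (x + y) (x + y) = 0" using alternating[of "x + y"] subspace_add[OF subspace] by blast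
  then show ?thesis using alternating[OF x] alternating[OF y] by (simp add: eq_neg_iff_add_eq_0 add.commute)
qed

lemma bracket_bracket:
  assumes "x \<in> g" "y \<in> g" "z \<in> g"
  shows "br (br x y) z = br x (br y z) - br y (br x z)"
proof -
  have "br (br x y) z = - br z (br x y)" using antisym assms closed by blast
  moreover have "br y (br z x) = - br y (br x z)" using antisym[of z x] assms by simp
  ultimately show ?thesis using jacobi[OF assms] by (simp add: algebra_simps add_eq_0_iff)
qed

lemma subalgebra_fd_lie:
  assumes "subspace M" "M \<subseteq> g" "\<And>x y. x \<in> M \<Longrightarrow> y \<in> M \<Longrightarrow> br x y \<in> M"
  shows "fd_lie M br"
proof unfold_locales
  show "finite_dimensional M" using finite_dimensional_subset[OF assms(1,2) fd] .
  show "br x x = 0" if "x \<in> M" for x using alternating that assms(2) by blast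
  show "br x (br y z) + br y (br z x) + br z (br x y) = 0" if "x \<in> M" "y \<in> M" "z \<in> M" for x y z
    using jacobi that assms(2) by blast
qed (fact assms(1) assms(3) linear_left linear_right | simp)+

end

lemma bracket_span_subset:
  "subspace W \<Longrightarrow> (\<And>x y. x \<in> A \<Longrightarrow> y \<in> B \<Longrightarrow> br x y \<in> W) \<Longrightarrow> bracket_span br A B \<subseteq> W"
  unfolding bracket_span_def by (rule span_minimal) auto

lemma bracket_span_mono:
  "A \<subseteq> A' \<Longrightarrow> B \<subseteq> B' \<Longrightarrow> bracket_span br A B \<subseteq> bracket_span br A' B'"
  unfolding bracket_span_def by (rule span_mono) blast

lemma subspace_bracket_span: "subspace (bracket_span br A B)"
  by (simp add: bracket_span_def)

lemma bracket_in_span: "x \<in> A \<Longrightarrow> y \<in> B \<Longrightarrow> br x y \<in> bracket_span br A B"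
  unfolding bracket_span_def by (rule span_base) blast

lemma derived_series_Suc:
  "(derived_algebra br ^^ Suc n) A = bracket_span br ((derived_algebra br ^^ n) A) ((derived_algebra br ^^ n) A)"
  by (simp add: derived_algebra_def)

lemma derived_series_mono:
  "A \<subseteq> B \<Longrightarrow> (derived_algebra br ^^ n) A \<subseteq> (derived_algebra br ^^ n) B"
  by (induction n) (simp_all add: derived_algebra_def bracket_span_mono)

lemma subspace_derived_series: "subspace A \<Longrightarrow> subspace ((derived_algebra br ^^ n) A)"
  by (cases n) (simp_all add: derived_algebra_def subspace_bracket_span)

lemma derived_series_cong:
  assumes "\<And>x y. x \<in> g \<Longrightarrow> y \<in> g \<Longrightarrow> br x y = br' x y" "\<And>x y. x \<in> g \<Longrightarrow> y \<in> g \<Longrightarrow> br x y \<in> g" "subspace g"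
  shows "(derived_algebra br ^^ n) g = (derived_algebra br' ^^ n) g \<and> (derived_algebra br ^^ n) g \<subseteq> g"
proof (induction n)
  case (Suc n)
  let ?D = "(derived_algebra br ^^ n) g"
  have "{br x y |x y. x \<in> ?D \<and> y \<in> ?D} = {br' x y |x y. x \<in> ?D \<and> y \<in> ?D}"
    using Suc assms(1) by (metis (no_types, opaque_lifting) subsetD)
  moreover have "derived_algebra br ?D \<subseteq> g"
    unfolding derived_algebra_def[of br ?D]
    by (intro bracket_span_subset assms(2,3)) (simp_all only: subsetD[OF conjunct2[OF Suc]])
  ultimately show ?case using Suc by (auto simp: derived_algebra_def bracket_span_def)
qed simp

lemma solvable_lie_subset:
  assumes "solvable_lie br B" "A \<subseteq> B" "subspace A"
  shows "solvable_lie br A"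
proof -
  obtain n where "(derived_algebra br ^^ n) B = {0}" using assms by (auto simp: solvable_lie_def)
  then have "(derived_algebra br ^^ n) A = {0}"
    using derived_series_mono[OF assms(2), where br=br and n=n] subspace_0[OF subspace_derived_series[OF assms(3), of n br]]
    by blast
  then show ?thesis by (auto simp: solvable_lie_def)
qed

lemma solvable_lie_derived:
  "solvable_lie br (derived_algebra br A) \<Longrightarrow> solvable_lie br A"
  unfolding solvable_lie_def by (metis funpow_Suc_right o_apply)

lemma solvable_lie_perfect:
  assumes "solvable_lie br A" "derived_algebra br A = A"
  shows "A = {0}"
proof -
  have "(derived_algebra br ^^ n) A = A" for n by (induction n) (simp_all add: assms(2))
  then show ?thesis using assms(1) by (auto simp: solvable_lie_def)
qed

lemma derived_series_image:
  assumes "linear p" "\<And>x y. x \<in> A \<Longrightarrow> y \<in> A \<Longrightarrow> p (br x y) = br' (p x) (p y)"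
    "subspace A" "\<And>x y. x \<in> A \<Longrightarrow> y \<in> A \<Longrightarrow> br x y \<in> A"
  shows "p ` (derived_algebra br ^^ n) A = (derived_algebra br' ^^ n) (p ` A) \<and> (derived_algebra br ^^ n) A \<subseteq> A"
proof (induction n)
  case (Suc n)
  let ?D = "(derived_algebra br ^^ n) A"
  have "p ` {br x y |x y. x \<in> ?D \<and> y \<in> ?D} = {br' x y |x y. x \<in> p ` ?D \<and> y \<in> p ` ?D}"
  proof (intro equalityI subsetI)
    fix z assume "z \<in> p ` {br x y |x y. x \<in> ?D \<and> y \<in> ?D}"
    then obtain x y where "z = p (br x y)" "x \<in> ?D" "y \<in> ?D" by blast
    then show "z \<in> {br' x y |x y. x \<in> p ` ?D \<and> y \<in> p ` ?D}" using Suc assms(2) by blast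
  next
    fix z assume "z \<in> {br' x y |x y. x \<in> p ` ?D \<and> y \<in> p ` ?D}"
    then obtain x y where xy: "z = br' (p x) (p y)" "x \<in> ?D" "y \<in> ?D" by blast
    then have "z = p (br x y)" using Suc assms(2)[of x y] by (metis subsetD)
    then show "z \<in> p ` {br x y |x y. x \<in> ?D \<and> y \<in> ?D}" using xy by blast
  qed
  moreover have "derived_algebra br ?D \<subseteq> A"
    unfolding derived_algebra_def[of br ?D]
    by (intro bracket_span_subset assms(3,4)) (simp_all only: subsetD[OF conjunct2[OF Suc]])
  ultimately show ?case
    using conjunct1[OF Suc, symmetric] unfolding derived_series_Suc derived_algebra_def[of br ?D]
    by (simp add: bracket_span_def linear_span_image[OF assms(1), symmetric])
qed simp

lemma solvable_lie_image:
  assumes "linear p" "\<And>x y. x \<in> A \<Longrightarrow> y \<in> A \<Longrightarrow> p (br x y) = br' (p x) (p y)"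
    "subspace A" "\<And>x y. x \<in> A \<Longrightarrow> y \<in> A \<Longrightarrow> br x y \<in> A" "solvable_lie br A"
  shows "solvable_lie br' (p ` A)"
proof -
  obtain n where n: "(derived_algebra br ^^ n) A = {0}" using assms(5) by (auto simp: solvable_lie_def)
  have "p ` (derived_algebra br ^^ n) A = (derived_algebra br' ^^ n) (p ` A)"
    using derived_series_image[of p A br br' n] assms(1-4) by simp
  then show ?thesis using n linear_0[OF assms(1)] by (auto simp: solvable_lie_def)
qed

lemma hyperplane_extension:
  assumes "subspace D" "D \<subset> L" "finite_dimensional L"
  obtains M z where "subspace M" "D \<subseteq> M" "M \<subseteq> L" "z \<in> L" "z \<notin> M" "\<And>x. x \<in> L \<Longrightarrow> \<exists>c. x - c *\<^sub>R z \<in> M"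
    "dim L = dim M + 1"
proof -
  obtain B C where BC: "finite C" "B \<subseteq> C" "independent C" "span B = D" "span C = L" "card B = dim D" "card C = dim L"
    by (rule subset_finite_dimensional_basis[OF assms(1) psubset_imp_subset[OF assms(2)] assms(3)])
  have "B \<noteq> C" using BC assms(2) by auto
  then obtain z where z: "z \<in> C" "z \<notin> B" using BC(2) by blast
  let ?M = "span (C - {z})"
  have ind: "independent (C - {z})" using BC(3) independent_mono by blast
  show ?thesis
  proof (rule that[of ?M z])
    show "D \<subseteq> ?M" unfolding BC(4)[symmetric] using BC(2) z by (intro span_mono) blast
    show "?M \<subseteq> L" unfolding BC(5)[symmetric] by (intro span_mono) blast
    show "z \<in> L" unfolding BC(5)[symmetric] using z by (intro span_base)
    show "z \<notin> ?M" using BC(3) z by (auto simp: dependent_def)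
    show "\<exists>c. x - c *\<^sub>R z \<in> ?M" if "x \<in> L" for x
      using span_breakdown[OF z(1), of x] that BC(5) by blast
    have "dim ?M = card (C - {z})" using ind by (rule dim_span_eq_card_independent)
    moreover have "card C > 0" using z BC(1) by (auto simp: card_gt_0_iff)
    ultimately show "dim L = dim ?M + 1" using z BC(1,7) by (simp only: card_Diff_singleton)
  qed simp
qed

section \<open>Representations and nilpotent actions of solvable algebras\<close>

locale lie_rep = fd_lie L br
  for L :: "'a::real_vector set" and br +
  fixes V :: "'v::real_vector set" and \<rho> :: "'a \<Rightarrow> 'v \<Rightarrow> 'v"
  assumes fdV: "finite_dimensional V"
    and rep_linear: "linear (\<rho> x)"
    and rep_linear_left: "linear (\<lambda>x. \<rho> x v)"
    and rep_closed: "x \<in> L \<Longrightarrow> v \<in> V \<Longrightarrow> \<rho> x v \<in> V"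
    and rep_bracket: "x \<in> L \<Longrightarrow> y \<in> L \<Longrightarrow> v \<in> V \<Longrightarrow> \<rho> (br x y) v = \<rho> x (\<rho> y v) - \<rho> y (\<rho> x v)"
begin

lemma rep_simps [simp]:
  "\<rho> (x + y) z = \<rho> x z + \<rho> y z" "\<rho> x (u + v) = \<rho> x u + \<rho> x v"
  "\<rho> (x - y) z = \<rho> x z - \<rho> y z" "\<rho> x (u - v) = \<rho> x u - \<rho> x v"
  "\<rho> (- x) z = - \<rho> x z" "\<rho> x (- u) = - \<rho> x u"
  "\<rho> (c *\<^sub>R x) z = c *\<^sub>R \<rho> x z" "\<rho> x (c *\<^sub>R u) = c *\<^sub>R \<rho> x u"
  "\<rho> 0 z = 0" "\<rho> x 0 = 0"
  using linear_add[OF rep_linear_left[of z]] linear_add[OF rep_linear[of x]]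
    linear_diff[OF rep_linear_left[of z]] linear_diff[OF rep_linear[of x]]
    linear_neg[OF rep_linear_left[of z]] linear_neg[OF rep_linear[of x]]
    linear_scale[OF rep_linear_left[of z]] linear_scale[OF rep_linear[of x]]
    linear_0[OF rep_linear_left[of z]] linear_0[OF rep_linear[of x]]
  by simp_all

lemma subV: "subspace V" using finite_dimensional_imp_subspace[OF fdV] .

lemma rep_image: "x \<in> L \<Longrightarrow> \<rho> x ` V \<subseteq> V" using rep_closed by blast

lemma linear_comp2: "linear f \<Longrightarrow> linear h \<Longrightarrow> linear (\<lambda>v. f (h v))"
  using linear_compose[of h f] by (simp add: o_def)

lemma lie_rep_subalgebra:
  assumes "subspace M" "M \<subseteq> L" "\<And>x y. x \<in> M \<Longrightarrow> y \<in> M \<Longrightarrow> br x y \<in> M"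
  shows "lie_rep M br V \<rho>"
proof -
  interpret M: fd_lie M br using subalgebra_fd_lie[OF assms] .
  show ?thesis
  proof (intro lie_rep.intro lie_rep_axioms.intro M.fd_lie_axioms)
    show "\<rho> x v \<in> V" if "x \<in> M" "v \<in> V" for x v
      using rep_closed[OF subsetD[OF assms(2) that(1)] that(2)] .
    show "\<rho> (br x y) v = \<rho> x (\<rho> y v) - \<rho> y (\<rho> x v)" if "x \<in> M" "y \<in> M" "v \<in> V" for x y v
      using rep_bracket[OF subsetD[OF assms(2) that(1)] subsetD[OF assms(2) that(2)] that(3)] .
  qed (fact fdV rep_linear rep_linear_left)+
qed

lemma lie_rep_sub:
  assumes "subspace W" "W \<subseteq> V" "\<And>x v. x \<in> L \<Longrightarrow> v \<in> W \<Longrightarrow> \<rho> x v \<in> W"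
  shows "lie_rep L br W \<rho>"
proof (intro lie_rep.intro lie_rep_axioms.intro fd_lie_axioms)
  show "\<rho> x v \<in> W" if "x \<in> L" "v \<in> W" for x v using assms(3)[OF that] .
  show "\<rho> (br x y) v = \<rho> x (\<rho> y v) - \<rho> y (\<rho> x v)" if "x \<in> L" "y \<in> L" "v \<in> W" for x y v
    using rep_bracket[OF that(1,2) subsetD[OF assms(2) that(3)]] .
qed (fact finite_dimensional_subset[OF assms(1,2) fdV] rep_linear rep_linear_left)+

lemma lie_rep_quotient:
  assumes "subspace W" "W \<subseteq> V" "\<And>x v. x \<in> L \<Longrightarrow> v \<in> W \<Longrightarrow> \<rho> x v \<in> W"
    "subspace U" "U \<subseteq> V" "linear p" "\<And>w. w \<in> W \<Longrightarrow> p w = 0"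
    "\<And>v. v \<in> V \<Longrightarrow> p v \<in> U" "\<And>v. v \<in> V \<Longrightarrow> v - p v \<in> W"
  shows "lie_rep L br U (\<lambda>x v. p (\<rho> x v))"
proof (intro lie_rep.intro lie_rep_axioms.intro fd_lie_axioms)
  have p: "p (\<rho> x (p v)) = p (\<rho> x v)" if "x \<in> L" "v \<in> V" for x v
    using assms(7)[OF assms(3)[OF that(1) assms(9)[OF that(2)]]] linear_diff[OF assms(6)] by simp
  show "p (\<rho> (br x y) v) = p (\<rho> x (p (\<rho> y v))) - p (\<rho> y (p (\<rho> x v)))" if "x \<in> L" "y \<in> L" "v \<in> U" for x y v
  proof -
    have v: "v \<in> V" using that assms(5) by blast
    show ?thesis
      using that v by (simp add: rep_bracket p rep_closed linear_diff[OF assms(6)])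
  qed
  show "finite_dimensional U" using finite_dimensional_subset[OF assms(4,5) fdV] .
  show "linear (\<lambda>v. p (\<rho> x v))" for x using linear_comp2[OF assms(6) rep_linear] .
  show "linear (\<lambda>x. p (\<rho> x v))" for v using linear_compose[OF rep_linear_left assms(6)] by (simp add: o_def)
  show "p (\<rho> x v) \<in> U" if "x \<in> L" "v \<in> U" for x v using that rep_closed assms(5,8) by blast
qed

definition acts_nilpotently :: "'a \<Rightarrow> bool"
  where "acts_nilpotently x \<longleftrightarrow> (\<exists>n. \<forall>v\<in>V. (\<rho> x ^^ n) v = 0)"

end

text \<open>Engel's theorem relative to an invariant subspace W, which plays the part of 0.
  Solvability hands over an ideal M of codimension 1 at once, namely any hyperplane that contains
  the derived algebra, so the search for one in the general theorem is avoided.\<close>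

lemma engel_solvable:
  assumes "lie_rep L br V \<rho>" "solvable_lie br L" "\<And>x. x \<in> L \<Longrightarrow> \<exists>n. \<forall>v\<in>V. (\<rho> x ^^ n) v = 0"
    "subspace W" "W \<subset> V" "\<And>x v. x \<in> L \<Longrightarrow> v \<in> W \<Longrightarrow> \<rho> x v \<in> W"
  shows "\<exists>v\<in>V - W. \<forall>x\<in>L. \<rho> x v \<in> W"
  using assms
proof (induction "dim L" arbitrary: L rule: less_induct)
  case less
  interpret lie_rep L br V \<rho> by fact
  show ?case
  proof (cases "L = {0}")
    case True
    obtain v where "v \<in> V - W" using less.prems(5) by blast
    then show ?thesis using True subspace_0[OF less.prems(4)] by auto
  next
    case False
    let ?D = "derived_algebra br L"
    have DL: "?D \<subseteq> L" unfolding derived_algebra_def using subspace closed by (intro bracket_span_subset)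
    moreover have "?D \<noteq> L" using solvable_lie_perfect[OF less.prems(2)] False by blast
    ultimately have DL': "?D \<subset> L" by blast
    obtain M z where M: "subspace M" "?D \<subseteq> M" "M \<subseteq> L" "z \<in> L" "z \<notin> M"
      "\<And>x. x \<in> L \<Longrightarrow> \<exists>c. x - c *\<^sub>R z \<in> M" "dim L = dim M + 1"
      using hyperplane_extension[OF _ DL' fd] by (auto simp: derived_algebra_def subspace_bracket_span)
    have brM: "br x y \<in> M" if "x \<in> L" "y \<in> L" for x y
      using bracket_in_span[OF that, of br] M(2) by (auto simp: derived_algebra_def)
    have repM: "lie_rep M br V \<rho>" using lie_rep_subalgebra[OF M(1,3)] brM M(3) by blast
    have "solvable_lie br M" using solvable_lie_subset[OF less.prems(2) M(3,1)] .
    then have "\<exists>v\<in>V - W. \<forall>x\<in>M. \<rho> x v \<in> W"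
      using less.hyps[of M, OF _ repM] M(3,7) less.prems(3,4,5,6) by (simp add: subset_iff)
    then obtain u where u: "u \<in> V - W" "\<forall>x\<in>M. \<rho> x u \<in> W" by blast
    \<comment> \<open>The vectors that M maps into W are stable under z, because [M, z] lies in
      M.\<close>
    have zj: "(\<rho> z ^^ j) u \<in> V \<and> (\<forall>x\<in>M. \<rho> x ((\<rho> z ^^ j) u) \<in> W)" for j
    proof (induction j)
      case (Suc j)
      let ?u = "(\<rho> z ^^ j) u"
      have "\<rho> x (\<rho> z ?u) \<in> W" if x: "x \<in> M" for x
      proof -
        have "\<rho> x (\<rho> z ?u) = \<rho> z (\<rho> x ?u) + \<rho> (br x z) ?u"
          using rep_bracket[of x z ?u] x M(3,4) Suc by auto
        moreover have "\<rho> z (\<rho> x ?u) \<in> W" using less.prems(6) M(4) Suc x by blast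
        moreover have "\<rho> (br x z) ?u \<in> W" using Suc brM x M(3,4) by blast
        ultimately show ?thesis using subspace_add[OF less.prems(4)] by simp
      qed
      then show ?case using Suc rep_closed M(4) by simp
    qed (use u in simp)
    obtain n where "\<forall>v\<in>V. (\<rho> z ^^ n) v = 0" using less.prems(3)[OF M(4)] by blast
    then have n: "(\<rho> z ^^ n) u \<in> W" using u subspace_0[OF less.prems(4)] by simp
    \<comment> \<open>The last iterate of z on u that lies outside W is mapped into W by z as well
      as by M.\<close>
    define j where "j = (LEAST j. (\<rho> z ^^ j) u \<in> W)"
    have j: "(\<rho> z ^^ j) u \<in> W" unfolding j_def using n by (rule LeastI)
    then have "j \<noteq> 0" using u by (intro notI) simp
    then obtain i where i: "j = Suc i" using not0_implies_Suc by blast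
    have iW: "(\<rho> z ^^ i) u \<notin> W" using not_less_Least[of i "\<lambda>j. (\<rho> z ^^ j) u \<in> W"] i j_def by auto
    have "\<rho> x ((\<rho> z ^^ i) u) \<in> W" if "x \<in> L" for x
    proof -
      obtain c where c: "x - c *\<^sub>R z \<in> M" using M(6) \<open>x \<in> L\<close> by metis
      have "\<rho> x ((\<rho> z ^^ i) u) = \<rho> (x - c *\<^sub>R z) ((\<rho> z ^^ i) u) + c *\<^sub>R (\<rho> z ^^ j) u"
        by (simp add: i)
      then show ?thesis using zj c j less.prems(4) by (metis subspace_add subspace_scale)
    qed
    then show ?thesis using zj iW by blast
  qed
qed

context lie_rep
begin

definition irreducible :: bool
  where "irreducible \<longleftrightarrow> V \<noteq> {0} \<and>
    (\<forall>W. subspace W \<longrightarrow> W \<subseteq> V \<longrightarrow> (\<forall>x\<in>L. \<forall>v\<in>W. \<rho> x v \<in> W) \<longrightarrow> W = {0} \<or> W = V)"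

lemma linear_trace_rep:
  assumes "linear w" "w ` V \<subseteq> V" "x \<in> L" "y \<in> L"
  shows "trace_on V (\<lambda>v. \<rho> (x + y) (w v)) = trace_on V (\<lambda>v. \<rho> x (w v)) + trace_on V (\<lambda>v. \<rho> y (w v))"
    "trace_on V (\<lambda>v. \<rho> (c *\<^sub>R x) (w v)) = c * trace_on V (\<lambda>v. \<rho> x (w v))"
proof -
  have l: "linear (\<lambda>v. \<rho> u (w v))" for u using linear_comp2[OF rep_linear assms(1)] .
  have i: "(\<lambda>v. \<rho> u (w v)) ` V \<subseteq> V" if "u \<in> L" for u using rep_closed[OF that] assms(2) by blast
  show "trace_on V (\<lambda>v. \<rho> (x + y) (w v)) = trace_on V (\<lambda>v. \<rho> x (w v)) + trace_on V (\<lambda>v. \<rho> y (w v))"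
    using trace_on_add[OF fdV l i l i, OF assms(3,4)] by simp
  show "trace_on V (\<lambda>v. \<rho> (c *\<^sub>R x) (w v)) = c * trace_on V (\<lambda>v. \<rho> x (w v))"
    using trace_on_scale[OF fdV l i, OF assms(3)] by simp
qed

text \<open>If \<open>w\<close> is the inverse of \<open>\<rho> z\<close> on its Fitting one-component, extended by zero, then
  \<open>\<rho> y\<close> commutes with \<open>w\<close> and \<open>tr ([\<rho> x, \<rho> y] w) = 0\<close>, so that component is zero.\<close>

lemma acts_nilpotently_if_commuting:
  assumes "P \<subseteq> L" "Q \<subseteq> L" "z \<in> bracket_span br P Q"
    "\<And>y v. y \<in> Q \<Longrightarrow> v \<in> V \<Longrightarrow> \<rho> z (\<rho> y v) = \<rho> y (\<rho> z v)"
  shows "\<exists>n. \<forall>v\<in>V. (\<rho> z ^^ n) v = 0"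
proof -
  have PQL: "bracket_span br P Q \<subseteq> L" using assms(1,2) closed by (intro bracket_span_subset[OF subspace]) blast
  have z: "z \<in> L" using assms(3) PQL by blast
  obtain w where w: "linear w" "w ` V \<subseteq> V"
    "\<And>y v. linear y \<Longrightarrow> y ` V \<subseteq> V \<Longrightarrow> (\<And>u. u \<in> V \<Longrightarrow> y (\<rho> z u) = \<rho> z (y u)) \<Longrightarrow> v \<in> V \<Longrightarrow> y (w v) = w (y v)"
    "trace_on V (\<lambda>v. \<rho> z (w v)) = 0 \<Longrightarrow> \<exists>n. \<forall>v\<in>V. (\<rho> z ^^ n) v = 0"
    using Fitting_inverse[OF fdV rep_linear rep_image[OF z]] by blast
  have 0: "trace_on V (\<lambda>v. \<rho> (br x y) (w v)) = 0" if "x \<in> P" "y \<in> Q" for x y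
  proof -
    have xy: "x \<in> L" "y \<in> L" using that assms(1,2) by auto
    have wV: "w v \<in> V" if "v \<in> V" for v using that w(2) by blast
    have c: "\<rho> y (w v) = w (\<rho> y v)" if "v \<in> V" for v
      using w(3)[OF rep_linear rep_image[OF xy(2)] _ that] assms(4)[OF \<open>y \<in> Q\<close>] by simp
    have l1: "linear (\<lambda>v. \<rho> (br x y) (w v))" using linear_comp2[OF rep_linear w(1)] .
    have l2: "linear (\<lambda>v. \<rho> x (w v))" using linear_comp2[OF rep_linear w(1)] .
    have l3: "linear (\<lambda>v. \<rho> x (w (\<rho> y v)))" using linear_comp2[OF l2 rep_linear] .
    have l4: "linear (\<lambda>v. \<rho> y (\<rho> x (w v)))" using linear_comp2[OF rep_linear l2] .
    have i1: "(\<lambda>v. \<rho> (br x y) (w v)) ` V \<subseteq> V" using rep_closed closed[OF xy] wV by blast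
    have i2: "(\<lambda>v. \<rho> x (w v)) ` V \<subseteq> V" using rep_closed xy wV by blast
    have i3: "(\<lambda>v. \<rho> x (w (\<rho> y v))) ` V \<subseteq> V" using rep_closed xy wV by blast
    have i4: "(\<lambda>v. \<rho> y (\<rho> x (w v))) ` V \<subseteq> V" using rep_closed xy wV by blast
    have "trace_on V (\<lambda>v. \<rho> (br x y) (w v)) = trace_on V (\<lambda>v. \<rho> x (w (\<rho> y v)) - \<rho> y (\<rho> x (w v)))"
      using trace_on_cong[OF fdV l1 i1 linear_compose_sub[OF l3 l4]] xy wV c by (simp add: rep_bracket)
    also have "\<dots> = 0"
      using trace_on_diff[OF fdV l3 i3 l4 i4] trace_on_comm[OF fdV l2 i2 rep_linear rep_image[OF xy(2)]] by simp
    finally show ?thesis .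
  qed
  have "trace_on V (\<lambda>v. \<rho> u (w v)) = 0 \<and> u \<in> L" if "u \<in> bracket_span br P Q" for u
    using that unfolding bracket_span_def
  proof (induction rule: span_induct_alt)
    case base
    then show ?case using trace_on_zero[of V] subspace_0[OF subspace] by simp
  next
    case (step c x y)
    from step(1) obtain a b where ab: "x = br a b" "a \<in> P" "b \<in> Q" by blast
    have "x \<in> L" unfolding ab(1) using closed subsetD[OF assms(1) ab(2)] subsetD[OF assms(2) ab(3)] .
    moreover have "trace_on V (\<lambda>v. \<rho> x (w v)) = 0" unfolding ab(1) using 0[OF ab(2,3)] .
    moreover have "c *\<^sub>R x \<in> L" using \<open>x \<in> L\<close> subspace_scale[OF subspace] by blast
    ultimately show ?case
      using linear_trace_rep(1)[OF w(1,2), of "c *\<^sub>R x" y] linear_trace_rep(2)[OF w(1,2) \<open>x \<in> L\<close> \<open>x \<in> L\<close>, of c]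
        step(2) subspace_add[OF subspace] by simp
  qed
  then show ?thesis using w(4) assms(3) by blast
qed

text \<open>The commutation hypothesis makes I act by nilpotent operators, so Engel's theorem yields
  a nonzero vector killed by I. As I is an ideal, the vectors killed by it form a submodule, which
  is all of V by irreducibility.\<close>

lemma irreducible_trivial_action:
  assumes irr: irreducible and PQ: "P \<subseteq> L" "Q \<subseteq> L" and I: "I = bracket_span br P Q"
    and ideal: "\<And>x y. x \<in> L \<Longrightarrow> y \<in> I \<Longrightarrow> br x y \<in> I" and solv: "solvable_lie br I"
    and comm: "\<And>z y v. z \<in> I \<Longrightarrow> y \<in> Q \<Longrightarrow> v \<in> V \<Longrightarrow> \<rho> z (\<rho> y v) = \<rho> y (\<rho> z v)"
    and "z \<in> I" "v \<in> V"
  shows "\<rho> z v = 0"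
proof -
  have IL: "I \<subseteq> L" using PQ closed unfolding I by (intro bracket_span_subset[OF subspace]) blast
  have sI: "subspace I" unfolding I by (rule subspace_bracket_span)
  have nil: "\<exists>n. \<forall>v\<in>V. (\<rho> z ^^ n) v = 0" if "z \<in> I" for z
    using acts_nilpotently_if_commuting[OF PQ] comm that I by blast
  have V0: "V \<noteq> {0}" using irr by (simp add: irreducible_def)
  then have "{0} \<subset> V" using subspace_0[OF subV] by blast
  then obtain u where u: "u \<in> V" "u \<noteq> 0" "\<forall>x\<in>I. \<rho> x u = 0"
    using engel_solvable[OF lie_rep_subalgebra[OF sI IL] solv nil subspace_single_0] ideal IL by auto
  define U where "U = {v \<in> V. \<forall>x\<in>I. \<rho> x v = 0}"
  have "subspace U" unfolding U_def subspace_def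
    using subspace_0[OF subV] subspace_add[OF subV] subspace_scale[OF subV] by auto
  moreover have "\<rho> x v \<in> U" if x: "x \<in> L" and v: "v \<in> U" for x v
  proof -
    have "\<rho> y (\<rho> x v) = 0" if y: "y \<in> I" for y
    proof -
      have "\<rho> (br x y) v = \<rho> x (\<rho> y v) - \<rho> y (\<rho> x v)" using rep_bracket x v y IL by (auto simp: U_def)
      then show ?thesis using v y ideal[OF x y] by (simp add: U_def)
    qed
    then show ?thesis using x v rep_closed by (simp add: U_def)
  qed
  moreover have "U \<noteq> {0}" using u by (auto simp: U_def)
  ultimately have "U = V" using irr unfolding irreducible_def by (metis (no_types, lifting) U_def mem_Collect_eq subsetI)
  then show ?thesis using assms(8,9) by (auto simp: U_def)
qed

end

context fd_lie
begin

lemma ideal_bracket_span: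
  assumes "P \<subseteq> g" "Q \<subseteq> g" "\<And>x y. x \<in> g \<Longrightarrow> y \<in> P \<Longrightarrow> br x y \<in> P" "\<And>x y. x \<in> g \<Longrightarrow> y \<in> Q \<Longrightarrow> br x y \<in> Q"
    "x \<in> g" "y \<in> bracket_span br P Q"
  shows "br x y \<in> bracket_span br P Q"
  using assms(6) unfolding bracket_span_def
proof (induction rule: span_induct_alt)
  case base
  then show ?case by (simp add: span_0)
next
  case (step c u y)
  then obtain a b where ab: "u = br a b" "a \<in> P" "b \<in> Q" by blast
  have "br x u = br (br x a) b + br a (br x b)"
    unfolding ab(1) using bracket_bracket[OF assms(5) subsetD[OF assms(1) ab(2)] subsetD[OF assms(2) ab(3)]] by simp
  moreover have "br (br x a) b \<in> bracket_span br P Q" "br a (br x b) \<in> bracket_span br P Q"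
    using ab assms(3,4,5) by (auto intro: bracket_in_span)
  ultimately have "br x u \<in> bracket_span br P Q" using subspace_add[OF subspace_bracket_span, of _ br P Q] by simp
  then show ?case using step by (simp add: bracket_span_def span_add span_scale)
qed

lemma derived_series_ideal:
  assumes "I \<subseteq> g" "subspace I" "\<And>x y. x \<in> g \<Longrightarrow> y \<in> I \<Longrightarrow> br x y \<in> I"
  shows "(derived_algebra br ^^ n) I \<subseteq> I" "x \<in> g \<Longrightarrow> y \<in> (derived_algebra br ^^ n) I \<Longrightarrow> br x y \<in> (derived_algebra br ^^ n) I"
proof -
  have "(derived_algebra br ^^ n) I \<subseteq> I \<and> (\<forall>x\<in>g. \<forall>y\<in>(derived_algebra br ^^ n) I. br x y \<in> (derived_algebra br ^^ n) I)"
  proof (induction n)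
    case (Suc n)
    let ?D = "(derived_algebra br ^^ n) I"
    have D: "?D \<subseteq> g" using Suc assms(1) by blast
    have "bracket_span br ?D ?D \<subseteq> I" using Suc assms by (intro bracket_span_subset) blast+
    moreover have "br x y \<in> bracket_span br ?D ?D" if "x \<in> g" "y \<in> bracket_span br ?D ?D" for x y
      using ideal_bracket_span[OF D D _ _ that] Suc by blast
    ultimately show ?case unfolding derived_series_Suc by blast
  qed (use assms in simp)
  then show "(derived_algebra br ^^ n) I \<subseteq> I" "x \<in> g \<Longrightarrow> y \<in> (derived_algebra br ^^ n) I \<Longrightarrow> br x y \<in> (derived_algebra br ^^ n) I" by blast+
qed

lemma solvable_derived_series_subset:
  assumes "solvable_lie br g" shows "solvable_lie br ((derived_algebra br ^^ n) g)"
  using solvable_lie_subset[OF assms derived_series_ideal(1)[OF order_refl subspace closed] subspace_derived_series[OF subspace]] by blast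

end

text \<open>A form of Lie's theorem that holds over the reals, since it speaks of no eigenvalues.
  The derived series is climbed from its zero term upwards, with two applications of
  \<open>irreducible_trivial_action\<close> for each step.\<close>

lemma (in lie_rep) irreducible_solvable_derived:
  assumes irreducible "solvable_lie br L" "x \<in> derived_algebra br L" "v \<in> V"
  shows "\<rho> x v = 0"
proof -
  let ?D = "\<lambda>n. (derived_algebra br ^^ n) L"
  have ideal: "br x y \<in> ?D n" if "x \<in> L" "y \<in> ?D n" for x y n
    using derived_series_ideal(2)[OF order_refl subspace closed that] .
  have sub: "?D n \<subseteq> L" for n using derived_series_ideal(1)[OF order_refl subspace closed] .
  have step: "\<forall>z\<in>?D (Suc i). \<forall>v\<in>V. \<rho> z v = 0" if 0: "\<forall>z\<in>?D (Suc (Suc i)). \<forall>v\<in>V. \<rho> z v = 0" for i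
  proof -
    have comm: "\<rho> z (\<rho> y v) = \<rho> y (\<rho> z v)" if "z \<in> ?D (Suc i)" "y \<in> ?D (Suc i)" "v \<in> V" for z y v
    proof -
      have "br z y \<in> ?D (Suc (Suc i))" using bracket_in_span[OF that(1,2), of br] by (simp add: derived_algebra_def)
      then have "\<rho> (br z y) v = 0" using 0 that(3) by blast
      moreover have "z \<in> L" "y \<in> L" using that(1,2) sub by blast+
      ultimately show ?thesis using rep_bracket[of z y v] that(3) by simp
    qed
    \<comment> \<open>First half: as D^(i+2) acts by 0, the elements of D^(i+1) commute as
      operators, and therefore [L, D^(i+1)] acts by 0.\<close>
    let ?M = "bracket_span br L (?D (Suc i))"
    have M_sub: "?M \<subseteq> ?D (Suc i)"
      by (rule bracket_span_subset[OF subspace_derived_series[OF subspace]]) (rule ideal)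
    have M0: "\<rho> z v = 0" if "z \<in> ?M" "v \<in> V" for z v
    proof (rule irreducible_trivial_action[OF assms(1) order_refl sub refl _ _ _ that])
      show "br x y \<in> ?M" if "x \<in> L" "y \<in> ?M" for x y
        by (rule ideal_bracket_span[OF order_refl sub closed ideal that])
      show "solvable_lie br ?M"
        using solvable_lie_subset[OF solvable_derived_series_subset[OF assms(2)] M_sub subspace_bracket_span] .
      show "\<rho> z (\<rho> y v) = \<rho> y (\<rho> z v)" if "z \<in> ?M" "y \<in> ?D (Suc i)" "v \<in> V" for z y v
        using comm that M_sub by blast
    qed
    \<comment> \<open>Second half: now D^(i+1) commutes with all operators from L, in particular
      with those from D^i, and it equals [D^i, D^i].\<close>
    have eq: "?D (Suc i) = bracket_span br (?D i) (?D i)" by (simp add: derived_algebra_def)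
    have "\<rho> z v = 0" if "z \<in> ?D (Suc i)" "v \<in> V" for z v
    proof (rule irreducible_trivial_action[OF assms(1) sub sub eq ideal _ _ that])
      show "solvable_lie br (?D (Suc i))" using solvable_derived_series_subset[OF assms(2)] .
      fix z y v assume z: "z \<in> ?D (Suc i)" and y: "y \<in> ?D i" and v: "v \<in> V"
      have y': "y \<in> L" and z': "z \<in> L" using y z sub by blast+
      have "\<rho> (br y z) v = 0" by (rule M0[OF bracket_in_span[OF y' z] v])
      then show "\<rho> z (\<rho> y v) = \<rho> y (\<rho> z v)" using rep_bracket[OF y' z' v] by simp
    qed
    then show ?thesis by blast
  qed
  obtain n where n: "?D n = {0}" using assms(2) by (auto simp: solvable_lie_def)
  have "\<forall>z\<in>?D (Suc n). \<forall>v\<in>V. \<rho> z v = 0"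
    unfolding derived_series_Suc n by (simp add: bracket_span_def)
  then have "\<forall>z\<in>?D (Suc 0). \<forall>v\<in>V. \<rho> z v = 0"
    by (induction n) (use step in blast)+
  then show ?thesis using assms(3,4) by simp
qed

text \<open>Along a composition series: x acts by 0 on an irreducible module, and the nilpotency
  exponents n on a submodule W and m on the quotient add up. The quotient is modelled by the
  complement U with the action p \<rho>.\<close>

lemma solvable_derived_acts_nilpotently:
  assumes "lie_rep L br V \<rho>" "solvable_lie br L" "x \<in> derived_algebra br L"
  shows "\<exists>n. \<forall>v\<in>V. (\<rho> x ^^ n) v = 0"
  using assms
proof (induction "dim V" arbitrary: V \<rho> rule: less_induct)
  case less
  interpret lie_rep L br V \<rho> by fact
  have x: "x \<in> L" using assms(3) derived_series_ideal(1)[OF order_refl subspace closed, where n=1] by auto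
  consider "V = {0}" | "irreducible" | W where "subspace W" "W \<subseteq> V" "\<forall>x\<in>L. \<forall>v\<in>W. \<rho> x v \<in> W" "W \<noteq> {0}" "W \<noteq> V"
    unfolding irreducible_def by blast
  then show ?case
  proof cases
    case 1
    then show ?thesis by (intro exI[of _ 0]) auto
  next
    case 2
    then show ?thesis using irreducible_solvable_derived[OF 2 assms(2,3)] by (intro exI[of _ 1]) auto
  next
    case 3
    obtain U p where U: "subspace U" "U \<subseteq> V" "linear p" "\<And>w. w \<in> W \<Longrightarrow> p w = 0"
      "\<And>u. u \<in> U \<Longrightarrow> p u = u" "\<And>v. v \<in> V \<Longrightarrow> p v \<in> U" "\<And>v. v \<in> V \<Longrightarrow> v - p v \<in> W"
      by (rule complement_projection[OF 3(1,2) subV]) blast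
    have dW: "dim W < dim V" using finite_dimensional_dim_strict_mono[OF 3(1) _ fdV] 3(2,5) by blast
    have dU: "dim U < dim V" using complement_dim[OF fdV 3(1,2,4) U(1,2,4,5)] .
    have "lie_rep L br W \<rho>" using lie_rep_sub[OF 3(1,2)] 3(3) by blast
    then obtain n where n: "\<forall>v\<in>W. (\<rho> x ^^ n) v = 0" using less.hyps[OF dW _ assms(2,3)] by blast
    have "lie_rep L br U (\<lambda>x v. p (\<rho> x v))" using lie_rep_quotient[OF 3(1,2) _ U(1,2,3,4,6,7)] 3(3) by blast
    then obtain m where m: "\<forall>v\<in>U. ((\<lambda>v. p (\<rho> x v)) ^^ m) v = 0" using less.hyps[OF dU _ assms(2,3)] by blast
    have pm: "p ((\<rho> x ^^ j) v) = ((\<lambda>v. p (\<rho> x v)) ^^ j) (p v) \<and> (\<rho> x ^^ j) v \<in> V" if v: "v \<in> V" for j v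
    proof (induction j)
      case (Suc j)
      let ?u = "(\<rho> x ^^ j) v"
      have "p (\<rho> x (?u - p ?u)) = 0" using U(4,7) 3(3) x Suc by blast
      then have "p (\<rho> x ?u) = p (\<rho> x (p ?u))" by (simp add: linear_diff[OF U(3)])
      then show ?case using Suc rep_closed[OF x] by simp
    qed (use v in simp)
    have "(\<rho> x ^^ (n + m)) v = 0" if v: "v \<in> V" for v
    proof -
      have "p ((\<rho> x ^^ m) v) = 0" using pm[OF v, of m] m U(6)[OF v] by simp
      then have "(\<rho> x ^^ m) v \<in> W" using U(7) pm[OF v, of m] by fastforce
      then show ?thesis using n by (simp add: funpow_add)
    qed
    then show ?thesis by blast
  qed
qed

lemma (in fd_lie) adjoint_rep:
  assumes "subspace M" "M \<subseteq> g" "\<And>x y. x \<in> M \<Longrightarrow> y \<in> M \<Longrightarrow> br x y \<in> M"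
  shows "lie_rep M br g br"
proof -
  interpret M: fd_lie M br using subalgebra_fd_lie[OF assms] .
  show ?thesis
  proof (intro lie_rep.intro lie_rep_axioms.intro M.fd_lie_axioms)
    show "br x v \<in> g" if "x \<in> M" "v \<in> g" for x v
      using closed[OF subsetD[OF assms(2) that(1)] that(2)] .
    show "br (br x y) v = br x (br y v) - br y (br x v)" if "x \<in> M" "y \<in> M" "v \<in> g" for x y v
      using bracket_bracket[OF subsetD[OF assms(2) that(1)] subsetD[OF assms(2) that(2)] that(3)] .
  qed (fact fd linear_left linear_right)+
qed

text \<open>Every element of k = [g, g] acts nilpotently under ad. Engel's theorem, applied with W =
  \<open>U i\<close>, makes the upper central series of k grow until it is everything, and the lower
  central series descends along it.\<close>

theorem (in fd_lie) solvable_derived_nilpotent: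
  assumes "solvable_lie br g"
  shows "nilpotent_lie br (derived_algebra br g)"
proof -
  let ?k = "derived_algebra br g"
  have kg: "?k \<subseteq> g" and kid: "\<And>x y. x \<in> g \<Longrightarrow> y \<in> ?k \<Longrightarrow> br x y \<in> ?k"
    using derived_series_ideal[OF order_refl subspace closed, where n=1] by simp_all
  have sk: "subspace ?k" by (simp add: derived_algebra_def subspace_bracket_span)
  have fk: "finite_dimensional ?k" using finite_dimensional_subset[OF sk kg fd] .
  interpret k: fd_lie ?k br using subalgebra_fd_lie[OF sk kg] kid kg by blast
  have rep: "lie_rep ?k br ?k br" using k.adjoint_rep[OF sk order_refl k.closed] .
  have solv: "solvable_lie br ?k" using solvable_lie_subset[OF assms kg sk] .
  have nil: "\<exists>n. \<forall>v\<in>?k. (br x ^^ n) v = 0" if "x \<in> ?k" for x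
    using solvable_derived_acts_nilpotently[OF adjoint_rep[OF subspace order_refl closed] assms that] kg by blast
  \<comment> \<open>\<open>F W\<close> collects the elements of k that k brackets into W, so
    \<open>U i\<close> is the i-th term of the upper central series.\<close>
  define F where "F W = {v \<in> ?k. \<forall>x\<in>?k. br x v \<in> W}" for W
  define U where "U i = (F ^^ i) {0}" for i
  have U: "subspace (U i) \<and> U i \<subseteq> ?k \<and> U i \<subseteq> U (Suc i)" for i
  proof (induction i)
    case 0
    show ?case unfolding U_def using subspace_0[OF sk] by (auto simp: F_def subspace_single_0)
  next
    case (Suc i)
    have eq: "U (Suc i) = F (U i)" "U (Suc (Suc i)) = F (U (Suc i))" by (simp_all add: U_def)
    have "subspace (F (U i))"
      using Suc sk by (auto simp: F_def subspace_def)
    moreover have "F (U i) \<subseteq> F (U (Suc i))" using Suc by (auto simp: F_def)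
    ultimately show ?case unfolding eq by (auto simp: F_def)
  qed
  have inv: "br x v \<in> U i" if "x \<in> ?k" "v \<in> U i" for x v i
    using U[of i] that by (auto simp: U_def F_def)
  have grow: "U i = ?k \<or> dim (U i) \<ge> i" for i
  proof (induction i)
    case (Suc i)
    show ?case
    proof (cases "U i = ?k")
      case True
      then show ?thesis using U[of i] U[of "Suc i"] by blast
    next
      case False
      then have "U i \<subset> ?k" using U[of i] by blast
      then obtain v where "v \<in> ?k - U i" "\<forall>x\<in>?k. br x v \<in> U i"
        using engel_solvable[OF rep solv nil _ _ inv] U[of i] by blast
      then have "v \<in> U (Suc i)" "v \<notin> U i" by (auto simp: U_def F_def)
      then have "U i \<subset> U (Suc i)" using U[of i] by blast
      moreover have "finite_dimensional (U (Suc i))" using finite_dimensional_subset[OF _ _ fk] U[of "Suc i"] by blast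
      ultimately have "dim (U i) < dim (U (Suc i))" using finite_dimensional_dim_strict_mono U[of i] by blast
      then show ?thesis using Suc False by simp
    qed
  qed simp
  \<comment> \<open>One more than the dimension, so that the alternative
    \<open>dim (U i) \<ge> i\<close> in \<open>grow\<close> is impossible at this index.\<close>
  let ?n = "Suc (dim ?k)"
  have Un: "U ?n = ?k"
    using grow[of ?n] finite_dimensional_dim_mono[OF _ _ fk, of "U ?n"] U[of ?n] by fastforce
  have "(bracket_span br ?k ^^ j) ?k \<subseteq> U (?n - j)" if "j \<le> ?n" for j
    using that
  proof (induction j)
    case 0
    then show ?case using Un by simp
  next
    case (Suc j)
    then have j: "?n - j = Suc (?n - Suc j)" by simp
    have IH: "(bracket_span br ?k ^^ j) ?k \<subseteq> U (?n - j)" using Suc by simp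
    have "br x y \<in> U (?n - Suc j)" if "x \<in> ?k" "y \<in> (bracket_span br ?k ^^ j) ?k" for x y
    proof -
      have "y \<in> F (U (?n - Suc j))" using IH that unfolding j by (auto simp: U_def)
      then show ?thesis using that by (simp add: F_def)
    qed
    then have "bracket_span br ?k ((bracket_span br ?k ^^ j) ?k) \<subseteq> U (?n - Suc j)"
      using U by (intro bracket_span_subset) blast+
    then show ?case by simp
  qed
  from this[of ?n] have "(bracket_span br ?k ^^ ?n) ?k \<subseteq> {0}" by (simp add: U_def)
  moreover have "subspace ((bracket_span br ?k ^^ ?n) ?k)" by (simp add: subspace_bracket_span)
  ultimately have "(bracket_span br ?k ^^ ?n) ?k = {0}" using subspace_0 by blast
  then show ?thesis unfolding nilpotent_lie_def by blast
qed

section \<open>Cartan's criterion\<close>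

text \<open>Multiplication by i on the complexification, where the pair (x, y) stands for x + i y.
  All dimensions and traces remain real ones.\<close>

definition times_i :: "'v::real_vector \<times> 'v \<Rightarrow> 'v \<times> 'v"
  where "times_i u = (- snd u, fst u)"

definition cscale :: "complex \<Rightarrow> 'v::real_vector \<times> 'v \<Rightarrow> 'v \<times> 'v"
  where "cscale c u = Re c *\<^sub>R u + Im c *\<^sub>R times_i u"

lemma linear_times_i: "linear times_i"
  by (rule linearI) (simp_all add: times_i_def prod_eq_iff)

lemma times_i_times_i [simp]: "times_i (times_i u) = - u"
  by (simp add: times_i_def prod_eq_iff)

lemma times_i_simps [simp]: "times_i (u + v) = times_i u + times_i v" "times_i (r *\<^sub>R u) = r *\<^sub>R times_i u" "times_i 0 = 0" "times_i (- u) = - times_i u"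
  "times_i (u - v) = times_i u - times_i v"
  by (simp_all add: times_i_def prod_eq_iff)

lemma cscale_simps:
  "cscale c (u + v) = cscale c u + cscale c v" "cscale c (u - v) = cscale c u - cscale c v"
  "cscale (a + c) u = cscale a u + cscale c u" "cscale (a - c) u = cscale a u - cscale c u"
  "cscale (a * c) u = cscale a (cscale c u)" "cscale (- c) u = - cscale c u"
  "cscale 1 u = u" "cscale 0 u = 0" "cscale c 0 = 0" "cscale (of_real r) u = r *\<^sub>R u"
  "cscale \<i> u = times_i u" "cscale c (r *\<^sub>R u) = r *\<^sub>R cscale c u"
  by (simp_all add: cscale_def algebra_simps)

lemma linear_cscale: "linear (cscale c)"
  by (rule linearI) (simp_all add: cscale_simps)

lemma cscale_eq_0: "cscale c u = 0 \<Longrightarrow> c \<noteq> 0 \<Longrightarrow> u = 0"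
proof -
  assume "cscale c u = 0" "c \<noteq> 0"
  then have "cscale (inverse c * c) u = 0" by (simp only: cscale_simps)
  then show "u = 0" using \<open>c \<noteq> 0\<close> by (simp add: cscale_simps)
qed

definition complex_linear :: "('v::real_vector \<times> 'v \<Rightarrow> 'w::real_vector \<times> 'w) \<Rightarrow> bool"
  where "complex_linear T \<longleftrightarrow> linear T \<and> (\<forall>u. T (times_i u) = times_i (T u))"

lemma complex_linear_linear: "complex_linear T \<Longrightarrow> linear T"
  by (simp only: complex_linear_def)

lemma complex_linear_times_i: "complex_linear T \<Longrightarrow> T (times_i u) = times_i (T u)"
  unfolding complex_linear_def by blast

lemma complex_linear_cscale: "complex_linear T \<Longrightarrow> T (cscale c u) = cscale c (T u)"
  unfolding cscale_def by (simp only: complex_linear_linear complex_linear_times_i linear_add linear_scale)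

definition shift :: "('v::real_vector \<times> 'v \<Rightarrow> 'v \<times> 'v) \<Rightarrow> complex \<Rightarrow> 'v \<times> 'v \<Rightarrow> 'v \<times> 'v"
  where "shift T c u = T u - cscale c u"

lemma complex_linear_shift: "complex_linear T \<Longrightarrow> complex_linear (shift T c)"
  unfolding complex_linear_def shift_def[abs_def]
  by (intro conjI linear_compose_sub linear_cscale allI) (simp_all only: cscale_def times_i_simps)

lemma complex_linear_funpow:
  fixes T :: "'v::real_vector \<times> 'v \<Rightarrow> 'v \<times> 'v"
  assumes "complex_linear T"
  shows "complex_linear (T ^^ n)"
proof -
  have "(T ^^ n) (times_i u) = times_i ((T ^^ n) u)" for u
    by (induction n) (simp_all add: complex_linear_times_i[OF assms])
  then show ?thesis
    unfolding complex_linear_def using linear_funpow[OF complex_linear_linear[OF assms]] by blast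
qed

lemma shift_commute: "complex_linear T \<Longrightarrow> shift T c (shift T d u) = shift T d (shift T c u)"
  unfolding shift_def
  by (simp add: linear_diff[OF complex_linear_linear] complex_linear_cscale cscale_simps(2)
      cscale_simps(5)[symmetric] mult.commute)

section \<open>Eigenvectors and the real parts of eigenvalues\<close>

lemma funpow_commute_apply:
  assumes "\<And>u. f (h u) = h (f u)"
  shows "f ((h ^^ n) u) = (h ^^ n) (f u)"
  by (induction n) (simp_all add: assms)

text \<open>The dependence concerns the indexed family and not the set of its values, so a repeated
  value counts as well. Applied to the powers of T on a vector it produces an annihilating
  polynomial.\<close>

lemma sequence_dependent:
  fixes f :: "nat \<Rightarrow> 'v::real_vector"
  assumes "finite_dimensional U" "\<And>i. f i \<in> U"
  shows "\<exists>a n. (\<exists>i\<le>n. a i \<noteq> 0) \<and> (\<Sum>i\<le>n. a i *\<^sub>R f i) = 0"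
proof -
  obtain B where B: "finite B" "independent B" "span B = U" "card B = dim U"
    using finite_dimensional_basis[OF assms(1)] by metis
  let ?n = "dim U"
  show ?thesis
  proof (cases "inj_on f {..?n}")
    case False
    then obtain i j where ij: "i \<le> ?n" "j \<le> ?n" "i \<noteq> j" "f i = f j" by (auto simp: inj_on_def)
    let ?a = "\<lambda>k. if k = i then 1 else if k = j then -1 else (0::real)"
    have "(\<Sum>k\<le>?n. ?a k *\<^sub>R f k) = (\<Sum>k\<in>{i,j}. ?a k *\<^sub>R f k)"
      using ij by (intro sum.mono_neutral_right) auto
    also have "\<dots> = 0" using ij by simp
    finally show ?thesis using ij(1) by (intro exI[of _ ?a] exI[of _ ?n]) auto
  next
    case True
    let ?S = "f ` {..?n}"
    have "card ?S = Suc (dim U)" using card_image[OF True] by simp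
    moreover have "?S \<subseteq> span B" using assms(2) B(3) by blast
    ultimately have "dependent ?S" using independent_span_bound[OF B(1), of ?S] B(4) by fastforce
    then obtain u where u: "\<exists>v\<in>?S. u v \<noteq> 0" "(\<Sum>v\<in>?S. u v *\<^sub>R v) = 0"
      using real_vector.dependent_finite[of ?S] by auto
    have "(\<Sum>i\<le>?n. u (f i) *\<^sub>R f i) = 0" using u(2) sum.reindex[OF True, of "\<lambda>v. u v *\<^sub>R v"] by simp
    then show ?thesis using u(1) by (intro exI[of _ "\<lambda>i. u (f i)"] exI[of _ ?n]) auto
  qed
qed

text \<open>With z a root of p = (X - z) q and w = q(T) v, the hypothesis becomes T w = z w. Either
  w is an eigenvector, or q annihilates v and has smaller degree. A bound \<open>N\<close> replaces
  the degree itself so that all sums have a fixed length.\<close>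

lemma eigenvector_of_polynomial:
  fixes T :: "'v::real_vector \<times> 'v \<Rightarrow> 'v \<times> 'v" and p :: "complex poly"
  assumes T: "complex_linear T" and U: "subspace U" "\<And>u. u \<in> U \<Longrightarrow> T u \<in> U" "\<And>u. u \<in> U \<Longrightarrow> times_i u \<in> U"
    and v: "v \<in> U" "v \<noteq> 0" and p: "p \<noteq> 0" "degree p \<le> N" "(\<Sum>i\<le>N. cscale (coeff p i) ((T ^^ i) v)) = 0"
  shows "\<exists>c u. u \<in> U \<and> u \<noteq> 0 \<and> T u = cscale c u"
  using p
proof (induction N arbitrary: p)
  case 0
  then have "coeff p 0 \<noteq> 0" using leading_coeff_0_iff[of p] by simp
  then show ?case using 0 cscale_eq_0 v by fastforce
next
  case (Suc N)
  show ?case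
  proof (cases "degree p = 0")
    case True
    then have p0: "coeff p 0 \<noteq> 0" using Suc.prems(1) leading_coeff_0_iff[of p] by simp
    have "(\<Sum>i\<le>Suc N. cscale (coeff p i) ((T ^^ i) v)) = (\<Sum>i\<in>{0}. cscale (coeff p i) ((T ^^ i) v))"
      using True by (intro sum.mono_neutral_right) (auto simp: coeff_eq_0 cscale_simps)
    then have "cscale (coeff p 0) v = 0" using Suc.prems(3) by simp
    then show ?thesis using cscale_eq_0 p0 v by blast
  next
    case False
    then have "\<not> constant (poly p)" by (simp add: constant_degree)
    then obtain z where "poly p z = 0" using fundamental_theorem_of_algebra by blast
    then obtain q where q: "p = [:- z, 1:] * q" unfolding poly_eq_0_iff_dvd by (auto elim: dvdE)
    have q0: "q \<noteq> 0" using Suc.prems(1) q by auto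
    have dq: "degree q \<le> N"
      using Suc.prems(2) degree_mult_eq[of "[:- z, 1:]" q] q q0 by simp
    define w where "w = (\<Sum>i\<le>N. cscale (coeff q i) ((T ^^ i) v))"
    have lT: "linear T" using complex_linear_linear[OF T] .
    have peq: "p = pCons 0 q - smult z q" unfolding q by simp
    have w': "w = (\<Sum>i\<le>Suc N. cscale (coeff q i) ((T ^^ i) v))"
      using coeff_eq_0[of q "Suc N"] dq by (simp add: w_def cscale_simps)
    have "(\<Sum>i\<le>Suc N. cscale (coeff (pCons 0 q) i) ((T ^^ i) v)) = (\<Sum>i\<le>N. cscale (coeff q i) ((T ^^ Suc i) v))"
      by (subst sum.atMost_Suc_shift) (simp add: cscale_simps)
    also have "\<dots> = T w"
      unfolding w_def linear_sum[OF lT] by (simp add: complex_linear_cscale[OF T])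
    finally have 1: "(\<Sum>i\<le>Suc N. cscale (coeff (pCons 0 q) i) ((T ^^ i) v)) = T w" .
    have 2: "(\<Sum>i\<le>Suc N. cscale (coeff (smult z q) i) ((T ^^ i) v)) = cscale z w"
      unfolding w' linear_sum[OF linear_cscale] coeff_smult cscale_simps(5) ..
    have "0 = T w - cscale z w"
      using Suc.prems(3) unfolding peq coeff_diff cscale_simps(4) sum_subtractf 1 2 by simp
    then have Tw: "T w = cscale z w" by simp
    have "(T ^^ i) v \<in> U" for i by (induction i) (use v U(2) in auto)
    then have "w \<in> U" unfolding w_def cscale_def
      using U by (intro subspace_sum subspace_add subspace_scale) auto
    then show ?thesis
      using Tw Suc.IH[OF q0 dq] w_def by blast
  qed
qed

lemma eigenvector_exists:
  fixes T :: "'v::real_vector \<times> 'v \<Rightarrow> 'v \<times> 'v"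
  assumes "complex_linear T" "finite_dimensional U" "\<And>u. u \<in> U \<Longrightarrow> T u \<in> U" "\<And>u. u \<in> U \<Longrightarrow> times_i u \<in> U"
    "U \<noteq> {0}"
  shows "\<exists>c u. u \<in> U \<and> u \<noteq> 0 \<and> T u = cscale c u"
proof -
  have sU: "subspace U" using finite_dimensional_imp_subspace[OF assms(2)] .
  obtain v where v: "v \<in> U" "v \<noteq> 0" using assms(5) subspace_0[OF sU] by blast
  have "(T ^^ i) v \<in> U" for i by (induction i) (use v assms(3) in auto)
  then obtain a n where a: "\<exists>i\<le>n. a i \<noteq> 0" "(\<Sum>i\<le>n. a i *\<^sub>R (T ^^ i) v) = 0"
    using sequence_dependent[OF assms(2), of "\<lambda>i. (T ^^ i) v"] by blast
  define p where "p = (\<Sum>i\<le>n. monom (complex_of_real (a i)) i)"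
  have cp: "coeff p i = (if i \<le> n then of_real (a i) else 0)" for i
    unfolding p_def coeff_sum coeff_monom by (auto simp: if_distrib cong: if_cong)
  have "p \<noteq> 0" using a(1) cp by (metis coeff_0 of_real_eq_0_iff)
  moreover have "degree p \<le> n" by (rule degree_le) (simp add: cp)
  moreover have "(\<Sum>i\<le>n. cscale (coeff p i) ((T ^^ i) v)) = 0"
    using a(2) by (simp add: cp cscale_simps)
  ultimately show ?thesis using eigenvector_of_polynomial[OF assms(1) sU assms(3,4) v] by blast
qed

text \<open>Real traces are used on complexified spaces, and this computes the trace of
  multiplication by i. A plane spanned by v and j v splits off; in this basis the diagonal of j is
  0, and j induces on a complement a map whose square is again -1.\<close>

lemma trace_on_complex_structure:
  fixes j :: "'v::real_vector \<Rightarrow> 'v"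
  assumes "finite_dimensional U" "linear j" "j ` U \<subseteq> U" "\<And>u. u \<in> U \<Longrightarrow> j (j u) = - u"
  shows "trace_on U j = 0"
  using assms
proof (induction "dim U" arbitrary: U j rule: less_induct)
  case less
  have sU: "subspace U" using finite_dimensional_imp_subspace[OF less.prems(1)] .
  show ?case
  proof (cases "U = {0}")
    case True
    then show ?thesis using trace_on_nilpotent[OF less.prems(1-3), of 0] by simp
  next
    case False
    then obtain v where v: "v \<in> U" "v \<noteq> 0" using subspace_0[OF sU] by blast
    let ?W = "span {v, j v}"
    have jv: "j v \<in> U" using v less.prems(3) by blast
    have WU: "?W \<subseteq> U" using v jv sU by (intro span_minimal) auto
    have jW: "j w \<in> ?W" if "w \<in> ?W" for w
      using that
    proof (induction rule: span_induct_alt)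
      case base show ?case using linear_0[OF less.prems(2)] by (simp add: span_0)
    next
      case (step c x y)
      have "j v \<in> ?W" "v \<in> ?W" by (auto intro: span_base)
      then have "j x \<in> ?W" using step(1) less.prems(4)[OF v(1)] span_neg[of v "{v, j v}"] by auto
      then show ?case using step(2) by (simp add: linear_add[OF less.prems(2)] linear_scale[OF less.prems(2)] span_add span_scale)
    qed
    have W0: "?W \<noteq> {0}" using v(2) span_base[of v "{v, j v}"] by auto
    obtain X p where X: "subspace X" "X \<subseteq> U" "linear p" "\<And>w. w \<in> ?W \<Longrightarrow> p w = 0"
      "\<And>u. u \<in> X \<Longrightarrow> p u = u" "\<And>u. u \<in> U \<Longrightarrow> p u \<in> X" "\<And>u. u \<in> U \<Longrightarrow> u - p u \<in> ?W"
      by (rule complement_projection[OF subspace_span WU sU]) blast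
    have dX: "dim X < dim U" using complement_dim[OF less.prems(1) subspace_span WU W0 X(1,2,4,5)] .
    have fX: "finite_dimensional X" using finite_dimensional_subset[OF X(1,2) less.prems(1)] .
    have fW: "finite_dimensional ?W" using finite_dimensional_subset[OF subspace_span WU less.prems(1)] .
    have jU: "j u \<in> U" if "u \<in> U" for u using that less.prems(3) by blast
    have lpj: "linear (\<lambda>u. p (j u))" using linear_compose[OF less.prems(2) X(3)] by (simp add: o_def)
    have ipj: "(\<lambda>u. p (j u)) ` U \<subseteq> X" using X(6) jU by blast
    have ljp: "linear (\<lambda>u. j u - p (j u))" using linear_compose_sub[OF less.prems(2) lpj] .
    have ijp: "(\<lambda>u. j u - p (j u)) ` U \<subseteq> ?W" using X(7) jU by blast
    have "trace_on X (\<lambda>u. p (j u)) = 0"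
    proof (rule less.hyps[OF dX fX lpj])
      show "(\<lambda>u. p (j u)) ` X \<subseteq> X" using ipj X(2) by blast
      show "p (j (p (j u))) = - u" if "u \<in> X" for u
      proof -
        have u: "u \<in> U" using that X(2) by blast
        have "p (j (j u - p (j u))) = 0" using X(4) jW X(7)[OF jU[OF u]] by blast
        then have "p (j (j u)) = p (j (p (j u)))"
          by (simp add: linear_diff[OF X(3)] linear_diff[OF less.prems(2)])
        then show ?thesis using less.prems(4)[OF u] X(5)[OF that] by (simp add: linear_neg[OF X(3)])
      qed
    qed
    then have 1: "trace_on U (\<lambda>u. p (j u)) = 0"
      using trace_on_range[OF less.prems(1) lpj ipj X(1,2)] by simp
    have "trace_on U (\<lambda>u. j u - p (j u)) = trace_on ?W (\<lambda>u. j u - p (j u))"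
      using trace_on_range[OF less.prems(1) ljp ijp subspace_span WU] .
    also have "\<dots> = trace_on ?W j"
    proof (rule trace_on_cong[OF fW ljp _ less.prems(2)])
      show "(\<lambda>u. j u - p (j u)) ` ?W \<subseteq> ?W" using ijp WU by blast
      show "j w - p (j w) = j w" if "w \<in> ?W" for w using X(4)[OF jW[OF that]] by simp
    qed
    also have "\<dots> = 0"
    proof -
      have nin: "v \<notin> span {j v}"
      proof
        assume "v \<in> span {j v}"
        then obtain c where c: "v = c *\<^sub>R j v" by (auto simp: span_singleton)
        then have "j v = j (c *\<^sub>R j v)" by simp
        also have "\<dots> = - c *\<^sub>R v" using less.prems(4)[OF v(1)] by (simp add: linear_scale[OF less.prems(2)])
        finally have "v = - (c * c) *\<^sub>R v" using c by (metis scaleR_scaleR mult_minus_right)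
        then have "(1 + c * c) *\<^sub>R v = 0" by (simp add: scaleR_add_left eq_neg_iff_add_eq_0)
        then have "1 + c * c = 0" using v(2) by simp
        then show False by (metis add_pos_nonneg less_irrefl zero_le_square zero_less_one)
      qed
      have jv0: "j v \<noteq> 0" using less.prems(4)[OF v(1)] v(2) linear_0[OF less.prems(2)] by auto
      have ind: "independent {v, j v}"
        using nin jv0 by (auto simp: real_vector.independent_insert)
      have ne: "v \<noteq> j v" using nin span_base[of "j v" "{j v}"] by auto
      have "representation {v, j v} (j v) v = 0"
        using real_vector.representation_basis[OF ind, of "j v"] ne by simp
      moreover have "representation {v, j v} (- v) (j v) = 0"
        using real_vector.representation_basis[OF ind, of v] ne
          real_vector.representation_neg[OF ind, of v] span_base[of v "{v, j v}"] by simp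
      ultimately show ?thesis
        using trace_on_basis[OF _ ind refl less.prems(2)] jW less.prems(4)[OF v(1)] ne by (simp add: image_subset_iff)
    qed
    finally have 2: "trace_on U (\<lambda>u. j u - p (j u)) = 0" .
    have "trace_on U (\<lambda>u. p (j u) + (j u - p (j u))) = 0"
      using trace_on_add[OF less.prems(1) lpj _ ljp, THEN trans] ipj ijp X(2) WU 1 2 by fastforce
    then show ?thesis by simp
  qed
qed

text \<open>By induction on m + n both (T - c) u and (T - d) u vanish, and their difference is (d -
  c) u.\<close>

lemma generalized_eigenvector_unique:
  assumes T: "complex_linear T" and "c \<noteq> d" "(shift T c ^^ m) u = 0" "(shift T d ^^ n) u = 0"
  shows "u = 0"
  using assms(3,4)
proof (induction "m + n" arbitrary: m n u)
  case (Suc k)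
  show ?case
  proof (cases "m = 0 \<or> n = 0")
    case False
    then obtain m' n' where mn: "m = Suc m'" "n = Suc n'" by (meson not0_implies_Suc)
    have z: "shift T e 0 = 0" for e
      using linear_0[OF complex_linear_linear[OF complex_linear_shift[OF T]]] .
    have comm: "shift T e ((shift T f ^^ i) w) = (shift T f ^^ i) (shift T e w)" for e f i w
      by (rule funpow_commute_apply) (rule shift_commute[OF T])
    have "shift T c u = 0"
    proof (rule Suc.hyps(1)[of m' n])
      show "(shift T c ^^ m') (shift T c u) = 0" using Suc.prems(1) mn by (simp add: funpow_swap1)
      show "(shift T d ^^ n) (shift T c u) = 0" using Suc.prems(2) comm[of c n d u] z by simp
    qed (use Suc.hyps(2) mn in simp)
    moreover have "shift T d u = 0"
    proof (rule Suc.hyps(1)[of m n'])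
      show "(shift T d ^^ n') (shift T d u) = 0" using Suc.prems(2) mn by (simp add: funpow_swap1)
      show "(shift T c ^^ m) (shift T d u) = 0" using Suc.prems(1) comm[of d m c u] z by simp
    qed (use Suc.hyps(2) mn in simp)
    ultimately have "cscale (c - d) u = 0" by (simp add: shift_def cscale_simps)
    then show ?thesis using cscale_eq_0 assms(2) by fastforce
  qed (use Suc.prems in auto)
qed simp

text \<open>\<open>S\<close> is the real part of the semisimple part of \<open>T\<close>, and the trace of \<open>S T\<close> is the sum of the
  squares of the real parts of the eigenvalues of \<open>T\<close>.\<close>

lemma real_part_operator:
  fixes T :: "'v::real_vector \<times> 'v \<Rightarrow> 'v \<times> 'v"
  assumes T: "complex_linear T" and U: "finite_dimensional U" "T ` U \<subseteq> U" "times_i ` U \<subseteq> U"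
  shows "\<exists>S. linear S \<and> (\<forall>u\<in>U. S u \<in> U) \<and>
    (\<forall>c n. \<forall>u\<in>U. (shift T c ^^ n) u = 0 \<longrightarrow> S u = Re c *\<^sub>R u) \<and>
    U \<subseteq> span {u \<in> U. \<exists>c n. (shift T c ^^ n) u = 0} \<and>
    trace_on U (\<lambda>u. S (T u)) \<ge> 0 \<and> (trace_on U (\<lambda>u. S (T u)) = 0 \<longrightarrow> (\<forall>u\<in>U. S u = 0))"
  using U
proof (induction "dim U" arbitrary: U rule: less_induct)
  case less
  have sU: "subspace U" using finite_dimensional_imp_subspace[OF less.prems(1)] .
  have TU: "T u \<in> U" "times_i u \<in> U" if "u \<in> U" for u using less.prems(2,3) that by blast+
  have lT: "linear T" using complex_linear_linear[OF T] .
  show ?case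
  proof (cases "U = {0}")
    case True
    then show ?thesis by (intro exI[of _ "\<lambda>u. 0"]) (simp add: linear_zero span_0 trace_on_zero)
  next
    case False
    obtain c e where e: "e \<in> U" "e \<noteq> 0" "T e = cscale c e"
      using eigenvector_exists[OF T less.prems(1) TU False] by blast
    define M where "M = shift T c"
    have cM: "complex_linear M" unfolding M_def using complex_linear_shift[OF T] .
    have lM: "linear M" using complex_linear_linear[OF cM] .
    have csU: "cscale d u \<in> X" if "subspace X" "u \<in> X" "times_i u \<in> X" for d u X
      unfolding cscale_def using that by (intro subspace_add subspace_scale)
    have MU: "M u \<in> U" if "u \<in> U" for u
      unfolding M_def shift_def by (intro subspace_diff[OF sU] csU[OF sU] TU that)
    obtain N where N: "\<And>n. n \<ge> N \<Longrightarrow> (M ^^ n) ` U = (M ^^ N) ` U" "M ` (M ^^ N) ` U = (M ^^ N) ` U"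
      "\<And>v. v \<in> (M ^^ N) ` U \<Longrightarrow> M v = 0 \<Longrightarrow> v = 0"
      by (rule Fitting[OF less.prems(1) lM]) (use MU in blast)+
    \<comment> \<open>\<open>A\<close> is the generalized eigenspace of c and \<open>B\<close> the
      Fitting one-component of T - c. Since \<open>B\<close> does not contain the eigenvector e, it
      has smaller dimension, and the induction hypothesis provides \<open>S1\<close> on it.\<close>
    define A where "A = {u \<in> U. (M ^^ N) u = 0}"
    define B where "B = (M ^^ N) ` U"
    have lMN: "linear (M ^^ n)" for n using linear_funpow[OF lM] .
    have MNU: "(M ^^ n) u \<in> U" if "u \<in> U" for u n using funpow_image_subset[of M U n] MU that by blast
    have sA: "subspace A" unfolding A_def using sU
      by (auto simp: subspace_def linear_add[OF lMN] linear_scale[OF lMN] linear_0[OF lMN])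
    have sB: "subspace B" unfolding B_def using linear_subspace_image[OF lMN sU] .
    have AU: "A \<subseteq> U" and BU: "B \<subseteq> U" unfolding A_def B_def using MNU by auto
    have fA: "finite_dimensional A" and fB: "finite_dimensional B"
      using finite_dimensional_subset less.prems(1) sA AU sB BU by blast+
    have TM: "T ((M ^^ n) u) = (M ^^ n) (T u)" for n u
      by (rule funpow_commute_apply) (simp add: M_def shift_def linear_diff[OF lT] complex_linear_cscale[OF T])
    have JM: "times_i ((M ^^ n) u) = (M ^^ n) (times_i u)" for n u
      using complex_linear_times_i[OF complex_linear_funpow[OF cM]] by simp
    have TA: "T u \<in> A" "times_i u \<in> A" if "u \<in> A" for u
      using that TU TM[of N u] JM[of N u] linear_0[OF lT] by (auto simp: A_def)
    have TB: "T u \<in> B" "times_i u \<in> B" if "u \<in> B" for u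
      using that TU TM[of N] JM[of N] by (auto simp: B_def)
    have inj: "u = 0" if "u \<in> B" "(M ^^ n) u = 0" for u n
      using linear_inj_on_funpow[of M B u n] N(2,3) that by (simp add: B_def)
    have AB: "A \<inter> B = {0}" using inj subspace_0[OF sA] subspace_0[OF sB] by (auto simp: A_def)
    have dec: "\<exists>a\<in>A. \<exists>b\<in>B. u = a + b" if u: "u \<in> U" for u
    proof -
      have "(M ^^ N) u \<in> (M ^^ (N + N)) ` U" using N(1)[of "N + N"] u by simp
      then obtain w where w: "w \<in> U" "(M ^^ N) u = (M ^^ N) ((M ^^ N) w)" by (auto simp: funpow_add)
      have "u - (M ^^ N) w \<in> A" using w u MNU sU by (simp add: A_def subspace_diff linear_diff[OF lMN])
      moreover have "(M ^^ N) w \<in> B" using w by (simp add: B_def)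
      ultimately show ?thesis by (metis diff_add_cancel)
    qed
    have Me: "M e = 0" using e by (simp add: M_def shift_def)
    have "B \<noteq> U" using Me N(3)[of e] e(1,2) unfolding B_def by blast
    then have dB: "dim B < dim U" using finite_dimensional_dim_strict_mono[OF sB _ less.prems(1)] BU by blast
    have "e \<in> A"
    proof -
      have "N \<noteq> 0"
      proof
        assume "N = 0"
        then have "e \<in> (M ^^ N) ` U" using e(1) by simp
        then show False using N(3) Me e(2) by blast
      qed
      then show ?thesis using Me e(1) linear_0[OF lMN] by (cases N) (auto simp: A_def funpow_swap1)
    qed
    then have dA: "dim A > 0"
      using e(2) finite_dimensional_dim_eq[OF subspace_single_0 _ fA] subspace_0[OF sA] by force
    have TBi: "T ` B \<subseteq> B" "times_i ` B \<subseteq> B" using TB by blast+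
    obtain S1 where S1': "linear S1" "\<forall>u\<in>B. S1 u \<in> B"
      "\<forall>c n. \<forall>u\<in>B. (shift T c ^^ n) u = 0 \<longrightarrow> S1 u = Re c *\<^sub>R u"
      "B \<subseteq> span {u \<in> B. \<exists>c n. (shift T c ^^ n) u = 0}"
      "trace_on B (\<lambda>u. S1 (T u)) \<ge> 0" "trace_on B (\<lambda>u. S1 (T u)) = 0 \<longrightarrow> (\<forall>u\<in>B. S1 u = 0)"
      using less.hyps[OF dB fB TBi] by (elim exE conjE) (rule that)
    have S1: "linear S1" "\<And>u. u \<in> B \<Longrightarrow> S1 u \<in> B"
      "\<And>c n u. u \<in> B \<Longrightarrow> (shift T c ^^ n) u = 0 \<Longrightarrow> S1 u = Re c *\<^sub>R u"
      "B \<subseteq> span {u \<in> B. \<exists>c n. (shift T c ^^ n) u = 0}"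
      "trace_on B (\<lambda>u. S1 (T u)) \<ge> 0" "trace_on B (\<lambda>u. S1 (T u)) = 0 \<Longrightarrow> (\<forall>u\<in>B. S1 u = 0)"
      subgoal using S1'(1) .
      subgoal for u using S1'(2) by (rule bspec)
      subgoal for c n u using S1'(3)[rule_format, of u n c] by blast
      subgoal using S1'(4) .
      subgoal using S1'(5) .
      subgoal using S1'(6) by (rule mp)
      done
    have dec': "\<exists>b\<in>B. \<exists>a\<in>A. u = b + a" if "u \<in> U" for u using dec[OF that] add.commute by metis
    have BA: "B \<inter> A = {0}" using AB by (simp add: Int_commute)
    obtain h where h: "linear h" "\<And>v. v \<in> U \<Longrightarrow> h v \<in> B" "\<And>v. v \<in> U \<Longrightarrow> v - h v \<in> A"
      "\<And>u. u \<in> B \<Longrightarrow> h u = u" "\<And>w. w \<in> A \<Longrightarrow> h w = 0"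
      by (rule direct_sum_projection[OF sU sB sA BU AU dec' BA]) blast+
    \<comment> \<open>Re c on \<open>A\<close> and \<open>S1\<close> on \<open>B\<close>, glued by
      the projection \<open>h\<close> onto \<open>B\<close>.\<close>
    define S where "S u = Re c *\<^sub>R (u - h u) + S1 (h u)" for u
    have lS: "linear S" unfolding S_def
      using linear_compose[OF h(1) S1(1)]
      by (intro linear_compose_add linear_compose_scale_right linear_compose_sub linear_ident h(1)) (simp add: o_def)
    have SA: "S u = Re c *\<^sub>R u" if "u \<in> A" for u
      using h(5)[OF that] linear_0[OF S1(1)] by (simp add: S_def)
    have SB: "S u = S1 u" if "u \<in> B" for u
      using h(4)[OF that] by (simp add: S_def)
    have SU: "S u \<in> U" if "u \<in> U" for u
      unfolding S_def
      by (intro subspace_add[OF sU] subspace_scale[OF sU] subsetD[OF AU] subsetD[OF BU, of "S1 _"] S1(2) h(2,3) that)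
    have cl: "complex_linear (shift T d ^^ n)" for d n using complex_linear_funpow[OF complex_linear_shift[OF T]] .
    have ls: "linear (shift T d ^^ n)" for d n using complex_linear_linear[OF cl] .
    have sh: "shift T d u \<in> A" if "u \<in> A" for d u
      unfolding shift_def by (intro subspace_diff[OF sA] csU[OF sA] TA that)
    have shB: "shift T d u \<in> B" if "u \<in> B" for d u
      unfolding shift_def by (intro subspace_diff[OF sB] csU[OF sB] TB that)
    \<comment> \<open>The components in \<open>A\<close> and \<open>B\<close> of a generalized
      eigenvector for d are again killed by the power of T - d; the one in \<open>A\<close> is 0
      unless d = c.\<close>
    have gen: "S u = Re d *\<^sub>R u" if u: "u \<in> U" "(shift T d ^^ n) u = 0" for d n u
    proof -
      let ?a = "u - h u" and ?b = "h u"
      have ab: "?a \<in> A" "?b \<in> B" using h(2,3) u(1) by auto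
      have "(shift T d ^^ n) ?a \<in> A" "(shift T d ^^ n) ?b \<in> B"
        using funpow_image_subset[of "shift T d" A n] funpow_image_subset[of "shift T d" B n] sh shB ab by blast+
      moreover have eq: "(shift T d ^^ n) ?a = - (shift T d ^^ n) ?b"
        using u(2) linear_diff[OF ls, of n d u ?b] by simp
      ultimately have "(shift T d ^^ n) ?a \<in> A \<inter> B" using subspace_neg[OF sB] by simp
      then have 0: "(shift T d ^^ n) ?a = 0" unfolding AB by simp
      have 0: "(shift T d ^^ n) ?a = 0" "(shift T d ^^ n) ?b = 0"
        using 0 eq by simp_all
      have b: "S1 ?b = Re d *\<^sub>R ?b" using S1(3)[OF ab(2) 0(2)] .
      have a: "Re c *\<^sub>R ?a = Re d *\<^sub>R ?a"
      proof (cases "c = d")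
        case False
        then have "?a = 0" using generalized_eigenvector_unique[OF T False _ 0(1)] ab(1) by (auto simp: A_def M_def)
        then show ?thesis by simp
      qed simp
      show ?thesis unfolding S_def a b by (simp add: algebra_simps)
    qed
    have sp: "U \<subseteq> span {u \<in> U. \<exists>c n. (shift T c ^^ n) u = 0}" (is "_ \<subseteq> ?sp")
    proof
      fix u assume u: "u \<in> U"
      obtain a b where ab: "a \<in> A" "b \<in> B" "u = a + b" using dec[OF u] by blast
      have "a \<in> ?sp" using ab(1) by (intro span_base) (auto simp: A_def M_def)
      moreover have "b \<in> ?sp" using ab(2) S1(4) span_mono[of "{u \<in> B. \<exists>c n. (shift T c ^^ n) u = 0}" "{u \<in> U. \<exists>c n. (shift T c ^^ n) u = 0}"] BU
        by blast
      ultimately show "u \<in> ?sp" unfolding ab(3) by (rule span_add)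
    qed
    have lST: "linear (\<lambda>u. S (T u))" using linear_compose[OF lT lS] by (simp add: o_def)
    have "trace_on U (\<lambda>u. S (T u)) = trace_on A (\<lambda>u. S (T u)) + trace_on B (\<lambda>u. S (T u))"
    proof (rule trace_on_direct_sum[OF less.prems(1) lST sA sB AU BU _ _ dec AB])
      show "(\<lambda>u. S (T u)) ` A \<subseteq> A"
        by (rule image_subsetI) (simp only: SA[OF TA(1)] subspace_scale[OF sA] TA)
      show "(\<lambda>u. S (T u)) ` B \<subseteq> B"
        by (rule image_subsetI) (simp only: SB[OF TB(1)] S1(2) TB)
    qed
    also have "trace_on B (\<lambda>u. S (T u)) = trace_on B (\<lambda>u. S1 (T u))"
    proof (rule trace_on_cong[OF fB lST])
      show "linear (\<lambda>u. S1 (T u))" using linear_compose[OF lT S1(1)] by (simp add: o_def)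
      show "(\<lambda>u. S (T u)) ` B \<subseteq> B"
        by (rule image_subsetI) (simp only: SB[OF TB(1)] S1(2) TB)
      show "S (T u) = S1 (T u)" if "u \<in> B" for u using SB[OF TB(1)[OF that]] .
    qed
    also have "trace_on A (\<lambda>u. S (T u)) = trace_on A (\<lambda>u. Re c *\<^sub>R T u)"
    proof (rule trace_on_cong[OF fA lST _ linear_compose_scale_right[OF lT]])
      show "(\<lambda>u. S (T u)) ` A \<subseteq> A"
        by (rule image_subsetI) (simp only: SA[OF TA(1)] subspace_scale[OF sA] TA)
      show "S (T u) = Re c *\<^sub>R T u" if "u \<in> A" for u using SA[OF TA(1)[OF that]] .
    qed
    also have "\<dots> = Re c * trace_on A T" by (rule trace_on_scale[OF fA lT image_subsetI]) (rule TA)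
    \<comment> \<open>On \<open>A\<close>, T is c plus the nilpotent operator M. Neither M nor
      multiplication by i contributes to the real trace, so the trace of S T on \<open>A\<close> is
      (Re c)^2 dim A.\<close>
    also have "trace_on A T = trace_on A (\<lambda>u. M u + (Re c *\<^sub>R u + Im c *\<^sub>R times_i u))"
      by (rule arg_cong[where f="trace_on A"]) (simp add: fun_eq_iff M_def shift_def cscale_def)
    also have "\<dots> = trace_on A M + (Re c * trace_on A (\<lambda>u. u) + Im c * trace_on A times_i)"
    proof -
      have l: "linear (\<lambda>u. Re c *\<^sub>R u)" "linear (\<lambda>u. Im c *\<^sub>R times_i u)"
        using linear_compose_scale_right[OF linear_ident] linear_compose_scale_right[OF linear_times_i] by auto
      have i: "(\<lambda>u. Re c *\<^sub>R u) ` A \<subseteq> A" "(\<lambda>u. Im c *\<^sub>R times_i u) ` A \<subseteq> A" "M ` A \<subseteq> A"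
        "(\<lambda>u. Re c *\<^sub>R u + Im c *\<^sub>R times_i u) ` A \<subseteq> A"
        by (intro image_subsetI subspace_add[OF sA] subspace_scale[OF sA] TA sh; (assumption | simp add: M_def sh))+
      show ?thesis
        using trace_on_add[OF fA lM i(3) linear_compose_add[OF l] i(4)] trace_on_add[OF fA l(1) i(1) l(2) i(2)]
          trace_on_scale[OF fA linear_ident, of "Re c"] trace_on_scale[OF fA linear_times_i, of "Im c"] image_subsetI[of A times_i A, OF TA(2)] by simp
    qed
    also have "trace_on A M = 0"
      by (rule trace_on_nilpotent[OF fA lM, of N]) (use sh in \<open>auto simp: M_def\<close>, simp add: A_def M_def)
    also have "trace_on A times_i = 0"
      by (rule trace_on_complex_structure[OF fA linear_times_i image_subsetI]) (rule TA(2), assumption, rule times_i_times_i)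
    also have "trace_on A (\<lambda>u. u) = dim A" by (rule trace_on_ident[OF fA])
    finally have tr: "trace_on U (\<lambda>u. S (T u)) = (Re c)\<^sup>2 * dim A + trace_on B (\<lambda>u. S1 (T u))"
      by (simp add: power2_eq_square)
    have nonneg: "(Re c)\<^sup>2 * dim A \<ge> 0" by simp
    have "S u = 0" if "trace_on U (\<lambda>u. S (T u)) = 0" "u \<in> U" for u
    proof -
      have "(Re c)\<^sup>2 * dim A = 0" "trace_on B (\<lambda>u. S1 (T u)) = 0"
        using tr that(1) nonneg S1(5) by linarith+
      then have "Re c = 0" "S1 (h u) = 0" using dA S1(6) h(2)[OF that(2)] by auto
      then show ?thesis by (simp add: S_def)
    qed
    then show ?thesis
      using lS SU gen sp tr nonneg S1(5) by (intro exI[of _ S]) auto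
  qed
qed

text \<open>Leibniz rule: (\<rho> x - a - c) (\<rho> y v) = \<rho> ((ad x - a) y) v + \<rho> y
  ((\<rho> x - c) v). Each summand lowers one of the two exponents, and m = 0 or n = 0 means y = 0
  or v = 0.\<close>

lemma complex_rep_generalized_eigenvectors:
  fixes L :: "('a::real_vector \<times> 'a) set" and V :: "('v::real_vector \<times> 'v) set"
  assumes "lie_rep L br V \<rho>"
    and J: "\<And>x. x \<in> L \<Longrightarrow> times_i x \<in> L" "\<And>v. v \<in> V \<Longrightarrow> times_i v \<in> V"
    "\<And>x y. br x (times_i y) = times_i (br x y)" "\<And>y v. \<rho> (times_i y) v = times_i (\<rho> y v)" "\<And>y v. \<rho> y (times_i v) = times_i (\<rho> y v)"
    and x: "x \<in> L" and yv: "y \<in> L" "v \<in> V" "(shift (br x) a ^^ m) y = 0" "(shift (\<rho> x) c ^^ n) v = 0"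
  shows "(shift (\<rho> x) (a + c) ^^ (m + n)) (\<rho> y v) = 0"
  using yv
proof (induction "m + n" arbitrary: m n y v)
  case 0
  then show ?case using linear_0[of "\<lambda>y. \<rho> y 0"] lie_rep.rep_linear_left[OF assms(1)] by simp
next
  case (Suc k)
  interpret lie_rep L br V \<rho> by fact
  have cr: "complex_linear (\<rho> z)" for z unfolding complex_linear_def using rep_linear J(5) by blast
  have cb: "complex_linear (br z)" for z unfolding complex_linear_def using linear_right J(3) by blast
  let ?X = "shift (\<rho> x) (a + c)"
  have lX: "linear (?X ^^ i)" for i
    using complex_linear_linear[OF complex_linear_funpow[OF complex_linear_shift[OF cr]]] .
  show ?case
  proof (cases "m = 0 \<or> n = 0")
    case True
    then have "\<rho> y v = 0" using Suc.prems by auto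
    then show ?thesis using linear_0[OF lX] by simp
  next
    case False
    then obtain m' n' where mn: "m = Suc m'" "n = Suc n'" by (meson not0_implies_Suc)
    have k: "k = m' + n" "k = m + n'" "m + n = Suc k" using Suc.hyps(2) mn by simp_all
    have csl: "\<rho> (cscale a y) v = cscale a (\<rho> y v)" by (simp add: cscale_def J(4))
    have y': "shift (br x) a y \<in> L"
      unfolding shift_def cscale_def
      by (intro subspace_diff[OF subspace] subspace_add[OF subspace] subspace_scale[OF subspace] closed x J Suc.prems(1))
    have v': "shift (\<rho> x) c v \<in> V"
      unfolding shift_def cscale_def
      by (intro subspace_diff[OF subV] subspace_add[OF subV] subspace_scale[OF subV] rep_closed x J Suc.prems(2))
    have "?X (\<rho> y v) = \<rho> (shift (br x) a y) v + \<rho> y (shift (\<rho> x) c v)"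
      unfolding shift_def using rep_bracket[OF x Suc.prems(1,2)]
      by (simp add: csl complex_linear_cscale[OF cr] cscale_simps)
    then have "(?X ^^ (m + n)) (\<rho> y v) = (?X ^^ k) (\<rho> (shift (br x) a y) v) + (?X ^^ k) (\<rho> y (shift (\<rho> x) c v))"
      unfolding k(3) by (simp add: funpow_swap1 linear_add[OF lX])
    also have "(?X ^^ k) (\<rho> (shift (br x) a y) v) = 0"
      using Suc.hyps(1)[OF k(1) y' Suc.prems(2) _ Suc.prems(4)] Suc.prems(3) mn(1) k(1) by (simp add: funpow_swap1)
    also have "(?X ^^ k) (\<rho> y (shift (\<rho> x) c v)) = 0"
      using Suc.hyps(1)[OF k(2) Suc.prems(1) v' Suc.prems(3)] Suc.prems(4) mn(2) k(2) by (simp add: funpow_swap1)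
    finally show ?thesis by simp
  qed
qed

text \<open>\<open>S\<close> takes the real parts of the generalized eigenvalues of \<rho> x. It
  need not come from L, but its commutators with the operators \<rho> y can be computed, and they
  turn tr (S \<rho> [y, z]) into multiples of traces tr (\<rho> y \<rho> z) = 0. Hence tr (S \<rho>
  x) = 0, and this trace is a sum of squares of real parts.\<close>

lemma complex_cartan_real_part:
  fixes L :: "('a::real_vector \<times> 'a) set" and V :: "('v::real_vector \<times> 'v) set"
  assumes "lie_rep L br V \<rho>"
    and J: "\<And>x. x \<in> L \<Longrightarrow> times_i x \<in> L" "\<And>v. v \<in> V \<Longrightarrow> times_i v \<in> V"
    "\<And>x y. br x (times_i y) = times_i (br x y)" "\<And>y v. \<rho> (times_i y) v = times_i (\<rho> y v)" "\<And>y v. \<rho> y (times_i v) = times_i (\<rho> y v)"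
    and tr: "\<And>x y. x \<in> L \<Longrightarrow> y \<in> L \<Longrightarrow> trace_on V (\<lambda>v. \<rho> x (\<rho> y v)) = 0"
    and perfect: "derived_algebra br L = L"
    and x: "x \<in> L" and v: "v \<in> V" "v \<noteq> 0" "(shift (\<rho> x) c ^^ n) v = 0"
  shows "Re c = 0"
proof -
  interpret lie_rep L br V \<rho> by fact
  have cr: "complex_linear (\<rho> z)" for z unfolding complex_linear_def using rep_linear J(5) by blast
  have cb: "complex_linear (br z)" for z unfolding complex_linear_def using linear_right J(3) by blast
  have JV: "times_i ` V \<subseteq> V" and JL: "times_i ` L \<subseteq> L" and bL: "br x ` L \<subseteq> L" using J(1,2) closed[OF x] by blast+
  obtain S where S': "linear S" "\<forall>u\<in>V. S u \<in> V"
    "\<forall>c n. \<forall>u\<in>V. (shift (\<rho> x) c ^^ n) u = 0 \<longrightarrow> S u = Re c *\<^sub>R u"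
    "V \<subseteq> span {u \<in> V. \<exists>c n. (shift (\<rho> x) c ^^ n) u = 0}"
    "trace_on V (\<lambda>u. S (\<rho> x u)) = 0 \<longrightarrow> (\<forall>u\<in>V. S u = 0)"
    using real_part_operator[OF cr fdV rep_image[OF x] JV]
    by (elim exE conjE) (rule that)
  have S: "linear S" "\<And>u. u \<in> V \<Longrightarrow> S u \<in> V"
    "\<And>c n u. u \<in> V \<Longrightarrow> (shift (\<rho> x) c ^^ n) u = 0 \<Longrightarrow> S u = Re c *\<^sub>R u"
    "V \<subseteq> span {u \<in> V. \<exists>c n. (shift (\<rho> x) c ^^ n) u = 0}"
    "trace_on V (\<lambda>u. S (\<rho> x u)) = 0 \<Longrightarrow> (\<forall>u\<in>V. S u = 0)"
    subgoal using S'(1) .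
    subgoal for u using S'(2) by (rule bspec)
    subgoal for c n u using S'(3)[rule_format, of u n c] by blast
    subgoal using S'(4) .
    subgoal using S'(5) by (rule mp)
    done
  have spL: "L \<subseteq> span {u \<in> L. \<exists>c n. (shift (br x) c ^^ n) u = 0}"
    using real_part_operator[OF cb fd bL JL]
    by (elim exE conjE)
  have lS: "linear (\<lambda>v. S (\<rho> u v))" for u using linear_comp2[OF S(1) rep_linear] .
  have iS: "(\<lambda>v. S (\<rho> u v)) ` V \<subseteq> V" if "u \<in> L" for u using rep_closed[OF that] S(2) by blast
  \<comment> \<open>If y has generalized eigenvalue a under ad x, then \<rho> y shifts the
    generalized eigenvalues of \<rho> x by a, so [S, \<rho> y] = Re a \<rho> y.\<close>
  have comm: "S (\<rho> y u) - \<rho> y (S u) = Re a *\<^sub>R \<rho> y u"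
    if y: "y \<in> L" "(shift (br x) a ^^ m) y = 0" and u: "u \<in> V" for y a m u
  proof -
    have "u \<in> span {u \<in> V. \<exists>c n. (shift (\<rho> x) c ^^ n) u = 0}" using u S(4) by blast
    then show ?thesis
    proof (induction rule: span_induct_alt)
      case base then show ?case by (simp add: linear_0[OF S(1)])
    next
      case (step r w u)
      from step(1) obtain b n where w: "w \<in> V" "(shift (\<rho> x) b ^^ n) w = 0" by blast
      have "(shift (\<rho> x) (a + b) ^^ (m + n)) (\<rho> y w) = 0"
        using complex_rep_generalized_eigenvectors[OF assms(1) J x y(1) w(1) y(2) w(2)] .
      then have "S (\<rho> y w) = Re (a + b) *\<^sub>R \<rho> y w" using S(3) rep_closed[OF y(1) w(1)] by blast
      then have "S (\<rho> y w) - \<rho> y (S w) = Re a *\<^sub>R \<rho> y w"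
        using S(3)[OF w] by (simp add: algebra_simps)
      then show ?case using step(2)
        by (simp add: linear_add[OF S(1)] linear_scale[OF S(1)] algebra_simps eq_diff_eq diff_eq_eq)
    qed
  qed
  \<comment> \<open>By cyclicity tr (S [\<rho> y, \<rho> z]) = tr ([S, \<rho> y] \<rho> z) = Re a tr
    (\<rho> y \<rho> z).\<close>
  have F0: "trace_on V (\<lambda>v. S (\<rho> (br y z) v)) = 0" if y: "y \<in> L" "(shift (br x) a ^^ m) y = 0" and z: "z \<in> L" for y a m z
  proof -
    have l1: "linear (\<lambda>v. S (\<rho> y (\<rho> z v)))" using linear_comp2[OF lS rep_linear] .
    have l2: "linear (\<lambda>v. S (\<rho> z (\<rho> y v)))" using linear_comp2[OF lS rep_linear] .
    have l3: "linear (\<lambda>v. \<rho> y (S (\<rho> z v)))" using linear_comp2[OF rep_linear lS] .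
    have l4: "linear (\<lambda>v. \<rho> y (\<rho> z v))" using linear_comp2[OF rep_linear rep_linear] .
    have c: "\<rho> y v \<in> V" "\<rho> z v \<in> V" if "v \<in> V" for v using rep_closed y z that by blast+
    have i1: "(\<lambda>v. S (\<rho> y (\<rho> z v))) ` V \<subseteq> V" "(\<lambda>v. S (\<rho> z (\<rho> y v))) ` V \<subseteq> V" "(\<lambda>v. \<rho> y (S (\<rho> z v))) ` V \<subseteq> V"
      "(\<lambda>v. \<rho> y (\<rho> z v)) ` V \<subseteq> V"
      using c S(2) by blast+
    have "trace_on V (\<lambda>v. S (\<rho> (br y z) v)) = trace_on V (\<lambda>v. S (\<rho> y (\<rho> z v)) - S (\<rho> z (\<rho> y v)))"
      using trace_on_cong[OF fdV lS iS[OF closed[OF y(1) z]] linear_compose_sub[OF l1 l2]] rep_bracket[OF y(1) z]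
      by (simp add: linear_diff[OF S(1)])
    also have "\<dots> = trace_on V (\<lambda>v. S (\<rho> y (\<rho> z v))) - trace_on V (\<lambda>v. S (\<rho> z (\<rho> y v)))"
      using trace_on_diff[OF fdV l1 i1(1) l2 i1(2)] .
    also have "trace_on V (\<lambda>v. S (\<rho> z (\<rho> y v))) = trace_on V (\<lambda>v. \<rho> y (S (\<rho> z v)))"
      using trace_on_comm[OF fdV lS iS[OF z] rep_linear rep_image[OF y(1)]] .
    also have "trace_on V (\<lambda>v. S (\<rho> y (\<rho> z v))) - \<dots> = trace_on V (\<lambda>v. S (\<rho> y (\<rho> z v)) - \<rho> y (S (\<rho> z v)))"
      using trace_on_diff[OF fdV l1 i1(1) l3 i1(3)] by simp
    also have "\<dots> = trace_on V (\<lambda>v. Re a *\<^sub>R \<rho> y (\<rho> z v))"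
    proof (rule trace_on_cong[OF fdV linear_compose_sub[OF l1 l3] _ linear_compose_scale_right[OF l4]])
      show "(\<lambda>v. S (\<rho> y (\<rho> z v)) - \<rho> y (S (\<rho> z v))) ` V \<subseteq> V"
        by (rule image_subsetI) (intro subspace_diff[OF subV] S(2) c rep_closed[OF y(1)])
      show "S (\<rho> y (\<rho> z v)) - \<rho> y (S (\<rho> z v)) = Re a *\<^sub>R \<rho> y (\<rho> z v)" if "v \<in> V" for v
        by (rule comm[OF y c(2)[OF that]])
    qed
    also have "\<dots> = 0" using trace_on_scale[OF fdV l4 i1(4)] tr[OF y(1) z] by simp
    finally show ?thesis .
  qed
  have add: "trace_on V (\<lambda>v. S (\<rho> (r *\<^sub>R u + w) v)) = r * trace_on V (\<lambda>v. S (\<rho> u v)) + trace_on V (\<lambda>v. S (\<rho> w v))"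
    if "u \<in> L" "w \<in> L" for r u w
  proof -
    have i: "(\<lambda>v. r *\<^sub>R S (\<rho> u v)) ` V \<subseteq> V" using iS[OF that(1)] subspace_scale[OF subV] by blast
    have "trace_on V (\<lambda>v. S (\<rho> (r *\<^sub>R u + w) v)) = trace_on V (\<lambda>v. r *\<^sub>R S (\<rho> u v) + S (\<rho> w v))"
      by (simp add: linear_add[OF S(1)] linear_scale[OF S(1)])
    then show ?thesis
      using trace_on_add[OF fdV linear_compose_scale_right[OF lS] i lS iS[OF that(2)]]
        trace_on_scale[OF fdV lS iS[OF that(1)], of r] by simp
  qed
  have F1: "trace_on V (\<lambda>v. S (\<rho> (br y z) v)) = 0" if y: "y \<in> L" and z: "z \<in> L" for y z
  proof -
    have "y \<in> span {u \<in> L. \<exists>c n. (shift (br x) c ^^ n) u = 0}" using y spL by blast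
    then have "trace_on V (\<lambda>v. S (\<rho> (br y z) v)) = 0 \<and> y \<in> L"
    proof (induction rule: span_induct_alt)
      case base
      then show ?case using trace_on_zero[of V] subspace_0[OF subspace] by (simp add: linear_0[OF S(1)])
    next
      case (step r w y)
      from step(1) obtain b n where w: "w \<in> L" "(shift (br x) b ^^ n) w = 0" by blast
      have "r *\<^sub>R w + y \<in> L" using w(1) step(2) subspace_add[OF subspace] subspace_scale[OF subspace] by blast
      moreover have "br (r *\<^sub>R w + y) z = r *\<^sub>R br w z + br y z" by simp
      moreover have "trace_on V (\<lambda>v. S (\<rho> (r *\<^sub>R br w z + br y z) v)) = 0"
        using add[OF closed[OF w(1) z] closed[OF conjunct2[OF step(2)] z], of r] F0[OF w z] step(2) by simp
      ultimately show ?case by (simp only: simp_thms)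
    qed
    then show ?thesis by simp
  qed
  have F2: "trace_on V (\<lambda>v. S (\<rho> u v)) = 0 \<and> u \<in> L" if "u \<in> span {br x y | x y. x \<in> L \<and> y \<in> L}" for u
    using that
  proof (induction rule: span_induct_alt)
    case base
    then show ?case using trace_on_zero[of V] subspace_0[OF subspace] by (simp add: linear_0[OF S(1)])
  next
    case (step r w u)
    from step(1) obtain y z where w: "w = br y z" "y \<in> L" "z \<in> L" by blast
    have "r *\<^sub>R w + u \<in> L" using w closed step(2) subspace_add[OF subspace] subspace_scale[OF subspace] by blast
    then show ?case using add[of w u r] F1[OF w(2,3)] step(2) closed[OF w(2,3)] w(1) by simp
  qed
  \<comment> \<open>Perfectness enters here: x itself is a sum of brackets.\<close>
  have "trace_on V (\<lambda>v. S (\<rho> x v)) = 0"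
    using F2[of x] x perfect unfolding derived_algebra_def bracket_span_def by blast
  then have "S v = 0" using S(5) v(1) by blast
  then show ?thesis using S(3)[OF v(1,3)] v(2) by simp
qed

text \<open>An eigenvalue c of x has Re c = 0, and the same statement for i x gives Im c = 0. So 0
  is the only possible eigenvalue, whereas a nonzero Fitting one-component would contain an
  eigenvector for another one.\<close>

lemma complex_cartan:
  fixes L :: "('a::real_vector \<times> 'a) set" and V :: "('v::real_vector \<times> 'v) set"
  assumes "lie_rep L br V \<rho>"
    and J: "\<And>x. x \<in> L \<Longrightarrow> times_i x \<in> L" "\<And>v. v \<in> V \<Longrightarrow> times_i v \<in> V"
    "\<And>x y. br x (times_i y) = times_i (br x y)" "\<And>y v. \<rho> (times_i y) v = times_i (\<rho> y v)" "\<And>y v. \<rho> y (times_i v) = times_i (\<rho> y v)"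
    and tr: "\<And>x y. x \<in> L \<Longrightarrow> y \<in> L \<Longrightarrow> trace_on V (\<lambda>v. \<rho> x (\<rho> y v)) = 0"
    and perfect: "derived_algebra br L = L"
    and x: "x \<in> L"
  shows "\<exists>n. \<forall>v\<in>V. (\<rho> x ^^ n) v = 0"
proof -
  interpret lie_rep L br V \<rho> by fact
  have cr: "complex_linear (\<rho> z)" for z unfolding complex_linear_def using rep_linear J(5) by blast
  have re: "Re c = 0" if "y \<in> L" "v \<in> V" "v \<noteq> 0" "(shift (\<rho> y) c ^^ n) v = 0" for y v c n
    using complex_cartan_real_part[OF assms(1) J tr perfect that] .
  have c0: "c = 0" if v: "v \<in> V" "v \<noteq> 0" "(shift (\<rho> x) c ^^ n) v = 0" for v c n
  proof -
    \<comment> \<open>On the same vector i x has the generalized eigenvalue i c, whose real part is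
      - Im c.\<close>
    have sh: "(shift (\<rho> (times_i x)) (\<i> * c) ^^ k) v = (times_i ^^ k) ((shift (\<rho> x) c ^^ k) v)" for k
    proof (induction k)
      case (Suc k)
      have "shift (\<rho> (times_i x)) (\<i> * c) ((times_i ^^ k) w) = (times_i ^^ k) (times_i (shift (\<rho> x) c w))" for w
      proof -
        have "shift (\<rho> (times_i x)) (\<i> * c) u = times_i (shift (\<rho> x) c u)" for u
          by (simp only: shift_def J(4) cscale_simps(5,11) times_i_simps)
        moreover have "times_i (shift (\<rho> x) c ((times_i ^^ k) w)) = (times_i ^^ k) (times_i (shift (\<rho> x) c w))"
          by (induction k) (simp_all add: complex_linear_times_i[OF complex_linear_shift[OF cr]])
        ultimately show ?thesis by simp
      qed
      then show ?case using Suc by (simp add: funpow_swap1)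
    qed simp
    have "(times_i ^^ n) 0 = 0" by (induction n) simp_all
    then have "Re (\<i> * c) = 0" using re[OF J(1)[OF x] v(1,2)] sh[of n] v(3) by metis
    moreover have "Re c = 0" using re[OF x v] .
    ultimately show "c = 0" by (simp add: complex_eq_iff)
  qed
  obtain N where N: "\<And>n. n \<ge> N \<Longrightarrow> (\<rho> x ^^ n) ` V = (\<rho> x ^^ N) ` V"
    "\<rho> x ` (\<rho> x ^^ N) ` V = (\<rho> x ^^ N) ` V"
    "\<And>v. v \<in> (\<rho> x ^^ N) ` V \<Longrightarrow> \<rho> x v = 0 \<Longrightarrow> v = 0"
    by (rule Fitting[OF fdV rep_linear rep_image[OF x]]) blast
  let ?I = "(\<rho> x ^^ N) ` V"
  have lN: "linear (\<rho> x ^^ n)" for n using linear_funpow[OF rep_linear] .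
  have fI: "finite_dimensional ?I" using finite_dimensional_image[OF lN fdV] .
  have IV: "?I \<subseteq> V" using funpow_image_subset[OF rep_image[OF x]] .
  have JI: "times_i u \<in> ?I" if "u \<in> ?I" for u
  proof -
    obtain w where w: "w \<in> V" "u = (\<rho> x ^^ N) w" using \<open>u \<in> ?I\<close> by blast
    then show ?thesis using imageI[OF J(2)[OF w(1)], of "\<rho> x ^^ N"]
      by (simp add: complex_linear_times_i[OF complex_linear_funpow[OF cr]])
  qed
  have "?I = {0}"
  proof (rule ccontr)
    assume "?I \<noteq> {0}"
    then obtain c u where u: "u \<in> ?I" "u \<noteq> 0" "\<rho> x u = cscale c u"
      using eigenvector_exists[OF cr fI _ JI] N(2) by blast
    have "(shift (\<rho> x) c ^^ 1) u = 0" using u(3) by (simp add: shift_def)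
    then have "c = 0" using c0 u(1,2) IV by blast
    then show False using u N(3) by (simp add: cscale_simps)
  qed
  then show ?thesis by blast
qed

lemma finite_dimensional_Times:
  assumes "finite_dimensional V" "finite_dimensional W"
  shows "finite_dimensional (V \<times> W)"
proof -
  obtain B C where B: "finite B" "span B = V" and C: "finite C" "span C = W"
    using assms by (auto simp: finite_dimensional_def)
  have l: "linear (\<lambda>v. (v, 0::'b))" "linear (\<lambda>w. (0::'a, w))" by (auto intro!: linearI)
  have "{x + y |x y. x \<in> (\<lambda>v. (v, 0)) ` V \<and> y \<in> (\<lambda>w. (0, w)) ` W} = V \<times> W"
  proof (intro equalityI subsetI)
    fix p assume "p \<in> V \<times> W"
    then obtain v w where vw: "p = (v, w)" "v \<in> V" "w \<in> W" by blast
    have "p = (v, 0) + (0, w)" by (simp add: vw(1))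
    then show "p \<in> {x + y |x y. x \<in> (\<lambda>v. (v, 0)) ` V \<and> y \<in> (\<lambda>w. (0, w)) ` W}" using vw(2,3) by blast
  next
    fix p assume "p \<in> {x + y |x y. x \<in> (\<lambda>v. (v, 0)) ` V \<and> y \<in> (\<lambda>w. (0, w)) ` W}"
    then obtain v w where "p = (v, 0) + (0, w)" "v \<in> V" "w \<in> W" by blast
    then show "p \<in> V \<times> W" by simp
  qed
  then have "span ((\<lambda>v. (v, 0)) ` B \<union> (\<lambda>w. (0, w)) ` C) = V \<times> W"
    unfolding span_Un linear_span_image[OF l(1)] linear_span_image[OF l(2)] B(2) C(2) .
  moreover have "finite ((\<lambda>v. (v, 0)) ` B \<union> (\<lambda>w. (0, w)) ` C)" using B(1) C(1) by simp
  ultimately show ?thesis unfolding finite_dimensional_def by (intro exI conjI)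
qed

text \<open>Reduction to the complex case: \<open>L \<times> L\<close> and \<open>V \<times> V\<close> with the operator \<open>times_i\<close> are the
  complexifications.\<close>

theorem cartan_criterion:
  fixes L :: "'a::real_vector set" and V :: "'v::real_vector set"
  assumes "lie_rep L br V \<rho>"
    and tr: "\<And>x y. x \<in> L \<Longrightarrow> y \<in> L \<Longrightarrow> trace_on V (\<lambda>v. \<rho> x (\<rho> y v)) = 0"
    and perfect: "derived_algebra br L = L"
    and x: "x \<in> L"
  shows "\<exists>n. \<forall>v\<in>V. (\<rho> x ^^ n) v = 0"
proof -
  interpret lie_rep L br V \<rho> by fact
  \<comment> \<open>The complex bilinear extensions of the bracket and of the action.\<close>
  define b2 where "b2 u w = (br (fst u) (fst w) - br (snd u) (snd w), br (fst u) (snd w) + br (snd u) (fst w))" for u w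
  define r2 where "r2 u w = (\<rho> (fst u) (fst w) - \<rho> (snd u) (snd w), \<rho> (fst u) (snd w) + \<rho> (snd u) (fst w))" for u w
  have jac: "br a (br b c) = br b (br a c) - br c (br a b)" if "a \<in> L" "b \<in> L" "c \<in> L" for a b c
  proof -
    have "br b (br c a) = - br b (br a c)" using antisym[OF that(1,3)] by simp
    then show ?thesis using jacobi[OF that] by (simp add: algebra_simps add_eq_0_iff)
  qed
  have lie: "fd_lie (L \<times> L) b2"
  proof (intro fd_lie.intro real_lie_algebra.intro fd_lie_axioms.intro)
    show "subspace (L \<times> L)" by (intro subspace_Times subspace)
    show "finite_dimensional (L \<times> L)" by (rule finite_dimensional_Times[OF fd fd])
    show "linear (\<lambda>x. b2 x y)" "linear (b2 x)" for x y
      by (auto intro!: linearI simp: b2_def algebra_simps)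
    show "b2 x y \<in> L \<times> L" if "x \<in> L \<times> L" "y \<in> L \<times> L" for x y
      using that by (simp add: b2_def mem_Times_iff closed subspace_add[OF subspace] subspace_diff[OF subspace])
    show "b2 x x = 0" if "x \<in> L \<times> L" for x
      using that antisym[of "fst x" "snd x"] by (simp add: b2_def zero_prod_def mem_Times_iff alternating)
    show "b2 x (b2 y z) + b2 y (b2 z x) + b2 z (b2 x y) = 0" if "x \<in> L \<times> L" "y \<in> L \<times> L" "z \<in> L \<times> L" for x y z
    proof -
      obtain a b c d e f where xyz: "x = (a, b)" "y = (c, d)" "z = (e, f)" by (metis surj_pair)
      have L: "a \<in> L" "b \<in> L" "c \<in> L" "d \<in> L" "e \<in> L" "f \<in> L" using that xyz by auto
      show ?thesis
      proof (rule prod_eqI)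
        define j where "j u v w = br u (br v w) + br v (br w u) + br w (br u v)" for u v w
        have j: "j u v w = 0" if "u \<in> L" "v \<in> L" "w \<in> L" for u v w
          unfolding j_def using jacobi[OF that] .
        have "fst (b2 x (b2 y z) + b2 y (b2 z x) + b2 z (b2 x y)) = j a c e - j a d f - j b c f - j b d e"
          by (simp add: b2_def xyz j_def algebra_simps)
        then show "fst (b2 x (b2 y z) + b2 y (b2 z x) + b2 z (b2 x y)) = fst 0" using j L by simp
        have "snd (b2 x (b2 y z) + b2 y (b2 z x) + b2 z (b2 x y)) = j a c f + j a d e + j b c e - j b d f"
          by (simp add: b2_def xyz j_def algebra_simps)
        then show "snd (b2 x (b2 y z) + b2 y (b2 z x) + b2 z (b2 x y)) = snd 0" using j L by simp
      qed
    qed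
  qed (auto simp: b2_def algebra_simps)
  have rep: "lie_rep (L \<times> L) b2 (V \<times> V) r2"
  proof (intro lie_rep.intro lie lie_rep_axioms.intro)
    show "finite_dimensional (V \<times> V)" by (rule finite_dimensional_Times[OF fdV fdV])
    show "linear (\<lambda>x. r2 x y)" "linear (r2 x)" for x y
      by (auto intro!: linearI simp: r2_def algebra_simps)
    show "r2 x y \<in> V \<times> V" if "x \<in> L \<times> L" "y \<in> V \<times> V" for x y
      using that by (simp add: r2_def mem_Times_iff rep_closed subspace_add[OF subV] subspace_diff[OF subV])
    show "r2 (b2 x y) v = r2 x (r2 y v) - r2 y (r2 x v)" if "x \<in> L \<times> L" "y \<in> L \<times> L" "v \<in> V \<times> V" for x y v
      using that by (simp add: r2_def b2_def mem_Times_iff rep_bracket algebra_simps)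
  qed
  have tr2: "trace_on (V \<times> V) (\<lambda>v. r2 x (r2 y v)) = 0" if xy: "x \<in> L \<times> L" "y \<in> L \<times> L" for x y
  proof -
    interpret R: lie_rep "L \<times> L" b2 "V \<times> V" r2 by (rule rep)
    obtain a b c d where xy': "x = (a, b)" "y = (c, d)" by (metis surj_pair)
    have L: "a \<in> L" "b \<in> L" "c \<in> L" "d \<in> L" using xy xy' by auto
    \<comment> \<open>\<open>P\<close> and \<open>Q\<close> are the real and imaginary parts of the
      product of the two operators. As a block operator on V \<times> V it has \<open>P\<close> in
      both diagonal places, so its real trace is 2 tr P = 0.\<close>
    define P where "P v = \<rho> a (\<rho> c v) - \<rho> b (\<rho> d v)" for v
    define Q where "Q v = \<rho> a (\<rho> d v) + \<rho> b (\<rho> c v)" for v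
    have eq: "r2 x (r2 y v) = (P (fst v), P (snd v)) + (- Q (snd v), Q (fst v))" for v
      by (simp add: r2_def xy' P_def Q_def algebra_simps)
    have l: "linear (\<lambda>v. \<rho> u (\<rho> w v))" for u w using linear_comp2[OF rep_linear rep_linear] .
    have i: "(\<lambda>v. \<rho> u (\<rho> w v)) ` V \<subseteq> V" if "u \<in> L" "w \<in> L" for u w using rep_closed that by blast
    have lP: "linear P" and lQ: "linear Q"
      unfolding P_def Q_def using linear_compose_sub[OF l l] linear_compose_add[OF l l] by blast+
    have P0: "trace_on V P = 0"
      unfolding P_def using trace_on_diff[OF fdV l i l i, OF L(1,3,2,4)] tr L by simp
    have PV: "P v \<in> V" "Q v \<in> V" if "v \<in> V" for v
      unfolding P_def Q_def using that L by (simp_all add: rep_closed subspace_diff[OF subV] subspace_add[OF subV])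
    have fVV: "finite_dimensional (V \<times> V)" by (rule finite_dimensional_Times[OF fdV fdV])
    let ?f = "\<lambda>v::'v \<times> 'v. P (fst v) - Q (snd v)" and ?h = "\<lambda>v::'v \<times> 'v. P (snd v) + Q (fst v)"
    let ?i = "\<lambda>v::'v. (v, 0::'v)" and ?k = "\<lambda>v::'v. (0::'v, v)"
    have lf: "linear ?f" "linear ?h" using lP lQ
      by (auto intro!: linearI simp: linear_add linear_scale algebra_simps)
    have li: "linear ?i" "linear ?k" by (auto intro!: linearI)
    have im: "?f ` (V \<times> V) \<subseteq> V" "?h ` (V \<times> V) \<subseteq> V" "?i ` V \<subseteq> V \<times> V" "?k ` V \<subseteq> V \<times> V"
      using subspace_0[OF subV]
      by (auto simp del: split_paired_All intro!: subspace_diff[OF subV] subspace_add[OF subV] PV)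
    have lc: "linear (\<lambda>v. ?i (?f v))" "linear (\<lambda>v. ?k (?h v))"
      using linear_compose[OF lf(1) li(1)] linear_compose[OF lf(2) li(2)] by (simp_all add: o_def)
    have ic: "(\<lambda>v. ?i (?f v)) ` (V \<times> V) \<subseteq> V \<times> V" "(\<lambda>v. ?k (?h v)) ` (V \<times> V) \<subseteq> V \<times> V" using im by blast+
    have "trace_on (V \<times> V) (\<lambda>v. r2 x (r2 y v)) = trace_on (V \<times> V) (\<lambda>v. ?i (?f v) + ?k (?h v))"
      unfolding eq by (simp add: algebra_simps)
    also have "\<dots> = trace_on (V \<times> V) (\<lambda>v. ?i (?f v)) + trace_on (V \<times> V) (\<lambda>v. ?k (?h v))"
      using trace_on_add[OF fVV lc(1) ic(1) lc(2) ic(2)] .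
    also have "\<dots> = trace_on V (\<lambda>v. ?f (?i v)) + trace_on V (\<lambda>v. ?h (?k v))"
      using trace_on_comm_between[OF fVV fdV li(1) im(3) lf(1) im(1)]
        trace_on_comm_between[OF fVV fdV li(2) im(4) lf(2) im(2)] by simp
    also have "\<dots> = 0" using P0 linear_0[OF lQ] by simp
    finally show ?thesis .
  qed
  have perf2: "derived_algebra b2 (L \<times> L) = L \<times> L"
  proof
    interpret R: fd_lie "L \<times> L" b2 by (rule lie)
    show "derived_algebra b2 (L \<times> L) \<subseteq> L \<times> L"
      unfolding derived_algebra_def by (rule bracket_span_subset[OF R.subspace R.closed])
    let ?D = "derived_algebra b2 (L \<times> L)"
    have sD: "subspace ?D" by (simp add: derived_algebra_def subspace_bracket_span)
    have gen: "b2 u w \<in> ?D" if "u \<in> L \<times> L" "w \<in> L \<times> L" for u w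
      unfolding derived_algebra_def by (rule bracket_in_span[OF that])
    have "(u, 0) \<in> ?D \<and> (0, u) \<in> ?D" if "u \<in> span {br x y | x y. x \<in> L \<and> y \<in> L}" for u
      using that
    proof (induction rule: span_induct_alt)
      case base then show ?case using subspace_0[OF sD] by (simp add: zero_prod_def)
    next
      case (step r w u)
      from step(1) obtain y z where w: "w = br y z" "y \<in> L" "z \<in> L" by blast
      have "(w, 0) \<in> ?D" "(0, w) \<in> ?D"
        using gen[of "(y, 0)" "(z, 0)"] gen[of "(y, 0)" "(0, z)"] w subspace_0[OF subspace] by (auto simp: b2_def)
      then have "r *\<^sub>R (w, 0) + (u, 0) \<in> ?D" "r *\<^sub>R (0, w) + (0, u) \<in> ?D"
        using step(2) by (auto intro!: subspace_add[OF sD] subspace_scale[OF sD] simp del: scaleR_Pair add_Pair)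
      then show ?case by simp
    qed
    then have D: "(u, 0) \<in> ?D \<and> (0, u) \<in> ?D" if "u \<in> L" for u
      using perfect that unfolding derived_algebra_def bracket_span_def by blast
    show "L \<times> L \<subseteq> ?D"
    proof
      fix p assume p: "p \<in> L \<times> L"
      then have "(fst p, 0) + (0, snd p) \<in> ?D" using D by (intro subspace_add[OF sD]) (auto simp: mem_Times_iff)
      then show "p \<in> ?D" by simp
    qed
  qed
  have "\<exists>n. \<forall>v\<in>V \<times> V. (r2 (x, 0) ^^ n) v = 0"
  proof (rule complex_cartan[OF rep _ _ _ _ _ tr2 perf2])
    show "times_i y \<in> L \<times> L" if "y \<in> L \<times> L" for y
      using that by (simp add: times_i_def mem_Times_iff subspace_neg[OF subspace])
    show "times_i y \<in> V \<times> V" if "y \<in> V \<times> V" for y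
      using that by (simp add: times_i_def mem_Times_iff subspace_neg[OF subV])
    show "(x, 0) \<in> L \<times> L" using x subspace_0[OF subspace] by simp
  qed (simp_all add: b2_def r2_def times_i_def)
  then obtain n where n: "\<forall>v\<in>V \<times> V. (r2 (x, 0) ^^ n) v = 0" by blast
  have "(r2 (x, 0) ^^ k) (v, 0) = ((\<rho> x ^^ k) v, 0)" for k v
    by (induction k) (simp_all add: r2_def)
  then have "\<forall>v\<in>V. (\<rho> x ^^ n) v = 0" using n subspace_0[OF subV] by (metis mem_Sigma_iff prod.inject zero_prod_def)
  then show ?thesis by blast
qed

section \<open>Minimal nonsolvable Lie algebras\<close>

lemma funpow_square: "((\<lambda>v. f (f v)) ^^ n) v = (f ^^ (2 * n)) v"
  by (induction n) simp_all

lemma trace_on_sum: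
  assumes "finite_dimensional V" "finite I" "\<And>i. i \<in> I \<Longrightarrow> linear (f i)" "\<And>i. i \<in> I \<Longrightarrow> f i ` V \<subseteq> V"
  shows "trace_on V (\<lambda>v. \<Sum>i\<in>I. f i v) = (\<Sum>i\<in>I. trace_on V (f i))"
  using assms(2,3,4)
proof (induction I rule: finite_induct)
  case empty
  then show ?case by (simp add: trace_on_zero)
next
  case (insert j I)
  have sV: "subspace V" using finite_dimensional_imp_subspace[OF assms(1)] .
  have "linear (\<lambda>v. \<Sum>i\<in>I. f i v)" by (rule linear_compose_sum) (use insert in simp)
  moreover have "(\<lambda>v. \<Sum>i\<in>I. f i v) ` V \<subseteq> V"
    by (rule image_subsetI, rule subspace_sum[OF sV]) (use insert in blast)
  ultimately show ?case
    using insert trace_on_add[OF assms(1), of "f j" "\<lambda>v. \<Sum>i\<in>I. f i v"] by simp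
qed

section \<open>Trace forms of representations\<close>

context lie_rep
begin

definition trace_form :: "'a \<Rightarrow> 'a \<Rightarrow> real"
  where "trace_form x y = trace_on V (\<lambda>v. \<rho> x (\<rho> y v))"

lemma linear_rep_rep: "linear (\<lambda>v. \<rho> x (\<rho> y v))"
  using linear_comp2[OF rep_linear rep_linear] .

lemma rep_rep_image: "x \<in> L \<Longrightarrow> y \<in> L \<Longrightarrow> (\<lambda>v. \<rho> x (\<rho> y v)) ` V \<subseteq> V"
  using rep_closed by blast

lemma trace_form_sym: "x \<in> L \<Longrightarrow> y \<in> L \<Longrightarrow> trace_form x y = trace_form y x"
  unfolding trace_form_def using trace_on_comm[OF fdV rep_linear rep_image rep_linear rep_image] .

lemma trace_form_add: "x \<in> L \<Longrightarrow> y \<in> L \<Longrightarrow> z \<in> L \<Longrightarrow> trace_form (x + y) z = trace_form x z + trace_form y z"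
  unfolding trace_form_def
  using trace_on_add[OF fdV linear_rep_rep rep_rep_image linear_rep_rep rep_rep_image] by simp

lemma trace_form_scale: "x \<in> L \<Longrightarrow> z \<in> L \<Longrightarrow> trace_form (c *\<^sub>R x) z = c * trace_form x z"
  unfolding trace_form_def using trace_on_scale[OF fdV linear_rep_rep rep_rep_image] by simp

lemma trace_form_invariant:
  assumes "x \<in> L" "y \<in> L" "z \<in> L"
  shows "trace_form (br x y) z = trace_form x (br y z)"
proof -
  have c: "\<rho> x v \<in> V" "\<rho> y v \<in> V" "\<rho> z v \<in> V" if "v \<in> V" for v using rep_closed assms that by auto
  have l: "linear (\<lambda>v. \<rho> a (\<rho> b (\<rho> c v)))" for a b c using linear_comp2[OF linear_rep_rep rep_linear] .
  have i: "(\<lambda>v. \<rho> x (\<rho> y (\<rho> z v))) ` V \<subseteq> V" "(\<lambda>v. \<rho> y (\<rho> x (\<rho> z v))) ` V \<subseteq> V" "(\<lambda>v. \<rho> x (\<rho> z (\<rho> y v))) ` V \<subseteq> V"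
    using c by blast+
  have "trace_form (br x y) z = trace_on V (\<lambda>v. \<rho> x (\<rho> y (\<rho> z v)) - \<rho> y (\<rho> x (\<rho> z v)))"
    unfolding trace_form_def
    by (rule trace_on_cong[OF fdV linear_rep_rep rep_rep_image[OF closed[OF assms(1,2)] assms(3)] linear_compose_sub[OF l l]])
      (simp add: rep_bracket assms c)
  also have "\<dots> = trace_on V (\<lambda>v. \<rho> x (\<rho> y (\<rho> z v))) - trace_on V (\<lambda>v. \<rho> y (\<rho> x (\<rho> z v)))"
    by (rule trace_on_diff[OF fdV l i(1) l i(2)])
  also have "trace_on V (\<lambda>v. \<rho> y (\<rho> x (\<rho> z v))) = trace_on V (\<lambda>v. \<rho> x (\<rho> z (\<rho> y v)))"
    by (rule trace_on_comm[OF fdV rep_linear rep_image[OF assms(2)] linear_rep_rep rep_rep_image[OF assms(1,3)]])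
  also have "trace_on V (\<lambda>v. \<rho> x (\<rho> y (\<rho> z v))) - \<dots> = trace_on V (\<lambda>v. \<rho> x (\<rho> y (\<rho> z v)) - \<rho> x (\<rho> z (\<rho> y v)))"
    by (rule trace_on_diff[OF fdV l i(1) l i(3), symmetric])
  also have "\<dots> = trace_form x (br y z)"
    unfolding trace_form_def
  proof (rule trace_on_cong[OF fdV linear_compose_sub[OF l l] _ linear_rep_rep])
    show "(\<lambda>v. \<rho> x (\<rho> y (\<rho> z v)) - \<rho> x (\<rho> z (\<rho> y v))) ` V \<subseteq> V"
      using c by (intro image_subsetI subspace_diff[OF subV]) simp_all
  qed (simp add: rep_bracket assms)
  finally show ?thesis .
qed

lemma trace_form_polarize:
  assumes "\<And>z. z \<in> L \<Longrightarrow> trace_form z z = 0" "y \<in> L" "z \<in> L"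
  shows "trace_form y z = 0"
proof -
  have yz: "y + z \<in> L" using assms(2,3) subspace_add[OF subspace] by blast
  have "trace_form (y + z) (y + z) = trace_form y y + trace_form z y + (trace_form y z + trace_form z z)"
    using trace_form_add[OF assms(2,3) yz] trace_form_sym[OF assms(2) yz] trace_form_sym[OF assms(3) yz]
      trace_form_add[OF assms(2,3,2)] trace_form_add[OF assms(2,3,3)] by simp
  then show ?thesis using trace_form_sym[OF assms(2,3)] assms(1)[OF assms(2)] assms(1)[OF assms(3)] assms(1)[OF yz] by simp
qed

lemma trace_form_nilpotent:
  assumes "z \<in> L" "\<And>v. v \<in> V \<Longrightarrow> (\<rho> z ^^ n) v = 0"
  shows "trace_form z z = 0"
proof -
  have "(\<rho> z ^^ (2 * n)) v = 0" if "v \<in> V" for v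
    using assms(2)[OF that] linear_0[OF linear_funpow[OF rep_linear]] by (simp add: mult_2 funpow_add)
  then show ?thesis unfolding trace_form_def
    by (intro trace_on_nilpotent[OF fdV linear_rep_rep rep_rep_image[OF assms(1,1)], of n]) (simp add: funpow_square)
qed

lemma trace_form_radical:
  "subspace {x \<in> L. \<forall>y\<in>L. trace_form x y = 0}"
  "y \<in> L \<Longrightarrow> x \<in> {x \<in> L. \<forall>y\<in>L. trace_form x y = 0} \<Longrightarrow> br y x \<in> {x \<in> L. \<forall>y\<in>L. trace_form x y = 0}"
proof -
  show "subspace {x \<in> L. \<forall>y\<in>L. trace_form x y = 0}"
    unfolding subspace_def using subspace_0[OF subspace] subspace_add[OF subspace] subspace_scale[OF subspace]
    by (auto simp: trace_form_add trace_form_scale, simp add: trace_form_def trace_on_zero)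
  assume y: "y \<in> L" and x: "x \<in> {x \<in> L. \<forall>y\<in>L. trace_form x y = 0}"
  have "trace_form (br y x) z = 0" if z: "z \<in> L" for z
  proof -
    have "trace_form (br y x) z = trace_form y (br x z)" using trace_form_invariant y x z by simp
    also have "\<dots> = trace_form (br x z) y" using trace_form_sym y x z closed by simp
    also have "\<dots> = trace_form x (br z y)" using trace_form_invariant x y z by simp
    finally show ?thesis using x closed[OF z y] by simp
  qed
  then show "br y x \<in> {x \<in> L. \<forall>y\<in>L. trace_form x y = 0}" using x y closed by simp
qed

end

section \<open>Dual bases and Casimir elements of an invariant form\<close>

locale inv_form = fd_lie L br for L :: "'a::real_vector set" and br +
  fixes K :: "'a \<Rightarrow> 'a \<Rightarrow> real"
  assumes K_sym: "x \<in> L \<Longrightarrow> y \<in> L \<Longrightarrow> K x y = K y x"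
    and K_add: "x \<in> L \<Longrightarrow> y \<in> L \<Longrightarrow> z \<in> L \<Longrightarrow> K (x + y) z = K x z + K y z"
    and K_scale: "x \<in> L \<Longrightarrow> z \<in> L \<Longrightarrow> K (c *\<^sub>R x) z = c * K x z"
    and K_inv: "x \<in> L \<Longrightarrow> y \<in> L \<Longrightarrow> z \<in> L \<Longrightarrow> K (br x y) z = K x (br y z)"
    and K_nondeg: "x \<in> L \<Longrightarrow> (\<And>y. y \<in> L \<Longrightarrow> K x y = 0) \<Longrightarrow> x = 0"
begin

lemma K_add_right: "x \<in> L \<Longrightarrow> y \<in> L \<Longrightarrow> z \<in> L \<Longrightarrow> K x (y + z) = K x y + K x z"
  using K_add[of y z x] K_sym subspace_add[OF subspace] by simp

lemma K_scale_right: "x \<in> L \<Longrightarrow> z \<in> L \<Longrightarrow> K x (c *\<^sub>R z) = c * K x z"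
  using K_scale[of z x c] K_sym subspace_scale[OF subspace] by simp

lemma K_zero: "x \<in> L \<Longrightarrow> K x 0 = 0" "x \<in> L \<Longrightarrow> K 0 x = 0"
  using K_scale_right[of x 0 0] K_scale[of 0 x 0] subspace_0[OF subspace] by auto

lemma K_diff: "x \<in> L \<Longrightarrow> y \<in> L \<Longrightarrow> z \<in> L \<Longrightarrow> K (x - y) z = K x z - K y z"
  using K_add[of x "(-1) *\<^sub>R y" z] K_scale[of y z "-1"] subspace_neg[OF subspace] by simp

lemma K_minus: "x \<in> L \<Longrightarrow> y \<in> L \<Longrightarrow> K (- x) y = - K x y" "x \<in> L \<Longrightarrow> y \<in> L \<Longrightarrow> K x (- y) = - K x y"
  using K_scale[of x y "-1"] K_scale_right[of x y "-1"] by auto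

lemma K_sum: "finite I \<Longrightarrow> (\<And>i. i \<in> I \<Longrightarrow> f i \<in> L) \<Longrightarrow> y \<in> L \<Longrightarrow> K (\<Sum>i\<in>I. f i) y = (\<Sum>i\<in>I. K (f i) y)"
  by (induction I rule: finite_induct) (simp_all add: K_zero K_add subspace_sum[OF subspace])

lemma K_sum_right: "finite I \<Longrightarrow> (\<And>i. i \<in> I \<Longrightarrow> f i \<in> L) \<Longrightarrow> y \<in> L \<Longrightarrow> K y (\<Sum>i\<in>I. f i) = (\<Sum>i\<in>I. K y (f i))"
  by (induction I rule: finite_induct) (simp_all add: K_zero K_add_right subspace_sum[OF subspace])

lemma K_skew: "x \<in> L \<Longrightarrow> y \<in> L \<Longrightarrow> z \<in> L \<Longrightarrow> K (br x y) z = - K y (br x z)"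
  using K_inv[of y x z] antisym[of x y] K_minus(1)[of "br y x" z] closed by simp

definition dual_bases :: "'a set \<Rightarrow> ('a \<Rightarrow> 'a) \<Rightarrow> bool"
  where "dual_bases B d \<longleftrightarrow> finite B \<and> independent B \<and> span B = L \<and> B \<subseteq> L \<and> card B = dim L \<and>
    (\<forall>b\<in>B. d b \<in> L) \<and> (\<forall>b\<in>B. \<forall>c\<in>B. K (d b) c = (if b = c then 1 else 0))"

text \<open>Nondegeneracy makes \<open>?F\<close> injective, hence onto, and \<open>d b\<close> is a
  preimage of b; comparing coefficients in the basis gives the values K (d b) c.\<close>

lemma dual_bases_exist: "\<exists>B d. dual_bases B d"
proof -
  obtain B where B: "finite B" "independent B" "span B = L" "card B = dim L"
    using finite_dimensional_basis[OF fd] by metis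
  have BL: "B \<subseteq> L" using B(3) span_superset[of B] by simp
  let ?F = "\<lambda>x. \<Sum>b\<in>B. K x b *\<^sub>R b"
  have add: "?F (u + v) = ?F u + ?F v" if "u \<in> L" "v \<in> L" for u v
    using that BL K_add by (simp add: sum.distrib[symmetric] scaleR_add_left subset_iff cong: sum.cong)
  have scale: "?F (c *\<^sub>R v) = c *\<^sub>R ?F v" if "v \<in> L" for c v
    using that BL K_scale by (simp add: scaleR_sum_right subset_iff cong: sum.cong)
  obtain h where h: "linear h" "\<And>v. v \<in> L \<Longrightarrow> h v = ?F v"
    using linear_extension_on[of L ?F, OF subspace add scale] by blast
  have "h ` L = L"
  proof (rule linear_inj_imp_surj_on[OF h(1) fd])
    show "h ` L \<subseteq> L"
      using h(2) BL by (auto intro!: subspace_sum[OF subspace] subspace_scale[OF subspace])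
    fix v assume v: "v \<in> L" "h v = 0"
    then have s: "(\<Sum>b\<in>B. K v b *\<^sub>R b) = 0" using h(2) by simp
    have kb: "K v b = 0" if "b \<in> B" for b
      using independentD[OF B(2) B(1) order_refl s that] .
    show "v = 0"
    proof (rule K_nondeg[OF v(1)])
      fix y assume "y \<in> L"
      then have "y \<in> span B" using B(3) by simp
      then have "K v y = 0 \<and> y \<in> L"
      proof (induction rule: span_induct_alt)
        case base then show ?case using K_zero v(1) subspace_0[OF subspace] by simp
      next
        case (step c x y)
        then show ?case using BL kb v(1) K_add_right K_scale_right subspace_add[OF subspace] subspace_scale[OF subspace]
          by (simp add: subset_iff)
      qed
      then show "K v y = 0" by simp
    qed
  qed
  then have "\<forall>b\<in>B. \<exists>e\<in>L. h e = b" using BL by (metis imageE subsetD)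
  then obtain d where d: "\<And>b. b \<in> B \<Longrightarrow> d b \<in> L \<and> h (d b) = b" by metis
  have "K (d b) c = (if b = c then 1 else 0)" if "b \<in> B" "c \<in> B" for b c
  proof -
    have "(\<Sum>c\<in>B. (K (d b) c - (if b = c then 1 else 0)) *\<^sub>R c) = ?F (d b) - (\<Sum>c\<in>B. (if b = c then 1 else 0) *\<^sub>R c)"
      by (simp add: scaleR_diff_left sum_subtractf)
    also have "(\<Sum>c\<in>B. (if b = c then 1 else 0) *\<^sub>R c) = (\<Sum>c\<in>B. if c = b then b else 0)"
      by (rule sum.cong) auto
    also have "\<dots> = b" using B(1) that(1) by simp
    also have "?F (d b) - b = 0" using h(2)[of "d b"] d[OF that(1)] by simp
    finally have "(\<Sum>c\<in>B. (K (d b) c - (if b = c then 1 else 0)) *\<^sub>R c) = 0" .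
    from independentD[OF B(2) B(1) order_refl this that(2)] show ?thesis by simp
  qed
  then have "dual_bases B d" using B BL d by (auto simp: dual_bases_def)
  then show ?thesis by blast
qed

lemma dual_bases_expand:
  assumes "dual_bases B d" "v \<in> L"
  shows "b \<in> B \<Longrightarrow> representation B v b = K (d b) v" "v = (\<Sum>b\<in>B. K (d b) v *\<^sub>R b)" "v = (\<Sum>b\<in>B. K v b *\<^sub>R d b)"
proof -
  have B: "finite B" "independent B" "span B = L" "B \<subseteq> L" "\<And>b. b \<in> B \<Longrightarrow> d b \<in> L"
    "\<And>b c. b \<in> B \<Longrightarrow> c \<in> B \<Longrightarrow> K (d b) c = (if b = c then 1 else 0)"
    using assms(1) by (auto simp: dual_bases_def)
  have v: "(\<Sum>b\<in>B. representation B v b *\<^sub>R b) = v"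
    using real_vector.sum_representation_eq[OF B(2) _ B(1) order_refl] B(3) assms(2) by simp
  have r: "representation B v b = K (d b) v" if b: "b \<in> B" for b
  proof -
    have "K (d b) v = (\<Sum>c\<in>B. K (d b) (representation B v c *\<^sub>R c))"
      using K_sum_right[OF B(1) _ B(5)[OF b], of "\<lambda>c. representation B v c *\<^sub>R c"] v B(4) subspace_scale[OF subspace]
      by (simp add: subset_iff)
    also have "\<dots> = (\<Sum>c\<in>B. if c = b then representation B v b else 0)"
      by (rule sum.cong) (use B(4,5,6) b K_scale_right in \<open>auto simp: subset_iff\<close>)
    also have "\<dots> = representation B v b" using B(1) b by simp
    finally show ?thesis by simp
  qed
  then show "b \<in> B \<Longrightarrow> representation B v b = K (d b) v" .
  show v': "v = (\<Sum>b\<in>B. K (d b) v *\<^sub>R b)" using v r by (simp cong: sum.cong)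
  let ?w = "\<Sum>b\<in>B. K v b *\<^sub>R d b"
  have w: "?w \<in> L" using B(5) by (intro subspace_sum[OF subspace] subspace_scale[OF subspace])
  have c: "K (v - ?w) c = 0" if c: "c \<in> B" for c
  proof -
    have cL: "c \<in> L" using c B(4) by blast
    have "K ?w c = (\<Sum>b\<in>B. K (K v b *\<^sub>R d b) c)"
      by (rule K_sum[OF B(1) _ cL]) (use B(5) subspace_scale[OF subspace] in blast)
    also have "\<dots> = (\<Sum>b\<in>B. if b = c then K v c else 0)"
      by (rule sum.cong) (use B(5,6) c cL K_scale in auto)
    also have "\<dots> = K v c" using B(1) c by simp
    finally show ?thesis using K_diff[OF assms(2) w cL] by simp
  qed
  have "v - ?w = 0"
  proof (rule K_nondeg)
    show vw: "v - ?w \<in> L" using assms(2) w subspace_diff[OF subspace] by blast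
    fix y assume "y \<in> L"
    then have "y \<in> span B" using B(3) by simp
    then have "K (v - ?w) y = 0 \<and> y \<in> L"
    proof (induction rule: span_induct_alt)
      case base then show ?case using K_zero vw subspace_0[OF subspace] by blast
    next
      case (step r x y)
      have x: "x \<in> L" using step(1) B(4) by blast
      then have rx: "r *\<^sub>R x \<in> L" using subspace_scale[OF subspace] by blast
      have "K (v - ?w) (r *\<^sub>R x + y) = r * K (v - ?w) x + K (v - ?w) y"
        using K_add_right[OF vw rx] K_scale_right[OF vw x] step(2) by metis
      then show ?case using c[OF step(1)] step(2) subspace_add[OF subspace rx] by simp
    qed
    then show "K (v - ?w) y = 0" by simp
  qed
  then show "v = ?w" by simp
qed

text \<open>Invariance of the Casimir element, the sum of b \<otimes> d b, tested against an
  arbitrary map F that is linear in each argument. The coefficient of c in [x, b] is K (d c) [x, b]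
  = - K [x, d c] b, which is minus the coefficient of d b in [x, d c].\<close>

lemma casimir_invariance:
  assumes "dual_bases B d" "\<And>y. linear (\<lambda>x. F x y)" "\<And>x. linear (F x)" "x \<in> L"
  shows "(\<Sum>b\<in>B. F (br x b) (d b)) = - (\<Sum>b\<in>B. F b (br x (d b)))"
proof -
  have B: "finite B" "B \<subseteq> L" "\<And>b. b \<in> B \<Longrightarrow> d b \<in> L" using assms(1) by (auto simp: dual_bases_def)
  have "(\<Sum>b\<in>B. F (br x b) (d b)) = (\<Sum>b\<in>B. \<Sum>c\<in>B. K (d c) (br x b) *\<^sub>R F c (d b))"
  proof (rule sum.cong[OF refl])
    fix b assume "b \<in> B"
    then have "br x b \<in> L" using B(2) assms(4) closed by blast
    then have "br x b = (\<Sum>c\<in>B. K (d c) (br x b) *\<^sub>R c)" by (rule dual_bases_expand(2)[OF assms(1)])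
    then have "F (br x b) (d b) = F (\<Sum>c\<in>B. K (d c) (br x b) *\<^sub>R c) (d b)" by simp
    also have "\<dots> = (\<Sum>c\<in>B. K (d c) (br x b) *\<^sub>R F c (d b))"
      by (simp add: linear_sum[OF assms(2)] linear_scale[OF assms(2)])
    finally show "F (br x b) (d b) = (\<Sum>c\<in>B. K (d c) (br x b) *\<^sub>R F c (d b))" .
  qed
  also have "\<dots> = (\<Sum>c\<in>B. \<Sum>b\<in>B. K (d c) (br x b) *\<^sub>R F c (d b))" by (rule sum.swap)
  also have "\<dots> = (\<Sum>c\<in>B. - F c (br x (d c)))"
  proof (rule sum.cong[OF refl])
    fix c assume c: "c \<in> B"
    have dc: "br x (d c) \<in> L" using B(3)[OF c] assms(4) closed by blast
    then have "br x (d c) = (\<Sum>b\<in>B. K (br x (d c)) b *\<^sub>R d b)" by (rule dual_bases_expand(3)[OF assms(1)])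
    then have "F c (br x (d c)) = F c (\<Sum>b\<in>B. K (br x (d c)) b *\<^sub>R d b)" by simp
    also have "\<dots> = (\<Sum>b\<in>B. K (br x (d c)) b *\<^sub>R F c (d b))"
      by (simp add: linear_sum[OF assms(3)] linear_scale[OF assms(3)])
    also have "\<dots> = (\<Sum>b\<in>B. - (K (d c) (br x b) *\<^sub>R F c (d b)))"
    proof (rule sum.cong[OF refl])
      fix b assume "b \<in> B"
      then show "K (br x (d c)) b *\<^sub>R F c (d b) = - (K (d c) (br x b) *\<^sub>R F c (d b))"
        using K_skew[OF assms(4) B(3)[OF c]] B(2) by (simp add: subset_iff)
    qed
    finally show "(\<Sum>b\<in>B. K (d c) (br x b) *\<^sub>R F c (d b)) = - F c (br x (d c))"
      by (simp add: sum_negf)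
  qed
  finally show ?thesis by (simp add: sum_negf)
qed

end

definition minimal_nonsolvable :: "('a::real_vector \<Rightarrow> 'a \<Rightarrow> 'a) \<Rightarrow> 'a set \<Rightarrow> bool"
  where "minimal_nonsolvable br g \<longleftrightarrow> \<not> solvable_lie br g \<and>
    (\<forall>M. subspace M \<longrightarrow> M \<subset> g \<longrightarrow> (\<forall>x\<in>M. \<forall>y\<in>M. br x y \<in> M) \<longrightarrow> solvable_lie br M)"

lemma solvable_lie_zero: "solvable_lie br {0}"
  by (auto simp: solvable_lie_def intro!: exI[of _ 0])

text \<open>Source of the abelian ideals: for a solvable ideal the last nonzero term of its derived
  series is one.\<close>

lemma solvable_last_derived:
  assumes "solvable_lie br I" "I \<noteq> {0}"
  obtains n where "(derived_algebra br ^^ n) I \<noteq> {0}" "(derived_algebra br ^^ Suc n) I = {0}"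
proof -
  let ?P = "\<lambda>n. (derived_algebra br ^^ n) I = {0}"
  have ex: "\<exists>n. ?P n" using assms(1) by (auto simp: solvable_lie_def)
  define m where "m = (LEAST n. ?P n)"
  have m: "?P m" unfolding m_def using ex by (rule LeastI_ex)
  have "m \<noteq> 0" using m assms(2) by (intro notI) simp
  then obtain n where n: "m = Suc n" using not0_implies_Suc by blast
  have "\<not> ?P n" using not_less_Least[of n ?P] n m_def by simp
  then show ?thesis using that m n by blast
qed

context fd_lie
begin

lemma minimal_nonsolvable_perfect:
  assumes "minimal_nonsolvable br g"
  shows "derived_algebra br g = g"
proof (rule ccontr)
  assume ne: "derived_algebra br g \<noteq> g"
  have D: "derived_algebra br g \<subseteq> g" "\<And>x y. x \<in> g \<Longrightarrow> y \<in> derived_algebra br g \<Longrightarrow> br x y \<in> derived_algebra br g"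
    using derived_series_ideal[OF order_refl subspace closed, where n=1] by simp_all
  have "subspace (derived_algebra br g)" by (simp add: derived_algebra_def subspace_bracket_span)
  then have "solvable_lie br (derived_algebra br g)"
    using assms ne D(1) D(2)[OF subsetD[OF D(1)]] unfolding minimal_nonsolvable_def by (metis psubsetI)
  then show False using solvable_lie_derived assms by (auto simp: minimal_nonsolvable_def)
qed

lemma minimal_nonsolvable_nonzero: "minimal_nonsolvable br g \<Longrightarrow> g \<noteq> {0}"
  using solvable_lie_zero by (auto simp: minimal_nonsolvable_def)

text \<open>A proper ideal \<open>I\<close> is solvable, and its last nonzero derived algebra is an abelian ideal,
  which lies in the radical of the Killing form.\<close>

lemma minimal_nonsolvable_simple:
  assumes mn: "minimal_nonsolvable br g"
    and nd: "\<And>x. x \<in> g \<Longrightarrow> (\<And>y. y \<in> g \<Longrightarrow> trace_on g (\<lambda>v. br x (br y v)) = 0) \<Longrightarrow> x = 0"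
    and I: "subspace I" "I \<subseteq> g" "\<And>x y. x \<in> g \<Longrightarrow> y \<in> I \<Longrightarrow> br x y \<in> I" "I \<noteq> g"
  shows "I = {0}"
proof (rule ccontr)
  assume "I \<noteq> {0}"
  moreover have "solvable_lie br I" using mn I unfolding minimal_nonsolvable_def by blast
  ultimately obtain n where n: "(derived_algebra br ^^ n) I \<noteq> {0}" "(derived_algebra br ^^ Suc n) I = {0}"
    using solvable_last_derived by metis
  let ?A = "(derived_algebra br ^^ n) I"
  have A: "?A \<subseteq> g" "\<And>x y. x \<in> g \<Longrightarrow> y \<in> ?A \<Longrightarrow> br x y \<in> ?A" "subspace ?A"
    using derived_series_ideal[OF I(2,1,3), where n=n] I(2) subspace_derived_series[OF I(1)] by blast+
  have ab: "br x y = 0" if "x \<in> ?A" "y \<in> ?A" for x y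
    using bracket_in_span[OF that, of br] n(2) unfolding derived_series_Suc by blast
  have fA: "finite_dimensional ?A" using finite_dimensional_subset[OF A(3,1) fd] .
  have "x = 0" if x: "x \<in> ?A" for x
  proof (rule nd)
    show xg: "x \<in> g" using x A(1) by blast
    fix y assume y: "y \<in> g"
    have l: "linear (\<lambda>v. br x (br y v))" using linear_compose[OF linear_right linear_right] by (simp add: o_def)
    have xA: "br x w \<in> ?A" if "w \<in> g" for w
      using A(2)[OF that x] antisym[OF xg that] subspace_neg[OF A(3)] by simp
    have i: "(\<lambda>v. br x (br y v)) ` g \<subseteq> ?A" using xA closed[OF y] by blast
    have "trace_on g (\<lambda>v. br x (br y v)) = trace_on ?A (\<lambda>v. br x (br y v))"
      using trace_on_range[OF fd l i A(3,1)] .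
    also have "\<dots> = trace_on ?A (\<lambda>v. 0)"
    proof (rule trace_on_cong[OF fA l _ linear_zero])
      show "(\<lambda>v. br x (br y v)) ` ?A \<subseteq> ?A" using i A(1) by blast
      show "br x (br y v) = 0" if "v \<in> ?A" for v using ab[OF x A(2)[OF y that]] .
    qed
    finally show "trace_on g (\<lambda>v. br x (br y v)) = 0" by (simp add: trace_on_zero)
  qed
  then show False using n(1) subspace_0[OF A(3)] by blast
qed

end

section \<open>Extensions by an abelian ideal\<close>

locale abelian_ideal = fd_lie g br for g :: "'a::real_vector set" and br +
  fixes a s :: "'a set" and p :: "'a \<Rightarrow> 'a"
  assumes sub_a: "subspace a" and a_g: "a \<subseteq> g"
    and ideal: "x \<in> g \<Longrightarrow> y \<in> a \<Longrightarrow> br x y \<in> a"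
    and abelian: "x \<in> a \<Longrightarrow> y \<in> a \<Longrightarrow> br x y = 0"
    and sub_s: "subspace s" and s_g: "s \<subseteq> g" and linear_p: "linear p"
    and p_a: "y \<in> a \<Longrightarrow> p y = 0" and p_s: "x \<in> s \<Longrightarrow> p x = x"
    and p_in: "x \<in> g \<Longrightarrow> p x \<in> s" and p_diff: "x \<in> g \<Longrightarrow> x - p x \<in> a"
begin

text \<open>\<open>s\<close> is merely a linear complement of \<open>a\<close>, in general not a
  subalgebra; with the projected bracket it becomes a model of g/a.\<close>

definition qbr :: "'a \<Rightarrow> 'a \<Rightarrow> 'a" where "qbr x y = p (br x y)"

lemma p_simps [simp]: "p (x + y) = p x + p y" "p (x - y) = p x - p y" "p (- x) = - p x" "p (c *\<^sub>R x) = c *\<^sub>R p x" "p 0 = 0"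
  using linear_p by (simp_all add: linear_add linear_diff linear_neg linear_scale linear_0)

lemma in_g: "x \<in> s \<Longrightarrow> x \<in> g" "y \<in> a \<Longrightarrow> y \<in> g" using s_g a_g by auto

lemma ideal_left: "x \<in> g \<Longrightarrow> y \<in> a \<Longrightarrow> br y x \<in> a"
  using ideal[of x y] antisym[of y x] in_g subspace_neg[OF sub_a] by simp

lemma p_bracket_p: "x \<in> g \<Longrightarrow> y \<in> g \<Longrightarrow> p (br x y) = p (br x (p y))" "x \<in> g \<Longrightarrow> y \<in> g \<Longrightarrow> p (br x y) = p (br (p x) y)"
proof -
  assume xy: "x \<in> g" "y \<in> g"
  have "p (br x (y - p y)) = 0" using p_a ideal[OF xy(1) p_diff[OF xy(2)]] by blast
  then show "p (br x y) = p (br x (p y))" by simp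
  have "p (br (x - p x) y) = 0" using p_a ideal_left[OF xy(2) p_diff[OF xy(1)]] by blast
  then show "p (br x y) = p (br (p x) y)" by simp
qed

lemma p_hom: "x \<in> g \<Longrightarrow> y \<in> g \<Longrightarrow> p (br x y) = qbr (p x) (p y)"
  unfolding qbr_def using p_bracket_p[of x y] p_bracket_p(1)[of "p x" y] p_in in_g by simp

lemma bracket_p_a: "x \<in> g \<Longrightarrow> v \<in> a \<Longrightarrow> br (p x) v = br x v"
proof -
  assume "x \<in> g" "v \<in> a"
  then have "br (x - p x) v = 0" using abelian p_diff by blast
  then show "br (p x) v = br x v" by simp
qed

lemma quotient_fd_lie: "fd_lie s qbr"
proof (intro fd_lie.intro real_lie_algebra.intro fd_lie_axioms.intro)
  show "subspace s" by (rule sub_s)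
  show "finite_dimensional s" using finite_dimensional_subset[OF sub_s s_g fd] .
  show "linear (\<lambda>x. qbr x y)" "linear (qbr x)" for x y
    unfolding qbr_def[abs_def] using linear_compose[OF linear_left linear_p] linear_compose[OF linear_right linear_p]
    by (simp_all add: o_def)
  show "qbr x x = 0" if "x \<in> s" for x using alternating in_g that by (simp add: qbr_def)
  show "qbr x (qbr y z) + qbr y (qbr z x) + qbr z (qbr x y) = 0" if "x \<in> s" "y \<in> s" "z \<in> s" for x y z
  proof -
    have xyz: "x \<in> g" "y \<in> g" "z \<in> g" using that in_g by auto
    have "p (br x (br y z) + br y (br z x) + br z (br x y)) = 0" using jacobi[OF xyz] by simp
    then show ?thesis unfolding qbr_def using xyz p_bracket_p(1) closed by simp
  qed
qed (use in_g closed p_in in \<open>auto simp: qbr_def\<close>)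

lemma solvable_image:
  assumes "subspace Q" "Q \<subseteq> g" "\<And>x y. x \<in> Q \<Longrightarrow> y \<in> Q \<Longrightarrow> br x y \<in> Q" "solvable_lie br Q"
  shows "solvable_lie qbr (p ` Q)"
proof (rule solvable_lie_image[OF linear_p _ assms(1,3,4)])
  show "p (br x y) = qbr (p x) (p y)" if "x \<in> Q" "y \<in> Q" for x y
    using p_hom that assms(2) by blast
qed

lemma p_image_g: "p ` g = s"
  using p_in p_s in_g by (metis image_iff image_subsetI subsetI subset_antisym)

text \<open>When the derived series of the quotient has reached 0, that of g lies in the abelian
  ideal, and its next term vanishes.\<close>

lemma solvable_of_quotient:
  assumes "solvable_lie qbr s"
  shows "solvable_lie br g"
proof -
  obtain n where n: "(derived_algebra qbr ^^ n) s = {0}" using assms by (auto simp: solvable_lie_def)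
  let ?D = "(derived_algebra br ^^ n) g"
  have D: "p ` ?D = (derived_algebra qbr ^^ n) (p ` g) \<and> ?D \<subseteq> g"
    using derived_series_image[of p g br qbr n] linear_p p_hom subspace closed by simp
  have "?D \<subseteq> a"
  proof
    fix x assume x: "x \<in> ?D"
    then have "p x = 0" "x \<in> g" using D n p_image_g by auto
    then show "x \<in> a" using p_diff[of x] by simp
  qed
  then have "bracket_span br ?D ?D \<subseteq> {0}"
    using abelian by (intro bracket_span_subset[OF subspace_single_0]) blast
  then have "(derived_algebra br ^^ Suc n) g = {0}"
    unfolding derived_series_Suc using subspace_0[OF subspace_bracket_span] by blast
  then show ?thesis unfolding solvable_lie_def by blast
qed

lemma quotient_minimal_nonsolvable:
  assumes "minimal_nonsolvable br g" "a \<noteq> {0}"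
  shows "minimal_nonsolvable qbr s"
  unfolding minimal_nonsolvable_def
proof (intro conjI allI impI)
  show "\<not> solvable_lie qbr s" using solvable_of_quotient assms(1) by (auto simp: minimal_nonsolvable_def)
  fix M assume M: "subspace M" "M \<subset> s" "\<forall>x\<in>M. \<forall>y\<in>M. qbr x y \<in> M"
  \<comment> \<open>The preimage of a proper subalgebra of the quotient is a proper subalgebra of g,
    solvable by minimality, and so is its image M.\<close>
  let ?Q = "{x \<in> g. p x \<in> M}"
  have sQ: "subspace ?Q" unfolding subspace_def
    using subspace_0[OF subspace] subspace_add[OF subspace] subspace_scale[OF subspace]
      subspace_0[OF M(1)] subspace_add[OF M(1)] subspace_scale[OF M(1)] by simp
  have cl: "br x y \<in> ?Q" if "x \<in> ?Q" "y \<in> ?Q" for x y using that M(3) closed p_hom by simp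
  obtain x where "x \<in> s" "x \<notin> M" using M(2) by blast
  then have "x \<in> g" "x \<notin> ?Q" using p_s in_g by auto
  then have "?Q \<subset> g" by blast
  then have "solvable_lie br ?Q" using assms(1) sQ cl unfolding minimal_nonsolvable_def by blast
  then have "solvable_lie qbr (p ` ?Q)" using solvable_image[OF sQ _ cl] by blast
  moreover have "p ` ?Q = M"
  proof
    show "M \<subseteq> p ` ?Q"
    proof
      fix x assume x: "x \<in> M"
      then have "x \<in> s" using M(2) by blast
      then have "p x = x" "x \<in> g" using p_s in_g by auto
      then show "x \<in> p ` ?Q" using x by (intro image_eqI[of _ _ x]) auto
    qed
  qed blast
  ultimately show "solvable_lie qbr M" by simp
qed

text \<open>A proper subalgebra Q is solvable by minimality; if it maps onto g/a, then g/a is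
  solvable, and so is g because \<open>a\<close> is abelian. The central and the noncentral case
  below both end by constructing such a Q.\<close>

lemma no_proper_supplement:
  assumes "minimal_nonsolvable br g" "subspace Q" "Q \<subset> g" "\<And>x y. x \<in> Q \<Longrightarrow> y \<in> Q \<Longrightarrow> br x y \<in> Q" "p ` Q = s"
  shows False
proof -
  have "solvable_lie br Q" using assms(1-4) unfolding minimal_nonsolvable_def by blast
  then have "solvable_lie qbr s" using solvable_image[OF assms(2) _ assms(4)] assms(3,5) by blast
  then show False using solvable_of_quotient assms(1) by (auto simp: minimal_nonsolvable_def)
qed


text \<open>The Casimir operator \<open>u\<close> of the Killing form of the quotient acts on \<open>g\<close>, because the
  ideal is central. It is the identity modulo \<open>a\<close> and kills \<open>a\<close>, so its image is a supplement.\<close>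

lemma central_contradiction:
  assumes mn: "minimal_nonsolvable br g" and "a \<noteq> {0}"
    and nd: "\<And>x. x \<in> s \<Longrightarrow> (\<And>y. y \<in> s \<Longrightarrow> trace_on s (\<lambda>v. qbr x (qbr y v)) = 0) \<Longrightarrow> x = 0"
    and central: "\<And>x v. x \<in> g \<Longrightarrow> v \<in> a \<Longrightarrow> br x v = 0"
  shows False
proof -
  interpret q: fd_lie s qbr by (rule quotient_fd_lie)
  interpret qa: lie_rep s qbr s qbr by (rule q.adjoint_rep[OF sub_s order_refl q.closed])
  interpret k: inv_form s qbr qa.trace_form
    by unfold_locales (auto simp: qa.trace_form_add qa.trace_form_scale qa.trace_form_invariant
        intro: qa.trace_form_sym nd[folded qa.trace_form_def])
  obtain B d where Bd: "k.dual_bases B d" using k.dual_bases_exist by blast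
  have B: "finite B" "independent B" "span B = s" "B \<subseteq> s" "\<And>b. b \<in> B \<Longrightarrow> d b \<in> s"
    using Bd by (auto simp: k.dual_bases_def)
  have Bg: "b \<in> g" "d b \<in> g" "b \<in> s" if "b \<in> B" for b using B(4,5) that in_g by blast+
  define u where "u x = (\<Sum>b\<in>B. br b (br (d b) x))" for x
  have lu: "linear u" unfolding u_def
    by (intro linear_compose_sum ballI) (use linear_compose[OF linear_right linear_right] in \<open>simp add: o_def\<close>)
  have ug: "u x \<in> g" if "x \<in> g" for x
    unfolding u_def using that Bg closed by (intro subspace_sum[OF subspace]) blast
  have ua: "u x = 0" if "x \<in> a" for x
    unfolding u_def using central[OF Bg(2) that] by simp
  have cen2: "br v x = 0" if "x \<in> g" "v \<in> a" for x v
    using central[OF that] antisym[of v x] that in_g by simp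
  \<comment> \<open>The bracket with b may be computed in the quotient: the error lies in
    \<open>a\<close>, and \<open>a\<close> is central in this lemma.\<close>
  have brp: "br (br z b) w = br (qbr (p z) b) w" if "z \<in> g" "b \<in> s" "w \<in> g" for z b w
  proof -
    have b: "b \<in> g" "p z \<in> g" using that in_g p_in by auto
    have "br z b = br (p z) b" using cen2[OF b(1) p_diff[OF that(1)]] by simp
    moreover have "br (br (p z) b - p (br (p z) b)) w = 0" using cen2[OF that(3) p_diff] closed b by blast
    ultimately show ?thesis by (simp add: qbr_def)
  qed
  have comm: "br z (u x) = u (br z x)" if z: "z \<in> g" and x: "x \<in> g" for z x
  proof -
    have "br z (u x) = (\<Sum>b\<in>B. br (qbr (p z) b) (br (d b) x) + br b (br (qbr (p z) (d b)) x) + br b (br (d b) (br z x)))"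
      unfolding u_def bracket_sum_right
    proof (rule sum.cong[OF refl])
      fix b assume b: "b \<in> B"
      have w: "br (d b) x \<in> g" "br z x \<in> g" using Bg[OF b] closed x z by auto
      have "br z (br b (br (d b) x)) = br (br z b) (br (d b) x) + br b (br z (br (d b) x))"
        using bracket_bracket[OF z Bg(1)[OF b] w(1)] by simp
      also have "br z (br (d b) x) = br (br z (d b)) x + br (d b) (br z x)"
        using bracket_bracket[OF z Bg(2)[OF b] x] by simp
      finally show "br z (br b (br (d b) x)) = br (qbr (p z) b) (br (d b) x) + br b (br (qbr (p z) (d b)) x) + br b (br (d b) (br z x))"
        using brp[OF z Bg(3)[OF b] w(1)] brp[OF z B(5)[OF b] x] by simp
    qed
    also have "\<dots> = u (br z x)"
    proof -
      have "(\<Sum>b\<in>B. br (qbr (p z) b) (br (d b) x)) = - (\<Sum>b\<in>B. br b (br (qbr (p z) (d b)) x))"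
      proof (rule k.casimir_invariance[OF Bd _ _ p_in[OF z]])
        show "linear (\<lambda>e. br e (br y x))" for y using linear_left .
        show "linear (\<lambda>f. br e (br f x))" for e using linear_compose[OF linear_left linear_right] by (simp add: o_def)
      qed
      then show ?thesis by (simp add: sum.distrib u_def)
    qed
    finally show ?thesis .
  qed
  \<comment> \<open>The Casimir operator of the Killing form K is the identity on the adjoint
    module: by invariance K (p (u x)) y becomes the trace of ad x ad y, which is K x y.\<close>
  have pu: "p (u x) = x" if x: "x \<in> s" for x
  proof -
    let ?w = "\<lambda>b. qbr b (qbr (d b) x)"
    have ws: "?w b \<in> s" if "b \<in> B" for b using that Bg B(5) x q.closed by blast
    have eq: "p (u x) = (\<Sum>b\<in>B. ?w b)"
      unfolding u_def linear_sum[OF linear_p]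
    proof (rule sum.cong[OF refl])
      fix b assume "b \<in> B"
      then show "p (br b (br (d b) x)) = ?w b"
        unfolding qbr_def using p_bracket_p(1)[of b "br (d b) x"] Bg closed in_g x by blast
    qed
    have pus: "p (u x) \<in> s" using p_in ug in_g x by blast
    have "p (u x) - x = 0"
    proof (rule k.K_nondeg)
      show "p (u x) - x \<in> s" using pus x subspace_diff[OF sub_s] by blast
      fix y assume y: "y \<in> s"
      have "qa.trace_form (p (u x)) y = (\<Sum>b\<in>B. qa.trace_form (?w b) y)"
        unfolding eq by (rule k.K_sum[OF B(1) ws y])
      also have "\<dots> = (\<Sum>b\<in>B. representation B (qbr x (qbr y b)) b)"
      proof (rule sum.cong[OF refl])
        fix b assume b: "b \<in> B"
        have s: "b \<in> s" "d b \<in> s" using b Bg B(5) by auto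
        have "qa.trace_form (?w b) y = - qa.trace_form (qbr (d b) x) (qbr b y)"
          using k.K_skew s x y q.closed by simp
        also have "\<dots> = - qa.trace_form (d b) (qbr x (qbr b y))"
          using k.K_inv[OF s(2) x q.closed[OF s(1) y]] by simp
        also have "qbr x (qbr b y) = - qbr x (qbr y b)" using q.antisym[OF s(1) y] by simp
        also have "- qa.trace_form (d b) (- qbr x (qbr y b)) = qa.trace_form (d b) (qbr x (qbr y b))"
          using k.K_minus(2)[of "d b" "qbr x (qbr y b)"] s x y q.closed by simp
        also have "\<dots> = representation B (qbr x (qbr y b)) b"
          using k.dual_bases_expand(1)[OF Bd _ b] s x y q.closed by simp
        finally show "qa.trace_form (?w b) y = representation B (qbr x (qbr y b)) b" .
      qed
      also have "\<dots> = qa.trace_form x y"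
        unfolding qa.trace_form_def
        by (rule trace_on_basis[OF B(1-3) qa.linear_rep_rep qa.rep_rep_image[OF x y], symmetric])
      finally show "qa.trace_form (p (u x) - x) y = 0"
        using k.K_diff[OF pus x y] by simp
    qed
    then show ?thesis by simp
  qed
  let ?Q = "u ` g"
  have Qg: "?Q \<subseteq> g" using ug by blast
  have "?Q \<noteq> g"
  proof
    assume "?Q = g"
    then have "x = 0" if "x \<in> a" for x
      using linear_surj_imp_inj_on[OF lu fd] ua[OF that] in_g(2)[OF that] by blast
    then show False using assms(2) subspace_0[OF sub_a] by blast
  qed
  moreover have "br x y \<in> ?Q" if "x \<in> ?Q" "y \<in> ?Q" for x y
  proof -
    obtain w where "w \<in> g" "y = u w" using \<open>y \<in> ?Q\<close> by blast
    moreover have "x \<in> g" using \<open>x \<in> ?Q\<close> Qg by blast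
    ultimately show ?thesis using comm closed by blast
  qed
  moreover have "p ` ?Q = s"
  proof
    show "p ` ?Q \<subseteq> s" using p_in ug by blast
    show "s \<subseteq> p ` ?Q"
    proof
      fix x assume x: "x \<in> s"
      then have "u x \<in> ?Q" using in_g by blast
      then show "x \<in> p ` ?Q" using pu[OF x] by (metis imageI)
    qed
  qed
  ultimately show False
    using no_proper_supplement[OF mn linear_subspace_image[OF lu subspace]] Qg by blast
qed

text \<open>The quotient acts on \<open>a\<close> because \<open>a\<close> is abelian: elements of g
  that differ by an element of \<open>a\<close> act alike on it.\<close>

lemma ideal_rep: "lie_rep s qbr a br"
proof (intro lie_rep.intro quotient_fd_lie lie_rep_axioms.intro)
  show "finite_dimensional a" using finite_dimensional_subset[OF sub_a a_g fd] .
  show "linear (br x)" "linear (\<lambda>x. br x y)" for x y by (rule linear_right linear_left)+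
  show "br x y \<in> a" if "x \<in> s" "y \<in> a" for x y using ideal that in_g by blast
  show "br (qbr x y) v = br x (br y v) - br y (br x v)" if "x \<in> s" "y \<in> s" "v \<in> a" for x y v
    unfolding qbr_def using that bracket_p_a[of "br x y" v] bracket_bracket[of x y v] closed in_g by simp
qed

text \<open>If \<open>a\<close> is not central, the trace form of \<open>a\<close> on the quotient is nondegenerate by Cartan's
  criterion: otherwise the quotient would act on \<open>a\<close>, hence on itself, by nilpotent operators.\<close>

lemma noncentral_trace_form_nondegenerate:
  assumes mn: "minimal_nonsolvable br g" and "a \<noteq> {0}"
    and nd: "\<And>x. x \<in> s \<Longrightarrow> (\<And>y. y \<in> s \<Longrightarrow> trace_on s (\<lambda>v. qbr x (qbr y v)) = 0) \<Longrightarrow> x = 0"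
    and noncentral: "x0 \<in> g" "v0 \<in> a" "br x0 v0 \<noteq> 0"
    and x: "x \<in> s" "\<And>y. y \<in> s \<Longrightarrow> trace_on a (\<lambda>v. br x (br y v)) = 0"
  shows "x = 0"
proof -
  interpret q: fd_lie s qbr by (rule quotient_fd_lie)
  interpret r: lie_rep s qbr a br by (rule ideal_rep)
  interpret qa: lie_rep s qbr s qbr by (rule q.adjoint_rep[OF sub_s order_refl q.closed])
  have qmn: "minimal_nonsolvable qbr s" using quotient_minimal_nonsolvable[OF mn assms(2)] .
  have simple: "I = {0}" if "subspace I" "I \<subseteq> s" "\<And>x y. x \<in> s \<Longrightarrow> y \<in> I \<Longrightarrow> qbr x y \<in> I" "I \<noteq> s" for I
    using q.minimal_nonsolvable_simple[OF qmn nd that] .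
  \<comment> \<open>The kernel of the action on \<open>a\<close>. It is an ideal of the quotient,
    proper because the action is nonzero, hence 0 by simplicity: the action is faithful.\<close>
  define N where "N = {x \<in> s. \<forall>v\<in>a. br x v = 0}"
  have "N = {0}"
  proof (rule simple)
    show "subspace N" unfolding N_def subspace_def
      using subspace_0[OF sub_s] subspace_add[OF sub_s] subspace_scale[OF sub_s] by simp
    show "N \<subseteq> s" by (auto simp: N_def)
    show "qbr y x \<in> N" if "y \<in> s" "x \<in> N" for y x
      using that q.closed r.rep_bracket[of y x] r.rep_closed[of y] by (simp add: N_def)
    have "br (p x0) v0 \<noteq> 0" using bracket_p_a noncentral by simp
    then show "N \<noteq> s" using p_in noncentral(1,2) unfolding N_def by blast
  qed
  then have faithful: "x = 0" if "x \<in> s" "\<And>v. v \<in> a \<Longrightarrow> br x v = 0" for x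
    using that unfolding N_def by blast
  \<comment> \<open>By simplicity the radical of the trace form is 0 or everything, and the second
    case has to be excluded.\<close>
  define R where "R = {x \<in> s. \<forall>y\<in>s. r.trace_form x y = 0}"
  have R: "subspace R" "R \<subseteq> s" "\<And>x y. x \<in> s \<Longrightarrow> y \<in> R \<Longrightarrow> qbr x y \<in> R"
    unfolding R_def using r.trace_form_radical by (blast | simp)+
  have "R \<noteq> s"
  proof
    assume Rs: "R = s"
    have tr0: "trace_on a (\<lambda>v. br x (br y v)) = 0" if "x \<in> s" "y \<in> s" for x y
      using that Rs unfolding R_def r.trace_form_def by blast
    have "qa.trace_form z z = 0" if z: "z \<in> s" for z
    proof -
      obtain n where n: "\<forall>v\<in>a. (br z ^^ n) v = 0"
        using cartan_criterion[OF ideal_rep tr0 q.minimal_nonsolvable_perfect[OF qmn] z] by blast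
      have nz: "(br z ^^ i) v = 0" if "i \<ge> n" "v \<in> a" for i v
      proof -
        have "(br z ^^ i) v = (br z ^^ (i - n)) ((br z ^^ n) v)" using that(1) by (simp add: funpow_add[symmetric, THEN fun_cong, simplified])
        also have "\<dots> = 0" using n that(2) linear_0[OF linear_funpow[OF linear_right]] by simp
        finally show ?thesis .
      qed
      have na: "(br z ^^ i) v \<in> a" if "v \<in> a" for i v
        using funpow_image_subset[OF r.rep_image[OF z]] that by blast
      have qs: "(qbr z ^^ i) y \<in> s" if "y \<in> s" for i y
        using funpow_image_subset[OF qa.rep_image[OF z]] that by blast
      \<comment> \<open>As an operator on \<open>a\<close>, (ad z)^m y is a combination of terms z^i
        y z^j with i + j = m. For m = 2 n one of the exponents reaches n, so every term vanishes,
        and faithfulness gives (ad z)^(2 n) = 0.\<close>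
      have key: "(br z ^^ i) (br ((qbr z ^^ m) y) ((br z ^^ j) v)) = 0"
        if "i + j + m \<ge> 2 * n" "y \<in> s" "v \<in> a" for i j m y v
        using that(1)
      proof (induction m arbitrary: i j)
        case 0
        then consider "i \<ge> n" | "j \<ge> n" by linarith
        then show ?case
        proof cases
          case 1
          then show ?thesis using nz r.rep_closed na that(2,3) by simp
        next
          case 2
          then show ?thesis using nz[OF 2 that(3)] linear_0[OF linear_funpow[OF linear_right]] by simp
        qed
      next
        case (Suc m)
        let ?y = "(qbr z ^^ m) y" and ?v = "(br z ^^ j) v"
        have "(br z ^^ i) (br ((qbr z ^^ Suc m) y) ?v) = (br z ^^ i) (br z (br ?y ?v) - br ?y (br z ?v))"
          using r.rep_bracket[OF z qs[OF that(2)] na[OF that(3)]] by simp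
        also have "\<dots> = (br z ^^ Suc i) (br ?y ?v) - (br z ^^ i) (br ?y ((br z ^^ Suc j) v))"
          by (simp add: linear_diff[OF linear_funpow[OF linear_right]] funpow_swap1)
        also have "\<dots> = 0" using Suc.IH[of "Suc i" j] Suc.IH[of i "Suc j"] Suc.prems by simp
        finally show ?case .
      qed
      have "(qbr z ^^ (2 * n)) y = 0" if "y \<in> s" for y
        using faithful[OF qs[OF that]] key[of 0 0 "2 * n", OF _ that] by simp
      then show ?thesis using qa.trace_form_nilpotent[OF z] by blast
    qed
    then have "qa.trace_form y z = 0" if "y \<in> s" "z \<in> s" for y z
      using qa.trace_form_polarize that by blast
    then have "z = 0" if "z \<in> s" for z using nd[OF that] that unfolding qa.trace_form_def by blast
    then show False using q.minimal_nonsolvable_nonzero[OF qmn] subspace_0[OF sub_s] by blast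
  qed
  then have "R = {0}" using simple[OF R] by blast
  then show ?thesis using x unfolding R_def r.trace_form_def by blast
qed

text \<open>Let \<open>f\<close> be the 2-cocycle of the extension and \<open>C\<close> the Casimir operator on \<open>a\<close>. Then
  \<open>C f\<close> is the coboundary of \<open>h\<close>, and the graph of \<open>- C\<^sup>-\<^sup>1 h\<close> is a supplement of \<open>a\<close>.\<close>

lemma noncentral_contradiction:
  assumes mn: "minimal_nonsolvable br g" and a0: "a \<noteq> {0}"
    and irr: "\<And>W. subspace W \<Longrightarrow> W \<subseteq> a \<Longrightarrow> (\<And>x w. x \<in> g \<Longrightarrow> w \<in> W \<Longrightarrow> br x w \<in> W) \<Longrightarrow> W = {0} \<or> W = a"
    and nd: "\<And>x. x \<in> s \<Longrightarrow> (\<And>y. y \<in> s \<Longrightarrow> trace_on s (\<lambda>v. qbr x (qbr y v)) = 0) \<Longrightarrow> x = 0"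
    and noncentral: "x0 \<in> g" "v0 \<in> a" "br x0 v0 \<noteq> 0"
  shows False
proof -
  interpret q: fd_lie s qbr by (rule quotient_fd_lie)
  interpret r: lie_rep s qbr a br by (rule ideal_rep)
  interpret k: inv_form s qbr r.trace_form
    by unfold_locales (auto simp: r.trace_form_add r.trace_form_scale r.trace_form_invariant
        intro: r.trace_form_sym noncentral_trace_form_nondegenerate[OF mn a0 nd noncentral, folded r.trace_form_def])
  have qmn: "minimal_nonsolvable qbr s" using quotient_minimal_nonsolvable[OF mn a0] .
  obtain B d where Bd: "k.dual_bases B d" using k.dual_bases_exist by blast
  have B: "finite B" "B \<subseteq> s" "\<And>b. b \<in> B \<Longrightarrow> d b \<in> s" "card B = dim s"
    "\<And>b. b \<in> B \<Longrightarrow> r.trace_form (d b) b = 1"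
    using Bd by (auto simp: k.dual_bases_def)
  have Bs: "b \<in> s" "d b \<in> s" "b \<in> g" "d b \<in> g" if "b \<in> B" for b using B(2,3) that in_g by blast+
  define C where "C v = (\<Sum>b\<in>B. br b (br (d b) v))" for v
  have lC: "linear C" unfolding C_def
    by (intro linear_compose_sum ballI) (use linear_compose[OF linear_right linear_right] in \<open>simp add: o_def\<close>)
  have Ca: "C v \<in> a" if "v \<in> a" for v
    unfolding C_def using that Bs r.rep_closed by (intro subspace_sum[OF sub_a]) blast
  have cas: "(\<Sum>b\<in>B. br (qbr x b) (F (d b))) = - (\<Sum>b\<in>B. br b (F (qbr x (d b))))"
    if "linear F" "x \<in> s" for F x
    by (rule k.casimir_invariance[OF Bd linear_left _ that(2), of "\<lambda>f. F f" for F, simplified])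
      (use linear_compose[OF that(1) linear_right] in \<open>simp add: o_def\<close>)
  have comm: "br x (C v) = C (br x v)" if x: "x \<in> s" and v: "v \<in> a" for x v
  proof -
    have "br x (C v) = (\<Sum>b\<in>B. br (qbr x b) (br (d b) v) + br b (br (qbr x (d b)) v) + br b (br (d b) (br x v)))"
      unfolding C_def bracket_sum_right
    proof (rule sum.cong[OF refl])
      fix b assume b: "b \<in> B"
      show "br x (br b (br (d b) v)) = br (qbr x b) (br (d b) v) + br b (br (qbr x (d b)) v) + br b (br (d b) (br x v))"
        using r.rep_bracket[OF x Bs(1)[OF b] r.rep_closed[OF Bs(2)[OF b] v]] r.rep_bracket[OF x Bs(2)[OF b] v] by simp
    qed
    then show ?thesis using cas[OF linear_left x, of v] by (simp add: sum.distrib C_def)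
  qed
  \<comment> \<open>Each summand is the value 1 of the trace form on a dual pair, so the trace
    counts the basis. Its being nonzero is what keeps \<open>C\<close> from vanishing on
    \<open>a\<close>.\<close>
  have "trace_on a C = (\<Sum>b\<in>B. r.trace_form b (d b))"
    unfolding C_def r.trace_form_def
    by (rule trace_on_sum[OF r.fdV B(1) r.linear_rep_rep r.rep_rep_image]) (use Bs in auto)
  also have "\<dots> = (\<Sum>b\<in>B. 1)" using B(5) r.trace_form_sym Bs by (intro sum.cong) auto
  finally have trC: "trace_on a C = dim s" using B(4) by simp
  have "dim s \<noteq> 0"
  proof
    assume "dim s = 0"
    then have "s = {0}"
      using finite_dimensional_dim_eq[OF subspace_single_0 _ q.fd] subspace_0[OF sub_s] by force
    then show False using q.minimal_nonsolvable_nonzero[OF qmn] by blast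
  qed
  \<comment> \<open>The argument of Schur's lemma: \<open>C\<close> commutes with the action, so its
    kernel is a submodule; irreducibility of \<open>a\<close> and the nonzero trace leave only the
    kernel 0.\<close>
  define W where "W = {v \<in> a. C v = 0}"
  have "W = {0} \<or> W = a"
  proof (rule irr)
    show "subspace W" unfolding W_def subspace_def
      using subspace_0[OF sub_a] subspace_add[OF sub_a] subspace_scale[OF sub_a]
      by (simp add: linear_0[OF lC] linear_add[OF lC] linear_scale[OF lC])
    show "W \<subseteq> a" by (auto simp: W_def)
    show "br x w \<in> W" if "x \<in> g" "w \<in> W" for x w
    proof -
      have w: "w \<in> a" "C w = 0" using that(2) by (auto simp: W_def)
      have "C (br x w) = C (br (p x) w)" using bracket_p_a[OF that(1) w(1)] by simp
      also have "\<dots> = 0" using comm[OF p_in[OF that(1)] w(1)] w(2) by simp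
      finally show ?thesis using ideal[OF that(1) w(1)] by (simp add: W_def)
    qed
  qed
  moreover have "W \<noteq> a"
  proof
    assume "W = a"
    then have C0: "C v = 0" if "v \<in> a" for v using that unfolding W_def by blast
    have "C ` a \<subseteq> a" using Ca by blast
    then have "trace_on a C = trace_on a (\<lambda>v. 0)"
      using C0 by (rule trace_on_cong[OF r.fdV lC _ linear_zero])
    then show False using trC \<open>dim s \<noteq> 0\<close> by (simp add: trace_on_zero)
  qed
  ultimately have Cinj: "v = 0" if "v \<in> a" "C v = 0" for v using that unfolding W_def by blast
  have Csurj: "C ` a = a"
    using linear_inj_imp_surj_on[OF lC r.fdV] Ca Cinj by blast
  define f where "f x y = br x y - p (br x y)" for x y
  \<comment> \<open>The contraction of \<open>f\<close> with the Casimir element, as in the proof of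
    Whitehead's second lemma.\<close>
  define h where "h x = (\<Sum>b\<in>B. br b (f (d b) x))" for x
  have fa: "f x y \<in> a" if "x \<in> g" "y \<in> g" for x y unfolding f_def using p_diff closed that by blast
  have lf: "linear (\<lambda>x. f x y)" "linear (f x)" for x y
    unfolding f_def[abs_def]
    using linear_compose_sub[OF linear_left linear_compose[OF linear_left linear_p]]
      linear_compose_sub[OF linear_right linear_compose[OF linear_right linear_p]] by (simp_all add: o_def)
  have lh: "linear h" unfolding h_def
    by (intro linear_compose_sum ballI) (use linear_compose[OF lf(2) linear_right] in \<open>simp add: o_def\<close>)
  have ha: "h x \<in> a" if "x \<in> g" for x
    unfolding h_def using that Bs fa ideal by (intro subspace_sum[OF sub_a]) blast
  have brf: "br x y = qbr x y + f x y" for x y by (simp add: qbr_def f_def)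
  have f_anti: "f x y = - f y x" if "x \<in> g" "y \<in> g" for x y
    unfolding f_def using antisym[OF that] by simp
  \<comment> \<open>The component in \<open>a\<close> of the Jacobi identity for e, x, y.\<close>
  have cocycle: "br e (f x y) = br x (f e y) - br y (f e x) - f e (qbr x y) + f (qbr y e) x - f (qbr x e) y"
    if "e \<in> s" "x \<in> s" "y \<in> s" for e x y
  proof -
    have ge: "e \<in> g" "x \<in> g" "y \<in> g" using that in_g by auto
    have P: "br u (br v w) - p (br u (br v w)) = f u (qbr v w) + br u (f v w)" if "u \<in> g" "v \<in> g" "w \<in> g" for u v w
    proof -
      have "br u (br v w) = br u (qbr v w) + br u (f v w)" by (subst brf[of v w]) simp
      moreover have "p (br u (f v w)) = 0" using p_a ideal fa that by blast
      ultimately show ?thesis by (simp add: f_def)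
    qed
    have "f e (qbr x y) + br e (f x y) + (f x (qbr y e) + br x (f y e)) + (f y (qbr e x) + br y (f e x)) =
        (br e (br x y) + br x (br y e) + br y (br e x)) - p (br e (br x y) + br x (br y e) + br y (br e x))"
      by (simp only: P[OF ge, symmetric] P[OF ge(2,3,1), symmetric] P[OF ge(3,1,2), symmetric] p_simps) simp
    also have "\<dots> = 0" using jacobi[OF ge] by simp
    finally have 0: "f e (qbr x y) + br e (f x y) + (f x (qbr y e) + br x (f y e)) + (f y (qbr e x) + br y (f e x)) = 0" .
    have "f x (qbr y e) = - f (qbr y e) x" using f_anti q.closed in_g that by blast
    moreover have "br x (f y e) = - br x (f e y)" using f_anti[OF ge(3,1)] by simp
    moreover have "f y (qbr e x) = f (qbr x e) y"
    proof -
      have xe: "qbr x e \<in> g" using q.closed[OF that(2,1)] in_g by blast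
      have "f y (qbr e x) = - f y (qbr x e)"
        unfolding q.antisym[OF that(1,2)] using linear_neg[OF lf(2)] by blast
      also have "\<dots> = f (qbr x e) y" using f_anti[OF ge(3) xe] by simp
      finally show ?thesis .
    qed
    ultimately have "f e (qbr x y) + br e (f x y) + (- f (qbr y e) x - br x (f e y)) + (f (qbr x e) y + br y (f e x)) = 0"
      using 0 by simp
    then have "br e (f x y) = - (f e (qbr x y) + (- f (qbr y e) x - br x (f e y)) + (f (qbr x e) y + br y (f e x)))"
      by (simp add: eq_neg_iff_add_eq_0 algebra_simps)
    then show ?thesis by simp
  qed
  have xh: "br x (h y) = (\<Sum>b\<in>B. br b (br x (f (d b) y))) - (\<Sum>b\<in>B. br b (f (qbr x (d b)) y))"
    if x: "x \<in> s" and y: "y \<in> s" for x y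
  proof -
    have "br x (h y) = (\<Sum>b\<in>B. br (qbr x b) (f (d b) y) + br b (br x (f (d b) y)))"
      unfolding h_def bracket_sum_right
    proof (rule sum.cong[OF refl])
      fix b assume b: "b \<in> B"
      have "f (d b) y \<in> a" using fa Bs[OF b] in_g y by blast
      then show "br x (br b (f (d b) y)) = br (qbr x b) (f (d b) y) + br b (br x (f (d b) y))"
        using r.rep_bracket[OF x Bs(1)[OF b]] by simp
    qed
    then show ?thesis using cas[OF lf(1) x, of y] by (simp add: sum.distrib)
  qed
  \<comment> \<open>Apply b to the cocycle identity with e = d b and sum over b. The terms with
    [x, d b] and [y, d b] are exactly those that arise in \<open>xh\<close> from moving x and y past
    b.\<close>
  have Cf: "C (f x y) = br x (h y) - br y (h x) - h (qbr x y)" if x: "x \<in> s" and y: "y \<in> s" for x y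
  proof -
    have "C (f x y) = (\<Sum>b\<in>B. br b (br x (f (d b) y)) - br b (br y (f (d b) x)) - br b (f (d b) (qbr x y))
        + br b (f (qbr y (d b)) x) - br b (f (qbr x (d b)) y))"
      unfolding C_def using cocycle[OF B(3) x y] by (intro sum.cong) simp_all
    also have "\<dots> = br x (h y) - br y (h x) - h (qbr x y)"
      unfolding xh[OF x y] xh[OF y x] by (simp add: sum.distrib sum_subtractf h_def)
    finally show ?thesis .
  qed
  \<comment> \<open>The elements x + v with x in \<open>s\<close>, v in \<open>a\<close> and C v = -
    h x. Closure under the bracket amounts to \<open>Cf\<close>; \<open>Q\<close> is proper because
    \<open>C\<close> is injective on \<open>a\<close>, and maps onto \<open>s\<close> because
    \<open>C\<close> is onto.\<close>
  define Q where "Q = {u \<in> g. C (u - p u) + h (p u) = 0}"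
  have lQ: "linear (\<lambda>u. C (u - p u) + h (p u))"
    using linear_compose_add[OF linear_compose[OF linear_compose_sub[OF linear_ident linear_p] lC] linear_compose[OF linear_p lh]]
    by (simp add: o_def)
  have sQ: "subspace Q" unfolding Q_def subspace_def
    using linear_0[OF lQ] linear_add[OF lQ] linear_scale[OF lQ] subspace_0[OF subspace] subspace_add[OF subspace] subspace_scale[OF subspace]
    by simp
  have Q_closed: "br u w \<in> Q" if "u \<in> Q" "w \<in> Q" for u w
  proof -
    have g: "u \<in> g" "w \<in> g" using that by (auto simp: Q_def)
    define x y v v' where "x = p u" and "y = p w" and "v = u - p u" and "v' = w - p w"
    have uw: "u = x + v" "w = y + v'" by (simp_all add: x_def y_def v_def v'_def)
    have xy: "x \<in> s" "y \<in> s" "v \<in> a" "v' \<in> a" using g p_in p_diff by (auto simp: x_def y_def v_def v'_def)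
    have CQ: "C v = - h x" "C v' = - h y" using that by (auto simp: Q_def x_def y_def v_def v'_def eq_neg_iff_add_eq_0)
    have xg: "x \<in> g" "y \<in> g" "v \<in> g" using xy in_g by auto
    have vy: "br v y = - br y v" using antisym[OF xg(3,2)] .
    have e: "br u w = qbr x y + (f x y + br x v' - br y v)"
      using abelian[OF xy(3,4)] vy brf[of x y] by (simp add: uw)
    have ea: "f x y + br x v' - br y v \<in> a"
      using fa ideal xg xy by (intro subspace_diff[OF sub_a] subspace_add[OF sub_a]) auto
    have pb: "p (br u w) = qbr x y"
      unfolding e using p_a[OF ea] p_s[OF q.closed[OF xy(1,2)]] by simp
    have "br u w - p (br u w) = f x y + br x v' - br y v" unfolding pb by (simp add: e)
    then have "C (br u w - p (br u w)) = C (f x y) + br x (C v') - br y (C v)"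
      using comm xy by (simp add: linear_diff[OF lC] linear_add[OF lC])
    also have "\<dots> = - h (qbr x y)" unfolding CQ Cf[OF xy(1,2)] by simp
    finally show ?thesis using pb closed g by (simp add: Q_def)
  qed
  have "Q \<subset> g"
  proof -
    obtain v where v: "v \<in> a" "v \<noteq> 0" using a0 subspace_0[OF sub_a] by blast
    have "v \<notin> Q" using v Cinj p_a linear_0[OF lh] by (auto simp: Q_def)
    then show ?thesis using in_g(2)[OF v(1)] unfolding Q_def by blast
  qed
  moreover have "p ` Q = s"
  proof
    show "p ` Q \<subseteq> s" using p_in by (auto simp: Q_def)
    show "s \<subseteq> p ` Q"
    proof
      fix x assume x: "x \<in> s"
      have "- h x \<in> C ` a" unfolding Csurj using ha in_g x subspace_neg[OF sub_a] by blast
      then obtain v where v: "v \<in> a" "C v = - h x" by force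
      have "x + v \<in> Q" using x v p_a p_s in_g subspace_add[OF subspace] by (simp add: Q_def)
      moreover have "p (x + v) = x" using x v p_a p_s by simp
      ultimately show "x \<in> p ` Q" by force
    qed
  qed
  ultimately show False using no_proper_supplement[OF mn sQ _ Q_closed] by blast
qed

end

lemma (in fd_lie) complement_abelian_ideal:
  assumes "subspace a" "a \<subseteq> g" "\<And>x y. x \<in> g \<Longrightarrow> y \<in> a \<Longrightarrow> br x y \<in> a" "\<And>x y. x \<in> a \<Longrightarrow> y \<in> a \<Longrightarrow> br x y = 0"
  shows "\<exists>s p. abelian_ideal g br a s p"
proof -
  obtain s p where "subspace s" "s \<subseteq> g" "linear p" "\<And>w. w \<in> a \<Longrightarrow> p w = 0"
    "\<And>u. u \<in> s \<Longrightarrow> p u = u" "\<And>v. v \<in> g \<Longrightarrow> p v \<in> s" "\<And>v. v \<in> g \<Longrightarrow> v - p v \<in> a"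
    by (rule complement_projection[OF assms(1,2) subspace]) blast
  then have "abelian_ideal g br a s p"
    by (intro abelian_ideal.intro fd_lie_axioms abelian_ideal_axioms.intro assms)
  then show ?thesis by blast
qed

text \<open>Induction on the dimension. If the radical of the Killing form is proper and nonzero, it
  is solvable and contains a minimal abelian ideal; the quotient by it is again minimal nonsolvable,
  has a nondegenerate Killing form by induction, and the two contradictions for abelian ideals
  apply. If the radical is everything, Cartan's criterion makes all ad x nilpotent, and an Engel
  argument contradicts perfectness.\<close>

theorem minimal_nonsolvable_killing_nondegenerate:
  assumes "fd_lie g br" "minimal_nonsolvable br g" "x \<in> g" "\<And>y. y \<in> g \<Longrightarrow> trace_on g (\<lambda>v. br x (br y v)) = 0"
  shows "x = 0"
  using assms
proof (induction "dim g" arbitrary: g br x rule: less_induct)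
  case less
  interpret fd_lie g br by fact
  interpret ad: lie_rep g br g br by (rule adjoint_rep[OF subspace order_refl closed])
  define R where "R = {x \<in> g. \<forall>y\<in>g. ad.trace_form x y = 0}"
  have R: "subspace R" "R \<subseteq> g" "\<And>x y. x \<in> g \<Longrightarrow> y \<in> R \<Longrightarrow> br x y \<in> R"
    unfolding R_def using ad.trace_form_radical by (blast | simp)+
  note perfect = minimal_nonsolvable_perfect[OF less.prems(2)]
  have "R \<noteq> g"
  proof
    assume "R = g"
    then have "trace_on g (\<lambda>v. br x (br y v)) = 0" if "x \<in> g" "y \<in> g" for x y
      using that unfolding R_def ad.trace_form_def by blast
    from cartan_criterion[OF ad.lie_rep_axioms this perfect]
    have nil: "\<exists>n. \<forall>v\<in>g. (br x ^^ n) v = 0" if "x \<in> g" for x using that by blast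
    define P where "P M \<longleftrightarrow> subspace M \<and> M \<subset> g \<and> (\<forall>x\<in>M. \<forall>y\<in>M. br x y \<in> M)" for M
    have P0: "P {0}" using minimal_nonsolvable_nonzero[OF less.prems(2)] subspace_0[OF subspace]
      by (auto simp: P_def subspace_single_0)
    have "dim M \<le> dim g" if "P M" for M using finite_dimensional_dim_mono[OF _ _ fd] that by (auto simp: P_def)
    then obtain M where M: "P M" "\<And>M'. P M' \<Longrightarrow> dim M' \<le> dim M"
      using ex_has_greatest_nat[of P "{0}" dim "Suc (dim g)"] P0 by (metis less_Suc_eq_le)
    have M': "subspace M" "M \<subset> g" "M \<subseteq> g" "\<And>x y. x \<in> M \<Longrightarrow> y \<in> M \<Longrightarrow> br x y \<in> M" using M(1) by (auto simp: P_def)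
    have "solvable_lie br M" using less.prems(2) M' unfolding minimal_nonsolvable_def by blast
    then obtain z where z: "z \<in> g" "z \<notin> M" "\<And>x. x \<in> M \<Longrightarrow> br x z \<in> M"
      using engel_solvable[OF adjoint_rep[OF M'(1,3,4)] _ _ M'(1,2,4)] nil M'(3) by blast
    \<comment> \<open>M plus the line through z. Since z normalizes M, this is a subalgebra larger
      than M, hence all of g by the maximal dimension of M; but its brackets lie in M, against
      perfectness.\<close>
    define M2 where "M2 = {x. \<exists>c. x - c *\<^sub>R z \<in> M}"
    have s2: "subspace M2"
    proof -
      have "0 \<in> M2" unfolding M2_def using subspace_0[OF M'(1)] by (auto intro!: exI[of _ 0])
      moreover have "x + y \<in> M2" if "x \<in> M2" "y \<in> M2" for x y
      proof -
        obtain c e where "x - c *\<^sub>R z \<in> M" "y - e *\<^sub>R z \<in> M" using \<open>x \<in> M2\<close> \<open>y \<in> M2\<close> by (auto simp: M2_def)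
        from subspace_add[OF M'(1) this] have "x + y - (c + e) *\<^sub>R z \<in> M" by (simp add: algebra_simps)
        then show ?thesis by (auto simp: M2_def)
      qed
      moreover have "r *\<^sub>R x \<in> M2" if "x \<in> M2" for r x
      proof -
        obtain c where "x - c *\<^sub>R z \<in> M" using \<open>x \<in> M2\<close> by (auto simp: M2_def)
        from subspace_scale[OF M'(1) this, of r] have "r *\<^sub>R x - (r * c) *\<^sub>R z \<in> M" by (simp add: algebra_simps)
        then show ?thesis by (auto simp: M2_def)
      qed
      ultimately show ?thesis unfolding subspace_def by blast
    qed
    have MM2: "M \<subseteq> M2" unfolding M2_def by (auto intro!: exI[of _ 0])
    have zM2: "z \<in> M2" unfolding M2_def using subspace_0[OF M'(1)] by (auto intro!: exI[of _ 1])
    have M2g: "M2 \<subseteq> g"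
    proof
      fix x assume "x \<in> M2"
      then obtain c where "x - c *\<^sub>R z \<in> M" by (auto simp: M2_def)
      then have "x - c *\<^sub>R z + c *\<^sub>R z \<in> g" using M'(3) z(1) subspace_add[OF subspace] subspace_scale[OF subspace] by blast
      then show "x \<in> g" by simp
    qed
    have br2: "br x y \<in> M" if "x \<in> M2" "y \<in> M2" for x y
    proof -
      obtain c e where ce: "x - c *\<^sub>R z \<in> M" "y - e *\<^sub>R z \<in> M" using \<open>x \<in> M2\<close> \<open>y \<in> M2\<close> by (auto simp: M2_def)
      define m m' where "m = x - c *\<^sub>R z" and "m' = y - e *\<^sub>R z"
      have m: "m \<in> M" "m' \<in> M" "m' \<in> g" using ce M'(3) by (auto simp: m_def m'_def)
      have xy: "x = m + c *\<^sub>R z" "y = m' + e *\<^sub>R z" by (simp_all add: m_def m'_def)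
      have "br x y = br m m' + e *\<^sub>R br m z - c *\<^sub>R br m' z"
        unfolding xy using alternating[OF z(1)] antisym[OF z(1) m(3)] by (simp add: algebra_simps)
      then show ?thesis using m z(3) M'(4) by (simp add: subspace_add[OF M'(1)] subspace_diff[OF M'(1)] subspace_scale[OF M'(1)])
    qed
    have "M2 = g"
    proof (rule ccontr)
      assume "M2 \<noteq> g"
      then have "P M2" unfolding P_def using s2 M2g br2 MM2 by blast
      then have "dim M2 \<le> dim M" using M(2) by blast
      then have "M = M2" using finite_dimensional_dim_eq[OF M'(1) MM2 finite_dimensional_subset[OF s2 M2g fd]] by blast
      then show False using zM2 z(2) by blast
    qed
    then have "derived_algebra br g \<subseteq> M"
      unfolding derived_algebra_def using br2 by (intro bracket_span_subset[OF M'(1)]) blast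
    then show False using perfect M'(2) by blast
  qed
  show ?case
  proof (rule ccontr)
    assume "x \<noteq> 0"
    moreover have "x \<in> R" using less.prems(3,4) unfolding R_def ad.trace_form_def by blast
    ultimately have "R \<noteq> {0}" by blast
    moreover have "solvable_lie br R" using less.prems(2) R \<open>R \<noteq> g\<close> unfolding minimal_nonsolvable_def by blast
    ultimately obtain n where n: "(derived_algebra br ^^ n) R \<noteq> {0}" "(derived_algebra br ^^ Suc n) R = {0}"
      using solvable_last_derived by metis
    define A where "A = (derived_algebra br ^^ n) R"
    have AR: "A \<subseteq> R" "\<And>x y. x \<in> g \<Longrightarrow> y \<in> A \<Longrightarrow> br x y \<in> A"
      unfolding A_def using derived_series_ideal[OF R(2,1,3), where n=n] by blast+
    have sA: "subspace A" unfolding A_def using subspace_derived_series[OF R(1)] .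
    have ab: "br x y = 0" if "x \<in> A" "y \<in> A" for x y
      using bracket_in_span[OF that, of br] n(2) unfolding derived_series_Suc A_def[symmetric] by blast
    \<comment> \<open>The choice of \<open>a\<close> with least dimension makes it irreducible under
      g; lying in the last nonzero derived term of the radical, it is abelian.\<close>
    define P where "P W \<longleftrightarrow> subspace W \<and> W \<subseteq> A \<and> W \<noteq> {0} \<and> (\<forall>x\<in>g. \<forall>w\<in>W. br x w \<in> W)" for W
    have "P A" unfolding P_def using sA AR n(1) A_def by blast
    then obtain a where a: "P a" "\<And>W. P W \<Longrightarrow> dim a \<le> dim W"
      using ex_has_least_nat[of P A dim] by blast
    have a': "subspace a" "a \<subseteq> A" "a \<noteq> {0}" "\<And>x w. x \<in> g \<Longrightarrow> w \<in> a \<Longrightarrow> br x w \<in> a" "a \<subseteq> g"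
      using a(1) AR(1) R(2) unfolding P_def by blast+
    have aba: "br x y = 0" if "x \<in> a" "y \<in> a" for x y using ab that a'(2) by blast
    have fa: "finite_dimensional a" using finite_dimensional_subset[OF a'(1,5) fd] .
    have irr: "W = {0} \<or> W = a" if W: "subspace W" "W \<subseteq> a" "\<And>x w. x \<in> g \<Longrightarrow> w \<in> W \<Longrightarrow> br x w \<in> W" for W
    proof (rule disjCI)
      assume "W \<noteq> a"
      show "W = {0}"
      proof (rule ccontr)
        assume "W \<noteq> {0}"
        then have "P W" unfolding P_def using W a'(2) by blast
        then have "dim a \<le> dim W" using a(2) by blast
        then show False using finite_dimensional_dim_eq[OF W(1,2) fa] \<open>W \<noteq> a\<close> by blast
      qed
    qed
    obtain s p where "abelian_ideal g br a s p" using complement_abelian_ideal[OF a'(1,5,4) aba] by blast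
    then interpret ai: abelian_ideal g br a s p .
    have ds: "dim s < dim g" using complement_dim[OF fd a'(1,5,3) ai.sub_s ai.s_g ai.p_a ai.p_s] .
    have nd: "x = 0" if "x \<in> s" "\<And>y. y \<in> s \<Longrightarrow> trace_on s (\<lambda>v. ai.qbr x (ai.qbr y v)) = 0" for x
      using less.hyps[OF ds ai.quotient_fd_lie ai.quotient_minimal_nonsolvable[OF less.prems(2) a'(3)] that] .
    show False
    proof (cases "\<forall>x\<in>g. \<forall>v\<in>a. br x v = 0")
      case True
      then show ?thesis using ai.central_contradiction[OF less.prems(2) a'(3) nd] by blast
    next
      case False
      then obtain x v where "x \<in> g" "v \<in> a" "br x v \<noteq> 0" by blast
      then show ?thesis using ai.noncentral_contradiction[OF less.prems(2) a'(3) irr nd] by blast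
    qed
  qed
qed

section \<open>Exact 3-forms and solvability\<close>

text \<open>Forms of degrees 1 to 3 are handled as curried functions with conditions on arguments in
  g only, so that two forms may differ outside g. The passage to lists of arguments is left to
  \<open>cochains_1\<close>, \<open>cochains_2\<close> and \<open>cochains_3\<close>.\<close>

definition lin1 :: "'a::real_vector set \<Rightarrow> ('a \<Rightarrow> real) \<Rightarrow> bool"
  where "lin1 g f \<longleftrightarrow> (\<forall>x\<in>g. \<forall>y\<in>g. f (x + y) = f x + f y) \<and> (\<forall>c. \<forall>x\<in>g. f (c *\<^sub>R x) = c * f x)"

definition alt2 :: "'a::real_vector set \<Rightarrow> ('a \<Rightarrow> 'a \<Rightarrow> real) \<Rightarrow> bool"
  where "alt2 g f \<longleftrightarrow> (\<forall>y\<in>g. lin1 g (\<lambda>x. f x y)) \<and> (\<forall>x\<in>g. lin1 g (f x)) \<and> (\<forall>x\<in>g. f x x = 0)"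

text \<open>Alternation is demanded in the two pairs of neighbouring arguments; that in the outer
  pair follows by a transposition.\<close>

definition alt3 :: "'a::real_vector set \<Rightarrow> ('a \<Rightarrow> 'a \<Rightarrow> 'a \<Rightarrow> real) \<Rightarrow> bool"
  where "alt3 g f \<longleftrightarrow> (\<forall>x\<in>g. alt2 g (f x)) \<and> (\<forall>z\<in>g. alt2 g (\<lambda>x y. f x y z))"

text \<open>\<open>d1\<close>, \<open>d2\<close> and \<open>d3\<close> are the Chevalley-Eilenberg
  differential written out by degree.\<close>

definition d1 :: "('a::real_vector \<Rightarrow> 'a \<Rightarrow> 'a) \<Rightarrow> ('a \<Rightarrow> real) \<Rightarrow> 'a \<Rightarrow> 'a \<Rightarrow> real"
  where "d1 br f x y = - f (br x y)"

definition d2 :: "('a::real_vector \<Rightarrow> 'a \<Rightarrow> 'a) \<Rightarrow> ('a \<Rightarrow> 'a \<Rightarrow> real) \<Rightarrow> 'a \<Rightarrow> 'a \<Rightarrow> 'a \<Rightarrow> real"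
  where "d2 br f x y z = - f (br x y) z + f (br x z) y - f (br y z) x"

definition d3 :: "('a::real_vector \<Rightarrow> 'a \<Rightarrow> 'a) \<Rightarrow> ('a \<Rightarrow> 'a \<Rightarrow> 'a \<Rightarrow> real) \<Rightarrow> 'a \<Rightarrow> 'a \<Rightarrow> 'a \<Rightarrow> 'a \<Rightarrow> real"
  where "d3 br f x y z w = - f (br x y) z w + f (br x z) y w - f (br y z) x w
    - f (br x w) y z + f (br y w) x z - f (br z w) x y"

lemma lin1_add: "lin1 g f \<Longrightarrow> x \<in> g \<Longrightarrow> y \<in> g \<Longrightarrow> f (x + y) = f x + f y"
  and lin1_scale: "lin1 g f \<Longrightarrow> x \<in> g \<Longrightarrow> f (c *\<^sub>R x) = c * f x"
  and lin1_minus: "lin1 g f \<Longrightarrow> x \<in> g \<Longrightarrow> f (- x) = - f x"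
  unfolding lin1_def using scaleR_minus1_left[of x] by (blast, blast, metis mult_minus1)

lemma lin1_diff: "lin1 g f \<Longrightarrow> subspace g \<Longrightarrow> x \<in> g \<Longrightarrow> y \<in> g \<Longrightarrow> f (x - y) = f x - f y"
  using lin1_add[of g f x "- y"] lin1_minus[of g f y] by (simp add: subspace_neg)

lemma lin1_zero: "lin1 g f \<Longrightarrow> subspace g \<Longrightarrow> f 0 = 0"
  using lin1_scale[of g f 0 0] by (simp add: subspace_0)

lemma alt2_lin1: "alt2 g f \<Longrightarrow> y \<in> g \<Longrightarrow> lin1 g (\<lambda>x. f x y)" "alt2 g f \<Longrightarrow> x \<in> g \<Longrightarrow> lin1 g (f x)"
  and alt2_same: "alt2 g f \<Longrightarrow> x \<in> g \<Longrightarrow> f x x = 0"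
  unfolding alt2_def by blast+

lemma alt2_anti: "alt2 g f \<Longrightarrow> subspace g \<Longrightarrow> x \<in> g \<Longrightarrow> y \<in> g \<Longrightarrow> f x y = - f y x"
  using alt2_same[of g f "x + y"] alt2_same[of g f x] alt2_same[of g f y]
    lin1_add[OF alt2_lin1(1)[of g f "x + y"], of x y] lin1_add[OF alt2_lin1(2)[of g f x], of x y]
    lin1_add[OF alt2_lin1(2)[of g f y], of x y]
  by (simp add: subspace_add)

lemma alt3_alt2: "alt3 g f \<Longrightarrow> x \<in> g \<Longrightarrow> alt2 g (f x)" "alt3 g f \<Longrightarrow> z \<in> g \<Longrightarrow> alt2 g (\<lambda>x y. f x y z)"
  unfolding alt3_def by blast+

context fd_lie
begin

text \<open>Cartan's 3-form of a trace form. Invariance makes it alternating and moves w out of the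
  inner brackets; the six terms of the differential then cancel by two instances of the Jacobi
  identity.\<close>

lemma killing_3form:
  assumes "lie_rep g br V \<rho>"
  defines "B \<equiv> lie_rep.trace_form V \<rho>"
  defines "\<phi> \<equiv> \<lambda>x y z. B (br x y) z"
  shows "alt3 g \<phi>" "x \<in> g \<Longrightarrow> y \<in> g \<Longrightarrow> z \<in> g \<Longrightarrow> w \<in> g \<Longrightarrow> d3 br \<phi> x y z w = 0"
proof -
  interpret r: lie_rep g br V \<rho> by fact
  have B: "B x y = r.trace_form x y" for x y by (simp add: B_def)
  have sym: "B x y = B y x" if "x \<in> g" "y \<in> g" for x y using r.trace_form_sym that B by simp
  have inv: "B (br x y) z = B x (br y z)" if "x \<in> g" "y \<in> g" "z \<in> g" for x y z using r.trace_form_invariant that B by simp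
  have add: "B (x + y) z = B x z + B y z" if "x \<in> g" "y \<in> g" "z \<in> g" for x y z using r.trace_form_add that B by simp
  have scale: "B (c *\<^sub>R x) z = c * B x z" if "x \<in> g" "z \<in> g" for c x z using r.trace_form_scale that B by simp
  have addr: "B z (x + y) = B z x + B z y" if "x \<in> g" "y \<in> g" "z \<in> g" for x y z
    using add[OF that] sym that subspace_add[OF subspace] by simp
  have scaler: "B z (c *\<^sub>R x) = c * B z x" if "x \<in> g" "z \<in> g" for c x z
    using scale[OF that] sym that subspace_scale[OF subspace] by simp
  have zero: "B 0 z = 0" "B z 0 = 0" if "z \<in> g" for z
    using scale[of 0 z 0] scaler[of 0 z 0] that subspace_0[OF subspace] by auto
  have neg: "B (- x) z = - B x z" "B z (- x) = - B z x" if "x \<in> g" "z \<in> g" for x z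
    using scale[of x z "-1"] scaler[of x z "-1"] that by auto
  show "alt3 g \<phi>"
    unfolding alt3_def alt2_def lin1_def \<phi>_def
    by (simp add: closed add scale addr scaler alternating zero inv)
  assume x: "x \<in> g" and y: "y \<in> g" and z: "z \<in> g" and w: "w \<in> g"
  have 1: "br (br x z) y = br (br x y) z + br (br y z) x"
    using jacobi[OF x y z] antisym[OF closed[OF x y] z] antisym[OF closed[OF x z] y] antisym[OF closed[OF y z] x] antisym[OF x z] closed[OF x z]
    by (simp add: algebra_simps add_eq_0_iff)
  have 2: "br y (br x z) = br x (br y z) + br z (br x y)"
  proof -
    have "br x (br y z) + br z (br x y) - (- br y (br z x)) = 0" using jacobi[OF x y z] by (simp add: algebra_simps)
    then have "br x (br y z) + br z (br x y) = - br y (br z x)" unfolding right_minus_eq .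
    then show ?thesis using antisym[OF x z] by simp
  qed
  have e1: "B (br (br x w) y) z = - B w (br x (br y z))"
    using inv[OF closed[OF x w] y z] antisym[OF x w] neg(1)[OF closed[OF w x] closed[OF y z]] inv[OF w x closed[OF y z]] by simp
  have e2: "B (br (br y w) x) z = - B w (br y (br x z))"
    using inv[OF closed[OF y w] x z] antisym[OF y w] neg(1)[OF closed[OF w y] closed[OF x z]] inv[OF w y closed[OF x z]] by simp
  have e3: "B (br (br z w) x) y = - B w (br z (br x y))"
    using inv[OF closed[OF z w] x y] antisym[OF z w] neg(1)[OF closed[OF w z] closed[OF x y]] inv[OF w z closed[OF x y]] by simp
  have a1: "B (br (br x z) y) w = B (br (br x y) z) w + B (br (br y z) x) w"
    unfolding 1 using add x y z w closed by simp
  have a2: "B w (br y (br x z)) = B w (br x (br y z)) + B w (br z (br x y))"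
    unfolding 2 using addr x y z w closed by simp
  show "d3 br \<phi> x y z w = 0"
    unfolding d3_def \<phi>_def e1 e2 e3 a1 a2 by simp
qed

end

text \<open>If the 3-form \<open>B([x, y], z)\<close> is \<open>d \<beta>\<close> on an algebra with nondegenerate Killing form \<open>K\<close>, and
  \<open>\<beta> = K(D -, -)\<close>, \<open>B = K(T -, -)\<close>, then \<open>D - T\<close> is a derivation, hence \<open>K\<close>-skew, and so is \<open>D\<close>.
  Therefore the symmetric operator \<open>T\<close> is zero.\<close>

lemma exact_3form_imp_zero:
  assumes lie: "fd_lie s br"
    and nd: "\<And>x. x \<in> s \<Longrightarrow> (\<And>y. y \<in> s \<Longrightarrow> trace_on s (\<lambda>v. br x (br y v)) = 0) \<Longrightarrow> x = 0"
    and rep: "lie_rep s br V \<rho>"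
    and \<beta>: "alt2 s \<beta>" "\<And>x y z. x \<in> s \<Longrightarrow> y \<in> s \<Longrightarrow> z \<in> s \<Longrightarrow> lie_rep.trace_form V \<rho> (br x y) z = d2 br \<beta> x y z"
    and xy: "x \<in> s" "y \<in> s"
  shows "lie_rep.trace_form V \<rho> x y = 0"
proof -
  interpret fd_lie s br by fact
  interpret r: lie_rep s br V \<rho> by fact
  interpret ad: lie_rep s br s br by (rule adjoint_rep[OF subspace order_refl closed])
  interpret k: inv_form s br ad.trace_form
    by unfold_locales (auto simp: ad.trace_form_add ad.trace_form_scale ad.trace_form_invariant
        intro: ad.trace_form_sym nd[folded ad.trace_form_def])
  let ?K = "ad.trace_form" and ?B = "r.trace_form"
  \<comment> \<open>Nondegeneracy of K turns bilinear forms into operators; the operator is written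
    down with a dual basis.\<close>
  have represent: "\<exists>F. linear F \<and> (\<forall>x\<in>s. F x \<in> s \<and> (\<forall>y\<in>s. ?K (F x) y = G x y))"
    if "\<forall>y\<in>s. lin1 s (\<lambda>x. G x y)" "\<forall>x\<in>s. lin1 s (G x)" for G
  proof -
    obtain B d where Bd: "k.dual_bases B d" using k.dual_bases_exist by blast
    have B: "finite B" "span B = s" "B \<subseteq> s" "\<And>b. b \<in> B \<Longrightarrow> d b \<in> s"
      "\<And>b c. b \<in> B \<Longrightarrow> c \<in> B \<Longrightarrow> ?K (d b) c = (if b = c then 1 else 0)"
      using Bd by (auto simp: k.dual_bases_def)
    let ?F = "\<lambda>x. \<Sum>b\<in>B. G x b *\<^sub>R d b"
    have add: "?F (u + v) = ?F u + ?F v" if "u \<in> s" "v \<in> s" for u v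
    proof -
      have "G (u + v) b = G u b + G v b" if "b \<in> B" for b
        using lin1_add[of s "\<lambda>x. G x b" u v] \<open>\<forall>y\<in>s. lin1 s (\<lambda>x. G x y)\<close> B(3) \<open>u \<in> s\<close> \<open>v \<in> s\<close> that by blast
      then show ?thesis by (simp add: sum.distrib[symmetric] scaleR_add_left cong: sum.cong)
    qed
    have scale: "?F (c *\<^sub>R v) = c *\<^sub>R ?F v" if "v \<in> s" for c v
    proof -
      have "G (c *\<^sub>R v) b = c * G v b" if "b \<in> B" for b
        using lin1_scale[of s "\<lambda>x. G x b" v c] \<open>\<forall>y\<in>s. lin1 s (\<lambda>x. G x y)\<close> B(3) \<open>v \<in> s\<close> that by blast
      then show ?thesis by (simp add: scaleR_sum_right cong: sum.cong)
    qed
    obtain F where F: "linear F" "\<And>v. v \<in> s \<Longrightarrow> F v = ?F v"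
      using linear_extension_on[of s ?F, OF subspace add scale] by blast
    have Fs: "F x \<in> s" if "x \<in> s" for x
      unfolding F(2)[OF that] using B(4) by (intro subspace_sum[OF subspace] subspace_scale[OF subspace])
    have FB: "?K (F x) c = G x c" if x: "x \<in> s" and c: "c \<in> B" for x c
    proof -
      have cs: "c \<in> s" using c B(3) by blast
      have "?K (F x) c = (\<Sum>b\<in>B. ?K (G x b *\<^sub>R d b) c)"
        unfolding F(2)[OF x] by (rule k.K_sum[OF B(1) _ cs]) (use B(4) subspace_scale[OF subspace] in blast)
      also have "\<dots> = (\<Sum>b\<in>B. if b = c then G x c else 0)"
        by (rule sum.cong) (use B(4,5) c cs k.K_scale in auto)
      finally show ?thesis using B(1) c by simp
    qed
    have "?K (F x) y = G x y" if x: "x \<in> s" and y: "y \<in> s" for x y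
    proof -
      have l: "lin1 s (G x)" using that \<open>\<forall>x\<in>s. lin1 s (G x)\<close> by blast
      have "y \<in> span B" using y B(2) by simp
      then have "?K (F x) y = G x y \<and> y \<in> s"
      proof (induction rule: span_induct_alt)
        case base
        then show ?case using k.K_zero(1)[OF Fs[OF x]] lin1_zero[OF l subspace] subspace_0[OF subspace] by simp
      next
        case (step c b y)
        have b: "b \<in> s" "c *\<^sub>R b \<in> s" using step(1) B(3) subspace_scale[OF subspace] by blast+
        have "?K (F x) (c *\<^sub>R b + y) = c * ?K (F x) b + ?K (F x) y"
          using k.K_add_right[OF Fs[OF x] b(2)] k.K_scale_right[OF Fs[OF x] b(1)] step(2) by simp
        moreover have "G x (c *\<^sub>R b + y) = c * G x b + G x y"
          using lin1_add[OF l b(2)] lin1_scale[OF l b(1)] step(2) by simp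
        ultimately show ?case using FB[OF x step(1)] step(2) b(2) subspace_add[OF subspace] by simp
      qed
      then show ?thesis by simp
    qed
    then show ?thesis using F(1) Fs by blast
  qed
  have K_eqI: "u = v" if "u \<in> s" "v \<in> s" "\<And>z. z \<in> s \<Longrightarrow> ?K u z = ?K v z" for u v
    using k.K_nondeg[of "u - v"] k.K_diff[OF that(1,2)] that subspace_diff[OF subspace] by simp
  obtain D where D: "linear D" "\<And>x. x \<in> s \<Longrightarrow> D x \<in> s" "\<And>x y. x \<in> s \<Longrightarrow> y \<in> s \<Longrightarrow> ?K (D x) y = \<beta> x y"
    using represent[of \<beta>] \<beta>(1) unfolding alt2_def by blast
  have Bl: "\<forall>y\<in>s. lin1 s (\<lambda>x. ?B x y)" using r.trace_form_add r.trace_form_scale by (simp add: lin1_def)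
  have "\<forall>x\<in>s. lin1 s (?B x)"
    using r.trace_form_add r.trace_form_scale r.trace_form_sym subspace_add[OF subspace] subspace_scale[OF subspace] by (simp add: lin1_def)
  then obtain T where T: "linear T" "\<And>x. x \<in> s \<Longrightarrow> T x \<in> s" "\<And>x y. x \<in> s \<Longrightarrow> y \<in> s \<Longrightarrow> ?K (T x) y = ?B x y"
    using represent[of ?B] Bl by blast
  \<comment> \<open>Both forms are invariant, hence \<open>T\<close> commutes with the adjoint
    action.\<close>
  have T1: "T (br x y) = br (T x) y" if "x \<in> s" "y \<in> s" for x y
  proof (rule K_eqI)
    fix z assume z: "z \<in> s"
    show "?K (T (br x y)) z = ?K (br (T x) y) z"
      using T that z closed r.trace_form_invariant[OF that z] k.K_inv[OF T(2)[OF that(1)] that(2) z] by simp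
  qed (use T(2) closed that in auto)
  have T2: "T (br x y) = br x (T y)" if "x \<in> s" "y \<in> s" for x y
    using T1[OF that(2,1)] antisym[OF that(1) T(2)[OF that(2)]] antisym[OF that] by (simp add: linear_neg[OF T(1)])
  \<comment> \<open>The equation B([x, y], z) = d \<beta> (x, y, z), expressed through
    \<open>D\<close> and \<open>T\<close> and freed of z by nondegeneracy.\<close>
  have DT: "T (br x y) = - D (br x y) + br x (D y) + br (D x) y" if xy: "x \<in> s" "y \<in> s" for x y
  proof (rule K_eqI)
    have c: "br x y \<in> s" "D (br x y) \<in> s" "br x (D y) \<in> s" "br (D x) y \<in> s" "D x \<in> s" "D y \<in> s" "br (D y) x \<in> s"
      using D(2) closed xy by simp_all
    show "- D (br x y) + br x (D y) + br (D x) y \<in> s" "T (br x y) \<in> s"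
      using c T(2) by (simp_all add: subspace_add[OF subspace] subspace_diff[OF subspace])
    fix z assume z: "z \<in> s"
    have "?K (br x (D y)) z = - ?K (br (D y) x) z"
      using antisym[OF xy(1) c(6)] k.K_minus(1)[OF c(7) z] by simp
    also have "\<dots> = - \<beta> y (br x z)" using k.K_inv[OF c(6) xy(1) z] D(3)[OF xy(2) closed[OF xy(1) z]] by simp
    also have "\<dots> = \<beta> (br x z) y" using alt2_anti[OF \<beta>(1) subspace xy(2) closed[OF xy(1) z]] by simp
    finally have 1: "?K (br x (D y)) z = \<beta> (br x z) y" .
    have "?K (br (D x) y) z = \<beta> x (br y z)" using k.K_inv[OF c(5) xy(2) z] D(3)[OF xy(1) closed[OF xy(2) z]] by simp
    also have "\<dots> = - \<beta> (br y z) x" using alt2_anti[OF \<beta>(1) subspace xy(1) closed[OF xy(2) z]] .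
    finally have 2: "?K (br (D x) y) z = - \<beta> (br y z) x" .
    have "?K (- D (br x y) + br x (D y) + br (D x) y) z = - ?K (D (br x y)) z + ?K (br x (D y)) z + ?K (br (D x) y) z"
      using k.K_add[OF _ c(4) z, of "- D (br x y) + br x (D y)"] k.K_add[OF _ c(3) z, of "- D (br x y)"] k.K_minus(1)[OF c(2) z]
        subspace_neg[OF subspace c(2)] subspace_diff[OF subspace c(3,2)] c by simp
    also have "\<dots> = d2 br \<beta> x y z" unfolding 1 2 D(3)[OF c(1) z] d2_def by simp
    also have "\<dots> = ?B (br x y) z" using \<beta>(2)[OF xy z] by simp
    finally show "?K (T (br x y)) z = ?K (- D (br x y) + br x (D y) + br (D x) y) z" using T(3)[OF c(1) z] by simp
  qed
  define E where "E x = D x - T x" for x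
  have lE: "linear E" unfolding E_def using linear_compose_sub[OF D(1) T(1)] .
  have Es: "E x \<in> s" if "x \<in> s" for x unfolding E_def using D(2) T(2) that subspace_diff[OF subspace] by blast
  have der: "E (br x y) = br (E x) y + br x (E y)" if "x \<in> s" "y \<in> s" for x y
    using DT[OF that] T1[OF that] T2[OF that] by (simp add: E_def algebra_simps)
  \<comment> \<open>Because E is a derivation, ad (E x) = [E, ad x]; so the left side is the trace
    of the commutator of E with ad x ad y.\<close>
  have skew: "?K (E x) y + ?K x (E y) = 0"
  proof -
    let ?F = "\<lambda>v. br x (br y v)"
    have lEF: "linear (\<lambda>v. E (?F v))" "linear (\<lambda>v. ?F (E v))"
      using linear_compose[OF ad.linear_rep_rep lE] linear_compose[OF lE ad.linear_rep_rep] by (simp_all add: o_def)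
    have Fs: "?F ` s \<subseteq> s" and Ei: "E ` s \<subseteq> s" using Es closed xy by blast+
    have iEF: "(\<lambda>v. E (?F v)) ` s \<subseteq> s" "(\<lambda>v. ?F (E v)) ` s \<subseteq> s" using Es closed xy by blast+
    have i: "(\<lambda>v. br (E x) (br y v)) ` s \<subseteq> s" "(\<lambda>v. br x (br (E y) v)) ` s \<subseteq> s" using Es closed xy by blast+
    have "?K (E x) y + ?K x (E y) = trace_on s (\<lambda>v. br (E x) (br y v) + br x (br (E y) v))"
      unfolding ad.trace_form_def
      by (rule trace_on_add[OF fd ad.linear_rep_rep i(1) ad.linear_rep_rep i(2), symmetric])
    also have "\<dots> = trace_on s (\<lambda>v. E (?F v) - ?F (E v))"
    proof (rule trace_on_cong[OF fd linear_compose_add[OF ad.linear_rep_rep ad.linear_rep_rep] _ linear_compose_sub[OF lEF]])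
      show "(\<lambda>v. br (E x) (br y v) + br x (br (E y) v)) ` s \<subseteq> s"
        using i by (intro image_subsetI subspace_add[OF subspace]) blast+
      show "br (E x) (br y v) + br x (br (E y) v) = E (?F v) - ?F (E v)" if "v \<in> s" for v
        using der[OF xy(1) closed[OF xy(2) that]] der[OF xy(2) that] by simp
    qed
    also have "\<dots> = 0"
      using trace_on_diff[OF fd lEF(1) iEF(1) lEF(2) iEF(2)] trace_on_comm[OF fd lE Ei ad.linear_rep_rep Fs] by simp
    finally show ?thesis .
  qed
  \<comment> \<open>In the sum with the next equation the alternating form \<beta> cancels, and -2
    B(x, y) = 0 remains.\<close>
  have "?K (E x) y = \<beta> x y - ?B x y"
    unfolding E_def using k.K_diff[OF D(2) T(2) xy(2)] xy D(3)[OF xy] T(3)[OF xy] by simp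
  moreover have "?K x (E y) = \<beta> y x - ?B y x"
    using k.K_sym[OF xy(1) Es[OF xy(2)]] k.K_diff[OF D(2) T(2) xy(1)] xy D(3)[OF xy(2,1)] T(3)[OF xy(2,1)] by (simp add: E_def)
  ultimately show ?thesis using skew alt2_anti[OF \<beta>(1) subspace xy] r.trace_form_sym[OF xy] by simp
qed

theorem (in fd_lie) solvable_if_3forms_exact:
  assumes exact: "\<And>\<phi>. alt3 g \<phi> \<Longrightarrow> (\<And>x y z w. x \<in> g \<Longrightarrow> y \<in> g \<Longrightarrow> z \<in> g \<Longrightarrow> w \<in> g \<Longrightarrow> d3 br \<phi> x y z w = 0) \<Longrightarrow>
    \<exists>\<beta>. alt2 g \<beta> \<and> (\<forall>x\<in>g. \<forall>y\<in>g. \<forall>z\<in>g. \<phi> x y z = d2 br \<beta> x y z)"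
  shows "solvable_lie br g"
proof (rule ccontr)
  assume nonsolv: "\<not> solvable_lie br g"
  interpret adg: lie_rep g br g br by (rule adjoint_rep[OF subspace order_refl closed])
  define P where "P s \<longleftrightarrow> subspace s \<and> s \<subseteq> g \<and> (\<forall>x\<in>s. \<forall>y\<in>s. br x y \<in> s) \<and> \<not> solvable_lie br s" for s
  have "P g" unfolding P_def using subspace closed nonsolv by blast
  then obtain s where s: "P s" "\<And>M. P M \<Longrightarrow> dim s \<le> dim M"
    using ex_has_least_nat[of P g dim] by blast
  have s': "subspace s" "s \<subseteq> g" "\<And>x y. x \<in> s \<Longrightarrow> y \<in> s \<Longrightarrow> br x y \<in> s" "\<not> solvable_lie br s"
    using s(1) by (auto simp: P_def)
  have fs: "finite_dimensional s" using finite_dimensional_subset[OF s'(1,2) fd] .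
  have mn: "minimal_nonsolvable br s"
    unfolding minimal_nonsolvable_def
  proof (intro conjI allI impI)
    fix M assume M: "subspace M" "M \<subset> s" "\<forall>x\<in>M. \<forall>y\<in>M. br x y \<in> M"
    then have "dim M < dim s" using finite_dimensional_dim_strict_mono fs by blast
    then have "\<not> P M" using s(2) by fastforce
    then show "solvable_lie br M" using M s'(2) by (auto simp: P_def)
  qed (rule s'(4))
  have lie: "fd_lie s br" by (rule subalgebra_fd_lie[OF s'(1-3)])
  then interpret s: fd_lie s br .
  interpret ads: lie_rep s br s br by (rule s.adjoint_rep[OF s'(1) order_refl s.closed])
  have rep: "lie_rep s br g br" by (rule adjoint_rep[OF s'(1-3)])
  then interpret r: lie_rep s br g br .
  note nd = minimal_nonsolvable_killing_nondegenerate[OF lie mn]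
  \<comment> \<open>The Killing form of g restricts to the trace form of s on g, which differs in
    general from the Killing form of s; the primitive \<beta> restricts as well.\<close>
  obtain \<beta> where \<beta>: "alt2 g \<beta>" "\<forall>x\<in>g. \<forall>y\<in>g. \<forall>z\<in>g. adg.trace_form (br x y) z = d2 br \<beta> x y z"
    using exact[OF killing_3form[OF adg.lie_rep_axioms]] by blast
  have "alt2 s \<beta>" using \<beta>(1) s'(2) unfolding alt2_def lin1_def by blast
  moreover have "r.trace_form (br x y) z = d2 br \<beta> x y z" if "x \<in> s" "y \<in> s" "z \<in> s" for x y z
    using \<beta>(2) that s'(2) unfolding r.trace_form_def adg.trace_form_def by blast
  ultimately have B0: "r.trace_form x y = 0" if "x \<in> s" "y \<in> s" for x y
    using exact_3form_imp_zero[OF lie nd rep _ _ that] by blast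
  \<comment> \<open>Cartan's criterion is applied to s acting on g. Nilpotency passes to the
    subspace s, so the Killing form of s vanishes, against its nondegeneracy.\<close>
  have "ads.trace_form z z = 0" if z: "z \<in> s" for z
  proof -
    obtain n where "\<forall>v\<in>g. (br z ^^ n) v = 0"
      using cartan_criterion[OF rep B0[unfolded r.trace_form_def] s.minimal_nonsolvable_perfect[OF mn] z] by blast
    then show ?thesis using ads.trace_form_nilpotent[OF z] s'(2) by blast
  qed
  then have "ads.trace_form y z = 0" if "y \<in> s" "z \<in> s" for y z
    using ads.trace_form_polarize that by blast
  then have "z = 0" if "z \<in> s" for z using nd[OF that] that unfolding ads.trace_form_def by blast
  then show False using s.minimal_nonsolvable_nonzero[OF mn] subspace_0[OF s'(1)] by blast
qed

section \<open>Forms on an ideal of codimension one\<close>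

lemma alt2_add:
  assumes "alt2 g f" "x \<in> g" "y \<in> g" "z \<in> g"
  shows "f (x + y) z = f x z + f y z" "f z (x + y) = f z x + f z y"
  using lin1_add[OF alt2_lin1(1)[OF assms(1,4)] assms(2,3)] lin1_add[OF alt2_lin1(2)[OF assms(1,4)] assms(2,3)] .

lemma alt2_scale:
  assumes "alt2 g f" "x \<in> g" "z \<in> g"
  shows "f (c *\<^sub>R x) z = c * f x z" "f z (c *\<^sub>R x) = c * f z x"
  using lin1_scale[OF alt2_lin1(1)[OF assms(1,3)] assms(2)] lin1_scale[OF alt2_lin1(2)[OF assms(1,3)] assms(2)] .

lemma alt3_add:
  assumes "alt3 g f" "x \<in> g" "y \<in> g" "z \<in> g" "w \<in> g"
  shows "f (x + y) z w = f x z w + f y z w" "f z (x + y) w = f z x w + f z y w" "f z w (x + y) = f z w x + f z w y"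
  using alt2_add(1)[OF alt3_alt2(2)[OF assms(1,5)] assms(2-4)] alt2_add[OF alt3_alt2(1)[OF assms(1,4)] assms(2,3,5)] .

lemma alt3_scale:
  assumes "alt3 g f" "x \<in> g" "z \<in> g" "w \<in> g"
  shows "f (c *\<^sub>R x) z w = c * f x z w" "f z (c *\<^sub>R x) w = c * f z x w" "f z w (c *\<^sub>R x) = c * f z w x"
  using alt2_scale(1)[OF alt3_alt2(2)[OF assms(1,4)] assms(2,3)] alt2_scale[OF alt3_alt2(1)[OF assms(1,3)] assms(2,4)] .

lemma alt3_same: "alt3 g f \<Longrightarrow> x \<in> g \<Longrightarrow> z \<in> g \<Longrightarrow> f x x z = 0" "alt3 g f \<Longrightarrow> x \<in> g \<Longrightarrow> z \<in> g \<Longrightarrow> f z x x = 0"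
  using alt2_same[OF alt3_alt2(2)] alt2_same[OF alt3_alt2(1)] by blast+

lemma alt3_anti:
  assumes "alt3 g f" "subspace g" "x \<in> g" "y \<in> g" "z \<in> g"
  shows "f x y z = - f y x z" "f x y z = - f x z y"
  using alt2_anti[OF alt3_alt2(2)[OF assms(1,5)] assms(2-4)] alt2_anti[OF alt3_alt2(1)[OF assms(1,3)] assms(2,4,5)] .

lemma lin1_subset: "lin1 g f \<Longrightarrow> h \<subseteq> g \<Longrightarrow> lin1 h f"
  unfolding lin1_def by blast

lemma alt2_subset: "alt2 g f \<Longrightarrow> h \<subseteq> g \<Longrightarrow> alt2 h f"
  unfolding alt2_def using lin1_subset by blast

lemma alt3_subset: "alt3 g f \<Longrightarrow> h \<subseteq> g \<Longrightarrow> alt3 h f"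
  unfolding alt3_def using alt2_subset by blast

text \<open>Lie derivatives along X in degrees 1 to 3, identified with \<open>form_action\<close> by
  \<open>form_action_form1\<close> to \<open>form_action_form3\<close>.\<close>

definition l1 :: "('a::real_vector \<Rightarrow> 'a \<Rightarrow> 'a) \<Rightarrow> 'a \<Rightarrow> ('a \<Rightarrow> real) \<Rightarrow> 'a \<Rightarrow> real"
  where "l1 br X f x = - f (br X x)"

definition l2 :: "('a::real_vector \<Rightarrow> 'a \<Rightarrow> 'a) \<Rightarrow> 'a \<Rightarrow> ('a \<Rightarrow> 'a \<Rightarrow> real) \<Rightarrow> 'a \<Rightarrow> 'a \<Rightarrow> real"
  where "l2 br X f x y = - (f (br X x) y + f x (br X y))"

definition l3 :: "('a::real_vector \<Rightarrow> 'a \<Rightarrow> 'a) \<Rightarrow> 'a \<Rightarrow> ('a \<Rightarrow> 'a \<Rightarrow> 'a \<Rightarrow> real) \<Rightarrow> 'a \<Rightarrow> 'a \<Rightarrow> 'a \<Rightarrow> real"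
  where "l3 br X f x y z = - (f (br X x) y z + f x (br X y) z + f x y (br X z))"

definition closed1 :: "('a::real_vector \<Rightarrow> 'a \<Rightarrow> 'a) \<Rightarrow> 'a set \<Rightarrow> ('a \<Rightarrow> real) \<Rightarrow> bool"
  where "closed1 br g f \<longleftrightarrow> lin1 g f \<and> (\<forall>x\<in>g. \<forall>y\<in>g. d1 br f x y = 0)"

definition closed2 :: "('a::real_vector \<Rightarrow> 'a \<Rightarrow> 'a) \<Rightarrow> 'a set \<Rightarrow> ('a \<Rightarrow> 'a \<Rightarrow> real) \<Rightarrow> bool"
  where "closed2 br g f \<longleftrightarrow> alt2 g f \<and> (\<forall>x\<in>g. \<forall>y\<in>g. \<forall>z\<in>g. d2 br f x y z = 0)"

definition closed3 :: "('a::real_vector \<Rightarrow> 'a \<Rightarrow> 'a) \<Rightarrow> 'a set \<Rightarrow> ('a \<Rightarrow> 'a \<Rightarrow> 'a \<Rightarrow> real) \<Rightarrow> bool"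
  where "closed3 br g f \<longleftrightarrow> alt3 g f \<and> (\<forall>x\<in>g. \<forall>y\<in>g. \<forall>z\<in>g. \<forall>w\<in>g. d3 br f x y z w = 0)"

definition exact2 :: "('a::real_vector \<Rightarrow> 'a \<Rightarrow> 'a) \<Rightarrow> 'a set \<Rightarrow> ('a \<Rightarrow> 'a \<Rightarrow> real) \<Rightarrow> bool"
  where "exact2 br g f \<longleftrightarrow> (\<exists>\<gamma>. lin1 g \<gamma> \<and> (\<forall>x\<in>g. \<forall>y\<in>g. f x y = d1 br \<gamma> x y))"

definition exact3 :: "('a::real_vector \<Rightarrow> 'a \<Rightarrow> 'a) \<Rightarrow> 'a set \<Rightarrow> ('a \<Rightarrow> 'a \<Rightarrow> 'a \<Rightarrow> real) \<Rightarrow> bool"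
  where "exact3 br g f \<longleftrightarrow> (\<exists>\<beta>. alt2 g \<beta> \<and> (\<forall>x\<in>g. \<forall>y\<in>g. \<forall>z\<in>g. f x y z = d2 br \<beta> x y z))"

locale lie_ideal = fd_lie g br for g :: "'a::real_vector set" and br +
  fixes k :: "'a set"
  assumes sub_k: "subspace k" and k_g: "k \<subseteq> g" and ideal_k: "x \<in> g \<Longrightarrow> y \<in> k \<Longrightarrow> br x y \<in> k"
begin

lemma k_closed: "x \<in> k \<Longrightarrow> y \<in> k \<Longrightarrow> br x y \<in> k" using ideal_k k_g by blast

lemma bracket_ideal:
  assumes "X \<in> g" "x \<in> k" "y \<in> k"
  shows "br X (br x y) = br (br X x) y + br x (br X y)"
  using bracket_bracket[of X x y] assms k_g by (simp add: subset_iff)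

lemma lin1_l1: "lin1 k f \<Longrightarrow> X \<in> g \<Longrightarrow> lin1 k (l1 br X f)"
  using lin1_add[of k f] lin1_scale[of k f] unfolding lin1_def[of k "l1 br X f"] l1_def by (simp add: ideal_k)

lemma alt2_l2: "alt2 k f \<Longrightarrow> X \<in> g \<Longrightarrow> alt2 k (l2 br X f)"
  unfolding alt2_def[of k "l2 br X f"] lin1_def l2_def
  using alt2_anti[of k f _ "br X _", OF _ sub_k]
  by (auto simp: alt2_add alt2_scale ideal_k algebra_simps)

lemma l2_d1:
  assumes "lin1 k f" "X \<in> g" "x \<in> k" "y \<in> k"
  shows "l2 br X (d1 br f) x y = d1 br (l1 br X f) x y"
  unfolding l2_def d1_def l1_def bracket_ideal[OF assms(2-4)]
  using lin1_add[OF assms(1)] assms by (simp add: k_closed ideal_k)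

lemma l3_d2:
  assumes f: "alt2 k f" and X: "X \<in> g" "x \<in> k" "y \<in> k" "z \<in> k"
  shows "l3 br X (d2 br f) x y z = d2 br (l2 br X f) x y z"
  unfolding l3_def d2_def l2_def
  using X by (simp add: bracket_ideal alt2_add[OF f] k_closed ideal_k)

lemma d2_d1:
  assumes f: "lin1 k f" and x: "x \<in> k" "y \<in> k" "z \<in> k"
  shows "d2 br (d1 br f) x y z = 0"
proof -
  have g: "x \<in> g" "y \<in> g" "z \<in> g" using x k_g by auto
  have "br (br x y) z - br (br x z) y + br (br y z) x = 0"
    using bracket_bracket[OF g] antisym[OF closed[OF g(1,3)] g(2)] antisym[OF closed[OF g(2,3)] g(1)] by simp
  then have "f (br (br x y) z - br (br x z) y + br (br y z) x) = 0" using lin1_zero[OF f sub_k] by simp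
  then show ?thesis
    unfolding d2_def d1_def
    using lin1_add[OF f subspace_diff[OF sub_k]] lin1_diff[OF f sub_k] x by (simp add: k_closed)
qed

text \<open>Cartan's formula L_X = d i_X + i_X d on a closed form, for X in k. It says that k acts
  trivially on H^2(k).\<close>

lemma l2_closed:
  assumes f: "closed2 br k f" and X: "X \<in> k" "x \<in> k" "y \<in> k"
  shows "l2 br X f x y = d1 br (f X) x y"
proof -
  have a: "alt2 k f" and "d2 br f X x y = 0" using f X by (auto simp: closed2_def)
  moreover have "f x (br X y) = - f (br X y) x" "f X (br x y) = - f (br x y) X"
    using alt2_anti[OF a sub_k] X k_closed by blast+
  ultimately show ?thesis unfolding l2_def d1_def d2_def by simp
qed

lemma closed1_l1: "closed1 br k f \<Longrightarrow> X \<in> g \<Longrightarrow> closed1 br k (l1 br X f)"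
  unfolding closed1_def using lin1_l1 l2_d1[of f X] by (simp add: l2_def ideal_k)

lemma closed2_l2: "closed2 br k f \<Longrightarrow> X \<in> g \<Longrightarrow> closed2 br k (l2 br X f)"
  unfolding closed2_def using alt2_l2 l3_d2[of f X] by (simp add: l3_def ideal_k)

end

text \<open>Interior product and restriction identify a form on \<open>g\<close> with a pair of forms on \<open>k\<close>:
  \<open>\<omega> = \<sigma> \<circ> p + \<alpha> \<and> (\<tau> \<circ> p)\<close>. In these terms \<open>d (\<sigma>, \<tau>) = (d \<sigma>, L\<^sub>A \<sigma> - d \<tau>)\<close>.\<close>

locale codim_one = lie_ideal g br k for g :: "'a::real_vector set" and br k +
  fixes A :: 'a and \<alpha> :: "'a \<Rightarrow> real" and p :: "'a \<Rightarrow> 'a"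
  assumes A: "A \<in> g" and lin_\<alpha>: "lin1 g \<alpha>" and \<alpha>_A: "\<alpha> A = 1" and \<alpha>_k: "x \<in> k \<Longrightarrow> \<alpha> x = 0"
    and p_def: "p x = x - \<alpha> x *\<^sub>R A" and p_k: "x \<in> g \<Longrightarrow> p x \<in> k"
    and bracket_k: "x \<in> g \<Longrightarrow> y \<in> g \<Longrightarrow> br x y \<in> k"
begin

lemma in_g: "x \<in> k \<Longrightarrow> x \<in> g" using k_g by blast

lemma p_id: "x \<in> k \<Longrightarrow> p x = x" by (simp add: p_def \<alpha>_k)

lemma p_A: "p A = 0" by (simp add: p_def \<alpha>_A)

lemma p_add: "x \<in> g \<Longrightarrow> y \<in> g \<Longrightarrow> p (x + y) = p x + p y"
  using lin1_add[OF lin_\<alpha>] by (simp add: p_def algebra_simps)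

lemma p_scale: "x \<in> g \<Longrightarrow> p (c *\<^sub>R x) = c *\<^sub>R p x"
  using lin1_scale[OF lin_\<alpha>] by (simp add: p_def algebra_simps)

lemma \<alpha>_add: "x \<in> g \<Longrightarrow> y \<in> g \<Longrightarrow> \<alpha> (x + y) = \<alpha> x + \<alpha> y"
  and \<alpha>_scale: "x \<in> g \<Longrightarrow> \<alpha> (c *\<^sub>R x) = c * \<alpha> x"
  using lin1_add[OF lin_\<alpha>] lin1_scale[OF lin_\<alpha>] by auto

lemma decompose: "x = p x + \<alpha> x *\<^sub>R A" by (simp add: p_def)

lemma bracket_decompose:
  assumes "x \<in> g" "y \<in> g"
  shows "br x y = br (p x) (p y) + \<alpha> x *\<^sub>R br A (p y) + (- \<alpha> y) *\<^sub>R br A (p x)"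
proof -
  have "br x y = br (p x + \<alpha> x *\<^sub>R A) (p y + \<alpha> y *\<^sub>R A)" using decompose by metis
  then show ?thesis
    using antisym[of "p x" A] p_k[OF assms(1)] in_g A alternating[OF A] by simp
qed

lemma lin1_bracket:
  assumes f: "lin1 k f" and "x \<in> g" "y \<in> g"
  shows "f (br x y) = f (br (p x) (p y)) + \<alpha> x * f (br A (p y)) - \<alpha> y * f (br A (p x))"
proof -
  have k: "br (p x) (p y) \<in> k" "br A (p x) \<in> k" "br A (p y) \<in> k"
    using bracket_k A p_k assms in_g by blast+
  show ?thesis unfolding bracket_decompose[OF assms(2,3)]
    using k by (simp add: lin1_add[OF f] lin1_diff[OF f sub_k] lin1_scale[OF f] subspace_add[OF sub_k] subspace_scale[OF sub_k])
qed

definition ext1 :: "('a \<Rightarrow> real) \<Rightarrow> 'a \<Rightarrow> real"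
  where "ext1 \<sigma> x = \<sigma> (p x)"

definition ext2 :: "('a \<Rightarrow> 'a \<Rightarrow> real) \<Rightarrow> ('a \<Rightarrow> real) \<Rightarrow> 'a \<Rightarrow> 'a \<Rightarrow> real"
  where "ext2 \<sigma> \<tau> x y = \<sigma> (p x) (p y) + \<alpha> x * \<tau> (p y) - \<alpha> y * \<tau> (p x)"

definition ext3 :: "('a \<Rightarrow> 'a \<Rightarrow> 'a \<Rightarrow> real) \<Rightarrow> ('a \<Rightarrow> 'a \<Rightarrow> real) \<Rightarrow> 'a \<Rightarrow> 'a \<Rightarrow> 'a \<Rightarrow> real"
  where "ext3 \<sigma> \<tau> x y z = \<sigma> (p x) (p y) (p z) + \<alpha> x * \<tau> (p y) (p z) - \<alpha> y * \<tau> (p x) (p z) + \<alpha> z * \<tau> (p x) (p y)"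

lemma lin1_ext1: "lin1 k \<sigma> \<Longrightarrow> lin1 g (ext1 \<sigma>)"
  using lin1_add[of k \<sigma>] lin1_scale[of k \<sigma>] unfolding lin1_def[of g] ext1_def by (simp add: p_add p_scale p_k)

lemma alt2_ext2: "alt2 k \<sigma> \<Longrightarrow> lin1 k \<tau> \<Longrightarrow> alt2 g (ext2 \<sigma> \<tau>)"
  using lin1_add[of k \<tau>] lin1_scale[of k \<tau>] unfolding alt2_def[of g] lin1_def[of g] ext2_def
  by (simp add: p_add p_scale p_k \<alpha>_add \<alpha>_scale alt2_add alt2_scale alt2_same algebra_simps)

lemma alt3_ext3:
  assumes "alt3 k \<sigma>" "alt2 k \<tau>"
  shows "alt3 g (ext3 \<sigma> \<tau>)"
  unfolding alt3_def[of g] alt2_def[of g] lin1_def[of g] ext3_def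
  by (simp add: p_add p_scale p_k \<alpha>_add \<alpha>_scale alt2_add[OF assms(2)] alt2_scale[OF assms(2)] alt2_same[OF assms(2)]
      alt3_add[OF assms(1)] alt3_scale[OF assms(1)] alt3_same[OF assms(1)] algebra_simps)

text \<open>Both f and the interior product f A are evaluated at projected arguments only, so this
  recovers f from two forms on k.\<close>

lemma alt2_eq_ext2:
  assumes f: "alt2 g f" and x: "x \<in> g" "y \<in> g"
  shows "f x y = ext2 f (f A) x y"
proof -
  have g: "p x \<in> g" "p y \<in> g" "\<alpha> x *\<^sub>R A \<in> g" "\<alpha> y *\<^sub>R A \<in> g" using p_k in_g x A subspace_scale[OF subspace] by auto
  have "f x y = f (p x + \<alpha> x *\<^sub>R A) (p y + \<alpha> y *\<^sub>R A)" using decompose by metis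
  then show ?thesis
    using alt2_anti[OF f subspace g(1) A] g A
    by (simp add: ext2_def alt2_add[OF f] alt2_scale[OF f] alt2_same[OF f] subspace_add[OF subspace])
qed

lemma alt3_eq_ext3:
  assumes f: "alt3 g f" and x: "x \<in> g" "y \<in> g" "z \<in> g"
  shows "f x y z = ext3 f (f A) x y z"
proof -
  have g: "p x \<in> g" "p y \<in> g" "p z \<in> g" using p_k in_g x by auto
  have 1: "f (p x) y z = f (p x) (p y) (p z) + \<alpha> y * f (p x) A (p z) - \<alpha> z * f (p x) A (p y)"
    using alt2_eq_ext2[OF alt3_alt2(1)[OF f g(1)] x(2,3)] by (simp add: ext2_def)
  have 2: "f A y z = f A (p y) (p z)"
    using alt2_eq_ext2[OF alt3_alt2(1)[OF f A] x(2,3)] alt3_same(1)[OF f A] g by (simp add: ext2_def)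
  have "f x y z = f (p x + \<alpha> x *\<^sub>R A) y z" using decompose by metis
  also have "\<dots> = f (p x) y z + \<alpha> x * f A y z"
    using g x A by (simp add: alt3_add[OF f] alt3_scale[OF f] subspace_scale[OF subspace])
  finally show ?thesis
    using alt3_anti(1)[OF f subspace g(1) A] g by (simp add: ext3_def 1 2)
qed

lemma d1_ext1:
  assumes "lin1 k \<sigma>" "x \<in> g" "y \<in> g"
  shows "d1 br (ext1 \<sigma>) x y = ext2 (d1 br \<sigma>) (l1 br A \<sigma>) x y"
  unfolding d1_def ext1_def ext2_def l1_def p_id[OF bracket_k[OF assms(2,3)]]
  using lin1_bracket[OF assms] by simp

lemma d2_ext2:
  assumes \<sigma>: "alt2 k \<sigma>" and \<tau>: "lin1 k \<tau>" and x: "x \<in> g" "y \<in> g" "z \<in> g"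
  shows "d2 br (ext2 \<sigma> \<tau>) x y z = ext3 (d2 br \<sigma>) (\<lambda>u v. l2 br A \<sigma> u v - d1 br \<tau> u v) x y z"
proof -
  have k: "p x \<in> k" "p y \<in> k" "p z \<in> k" using x p_k by auto
  have e: "ext2 \<sigma> \<tau> (br u v) w = \<sigma> (br u v) (p w) - \<alpha> w * \<tau> (br u v)" if "u \<in> g" "v \<in> g" for u v w
    unfolding ext2_def p_id[OF bracket_k[OF that]] \<alpha>_k[OF bracket_k[OF that]] by simp
  have s: "\<sigma> (br u v) (p w) = \<sigma> (br (p u) (p v)) (p w) + \<alpha> u * \<sigma> (br A (p v)) (p w) - \<alpha> v * \<sigma> (br A (p u)) (p w)"
    if "u \<in> g" "v \<in> g" "w \<in> g" for u v w
    using lin1_bracket[OF alt2_lin1(1)[OF \<sigma> p_k[OF that(3)]] that(1,2)] .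
  have a: "\<sigma> u (br A v) = - \<sigma> (br A v) u" if "u \<in> k" "v \<in> k" for u v
    using alt2_anti[OF \<sigma> sub_k that(1) ideal_k[OF A that(2)]] .
  show ?thesis
    unfolding d2_def ext3_def l2_def d1_def
    using x k by (simp add: e s a lin1_bracket[OF \<tau>]) (simp add: algebra_simps)
qed

text \<open>The rule d (\<sigma>, \<tau>) = (d \<sigma>, L_A \<sigma> - d \<tau>) once more; the
  4-form on the right is spelled out as d \<sigma> plus \<alpha> wedge the second component.\<close>

lemma d3_ext3:
  assumes \<sigma>: "alt3 k \<sigma>" and \<tau>: "alt2 k \<tau>" and x: "x \<in> g" "y \<in> g" "z \<in> g" "w \<in> g"
  shows "d3 br (ext3 \<sigma> \<tau>) x y z w = d3 br \<sigma> (p x) (p y) (p z) (p w)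
    + \<alpha> x * (l3 br A \<sigma> (p y) (p z) (p w) - d2 br \<tau> (p y) (p z) (p w))
    - \<alpha> y * (l3 br A \<sigma> (p x) (p z) (p w) - d2 br \<tau> (p x) (p z) (p w))
    + \<alpha> z * (l3 br A \<sigma> (p x) (p y) (p w) - d2 br \<tau> (p x) (p y) (p w))
    - \<alpha> w * (l3 br A \<sigma> (p x) (p y) (p z) - d2 br \<tau> (p x) (p y) (p z))"
proof -
  have k: "p x \<in> k" "p y \<in> k" "p z \<in> k" "p w \<in> k" using x p_k by auto
  have e: "ext3 \<sigma> \<tau> (br u v) s t = \<sigma> (br u v) (p s) (p t) - \<alpha> s * \<tau> (br u v) (p t) + \<alpha> t * \<tau> (br u v) (p s)"
    if "u \<in> g" "v \<in> g" for u v s t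
    unfolding ext3_def p_id[OF bracket_k[OF that]] \<alpha>_k[OF bracket_k[OF that]] by simp
  have s: "\<sigma> (br u v) (p s) (p t) = \<sigma> (br (p u) (p v)) (p s) (p t) + \<alpha> u * \<sigma> (br A (p v)) (p s) (p t) - \<alpha> v * \<sigma> (br A (p u)) (p s) (p t)"
    if "u \<in> g" "v \<in> g" "s \<in> g" "t \<in> g" for u v s t
    using lin1_bracket[OF alt2_lin1(1)[OF alt3_alt2(2)[OF \<sigma> p_k[OF that(4)]] p_k[OF that(3)]] that(1,2)] .
  have t: "\<tau> (br u v) (p w) = \<tau> (br (p u) (p v)) (p w) + \<alpha> u * \<tau> (br A (p v)) (p w) - \<alpha> v * \<tau> (br A (p u)) (p w)"
    if "u \<in> g" "v \<in> g" "w \<in> g" for u v w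
    using lin1_bracket[OF alt2_lin1(1)[OF \<tau> p_k[OF that(3)]] that(1,2)] .
  have a1: "\<sigma> u (br A v) w = - \<sigma> (br A v) u w" if "u \<in> k" "v \<in> k" "w \<in> k" for u v w
    using alt3_anti(1)[OF \<sigma> sub_k that(1) ideal_k[OF A that(2)] that(3)] .
  have a2: "\<sigma> u w (br A v) = \<sigma> (br A v) u w" if "u \<in> k" "v \<in> k" "w \<in> k" for u v w
    unfolding alt3_anti(2)[OF \<sigma> sub_k that(1,3) ideal_k[OF A that(2)]] a1[OF that] by simp
  show ?thesis
    unfolding d3_def l3_def d2_def
    using x k by (simp add: e s a1 a2 t) (simp add: algebra_simps)
qed

end

section \<open>Cochains as multilinear functions\<close>

definition form1 :: "'a::real_vector set \<Rightarrow> ('a \<Rightarrow> real) \<Rightarrow> 'a list \<Rightarrow> real"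
  where "form1 g f xs = (if length xs = 1 \<and> set xs \<subseteq> g then f (xs ! 0) else 0)"

definition form2 :: "'a::real_vector set \<Rightarrow> ('a \<Rightarrow> 'a \<Rightarrow> real) \<Rightarrow> 'a list \<Rightarrow> real"
  where "form2 g f xs = (if length xs = 2 \<and> set xs \<subseteq> g then f (xs ! 0) (xs ! 1) else 0)"

definition form3 :: "'a::real_vector set \<Rightarrow> ('a \<Rightarrow> 'a \<Rightarrow> 'a \<Rightarrow> real) \<Rightarrow> 'a list \<Rightarrow> real"
  where "form3 g f xs = (if length xs = 3 \<and> set xs \<subseteq> g then f (xs ! 0) (xs ! 1) (xs ! 2) else 0)"

lemma form_apply:
  "x \<in> g \<Longrightarrow> form1 g f1 [x] = f1 x"
  "x \<in> g \<Longrightarrow> y \<in> g \<Longrightarrow> form2 g f2 [x, y] = f2 x y"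
  "x \<in> g \<Longrightarrow> y \<in> g \<Longrightarrow> z \<in> g \<Longrightarrow> form3 g f3 [x, y, z] = f3 x y z"
  by (simp_all add: form1_def form2_def form3_def)

lemma length_1_conv: "length xs = 1 \<longleftrightarrow> (\<exists>x. xs = [x])"
  by (cases xs) auto

lemma length_2_conv: "length xs = 2 \<longleftrightarrow> (\<exists>x y. xs = [x, y])"
  by (auto simp: numeral_2_eq_2 length_Suc_conv)

lemma length_3_conv: "length xs = 3 \<longleftrightarrow> (\<exists>x y z. xs = [x, y, z])"
  by (auto simp: numeral_3_eq_3 length_Suc_conv)

lemma cochains_vanish: "\<omega> \<in> cochains g n \<Longrightarrow> \<not> (length xs = n \<and> set xs \<subseteq> g) \<Longrightarrow> \<omega> xs = 0"
  and cochains_add: "\<omega> \<in> cochains g n \<Longrightarrow> length xs = n \<Longrightarrow> set xs \<subseteq> g \<Longrightarrow> i < n \<Longrightarrow> u \<in> g \<Longrightarrow> v \<in> g \<Longrightarrow>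
      \<omega> (xs[i := u + v]) = \<omega> (xs[i := u]) + \<omega> (xs[i := v])"
  and cochains_scale: "\<omega> \<in> cochains g n \<Longrightarrow> length xs = n \<Longrightarrow> set xs \<subseteq> g \<Longrightarrow> i < n \<Longrightarrow> u \<in> g \<Longrightarrow>
      \<omega> (xs[i := r *\<^sub>R u]) = r * \<omega> (xs[i := u])"
  and cochains_same: "\<omega> \<in> cochains g n \<Longrightarrow> length xs = n \<Longrightarrow> set xs \<subseteq> g \<Longrightarrow> i < j \<Longrightarrow> j < n \<Longrightarrow> xs ! i = xs ! j \<Longrightarrow> \<omega> xs = 0"
  unfolding cochains_def mem_Collect_eq by (elim conjE, blast)+

lemma cochains_1:
  assumes "subspace g"
  shows "\<omega> \<in> cochains g 1 \<longleftrightarrow> (\<exists>f. lin1 g f \<and> \<omega> = form1 g f)"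
proof
  assume w: "\<omega> \<in> cochains g 1"
  have "lin1 g (\<lambda>x. \<omega> [x])"
    unfolding lin1_def
    using cochains_add[OF w, of "[x]" 0 x y for x y] cochains_scale[OF w, of "[x]" 0 x for x] by simp
  moreover have "\<omega> = form1 g (\<lambda>x. \<omega> [x])"
    using cochains_vanish[OF w] unfolding fun_eq_iff form1_def by (auto simp: length_Suc_conv)
  ultimately show "\<exists>f. lin1 g f \<and> \<omega> = form1 g f" by blast
next
  assume "\<exists>f. lin1 g f \<and> \<omega> = form1 g f"
  then obtain f where f: "lin1 g f" "\<omega> = form1 g f" by blast
  have "\<omega> (xs[i := u + v]) = \<omega> (xs[i := u]) + \<omega> (xs[i := v])"
    if "length xs = 1" "set xs \<subseteq> g" "i < 1" "u \<in> g" "v \<in> g" for xs i u v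
    using that lin1_add[OF f(1)] subspace_add[OF assms] unfolding f(2) length_1_conv by (auto simp: form1_def)
  moreover have "\<omega> (xs[i := r *\<^sub>R u]) = r * \<omega> (xs[i := u])"
    if "length xs = 1" "set xs \<subseteq> g" "i < 1" "u \<in> g" for xs i u r
    using that lin1_scale[OF f(1)] subspace_scale[OF assms] unfolding f(2) length_1_conv by (auto simp: form1_def)
  moreover have "\<omega> xs = 0" if "\<not> (length xs = 1 \<and> set xs \<subseteq> g)" for xs
    using that by (auto simp: f(2) form1_def)
  ultimately show "\<omega> \<in> cochains g 1"
    unfolding cochains_def mem_Collect_eq by (intro conjI allI impI; (elim conjE)?) auto
qed

lemma cochains_2:
  assumes "subspace g"
  shows "\<omega> \<in> cochains g 2 \<longleftrightarrow> (\<exists>f. alt2 g f \<and> \<omega> = form2 g f)"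
proof
  assume w: "\<omega> \<in> cochains g 2"
  have "alt2 g (\<lambda>x y. \<omega> [x, y])"
    unfolding alt2_def lin1_def
    using cochains_add[OF w, of "[x, y]" 0 u v for x y u v] cochains_scale[OF w, of "[x, y]" 0 u for x y u]
      cochains_add[OF w, of "[x, y]" 1 u v for x y u v] cochains_scale[OF w, of "[x, y]" 1 u for x y u]
      cochains_same[OF w, of "[x, y]" 0 1 for x y] by simp
  moreover have "\<omega> = form2 g (\<lambda>x y. \<omega> [x, y])"
    using cochains_vanish[OF w] unfolding fun_eq_iff form2_def by (auto simp: length_2_conv)
  ultimately show "\<exists>f. alt2 g f \<and> \<omega> = form2 g f" by blast
next
  assume "\<exists>f. alt2 g f \<and> \<omega> = form2 g f"
  then obtain f where f: "alt2 g f" "\<omega> = form2 g f" by blast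
  have "\<omega> (xs[i := u + v]) = \<omega> (xs[i := u]) + \<omega> (xs[i := v])"
    if xs: "length xs = 2" "set xs \<subseteq> g" "i < 2" "u \<in> g" "v \<in> g" for xs i u v
  proof -
    obtain x y where xs': "xs = [x, y]" "x \<in> g" "y \<in> g" using xs(1,2) by (auto simp: length_2_conv)
    show ?thesis using less_2_cases[OF xs(3)] xs(4,5) xs'
      by (auto simp: f(2) form2_def subspace_add[OF assms] alt2_add[OF f(1)])
  qed
  moreover have "\<omega> (xs[i := r *\<^sub>R u]) = r * \<omega> (xs[i := u])"
    if xs: "length xs = 2" "set xs \<subseteq> g" "i < 2" "u \<in> g" for xs i u r
  proof -
    obtain x y where xs': "xs = [x, y]" "x \<in> g" "y \<in> g" using xs(1,2) by (auto simp: length_2_conv)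
    show ?thesis using less_2_cases[OF xs(3)] xs(4) xs'
      by (auto simp: f(2) form2_def subspace_scale[OF assms] alt2_scale[OF f(1)])
  qed
  moreover have "\<omega> xs = 0" if xs: "length xs = 2" "set xs \<subseteq> g" "i < j" "j < 2" "xs ! i = xs ! j" for xs i j
  proof -
    obtain x y where xs': "xs = [x, y]" "x \<in> g" "y \<in> g" using xs(1,2) by (auto simp: length_2_conv)
    have "i = 0" "j = 1" using xs(3,4) by auto
    then show ?thesis using xs(5) xs' by (simp add: f(2) form2_def alt2_same[OF f(1)])
  qed
  moreover have "\<omega> xs = 0" if "\<not> (length xs = 2 \<and> set xs \<subseteq> g)" for xs
    using that by (auto simp: f(2) form2_def)
  ultimately show "\<omega> \<in> cochains g 2"
    unfolding cochains_def mem_Collect_eq by (intro conjI allI impI; (elim conjE)?) auto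
qed

lemma less_3_cases: "i < 3 \<Longrightarrow> i = 0 \<or> i = 1 \<or> i = (2::nat)" by linarith

lemma cochains_3:
  assumes "subspace g"
  shows "\<omega> \<in> cochains g 3 \<longleftrightarrow> (\<exists>f. alt3 g f \<and> \<omega> = form3 g f)"
proof
  assume w: "\<omega> \<in> cochains g 3"
  have "alt3 g (\<lambda>x y z. \<omega> [x, y, z])"
    unfolding alt3_def alt2_def lin1_def
    using cochains_add[OF w, of "[x, y, z]" 0 u v for x y z u v] cochains_scale[OF w, of "[x, y, z]" 0 u for x y z u]
      cochains_add[OF w, of "[x, y, z]" 1 u v for x y z u v] cochains_scale[OF w, of "[x, y, z]" 1 u for x y z u]
      cochains_add[OF w, of "[x, y, z]" 2 u v for x y z u v] cochains_scale[OF w, of "[x, y, z]" 2 u for x y z u]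
      cochains_same[OF w, of "[x, y, z]" 0 1 for x y z] cochains_same[OF w, of "[x, y, z]" 1 2 for x y z] by simp
  moreover have "\<omega> = form3 g (\<lambda>x y z. \<omega> [x, y, z])"
    using cochains_vanish[OF w] unfolding fun_eq_iff form3_def by (auto simp: length_3_conv)
  ultimately show "\<exists>f. alt3 g f \<and> \<omega> = form3 g f" by blast
next
  assume "\<exists>f. alt3 g f \<and> \<omega> = form3 g f"
  then obtain f where f: "alt3 g f" "\<omega> = form3 g f" by blast
  have "\<omega> (xs[i := u + v]) = \<omega> (xs[i := u]) + \<omega> (xs[i := v])"
    if xs: "length xs = 3" "set xs \<subseteq> g" "i < 3" "u \<in> g" "v \<in> g" for xs i u v
  proof -
    obtain x y z where xs': "xs = [x, y, z]" "x \<in> g" "y \<in> g" "z \<in> g" using xs(1,2) by (auto simp: length_3_conv)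
    show ?thesis using less_3_cases[OF xs(3)] xs(4,5) xs'
      by (auto simp: f(2) form3_def subspace_add[OF assms] alt3_add[OF f(1)])
  qed
  moreover have "\<omega> (xs[i := r *\<^sub>R u]) = r * \<omega> (xs[i := u])"
    if xs: "length xs = 3" "set xs \<subseteq> g" "i < 3" "u \<in> g" for xs i u r
  proof -
    obtain x y z where xs': "xs = [x, y, z]" "x \<in> g" "y \<in> g" "z \<in> g" using xs(1,2) by (auto simp: length_3_conv)
    show ?thesis using less_3_cases[OF xs(3)] xs(4) xs'
      by (auto simp: f(2) form3_def subspace_scale[OF assms] alt3_scale[OF f(1)])
  qed
  moreover have "\<omega> xs = 0" if xs: "length xs = 3" "set xs \<subseteq> g" "i < j" "j < 3" "xs ! i = xs ! j" for xs i j
  proof -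
    obtain x y z where xs': "xs = [x, y, z]" "x \<in> g" "y \<in> g" "z \<in> g" using xs(1,2) by (auto simp: length_3_conv)
    \<comment> \<open>Equal outer arguments become neighbours after one transposition.\<close>
    have f0: "f u v u = 0" if "u \<in> g" "v \<in> g" for u v
      using alt3_anti(1)[OF f(1) assms that(1,2,1)] alt3_same(2)[OF f(1) that] by simp
    have "i = 0 \<and> j = 1 \<or> i = 1 \<and> j = 2 \<or> i = 0 \<and> j = 2" using xs(3,4) by linarith
    then show ?thesis using xs(5) xs' f0 by (auto simp: f(2) form3_def alt3_same[OF f(1)])
  qed
  moreover have "\<omega> xs = 0" if "\<not> (length xs = 3 \<and> set xs \<subseteq> g)" for xs
    using that by (auto simp: f(2) form3_def)
  ultimately show "\<omega> \<in> cochains g 3"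
    unfolding cochains_def mem_Collect_eq by (intro conjI allI impI; (elim conjE)?) auto
qed

text \<open>Removing two entries and adding one bracket shortens a list by one, so only lists of
  length n + 1 lead to arguments at which \<omega> can be nonzero.\<close>

lemma ce_diff_vanish:
  assumes "\<omega> \<in> cochains h n" "length xs \<noteq> Suc n"
  shows "ce_diff br h \<omega> xs = 0"
proof -
  have "\<omega> (br (xs ! i) (xs ! j) # nths xs (- {i, j})) = 0" if "j < length xs" "i < j" for i j
  proof -
    have "{k. k < length xs \<and> k \<in> - {i, j}} = {..<length xs} - {i, j}" by auto
    then have "length (nths xs (- {i, j})) = length xs - 2"
      using that by (simp add: length_nths card_Diff_subset)
    then have "length (br (xs ! i) (xs ! j) # nths xs (- {i, j})) \<noteq> n" using assms(2) that by simp
    then show ?thesis using cochains_vanish[OF assms(1)] by blast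
  qed
  then show ?thesis by (simp add: ce_diff_def)
qed

context fd_lie
begin

lemma ce_diff_form1:
  assumes "lin1 g f"
  shows "ce_diff br g (form1 g f) = form2 g (d1 br f)"
proof
  fix xs
  have w: "form1 g f \<in> cochains g 1" using cochains_1[OF subspace] assms by blast
  show "ce_diff br g (form1 g f) xs = form2 g (d1 br f) xs"
  proof (cases "length xs = 2")
    case True
    then obtain x y where "xs = [x, y]" by (auto simp: length_2_conv)
    then show ?thesis
      by (simp add: ce_diff_def form1_def form2_def d1_def closed lessThan_Suc nths_Cons)
  next
    case False
    then show ?thesis using ce_diff_vanish[OF w, of xs br] by (simp add: form2_def)
  qed
qed

lemma ce_diff_form2:
  assumes "alt2 g f"
  shows "ce_diff br g (form2 g f) = form3 g (d2 br f)"
proof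
  fix xs
  have w: "form2 g f \<in> cochains g 2" using cochains_2[OF subspace] assms by blast
  show "ce_diff br g (form2 g f) xs = form3 g (d2 br f) xs"
  proof (cases "length xs = 3")
    case True
    then obtain x y z where "xs = [x, y, z]" by (auto simp: length_3_conv)
    then show ?thesis
      by (simp add: ce_diff_def form2_def form3_def d2_def closed lessThan_Suc nths_Cons)
  next
    case False
    then show ?thesis using ce_diff_vanish[OF w, of xs br] by (simp add: form3_def)
  qed
qed

lemma ce_diff_form3:
  assumes "alt3 g f"
  shows "ce_diff br g (form3 g f) = 0 \<longleftrightarrow> (\<forall>x\<in>g. \<forall>y\<in>g. \<forall>z\<in>g. \<forall>w\<in>g. d3 br f x y z w = 0)"
proof -
  have w: "form3 g f \<in> cochains g 3" using cochains_3[OF subspace] assms by blast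
  have e: "ce_diff br g (form3 g f) [x, y, z, w] = (if set [x, y, z, w] \<subseteq> g then d3 br f x y z w else 0)" for x y z w
    by (simp add: ce_diff_def form3_def d3_def closed lessThan_Suc nths_Cons)
  have l: "length xs = 4 \<Longrightarrow> \<exists>x y z w. xs = [x, y, z, w]" for xs :: "'a list"
    by (auto simp: numeral_eq_Suc length_Suc_conv)
  show ?thesis
  proof
    assume "ce_diff br g (form3 g f) = 0"
    then have "ce_diff br g (form3 g f) [x, y, z, w] = 0" for x y z w by simp
    moreover have "ce_diff br g (form3 g f) [x, y, z, w] = d3 br f x y z w"
      if "x \<in> g" "y \<in> g" "z \<in> g" "w \<in> g" for x y z w
      unfolding e using that by simp
    ultimately show "\<forall>x\<in>g. \<forall>y\<in>g. \<forall>z\<in>g. \<forall>w\<in>g. d3 br f x y z w = 0" by metis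
  next
    assume d: "\<forall>x\<in>g. \<forall>y\<in>g. \<forall>z\<in>g. \<forall>w\<in>g. d3 br f x y z w = 0"
    show "ce_diff br g (form3 g f) = 0"
    proof
      fix xs
      show "ce_diff br g (form3 g f) xs = 0 xs"
      proof (cases "length xs = 4")
        case True
        then obtain x y z w where "xs = [x, y, z, w]" using l by blast
        then show ?thesis using e[of x y z w] d by simp
      next
        case False
        then show ?thesis using ce_diff_vanish[OF w, of xs br] by simp
      qed
    qed
  qed
qed

lemma cocycles_1: "\<omega> \<in> cocycles br g 1 \<longleftrightarrow> (\<exists>f. closed1 br g f \<and> \<omega> = form1 g f)"
proof -
  have "form2 g (d1 br f) = 0 \<longleftrightarrow> (\<forall>x\<in>g. \<forall>y\<in>g. d1 br f x y = 0)" for f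
  proof
    assume "form2 g (d1 br f) = 0"
    then have "form2 g (d1 br f) [x, y] = 0" for x y by simp
    then show "\<forall>x\<in>g. \<forall>y\<in>g. d1 br f x y = 0" using form_apply(2) by metis
  qed (auto simp: form2_def fun_eq_iff length_2_conv)
  then show ?thesis unfolding cocycles_def closed1_def using cochains_1[OF subspace, of \<omega>] ce_diff_form1 by auto
qed

lemma cocycles_2: "\<omega> \<in> cocycles br g 2 \<longleftrightarrow> (\<exists>f. closed2 br g f \<and> \<omega> = form2 g f)"
proof -
  have "form3 g (d2 br f) = 0 \<longleftrightarrow> (\<forall>x\<in>g. \<forall>y\<in>g. \<forall>z\<in>g. d2 br f x y z = 0)" for f
  proof
    assume "form3 g (d2 br f) = 0"
    then have "form3 g (d2 br f) [x, y, z] = 0" for x y z by simp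
    then show "\<forall>x\<in>g. \<forall>y\<in>g. \<forall>z\<in>g. d2 br f x y z = 0" using form_apply(3) by metis
  qed (auto simp: form3_def fun_eq_iff length_3_conv)
  then show ?thesis unfolding cocycles_def closed2_def using cochains_2[OF subspace, of \<omega>] ce_diff_form2 by auto
qed

lemma cocycles_3: "\<omega> \<in> cocycles br g 3 \<longleftrightarrow> (\<exists>f. closed3 br g f \<and> \<omega> = form3 g f)"
  unfolding cocycles_def closed3_def using cochains_3[OF subspace, of \<omega>] ce_diff_form3 by auto

text \<open>A 0-cochain vanishes on nonempty lists, and every list that occurs in the differential
  starts with a bracket. So in degree 1 classes are the same as closed forms.\<close>

lemma coboundaries_1: "coboundaries br g 1 = {0}"
proof -
  have "ce_diff br g \<omega> = 0" if "\<omega> \<in> cochains g 0" for \<omega>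
  proof
    fix xs show "ce_diff br g \<omega> xs = 0 xs"
      using cochains_vanish[OF that] by (simp add: ce_diff_def)
  qed
  moreover have "0 \<in> cochains g 0" by (simp add: cochains_def)
  ultimately show ?thesis by auto
qed

lemma form2_eq_iff: "form2 g f = form2 g h \<longleftrightarrow> (\<forall>x\<in>g. \<forall>y\<in>g. f x y = h x y)"
proof
  assume e: "form2 g f = form2 g h"
  show "\<forall>x\<in>g. \<forall>y\<in>g. f x y = h x y"
  proof (intro ballI)
    fix x y assume "x \<in> g" "y \<in> g"
    then show "f x y = h x y" using fun_cong[OF e, of "[x, y]"] by (simp add: form2_def)
  qed
qed (auto simp: form2_def fun_eq_iff length_2_conv)

lemma form3_eq_iff: "form3 g f = form3 g h \<longleftrightarrow> (\<forall>x\<in>g. \<forall>y\<in>g. \<forall>z\<in>g. f x y z = h x y z)"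
proof
  assume e: "form3 g f = form3 g h"
  show "\<forall>x\<in>g. \<forall>y\<in>g. \<forall>z\<in>g. f x y z = h x y z"
  proof (intro ballI)
    fix x y z assume "x \<in> g" "y \<in> g" "z \<in> g"
    then show "f x y z = h x y z" using fun_cong[OF e, of "[x, y, z]"] by (simp add: form3_def)
  qed
qed (auto simp: form3_def fun_eq_iff length_3_conv)

lemma form1_eq_iff: "form1 g f = form1 g h \<longleftrightarrow> (\<forall>x\<in>g. f x = h x)"
proof
  assume e: "form1 g f = form1 g h"
  show "\<forall>x\<in>g. f x = h x"
  proof (intro ballI)
    fix x assume "x \<in> g"
    then show "f x = h x" using fun_cong[OF e, of "[x]"] by (simp add: form1_def)
  qed
qed (auto simp: form1_def fun_eq_iff length_Suc_conv)

lemma form1_in_coboundaries: "form1 g f \<in> coboundaries br g 1 \<longleftrightarrow> (\<forall>x\<in>g. f x = 0)"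
proof -
  have "(0 :: 'a list \<Rightarrow> real) = form1 g (\<lambda>x. 0)" by (simp add: form1_def fun_eq_iff)
  then have "form1 g f = 0 \<longleftrightarrow> (\<forall>x\<in>g. f x = 0)" using form1_eq_iff[of f "\<lambda>x. 0"] by metis
  then show ?thesis unfolding coboundaries_1 by simp
qed

lemma form2_in_coboundaries: "form2 g f \<in> coboundaries br g 2 \<longleftrightarrow> exact2 br g f"
proof -
  have c: "coboundaries br g 2 = ce_diff br g ` cochains g 1" by (simp add: numeral_2_eq_2)
  show ?thesis
    unfolding c exact2_def image_iff Bex_def cochains_1[OF subspace]
    using ce_diff_form1 form2_eq_iff by metis
qed

lemma form3_in_coboundaries: "form3 g f \<in> coboundaries br g 3 \<longleftrightarrow> exact3 br g f"
proof -
  have c: "coboundaries br g 3 = ce_diff br g ` cochains g 2" by (simp add: numeral_3_eq_3 numeral_2_eq_2)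
  show ?thesis
    unfolding c exact3_def image_iff Bex_def cochains_2[OF subspace]
    using ce_diff_form2 form3_eq_iff by metis
qed

end

section \<open>Finite dimension of the cochain spaces and vanishing of Betti numbers\<close>

lemma subspace_cochains: "subspace (cochains h n)"
  unfolding subspace_def cochains_def by (auto simp: scaleR_fun_def algebra_simps)

lemma linear_ce_diff: "linear (ce_diff br h)"
  by (rule linearI)
    (auto simp: ce_diff_def fun_eq_iff scaleR_fun_def sum.distrib algebra_simps sum_distrib_left)

lemma subspace_cocycles: "subspace (cocycles br h n)"
  unfolding cocycles_def subspace_def
  using subspace_0[OF subspace_cochains, of h n] subspace_add[OF subspace_cochains, of _ h n] subspace_scale[OF subspace_cochains, of _ h n]
  by (simp add: linear_0[OF linear_ce_diff] linear_add[OF linear_ce_diff] linear_scale[OF linear_ce_diff])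

lemma subspace_coboundaries: "subspace (coboundaries br h n)"
  by (cases n) (simp_all add: subspace_single_0 linear_subspace_image[OF linear_ce_diff subspace_cochains])

lemma linear_form_action: "linear (form_action br h X)"
  by (rule linearI)
    (auto simp: form_action_def fun_eq_iff scaleR_fun_def sum.distrib algebra_simps sum_distrib_left)

text \<open>Restriction to the finite set I is injective on Z and lands in the span of finitely many
  indicator functions; a linear left inverse carries finite dimension back to Z.\<close>

lemma finite_dimensional_restriction:
  fixes Z :: "('b \<Rightarrow> real) set"
  assumes "subspace Z" "finite I" "\<And>\<omega>. \<omega> \<in> Z \<Longrightarrow> (\<And>i. i \<in> I \<Longrightarrow> \<omega> i = 0) \<Longrightarrow> \<omega> = 0"
  shows "finite_dimensional Z"
proof -
  define R :: "('b \<Rightarrow> real) \<Rightarrow> 'b \<Rightarrow> real" where "R \<omega> = (\<lambda>i. if i \<in> I then \<omega> i else 0)" for \<omega>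
  define e :: "'b \<Rightarrow> 'b \<Rightarrow> real" where "e j = (\<lambda>i. if i = j then 1 else 0)" for j
  have lR: "linear R" by (rule linearI) (auto simp: R_def fun_eq_iff scaleR_fun_def)
  have "R \<omega> \<in> span (e ` I)" for \<omega>
  proof -
    have "(\<Sum>j\<in>I. \<omega> j *\<^sub>R e j) i = (\<Sum>j\<in>I. if j = i then \<omega> i else 0)" for i
      using assms(2) by (induction I rule: finite_induct) (auto simp: scaleR_fun_def e_def)
    then have "R \<omega> = (\<Sum>j\<in>I. \<omega> j *\<^sub>R e j)" using assms(2) by (simp add: R_def fun_eq_iff)
    also have "\<dots> \<in> span (e ` I)" by (intro span_sum span_scale span_base) blast
    finally show ?thesis .
  qed
  then have "R ` Z \<subseteq> span (e ` I)" by blast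
  moreover have "finite_dimensional (span (e ` I))" unfolding finite_dimensional_def using assms(2) by blast
  ultimately have fd: "finite_dimensional (R ` Z)"
    using finite_dimensional_subset linear_subspace_image[OF lR assms(1)] by blast
  have "inj_on R Z"
  proof (subst linear_inj_on_iff_eq_0[OF lR assms(1)], intro ballI impI)
    fix \<omega> assume w: "\<omega> \<in> Z" "R \<omega> = 0"
    have "\<omega> i = 0" if "i \<in> I" for i using fun_cong[OF w(2), of i] that by (simp add: R_def)
    then show "\<omega> = 0" using assms(3) w(1) by blast
  qed
  then obtain h where h: "linear h" "\<forall>v\<in>Z. h (R v) = v"
    using linear_exists_left_inverse_on[OF lR assms(1)] by blast
  have "h ` R ` Z = Z" using h(2) by (auto simp: image_image)
  then show ?thesis using finite_dimensional_image[OF h(1) fd] by simp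
qed

lemma lin1_zero_on_span:
  assumes "lin1 g f" "subspace g" "span B = g" "\<And>b. b \<in> B \<Longrightarrow> f b = 0" "x \<in> g"
  shows "f x = 0"
proof -
  have "x \<in> span B" using assms by simp
  then have "f x = 0 \<and> x \<in> g"
  proof (induction rule: span_induct_alt)
    case base
    then show ?case using lin1_zero[OF assms(1,2)] subspace_0[OF assms(2)] by simp
  next
    case (step c b y)
    have b: "b \<in> g" "c *\<^sub>R b \<in> g" using step(1) assms(2,3) span_base[of b B] subspace_scale by auto
    then show ?case
      using step lin1_add[OF assms(1) b(2)] lin1_scale[OF assms(1) b(1)] assms(4) subspace_add[OF assms(2)] by simp
  qed
  then show ?thesis by simp
qed

context fd_lie
begin

text \<open>A form is determined by its values on lists of vectors from a finite spanning set:
  vanishing there is carried over to all of g one argument at a time.\<close>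

lemma finite_dimensional_cochains:
  assumes "n = 1 \<or> n = 2 \<or> n = 3"
  shows "finite_dimensional (cochains g n)"
proof -
  obtain B where B: "finite B" "span B = g" using fd by (auto simp: finite_dimensional_def)
  have Bg: "B \<subseteq> g" using B(2) span_superset[of B] by simp
  note z = lin1_zero_on_span[OF _ subspace B(2)]
  let ?I = "{xs. set xs \<subseteq> B \<and> length xs = n}"
  show ?thesis
  proof (rule finite_dimensional_restriction[OF subspace_cochains])
    show "finite ?I" using finite_lists_length_eq[OF B(1)] .
    fix \<omega> assume w: "\<omega> \<in> cochains g n" and 0: "\<And>xs. xs \<in> ?I \<Longrightarrow> \<omega> xs = 0"
    consider "n = 1" | "n = 2" | "n = 3" using assms by blast
    then show "\<omega> = 0"
    proof cases
      case 1
      then obtain f where f: "lin1 g f" "\<omega> = form1 g f" using w cochains_1[OF subspace] by blast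
      have "f b = 0" if "b \<in> B" for b using 0[of "[b]"] 1 that form_apply(1)[OF subsetD[OF Bg]] by (simp add: f(2))
      then have "f x = 0" if "x \<in> g" for x using z[OF f(1) _ that] by blast
      then show ?thesis by (auto simp: f(2) form1_def fun_eq_iff length_Suc_conv)
    next
      case 2
      then obtain f where f: "alt2 g f" "\<omega> = form2 g f" using w cochains_2[OF subspace] by blast
      have "f b c = 0" if "b \<in> B" "c \<in> B" for b c
        using 0[of "[b, c]"] 2 that form_apply(2)[OF subsetD[OF Bg] subsetD[OF Bg]] by (simp add: f(2))
      then have "f b x = 0" if "b \<in> B" "x \<in> g" for b x
        using z[OF alt2_lin1(2)[OF f(1), of b] _ that(2)] that(1) Bg by blast
      then have "f y x = 0" if "y \<in> g" "x \<in> g" for y x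
        using z[OF alt2_lin1(1)[OF f(1) that(2)] _ that(1)] that(2) by blast
      then show ?thesis by (auto simp: f(2) form2_def fun_eq_iff length_2_conv)
    next
      case 3
      then obtain f where f: "alt3 g f" "\<omega> = form3 g f" using w cochains_3[OF subspace] by blast
      have "f b c e = 0" if "b \<in> B" "c \<in> B" "e \<in> B" for b c e
        using 0[of "[b, c, e]"] 3 that form_apply(3)[OF subsetD[OF Bg] subsetD[OF Bg] subsetD[OF Bg]] by (simp add: f(2))
      then have "f b c x = 0" if "b \<in> B" "c \<in> B" "x \<in> g" for b c x
        using z[OF alt2_lin1(2)[OF alt3_alt2(1)[OF f(1)], of b c] _ that(3)] that(1,2) Bg by blast
      then have "f b y x = 0" if "b \<in> B" "y \<in> g" "x \<in> g" for b y x
        using z[OF alt2_lin1(1)[OF alt3_alt2(1)[OF f(1)], of b x] _ that(2)] that(1,3) Bg by blast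
      then have "f u y x = 0" if "u \<in> g" "y \<in> g" "x \<in> g" for u y x
        using z[OF alt2_lin1(1)[OF alt3_alt2(2)[OF f(1) that(3)] that(2)] _ that(1)] that(2,3) by blast
      then show ?thesis by (auto simp: f(2) form3_def fun_eq_iff length_3_conv)
    qed
  qed
qed

lemma finite_dimensional_cocycles:
  assumes "n = 1 \<or> n = 2 \<or> n = 3"
  shows "finite_dimensional (cocycles br g n)"
  using finite_dimensional_subset[OF subspace_cocycles _ finite_dimensional_cochains[OF assms]]
  by (auto simp: cocycles_def)

end

lemma affine_coset_eq_iff:
  assumes "subspace W"
  shows "affine_coset W u = affine_coset W v \<longleftrightarrow> u - v \<in> W"
proof
  assume "affine_coset W u = affine_coset W v"
  then have "u \<in> affine_coset W v" using subspace_0[OF assms] by (force simp: affine_coset_def)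
  then show "u - v \<in> W" by (auto simp: affine_coset_def)
next
  assume uv: "u - v \<in> W"
  have "affine_coset W a \<subseteq> affine_coset W b" if "a - b \<in> W" for a b
  proof
    fix x assume "x \<in> affine_coset W a"
    then obtain w where w: "w \<in> W" "x = a + w" by (auto simp: affine_coset_def)
    have "x = b + ((a - b) + w)" using w(2) by simp
    then show "x \<in> affine_coset W b" using subspace_add[OF assms that w(1)] unfolding affine_coset_def by blast
  qed
  moreover have "v - u \<in> W" using subspace_neg[OF assms uv] by simp
  ultimately show "affine_coset W u = affine_coset W v" using uv by blast
qed

text \<open>A spanning set of size 0 means that every coset is the zero coset. Finite dimension of V
  ensures that some size qualifies, so that the value of \<open>LEAST\<close> is attained.\<close>

lemma quotient_dim_eq_0_iff:
  assumes "finite_dimensional V" "subspace W"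
  shows "quotient_dim V W = 0 \<longleftrightarrow> V \<subseteq> W"
proof -
  let ?P = "\<lambda>n. \<exists>S. S \<subseteq> V \<and> finite S \<and> card S = n \<and> affine_coset W ` span S = quotient_space V W"
  have sV: "subspace V" using finite_dimensional_imp_subspace[OF assms(1)] .
  have P0: "?P 0 \<longleftrightarrow> V \<subseteq> W"
  proof
    assume "?P 0"
    then have "affine_coset W ` {0} = affine_coset W ` V" unfolding quotient_space_def by force
    then have "affine_coset W v = affine_coset W 0" if "v \<in> V" for v using that by blast
    then show "V \<subseteq> W" using affine_coset_eq_iff[OF assms(2)] by auto
  next
    assume "V \<subseteq> W"
    then have "affine_coset W v = affine_coset W 0" if "v \<in> V" for v
      using affine_coset_eq_iff[OF assms(2)] that by auto
    then have "affine_coset W ` {0} = affine_coset W ` V" using subspace_0[OF sV] by blast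
    then show "?P 0" by (intro exI[of _ "{}"]) (simp add: quotient_space_def)
  qed
  obtain S where S: "finite S" "span S = V" using assms(1) by (auto simp: finite_dimensional_def)
  have "?P (card S)" using S span_superset[of S] by (auto simp: quotient_space_def)
  then have "?P (LEAST n. ?P n)" by (rule LeastI)
  moreover have "?P 0 \<Longrightarrow> (LEAST n. ?P n) = 0" by (rule Least_eq_0)
  ultimately show ?thesis unfolding quotient_dim_def P0[symmetric] by metis
qed

context fd_lie
begin

lemma betti_2_eq_0: "betti br g 2 = 0 \<longleftrightarrow> (\<forall>f. closed2 br g f \<longrightarrow> exact2 br g f)"
proof -
  have "betti br g 2 = 0 \<longleftrightarrow> cocycles br g 2 \<subseteq> coboundaries br g 2"
    unfolding betti_def by (rule quotient_dim_eq_0_iff) (simp_all add: finite_dimensional_cocycles subspace_coboundaries del: coboundaries.simps)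
  then show ?thesis using cocycles_2 form2_in_coboundaries by (auto simp del: coboundaries.simps)
qed

lemma betti_3_eq_0: "betti br g 3 = 0 \<longleftrightarrow> (\<forall>f. closed3 br g f \<longrightarrow> exact3 br g f)"
proof -
  have "betti br g 3 = 0 \<longleftrightarrow> cocycles br g 3 \<subseteq> coboundaries br g 3"
    unfolding betti_def by (rule quotient_dim_eq_0_iff) (simp_all add: finite_dimensional_cocycles subspace_coboundaries del: coboundaries.simps)
  then show ?thesis using cocycles_3 form3_in_coboundaries by (auto simp del: coboundaries.simps)
qed

end

text \<open>Passage from classes to representatives. Because coboundaries are preserved by the
  action, a class is killed by X as soon as the Lie derivative of one representative is a
  coboundary.\<close>

lemma invariant_cohomology_trivial_iff:
  assumes inv: "\<And>X \<omega>. X \<in> g \<Longrightarrow> \<omega> \<in> coboundaries br k n \<Longrightarrow> form_action br k X \<omega> \<in> coboundaries br k n"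
  shows "invariant_cohomology br g k n = {null_class br k n} \<longleftrightarrow>
    (\<forall>\<omega>\<in>cocycles br k n. (\<forall>X\<in>g. form_action br k X \<omega> \<in> coboundaries br k n) \<longrightarrow> \<omega> \<in> coboundaries br k n)"
proof -
  let ?B = "coboundaries br k n" and ?L = "form_action br k"
  note sB = subspace_coboundaries[of br k n]
  have null: "null_class br k n = ?B" by (simp add: null_class_def affine_coset_def)
  have coset_B: "affine_coset ?B \<omega> = ?B \<longleftrightarrow> \<omega> \<in> ?B" for \<omega>
    using affine_coset_eq_iff[OF sB, of \<omega> 0] by (simp add: affine_coset_def)
  have self: "\<omega> \<in> affine_coset ?B \<omega>" for \<omega>
    using subspace_0[OF sB] by (force simp: affine_coset_def)
  have act: "class_action br k n X (affine_coset ?B \<omega>) = ?B \<longleftrightarrow> ?L X \<omega> \<in> ?B" if "X \<in> g" for X \<omega>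
  proof
    assume "class_action br k n X (affine_coset ?B \<omega>) = ?B"
    then show "?L X \<omega> \<in> ?B" using self[of \<omega>] self[of "?L X \<omega>"] unfolding class_action_def by blast
  next
    assume l: "?L X \<omega> \<in> ?B"
    have "affine_coset ?B (?L X \<eta>) = ?B" if "\<eta> \<in> affine_coset ?B \<omega>" for \<eta>
    proof -
      obtain b where b: "b \<in> ?B" "\<eta> = \<omega> + b" using \<open>\<eta> \<in> affine_coset ?B \<omega>\<close> by (auto simp: affine_coset_def)
      have "?L X \<eta> = ?L X \<omega> + ?L X b" unfolding b(2) by (rule linear_add[OF linear_form_action])
      then show ?thesis using coset_B l inv[OF \<open>X \<in> g\<close> b(1)] subspace_add[OF sB] by simp
    qed
    then show "class_action br k n X (affine_coset ?B \<omega>) = ?B"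
      unfolding class_action_def using self[of \<omega>] by blast
  qed
  have mem: "c \<in> invariant_cohomology br g k n \<longleftrightarrow>
      (\<exists>\<omega>\<in>cocycles br k n. c = affine_coset ?B \<omega> \<and> (\<forall>X\<in>g. ?L X \<omega> \<in> ?B))" for c
    unfolding invariant_cohomology_def cohomology_def quotient_space_def null using act by auto
  have "?B \<in> invariant_cohomology br g k n"
    unfolding mem
  proof (intro bexI conjI ballI)
    show "0 \<in> cocycles br k n" by (rule subspace_0[OF subspace_cocycles])
    show "?B = affine_coset ?B 0" using coset_B[of 0] subspace_0[OF sB] by simp
    show "?L X 0 \<in> ?B" for X unfolding linear_0[OF linear_form_action] by (rule subspace_0[OF sB])
  qed
  then have "invariant_cohomology br g k n = {?B} \<longleftrightarrow> (\<forall>c\<in>invariant_cohomology br g k n. c = ?B)" by blast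
  also have "\<dots> \<longleftrightarrow> (\<forall>\<omega>\<in>cocycles br k n. (\<forall>X\<in>g. ?L X \<omega> \<in> ?B) \<longrightarrow> \<omega> \<in> ?B)"
  proof (intro iffI ballI impI)
    fix \<omega> assume *: "\<forall>c\<in>invariant_cohomology br g k n. c = ?B"
      and w: "\<omega> \<in> cocycles br k n" "\<forall>X\<in>g. ?L X \<omega> \<in> ?B"
    have "affine_coset ?B \<omega> \<in> invariant_cohomology br g k n" unfolding mem using w by (intro bexI[of _ \<omega>]) auto
    then have "affine_coset ?B \<omega> = ?B" using * by (rule bspec[rotated])
    then show "\<omega> \<in> ?B" unfolding coset_B .
  next
    fix c assume *: "\<forall>\<omega>\<in>cocycles br k n. (\<forall>X\<in>g. ?L X \<omega> \<in> ?B) \<longrightarrow> \<omega> \<in> ?B" and "c \<in> invariant_cohomology br g k n"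
    then obtain \<omega> where "\<omega> \<in> cocycles br k n" "c = affine_coset ?B \<omega>" "\<forall>X\<in>g. ?L X \<omega> \<in> ?B" unfolding mem by (elim bexE conjE)
    then show "c = ?B" using * coset_B by metis
  qed
  finally show ?thesis unfolding null .
qed

section \<open>Invariant cohomology\<close>

lemma closed1D: "closed1 br g f \<Longrightarrow> lin1 g f" "closed1 br g f \<Longrightarrow> x \<in> g \<Longrightarrow> y \<in> g \<Longrightarrow> d1 br f x y = 0"
  by (auto simp: closed1_def)

lemma closed2D: "closed2 br g f \<Longrightarrow> alt2 g f" "closed2 br g f \<Longrightarrow> x \<in> g \<Longrightarrow> y \<in> g \<Longrightarrow> z \<in> g \<Longrightarrow> d2 br f x y z = 0"
  by (auto simp: closed2_def)

lemma closed3D: "closed3 br g f \<Longrightarrow> alt3 g f"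
  "closed3 br g f \<Longrightarrow> x \<in> g \<Longrightarrow> y \<in> g \<Longrightarrow> z \<in> g \<Longrightarrow> w \<in> g \<Longrightarrow> d3 br f x y z w = 0"
  by (auto simp: closed3_def)

text \<open>Finite dimension turns injectivity modulo B into surjectivity modulo B. The quotient Z/B
  is modelled by a complement \<open>U\<close>, on which p after L is injective.\<close>

lemma surjective_modulo:
  assumes "finite_dimensional Z" "subspace B" "B \<subseteq> Z" "linear L" "L ` Z \<subseteq> Z"
    "\<And>z. z \<in> Z \<Longrightarrow> L z \<in> B \<Longrightarrow> z \<in> B" "z \<in> Z"
  shows "\<exists>w\<in>Z. z - L w \<in> B"
proof -
  have sZ: "subspace Z" using finite_dimensional_imp_subspace[OF assms(1)] .
  obtain U p where U: "subspace U" "U \<subseteq> Z" "linear p" "\<And>w. w \<in> B \<Longrightarrow> p w = 0"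
      "\<And>u. u \<in> U \<Longrightarrow> p u = u" "\<And>v. v \<in> Z \<Longrightarrow> p v \<in> U" "\<And>v. v \<in> Z \<Longrightarrow> v - p v \<in> B"
    by (rule complement_projection[OF assms(2,3) sZ]) blast
  have LZ: "L u \<in> Z" if "u \<in> U" for u using that U(2) assms(5) by blast
  have l: "linear (\<lambda>u. p (L u))" using linear_compose[OF assms(4) U(3)] by (simp add: o_def)
  have "(\<lambda>u. p (L u)) ` U = U"
  proof (rule linear_inj_imp_surj_on[OF l finite_dimensional_subset[OF U(1,2) assms(1)]])
    show "(\<lambda>u. p (L u)) ` U \<subseteq> U" using LZ U(6) by blast
    fix u assume u: "u \<in> U" "p (L u) = 0"
    then have "L u \<in> B" using U(7)[OF LZ[OF u(1)]] by simp
    then have "u \<in> B" using assms(6) u(1) U(2) by blast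
    then show "u = 0" using U(4,5) u(1) by metis
  qed
  then obtain u where u: "u \<in> U" "p (L u) = p z" using U(6)[OF assms(7)] by (metis imageE)
  have uZ: "u \<in> Z" using u(1) U(2) by blast
  have d: "z - L u \<in> Z" using subspace_diff[OF sZ assms(7) LZ[OF u(1)]] .
  have "p (z - L u) = 0" using u(2) by (simp add: linear_diff[OF U(3)])
  then have "z - L u \<in> B" using U(7)[OF d] by simp
  then show ?thesis using uZ by blast
qed

context lie_ideal
begin

lemma k_fd_lie: "fd_lie k br"
  by (rule subalgebra_fd_lie[OF sub_k k_g k_closed])

lemma form_action_form1: "X \<in> g \<Longrightarrow> form_action br k X (form1 k f) = form1 k (l1 br X f)"
  by (auto simp: fun_eq_iff form_action_def form1_def l1_def length_Suc_conv ideal_k)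

lemma form_action_form2:
  assumes "X \<in> g"
  shows "form_action br k X (form2 k f) = form2 k (l2 br X f)"
proof
  fix xs
  show "form_action br k X (form2 k f) xs = form2 k (l2 br X f) xs"
  proof (cases "length xs = 2 \<and> set xs \<subseteq> k")
    case True
    then obtain x y where "xs = [x, y]" "x \<in> k" "y \<in> k" by (auto simp: length_2_conv)
    then show ?thesis using assms by (simp add: form_action_def form2_def l2_def ideal_k lessThan_Suc)
  qed (auto simp: form_action_def form2_def)
qed

lemma form_action_form3:
  assumes "X \<in> g"
  shows "form_action br k X (form3 k f) = form3 k (l3 br X f)"
proof
  fix xs
  show "form_action br k X (form3 k f) xs = form3 k (l3 br X f) xs"
  proof (cases "length xs = 3 \<and> set xs \<subseteq> k")
    case True
    then obtain x y z where "xs = [x, y, z]" "x \<in> k" "y \<in> k" "z \<in> k" by (auto simp: length_3_conv)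
    then show ?thesis using assms by (simp add: form_action_def form3_def l3_def ideal_k lessThan_Suc)
  qed (auto simp: form_action_def form3_def)
qed

lemma exact2_l2:
  assumes "exact2 br k f" "X \<in> g"
  shows "exact2 br k (l2 br X f)"
proof -
  obtain \<gamma> where \<gamma>: "lin1 k \<gamma>" "\<And>x y. x \<in> k \<Longrightarrow> y \<in> k \<Longrightarrow> f x y = d1 br \<gamma> x y"
    using assms(1) by (auto simp: exact2_def)
  have "l2 br X f x y = d1 br (l1 br X \<gamma>) x y" if "x \<in> k" "y \<in> k" for x y
    using l2_d1[OF \<gamma>(1) assms(2) that] that \<gamma>(2) ideal_k[OF assms(2)] by (simp add: l2_def)
  then show ?thesis unfolding exact2_def using lin1_l1[OF \<gamma>(1) assms(2)] by blast
qed

lemma exact3_l3: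
  assumes "exact3 br k f" "X \<in> g"
  shows "exact3 br k (l3 br X f)"
proof -
  obtain \<beta> where \<beta>: "alt2 k \<beta>" "\<And>x y z. x \<in> k \<Longrightarrow> y \<in> k \<Longrightarrow> z \<in> k \<Longrightarrow> f x y z = d2 br \<beta> x y z"
    using assms(1) by (auto simp: exact3_def)
  have "l3 br X f x y z = d2 br (l2 br X \<beta>) x y z" if "x \<in> k" "y \<in> k" "z \<in> k" for x y z
    using l3_d2[OF \<beta>(1) assms(2) that] that \<beta>(2) ideal_k[OF assms(2)] by (simp add: l3_def)
  then show ?thesis unfolding exact3_def using alt2_l2[OF \<beta>(1) assms(2)] by blast
qed

lemma invariant_cohomology_1:
  "invariant_cohomology br g k 1 = {null_class br k 1} \<longleftrightarrow>
    (\<forall>f. closed1 br k f \<longrightarrow> (\<forall>X\<in>g. \<forall>x\<in>k. l1 br X f x = 0) \<longrightarrow> (\<forall>x\<in>k. f x = 0))"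
proof -
  interpret k: fd_lie k br by (rule k_fd_lie)
  have "invariant_cohomology br g k 1 = {null_class br k 1} \<longleftrightarrow>
    (\<forall>\<omega>\<in>cocycles br k 1. (\<forall>X\<in>g. form_action br k X \<omega> \<in> coboundaries br k 1) \<longrightarrow> \<omega> \<in> coboundaries br k 1)"
    by (rule invariant_cohomology_trivial_iff) (simp only: k.coboundaries_1 singleton_iff linear_0[OF linear_form_action])
  also have "\<dots> \<longleftrightarrow> (\<forall>f. closed1 br k f \<longrightarrow> (\<forall>X\<in>g. form_action br k X (form1 k f) \<in> coboundaries br k 1) \<longrightarrow> form1 k f \<in> coboundaries br k 1)"
    unfolding Ball_def[of "cocycles br k 1"] k.cocycles_1 by blast
  also have "\<dots> \<longleftrightarrow> (\<forall>f. closed1 br k f \<longrightarrow> (\<forall>X\<in>g. \<forall>x\<in>k. l1 br X f x = 0) \<longrightarrow> (\<forall>x\<in>k. f x = 0))"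
    by (simp only: form_action_form1 k.form1_in_coboundaries cong: ball_cong)
  finally show ?thesis .
qed

lemma invariant_cohomology_2:
  "invariant_cohomology br g k 2 = {null_class br k 2} \<longleftrightarrow>
    (\<forall>f. closed2 br k f \<longrightarrow> (\<forall>X\<in>g. exact2 br k (l2 br X f)) \<longrightarrow> exact2 br k f)"
proof -
  interpret k: fd_lie k br by (rule k_fd_lie)
  have "form_action br k X \<omega> \<in> coboundaries br k 2" if X: "X \<in> g" and w: "\<omega> \<in> coboundaries br k 2" for X \<omega>
  proof -
    have "\<omega> \<in> ce_diff br k ` cochains k 1" using w by (simp add: numeral_2_eq_2)
    then obtain \<gamma> where \<gamma>: "lin1 k \<gamma>" "\<omega> = form2 k (d1 br \<gamma>)"
      using cochains_1[OF sub_k] k.ce_diff_form1 by fastforce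
    then show ?thesis using form_action_form2[OF X] k.form2_in_coboundaries exact2_l2[OF _ X] w by metis
  qed
  then have "invariant_cohomology br g k 2 = {null_class br k 2} \<longleftrightarrow>
    (\<forall>\<omega>\<in>cocycles br k 2. (\<forall>X\<in>g. form_action br k X \<omega> \<in> coboundaries br k 2) \<longrightarrow> \<omega> \<in> coboundaries br k 2)"
    by (rule invariant_cohomology_trivial_iff)
  also have "\<dots> \<longleftrightarrow> (\<forall>f. closed2 br k f \<longrightarrow> (\<forall>X\<in>g. form_action br k X (form2 k f) \<in> coboundaries br k 2) \<longrightarrow> form2 k f \<in> coboundaries br k 2)"
    unfolding Ball_def[of "cocycles br k 2"] k.cocycles_2 by blast
  also have "\<dots> \<longleftrightarrow> (\<forall>f. closed2 br k f \<longrightarrow> (\<forall>X\<in>g. exact2 br k (l2 br X f)) \<longrightarrow> exact2 br k f)"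
    by (simp only: form_action_form2 k.form2_in_coboundaries cong: ball_cong)
  finally show ?thesis .
qed

lemma invariant_cohomology_3:
  "invariant_cohomology br g k 3 = {null_class br k 3} \<longleftrightarrow>
    (\<forall>f. closed3 br k f \<longrightarrow> (\<forall>X\<in>g. exact3 br k (l3 br X f)) \<longrightarrow> exact3 br k f)"
proof -
  interpret k: fd_lie k br by (rule k_fd_lie)
  have "form_action br k X \<omega> \<in> coboundaries br k 3" if X: "X \<in> g" and w: "\<omega> \<in> coboundaries br k 3" for X \<omega>
  proof -
    have "\<omega> \<in> ce_diff br k ` cochains k 2" using w by (simp add: numeral_3_eq_3 numeral_2_eq_2)
    then obtain \<gamma> where \<gamma>: "alt2 k \<gamma>" "\<omega> = form3 k (d2 br \<gamma>)"
      using cochains_2[OF sub_k] k.ce_diff_form2 by fastforce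
    then show ?thesis using form_action_form3[OF X] k.form3_in_coboundaries exact3_l3[OF _ X] w by metis
  qed
  then have "invariant_cohomology br g k 3 = {null_class br k 3} \<longleftrightarrow>
    (\<forall>\<omega>\<in>cocycles br k 3. (\<forall>X\<in>g. form_action br k X \<omega> \<in> coboundaries br k 3) \<longrightarrow> \<omega> \<in> coboundaries br k 3)"
    by (rule invariant_cohomology_trivial_iff)
  also have "\<dots> \<longleftrightarrow> (\<forall>f. closed3 br k f \<longrightarrow> (\<forall>X\<in>g. form_action br k X (form3 k f) \<in> coboundaries br k 3) \<longrightarrow> form3 k f \<in> coboundaries br k 3)"
    unfolding Ball_def[of "cocycles br k 3"] k.cocycles_3 by blast
  also have "\<dots> \<longleftrightarrow> (\<forall>f. closed3 br k f \<longrightarrow> (\<forall>X\<in>g. exact3 br k (l3 br X f)) \<longrightarrow> exact3 br k f)"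
    by (simp only: form_action_form3 k.form3_in_coboundaries cong: ball_cong)
  finally show ?thesis .
qed

end

lemma lin1_0: "lin1 g (\<lambda>x. 0)" and alt2_0: "alt2 g (\<lambda>x y. 0)"
  by (simp_all add: lin1_def alt2_def)

lemma lin1_diff_fun: "lin1 g f \<Longrightarrow> lin1 g h \<Longrightarrow> lin1 g (\<lambda>x. f x - h x)"
  by (simp add: lin1_def algebra_simps)

lemma lin1_add_fun: "lin1 g f \<Longrightarrow> lin1 g h \<Longrightarrow> lin1 g (\<lambda>x. f x + h x)"
  by (simp add: lin1_def algebra_simps)

lemma alt2_add_fun: "alt2 g f \<Longrightarrow> alt2 g h \<Longrightarrow> alt2 g (\<lambda>x y. f x y + h x y)"
  unfolding alt2_def using lin1_add_fun by fastforce

lemma alt2_diff_fun: "alt2 g f \<Longrightarrow> alt2 g h \<Longrightarrow> alt2 g (\<lambda>x y. f x y - h x y)"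
  unfolding alt2_def using lin1_diff_fun by fastforce

lemma alt2_d1:
  assumes "fd_lie g br" "lin1 g f"
  shows "alt2 g (d1 br f)"
proof -
  interpret fd_lie g br by fact
  show ?thesis
    using lin1_add[OF assms(2)] lin1_scale[OF assms(2)] lin1_zero[OF assms(2) subspace]
    unfolding alt2_def lin1_def d1_def by (simp add: closed alternating)
qed

context codim_one
begin

text \<open>The two components of d (\<sigma>, \<tau>) are read off by taking all arguments in k, or
  the first one equal to A.\<close>

lemma closed2_ext2_iff:
  assumes \<sigma>: "alt2 k \<sigma>" and \<tau>: "lin1 k \<tau>"
  shows "closed2 br g (ext2 \<sigma> \<tau>) \<longleftrightarrow> closed2 br k \<sigma> \<and> (\<forall>x\<in>k. \<forall>y\<in>k. l2 br A \<sigma> x y = d1 br \<tau> x y)"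
proof
  assume c: "closed2 br g (ext2 \<sigma> \<tau>)"
  have "d2 br \<sigma> x y z = 0" if "x \<in> k" "y \<in> k" "z \<in> k" for x y z
    using closed2D(2)[OF c, of x y z] d2_ext2[OF \<sigma> \<tau>, of x y z] that in_g by (simp add: ext3_def p_id \<alpha>_k)
  moreover have "l2 br A \<sigma> x y = d1 br \<tau> x y" if "x \<in> k" "y \<in> k" for x y
  proof -
    have "d2 br \<sigma> 0 x y = 0"
      using that alt2_scale(1)[OF \<sigma>, of 0 _ 0] alt2_scale(2)[OF \<sigma>, of 0 _ 0] k_closed subspace_0[OF sub_k] by (simp add: d2_def)
    then show ?thesis
      using closed2D(2)[OF c, of A x y] d2_ext2[OF \<sigma> \<tau>, of A x y] that in_g A by (simp add: ext3_def p_id p_A \<alpha>_A \<alpha>_k)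
  qed
  ultimately show "closed2 br k \<sigma> \<and> (\<forall>x\<in>k. \<forall>y\<in>k. l2 br A \<sigma> x y = d1 br \<tau> x y)" using \<sigma> by (simp add: closed2_def)
next
  assume "closed2 br k \<sigma> \<and> (\<forall>x\<in>k. \<forall>y\<in>k. l2 br A \<sigma> x y = d1 br \<tau> x y)"
  then show "closed2 br g (ext2 \<sigma> \<tau>)"
    unfolding closed2_def using alt2_ext2[OF \<sigma> \<tau>] by (simp add: d2_ext2[OF \<sigma> \<tau>] ext3_def p_k)
qed

lemma closed3_ext3:
  assumes \<sigma>: "alt3 k \<sigma>" and \<tau>: "alt2 k \<tau>"
    and "closed3 br k \<sigma>" "\<And>x y z. x \<in> k \<Longrightarrow> y \<in> k \<Longrightarrow> z \<in> k \<Longrightarrow> l3 br A \<sigma> x y z = d2 br \<tau> x y z"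
  shows "closed3 br g (ext3 \<sigma> \<tau>)"
  unfolding closed3_def using alt3_ext3[OF \<sigma> \<tau>] assms(3,4) by (simp add: d3_ext3[OF \<sigma> \<tau>] p_k closed3_def)

text \<open>Cartan's formula: for a closed form f on g and X in g, L_X f = d (i_X f). Hence the
  restriction of f to k has an invariant class.\<close>

lemma closed3_restrict:
  assumes f: "closed3 br g f"
  shows "closed3 br k f" "X \<in> g \<Longrightarrow> x \<in> k \<Longrightarrow> y \<in> k \<Longrightarrow> z \<in> k \<Longrightarrow> l3 br X f x y z = d2 br (f X) x y z"
proof -
  have a: "alt3 g f" using closed3D(1)[OF f] .
  show "closed3 br k f" using f alt3_subset[OF a k_g] k_g unfolding closed3_def by blast
  assume X: "X \<in> g" and "x \<in> k" "y \<in> k" "z \<in> k"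
  then have g: "x \<in> g" "y \<in> g" "z \<in> g" using in_g by auto
  have "f x (br X y) z = - f (br X y) x z" "f x y (br X z) = f (br X z) x y"
    using alt3_anti(1)[OF a subspace g(1) closed[OF X g(2)] g(3)]
      alt3_anti(2)[OF a subspace g(1,2) closed[OF X g(3)]] alt3_anti(1)[OF a subspace g(1) closed[OF X g(3)] g(2)] by simp_all
  moreover have "f X (br u v) w = - f (br u v) X w" if "u \<in> g" "v \<in> g" "w \<in> g" for u v w
    using alt3_anti(1)[OF a subspace X closed[OF that(1,2)] that(3)] .
  ultimately show "l3 br X f x y z = d2 br (f X) x y z"
    using closed3D(2)[OF f X g] g by (simp add: l3_def d2_def d3_def)
qed

lemma closed2_restrict:
  assumes f: "closed2 br g f"
  shows "closed2 br k f" "X \<in> g \<Longrightarrow> x \<in> k \<Longrightarrow> y \<in> k \<Longrightarrow> l2 br X f x y = d1 br (f X) x y"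
proof -
  have a: "alt2 g f" using closed2D(1)[OF f] .
  show "closed2 br k f" using f alt2_subset[OF a k_g] k_g unfolding closed2_def by blast
  assume X: "X \<in> g" and "x \<in> k" "y \<in> k"
  then have g: "x \<in> g" "y \<in> g" using in_g by auto
  have "f x (br X y) = - f (br X y) x" "f X (br x y) = - f (br x y) X"
    using alt2_anti[OF a subspace] X g closed by blast+
  then show "l2 br X f x y = d1 br (f X) x y"
    using closed2D(2)[OF f X g] by (simp add: l2_def d1_def d2_def)
qed

text \<open>The form \<alpha> wedge \<eta> is closed on g. A primitive \<gamma> of it is closed on
  k, as \<alpha> vanishes there, and inserting A gives L_A \<gamma> = \<eta>.\<close>

lemma H1_surjective:
  assumes E2: "\<And>f. closed2 br g f \<Longrightarrow> exact2 br g f" and \<eta>: "closed1 br k \<eta>"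
  shows "\<exists>\<gamma>. closed1 br k \<gamma> \<and> (\<forall>x\<in>k. \<eta> x = l1 br A \<gamma> x)"
proof -
  have c: "closed2 br g (ext2 (\<lambda>x y. 0) \<eta>)"
    using closed2_ext2_iff[OF alt2_0 closed1D(1)[OF \<eta>]] closed1D(2)[OF \<eta>] by (simp add: closed2_def alt2_0 d2_def l2_def)
  then obtain \<gamma> where \<gamma>: "lin1 g \<gamma>" "\<And>x y. x \<in> g \<Longrightarrow> y \<in> g \<Longrightarrow> ext2 (\<lambda>x y. 0) \<eta> x y = d1 br \<gamma> x y"
    using c E2[of "ext2 (\<lambda>x y. 0) \<eta>"] unfolding exact2_def by blast
  have "d1 br \<gamma> x y = 0" if "x \<in> k" "y \<in> k" for x y
    using \<gamma>(2)[of x y] that in_g by (simp add: ext2_def \<alpha>_k)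
  moreover have "\<eta> x = l1 br A \<gamma> x" if "x \<in> k" for x
    using \<gamma>(2)[of A x] that in_g A by (simp add: ext2_def \<alpha>_k \<alpha>_A p_id d1_def l1_def)
  ultimately show ?thesis using lin1_subset[OF \<gamma>(1) k_g] unfolding closed1_def by blast
qed

text \<open>From b_2 = 0 comes only that A is onto on H^1(k); injectivity is deduced from the finite
  dimension of the space of closed 1-forms.\<close>

lemma H1_injective:
  assumes E2: "\<And>f. closed2 br g f \<Longrightarrow> exact2 br g f" and \<gamma>: "closed1 br k \<gamma>" "\<And>x. x \<in> k \<Longrightarrow> l1 br A \<gamma> x = 0" "x \<in> k"
  shows "\<gamma> x = 0"
proof -
  interpret k: fd_lie k br by (rule k_fd_lie)
  let ?Z = "cocycles br k 1"
  have "form_action br k A ` ?Z = ?Z"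
  proof (intro equalityI subsetI)
    fix \<omega> assume "\<omega> \<in> form_action br k A ` ?Z"
    then obtain f where "closed1 br k f" "\<omega> = form_action br k A (form1 k f)" unfolding k.cocycles_1 image_iff Bex_def by metis
    then show "\<omega> \<in> ?Z" unfolding k.cocycles_1 using form_action_form1[OF A] closed1_l1[OF _ A] by metis
  next
    fix \<omega> assume "\<omega> \<in> ?Z"
    then obtain f where f: "closed1 br k f" "\<omega> = form1 k f" unfolding k.cocycles_1 by metis
    obtain h where h: "closed1 br k h" "\<forall>x\<in>k. f x = l1 br A h x" using H1_surjective[OF E2 f(1)] by blast
    have "\<omega> = form_action br k A (form1 k h)"
      unfolding f(2) form_action_form1[OF A] k.form1_eq_iff by (rule h(2))
    moreover have "form1 k h \<in> ?Z" unfolding k.cocycles_1 using h(1) by metis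
    ultimately show "\<omega> \<in> form_action br k A ` ?Z" by blast
  qed
  moreover have "form1 k \<gamma> \<in> ?Z" unfolding k.cocycles_1 using \<gamma>(1) by metis
  moreover have "form_action br k A (form1 k \<gamma>) = 0"
    using k.form1_in_coboundaries[of "l1 br A \<gamma>"] \<gamma>(2) unfolding form_action_form1[OF A] k.coboundaries_1 by blast
  ultimately have "form1 k \<gamma> = 0"
    using linear_surj_imp_inj_on[OF linear_form_action k.finite_dimensional_cocycles] by blast
  then show ?thesis using k.form1_in_coboundaries[of \<gamma>] \<gamma>(3) unfolding k.coboundaries_1 by blast
qed

end

lemma hyperplane_coefficient:
  assumes "subspace M" "z \<notin> M" "\<And>x. x \<in> g \<Longrightarrow> \<exists>c. x - c *\<^sub>R z \<in> M" "subspace g" "M \<subseteq> g" "z \<in> g"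
  obtains \<alpha> where "lin1 g \<alpha>" "\<alpha> z = 1" "\<And>x. x \<in> M \<Longrightarrow> \<alpha> x = 0" "\<And>x. x \<in> g \<Longrightarrow> x - \<alpha> x *\<^sub>R z \<in> M"
proof -
  define \<alpha> where "\<alpha> x = (SOME c. x - c *\<^sub>R z \<in> M)" for x
  have \<alpha>: "x - \<alpha> x *\<^sub>R z \<in> M" if "x \<in> g" for x
    unfolding \<alpha>_def using someI_ex[OF assms(3)[OF that]] .
  have uni: "\<alpha> x = c" if "x \<in> g" "x - c *\<^sub>R z \<in> M" for x c
  proof (rule ccontr)
    assume "\<alpha> x \<noteq> c"
    have "(x - c *\<^sub>R z) - (x - \<alpha> x *\<^sub>R z) \<in> M" using subspace_diff[OF assms(1) that(2) \<alpha>[OF that(1)]] .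
    then have "(\<alpha> x - c) *\<^sub>R z \<in> M" by (simp add: scaleR_diff_left)
    then have "inverse (\<alpha> x - c) *\<^sub>R (\<alpha> x - c) *\<^sub>R z \<in> M" using subspace_scale[OF assms(1)] by blast
    then show False using \<open>\<alpha> x \<noteq> c\<close> assms(2) by simp
  qed
  show ?thesis
  proof (rule that[OF _ _ _ \<alpha>])
    show "lin1 g \<alpha>"
      unfolding lin1_def
    proof (intro conjI ballI allI)
      fix x y assume xy: "x \<in> g" "y \<in> g"
      have "x + y - (\<alpha> x + \<alpha> y) *\<^sub>R z = (x - \<alpha> x *\<^sub>R z) + (y - \<alpha> y *\<^sub>R z)" by (simp add: algebra_simps)
      then have "x + y - (\<alpha> x + \<alpha> y) *\<^sub>R z \<in> M" using subspace_add[OF assms(1) \<alpha>[OF xy(1)] \<alpha>[OF xy(2)]] by (simp only:)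
      then show "\<alpha> (x + y) = \<alpha> x + \<alpha> y" using uni subspace_add[OF assms(4) xy] by blast
    next
      fix c x assume x: "x \<in> g"
      have "c *\<^sub>R x - (c * \<alpha> x) *\<^sub>R z = c *\<^sub>R (x - \<alpha> x *\<^sub>R z)" by (simp add: algebra_simps)
      then have "c *\<^sub>R x - (c * \<alpha> x) *\<^sub>R z \<in> M" using subspace_scale[OF assms(1) \<alpha>[OF x]] by (simp only:)
      then show "\<alpha> (c *\<^sub>R x) = c * \<alpha> x" using uni subspace_scale[OF assms(4) x] by blast
    qed
    show "\<alpha> z = 1" using uni[OF assms(6), of 1] subspace_0[OF assms(1)] by simp
    show "\<alpha> x = 0" if "x \<in> M" for x using uni[of x 0] that assms(5) by auto
  qed
qed

lemma (in fd_lie) codim_one_exists: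
  assumes "derived_algebra br g \<subseteq> k" "subspace k" "k \<subseteq> g" "z \<in> g" "z \<notin> k" "\<And>x. x \<in> g \<Longrightarrow> \<exists>c. x - c *\<^sub>R z \<in> k"
  shows "\<exists>\<alpha> p. codim_one g br k z \<alpha> p"
proof -
  obtain \<alpha> where \<alpha>: "lin1 g \<alpha>" "\<alpha> z = 1" "\<And>x. x \<in> k \<Longrightarrow> \<alpha> x = 0" "\<And>x. x \<in> g \<Longrightarrow> x - \<alpha> x *\<^sub>R z \<in> k"
    by (rule hyperplane_coefficient[OF assms(2,5,6) subspace assms(3,4)]) blast+
  have br: "br x y \<in> k" if "x \<in> g" "y \<in> g" for x y
    using bracket_in_span[OF that, of br] assms(1) unfolding derived_algebra_def by blast
  have "codim_one g br k z \<alpha> (\<lambda>x. x - \<alpha> x *\<^sub>R z)"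
  proof (intro codim_one.intro lie_ideal.intro fd_lie_axioms lie_ideal_axioms.intro codim_one_axioms.intro)
    show "br x y \<in> k" if "x \<in> g" "y \<in> k" for x y using br that assms(3) by blast
  qed (simp_all add: assms \<alpha> br)
  then show ?thesis by blast
qed

section \<open>The characterization\<close>

context codim_one
begin

text \<open>Write X = p X + \<alpha> X A. The part in k annihilates closed 1-forms, so the action of
  A decides about invariance under g.\<close>

lemma l1_eq_zero:
  assumes "closed1 br k \<gamma>" "\<And>x. x \<in> k \<Longrightarrow> l1 br A \<gamma> x = 0" "X \<in> g" "x \<in> k"
  shows "l1 br X \<gamma> x = 0"
proof -
  have "\<gamma> (br X x) = \<gamma> (br (p X) x) + \<alpha> X * \<gamma> (br A x)"
    using lin1_bracket[OF closed1D(1)[OF assms(1)] assms(3), of x] assms(4) in_g by (simp add: p_id \<alpha>_k)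
  then show ?thesis
    using assms(2)[OF assms(4)] closed1D(2)[OF assms(1) p_k[OF assms(3)] assms(4)] by (simp add: l1_def d1_def)
qed

text \<open>As in degree 1 it is enough to test invariance on A, because k acts trivially on classes
  by \<open>l2_closed\<close>.\<close>

lemma exact2_l2_if_exact:
  assumes f: "closed2 br k f" and "exact2 br k (l2 br A f)" "X \<in> g"
  shows "exact2 br k (l2 br X f)"
proof -
  have a: "alt2 k f" using closed2D(1)[OF f] .
  obtain \<gamma> where \<gamma>: "lin1 k \<gamma>" "\<And>x y. x \<in> k \<Longrightarrow> y \<in> k \<Longrightarrow> l2 br A f x y = d1 br \<gamma> x y"
    using assms(2) unfolding exact2_def by blast
  have b: "f (br X x) y = f (br (p X) x) y + \<alpha> X * f (br A x) y" "f y (br X x) = f y (br (p X) x) + \<alpha> X * f y (br A x)"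
    if "x \<in> k" "y \<in> k" for x y
    using lin1_bracket[OF alt2_lin1(1)[OF a that(2)] assms(3), of x] lin1_bracket[OF alt2_lin1(2)[OF a that(2)] assms(3), of x] that in_g
    by (simp_all add: p_id \<alpha>_k)
  \<comment> \<open>Primitive of L_X f for X = p X + \<alpha> X A: the interior product with p X
    takes care of the part in k, and \<gamma> is a primitive of L_A f.\<close>
  define \<zeta> where "\<zeta> x = f (p X) x + \<alpha> X * \<gamma> x" for x
  have "lin1 k \<zeta>" unfolding \<zeta>_def using alt2_lin1(2)[OF a p_k[OF assms(3)]] \<gamma>(1) by (simp add: lin1_def algebra_simps)
  moreover have "l2 br X f x y = d1 br \<zeta> x y" if "x \<in> k" "y \<in> k" for x y
  proof -
    have "l2 br X f x y = l2 br (p X) f x y + \<alpha> X * l2 br A f x y"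
      unfolding l2_def b(1)[OF that] b(2)[OF that(2,1)] by (simp add: algebra_simps)
    then show ?thesis using l2_closed[OF f p_k[OF assms(3)] that] \<gamma>(2)[OF that] by (simp add: d1_def \<zeta>_def)
  qed
  ultimately show ?thesis unfolding exact2_def by blast
qed

text \<open>A functional on k that vanishes on [g, g] is closed and annihilated by A, hence 0 by
  \<open>H1_injective\<close>. If [g, g] were smaller than k, a nonzero one would exist.\<close>

lemma ideal_eq_derived_algebra:
  assumes E2: "\<And>f. closed2 br g f \<Longrightarrow> exact2 br g f"
  shows "derived_algebra br g = k"
proof (rule ccontr)
  let ?D = "derived_algebra br g"
  assume "?D \<noteq> k"
  moreover have "?D \<subseteq> k" unfolding derived_algebra_def by (rule bracket_span_subset[OF sub_k bracket_k])
  ultimately have D: "?D \<subset> k" by blast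
  have sD: "subspace ?D" by (simp add: derived_algebra_def subspace_bracket_span)
  have fk: "finite_dimensional k" using finite_dimensional_subset[OF sub_k k_g fd] .
  obtain M z where M: "subspace M" "?D \<subseteq> M" "M \<subseteq> k" "z \<in> k" "z \<notin> M" "\<And>x. x \<in> k \<Longrightarrow> \<exists>c. x - c *\<^sub>R z \<in> M"
    by (rule hyperplane_extension[OF sD D fk]) blast
  obtain \<beta> where \<beta>: "lin1 k \<beta>" "\<beta> z = 1" "\<And>x. x \<in> M \<Longrightarrow> \<beta> x = 0"
    by (rule hyperplane_coefficient[OF M(1,5,6) sub_k M(3,4)]) blast+
  have 0: "\<beta> (br x y) = 0" if "x \<in> g" "y \<in> g" for x y
    using \<beta>(3) M(2) bracket_in_span[OF that, of br] unfolding derived_algebra_def by blast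
  have "closed1 br k \<beta>" using \<beta>(1) 0 in_g by (simp add: closed1_def d1_def)
  moreover have "l1 br A \<beta> x = 0" if "x \<in> k" for x using 0 A in_g that by (simp add: l1_def)
  ultimately show False using H1_injective[OF E2 _ _ M(4)] \<beta>(2) by fastforce
qed

text \<open>If L_A f = d \<gamma> on k for a closed f, then the pair (f, \<gamma>) is a closed form
  on g, and any primitive of it restricts to a primitive of f on k. In degree 1 the injectivity of A
  is used directly.\<close>

lemma invariants_trivial:
  assumes E2: "\<And>f. closed2 br g f \<Longrightarrow> exact2 br g f" and E3: "\<And>f. closed3 br g f \<Longrightarrow> exact3 br g f"
  shows "invariant_cohomology br g k 1 = {null_class br k 1}"
    "invariant_cohomology br g k 2 = {null_class br k 2}"
    "invariant_cohomology br g k 3 = {null_class br k 3}"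
proof -
  show "invariant_cohomology br g k 1 = {null_class br k 1}"
    unfolding invariant_cohomology_1 using H1_injective[OF E2] A by blast
  show "invariant_cohomology br g k 2 = {null_class br k 2}"
    unfolding invariant_cohomology_2
  proof (intro allI impI)
    fix f assume f: "closed2 br k f" and "\<forall>X\<in>g. exact2 br k (l2 br X f)"
    then obtain \<gamma> where \<gamma>: "lin1 k \<gamma>" "\<forall>x\<in>k. \<forall>y\<in>k. l2 br A f x y = d1 br \<gamma> x y"
      using A unfolding exact2_def by blast
    have "closed2 br g (ext2 f \<gamma>)" using closed2_ext2_iff[OF closed2D(1)[OF f] \<gamma>(1)] f \<gamma>(2) by blast
    then obtain \<zeta> where \<zeta>: "lin1 g \<zeta>" "\<And>x y. x \<in> g \<Longrightarrow> y \<in> g \<Longrightarrow> ext2 f \<gamma> x y = d1 br \<zeta> x y"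
      using E2[of "ext2 f \<gamma>"] unfolding exact2_def by blast
    have "f x y = d1 br \<zeta> x y" if "x \<in> k" "y \<in> k" for x y
      using \<zeta>(2)[of x y] that in_g by (simp add: ext2_def p_id \<alpha>_k)
    then show "exact2 br k f" using lin1_subset[OF \<zeta>(1) k_g] unfolding exact2_def by blast
  qed
  show "invariant_cohomology br g k 3 = {null_class br k 3}"
    unfolding invariant_cohomology_3
  proof (intro allI impI)
    fix f assume f: "closed3 br k f" and "\<forall>X\<in>g. exact3 br k (l3 br X f)"
    then obtain \<gamma> where \<gamma>: "alt2 k \<gamma>" "\<And>x y z. x \<in> k \<Longrightarrow> y \<in> k \<Longrightarrow> z \<in> k \<Longrightarrow> l3 br A f x y z = d2 br \<gamma> x y z"
      using A unfolding exact3_def by blast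
    have "closed3 br g (ext3 f \<gamma>)" using closed3_ext3[OF closed3D(1)[OF f] \<gamma>(1) f] \<gamma>(2) by blast
    then obtain \<zeta> where \<zeta>: "alt2 g \<zeta>" "\<And>x y z. x \<in> g \<Longrightarrow> y \<in> g \<Longrightarrow> z \<in> g \<Longrightarrow> ext3 f \<gamma> x y z = d2 br \<zeta> x y z"
      using E3[of "ext3 f \<gamma>"] unfolding exact3_def by blast
    have "f x y z = d2 br \<zeta> x y z" if "x \<in> k" "y \<in> k" "z \<in> k" for x y z
      using \<zeta>(2)[of x y z] that in_g by (simp add: ext3_def p_id \<alpha>_k)
    then show "exact3 br k f" using alt2_subset[OF \<zeta>(1) k_g] unfolding exact3_def by blast
  qed
qed

section \<open>From trivial invariants back to vanishing Betti numbers\<close>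

lemma H1_surjective_of_invariants:
  assumes "invariant_cohomology br g k 1 = {null_class br k 1}" "closed1 br k \<eta>"
  shows "\<exists>\<sigma>. closed1 br k \<sigma> \<and> (\<forall>x\<in>k. \<eta> x = l1 br A \<sigma> x)"
proof -
  interpret k: fd_lie k br by (rule k_fd_lie)
  let ?Z = "cocycles br k 1" and ?B = "coboundaries br k 1"
  have inj: "\<omega> \<in> ?B" if "\<omega> \<in> ?Z" "form_action br k A \<omega> \<in> ?B" for \<omega>
  proof -
    obtain f where f: "closed1 br k f" "\<omega> = form1 k f" using \<open>\<omega> \<in> ?Z\<close> unfolding k.cocycles_1 by metis
    have "\<forall>x\<in>k. l1 br A f x = 0" using that(2) unfolding f(2) form_action_form1[OF A] k.form1_in_coboundaries .
    then have "\<forall>X\<in>g. \<forall>x\<in>k. l1 br X f x = 0" using l1_eq_zero[OF f(1)] by blast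
    then have "\<forall>x\<in>k. f x = 0" using assms(1) f(1) unfolding invariant_cohomology_1 by blast
    then show ?thesis unfolding f(2) k.form1_in_coboundaries .
  qed
  have "form_action br k A \<omega> \<in> ?Z" if "\<omega> \<in> ?Z" for \<omega>
    using that closed1_l1[OF _ A] form_action_form1[OF A] unfolding k.cocycles_1 by metis
  then have im: "form_action br k A ` ?Z \<subseteq> ?Z" by blast
  have "?B \<subseteq> ?Z" unfolding k.coboundaries_1 using subspace_0[OF subspace_cocycles] by simp
  moreover have "form1 k \<eta> \<in> ?Z" unfolding k.cocycles_1 using assms(2) by metis
  ultimately obtain w where w: "w \<in> ?Z" "form1 k \<eta> - form_action br k A w \<in> ?B"
    using surjective_modulo[OF k.finite_dimensional_cocycles subspace_coboundaries _ linear_form_action im inj] by blast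
  obtain \<sigma> where \<sigma>: "closed1 br k \<sigma>" "w = form1 k \<sigma>" using w(1) unfolding k.cocycles_1 by metis
  have "form1 k \<eta> = form1 k (l1 br A \<sigma>)"
    using w(2) unfolding \<sigma>(2) form_action_form1[OF A] k.coboundaries_1 by simp
  then show ?thesis using \<sigma>(1) k.form1_eq_iff by metis
qed

text \<open>Without invariant classes A is injective on H^2(k), since invariance under A implies
  invariance under g. Finite dimension makes it onto, which for forms means up to an exact
  one.\<close>

lemma H2_surjective_of_invariants:
  assumes "invariant_cohomology br g k 2 = {null_class br k 2}" "closed2 br k \<eta>"
  shows "\<exists>\<sigma>. closed2 br k \<sigma> \<and> exact2 br k (\<lambda>x y. \<eta> x y - l2 br A \<sigma> x y)"
proof -
  interpret k: fd_lie k br by (rule k_fd_lie)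
  let ?Z = "cocycles br k 2" and ?B = "coboundaries br k 2"
  have inj: "\<omega> \<in> ?B" if "\<omega> \<in> ?Z" "form_action br k A \<omega> \<in> ?B" for \<omega>
  proof -
    obtain f where f: "closed2 br k f" "\<omega> = form2 k f" using \<open>\<omega> \<in> ?Z\<close> unfolding k.cocycles_2 by metis
    have "exact2 br k (l2 br A f)" using that(2) unfolding f(2) form_action_form2[OF A] k.form2_in_coboundaries .
    then have "\<forall>X\<in>g. exact2 br k (l2 br X f)" using exact2_l2_if_exact[OF f(1)] by blast
    then have "exact2 br k f" using assms(1) f(1) unfolding invariant_cohomology_2 by blast
    then show ?thesis unfolding f(2) k.form2_in_coboundaries .
  qed
  have "form_action br k A \<omega> \<in> ?Z" if "\<omega> \<in> ?Z" for \<omega>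
    using that closed2_l2[OF _ A] form_action_form2[OF A] unfolding k.cocycles_2 by metis
  then have im: "form_action br k A ` ?Z \<subseteq> ?Z" by blast
  have BZ: "?B \<subseteq> ?Z"
  proof
    fix \<omega> assume "\<omega> \<in> ?B"
    then have "\<omega> \<in> ce_diff br k ` cochains k 1" by (simp add: numeral_2_eq_2)
    then obtain \<gamma> where \<gamma>: "lin1 k \<gamma>" "\<omega> = form2 k (d1 br \<gamma>)"
      using cochains_1[OF sub_k] k.ce_diff_form1 by fastforce
    then have "closed2 br k (d1 br \<gamma>)" unfolding closed2_def using alt2_d1[OF k_fd_lie] d2_d1 by blast
    then show "\<omega> \<in> ?Z" unfolding k.cocycles_2 \<gamma>(2) by blast
  qed
  have "form2 k \<eta> \<in> ?Z" unfolding k.cocycles_2 using assms(2) by metis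
  then obtain w where w: "w \<in> ?Z" "form2 k \<eta> - form_action br k A w \<in> ?B"
    using surjective_modulo[OF k.finite_dimensional_cocycles subspace_coboundaries BZ linear_form_action im inj] by blast
  obtain \<sigma> where \<sigma>: "closed2 br k \<sigma>" "w = form2 k \<sigma>" using w(1) unfolding k.cocycles_2 by metis
  have "form2 k \<eta> - form2 k (l2 br A \<sigma>) = form2 k (\<lambda>x y. \<eta> x y - l2 br A \<sigma> x y)"
    by (auto simp: form2_def fun_eq_iff)
  then have "exact2 br k (\<lambda>x y. \<eta> x y - l2 br A \<sigma> x y)"
    using w(2) unfolding \<sigma>(2) form_action_form2[OF A] using k.form2_in_coboundaries by metis
  then show ?thesis using \<sigma>(1) by blast
qed

text \<open>The class of f on k is invariant, so f = d \<zeta> there. The defect \<eta> = i_A f -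
  L_A \<zeta> is closed on k and, A being onto on H^1(k), equal to L_A \<sigma> with \<sigma>
  closed. Then \<zeta> + \<sigma>, extended by 0 on A, is a primitive of f.\<close>

lemma exact2_of_invariants:
  assumes I1: "invariant_cohomology br g k 1 = {null_class br k 1}"
    and I2: "invariant_cohomology br g k 2 = {null_class br k 2}"
    and f: "closed2 br g f"
  shows "exact2 br g f"
proof -
  have a: "alt2 g f" using closed2D(1)[OF f] .
  have l: "lin1 k (f X)" if "X \<in> g" for X using lin1_subset[OF alt2_lin1(2)[OF a that] k_g] .
  have "\<forall>X\<in>g. exact2 br k (l2 br X f)"
    unfolding exact2_def using closed2_restrict(2)[OF f] l by blast
  then have "exact2 br k f" using I2 closed2_restrict(1)[OF f] unfolding invariant_cohomology_2 by blast
  then obtain \<zeta> where \<zeta>: "lin1 k \<zeta>" "\<And>x y. x \<in> k \<Longrightarrow> y \<in> k \<Longrightarrow> f x y = d1 br \<zeta> x y" unfolding exact2_def by blast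
  define \<eta> where "\<eta> x = f A x - l1 br A \<zeta> x" for x
  have "d1 br \<eta> x y = 0" if "x \<in> k" "y \<in> k" for x y
  proof -
    have "d1 br \<eta> x y = d1 br (f A) x y - d1 br (l1 br A \<zeta>) x y" by (simp add: d1_def \<eta>_def)
    also have "\<dots> = l2 br A f x y - l2 br A (d1 br \<zeta>) x y"
      using closed2_restrict(2)[OF f A that] l2_d1[OF \<zeta>(1) A that] by simp
    also have "\<dots> = 0" using \<zeta>(2) that ideal_k[OF A] by (simp add: l2_def)
    finally show ?thesis .
  qed
  then have "closed1 br k \<eta>"
    unfolding closed1_def \<eta>_def using lin1_diff_fun[OF l[OF A] lin1_l1[OF \<zeta>(1) A]] by blast
  then obtain \<sigma> where \<sigma>: "closed1 br k \<sigma>" "\<And>x. x \<in> k \<Longrightarrow> \<eta> x = l1 br A \<sigma> x"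
    using H1_surjective_of_invariants[OF I1] by blast
  let ?\<phi> = "\<lambda>x. \<zeta> x + \<sigma> x"
  have \<phi>: "lin1 k ?\<phi>" using lin1_add_fun[OF \<zeta>(1) closed1D(1)[OF \<sigma>(1)]] .
  have 1: "d1 br ?\<phi> x y = f x y" if "x \<in> k" "y \<in> k" for x y
    using closed1D(2)[OF \<sigma>(1) that] \<zeta>(2)[OF that] by (simp add: d1_def)
  have 2: "l1 br A ?\<phi> x = f A x" if "x \<in> k" for x
    using \<sigma>(2)[OF that] by (simp add: l1_def \<eta>_def)
  have "f x y = d1 br (ext1 ?\<phi>) x y" if "x \<in> g" "y \<in> g" for x y
    unfolding d1_ext1[OF \<phi> that] alt2_eq_ext2[OF a that] ext2_def using 1 2 p_k that by simp
  then show ?thesis unfolding exact2_def using lin1_ext1[OF \<phi>] by blast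
qed

text \<open>The same correction one degree higher. Now L_A \<sigma> meets the defect only up to an
  exact form d \<rho>, and \<rho> goes into the \<alpha>-component of the primitive.\<close>

lemma exact3_of_invariants:
  assumes I2: "invariant_cohomology br g k 2 = {null_class br k 2}"
    and I3: "invariant_cohomology br g k 3 = {null_class br k 3}"
    and f: "closed3 br g f"
  shows "exact3 br g f"
proof -
  have a: "alt3 g f" using closed3D(1)[OF f] .
  have l: "alt2 k (f X)" if "X \<in> g" for X using alt2_subset[OF alt3_alt2(1)[OF a that] k_g] .
  have "\<forall>X\<in>g. exact3 br k (l3 br X f)"
    unfolding exact3_def using closed3_restrict(2)[OF f] l by blast
  then have "exact3 br k f" using I3 closed3_restrict(1)[OF f] unfolding invariant_cohomology_3 by blast
  then obtain \<beta> where \<beta>: "alt2 k \<beta>" "\<And>x y z. x \<in> k \<Longrightarrow> y \<in> k \<Longrightarrow> z \<in> k \<Longrightarrow> f x y z = d2 br \<beta> x y z"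
    unfolding exact3_def by blast
  define \<eta> where "\<eta> x y = f A x y - l2 br A \<beta> x y" for x y
  have "d2 br \<eta> x y z = 0" if "x \<in> k" "y \<in> k" "z \<in> k" for x y z
  proof -
    have "d2 br \<eta> x y z = d2 br (f A) x y z - d2 br (l2 br A \<beta>) x y z" by (simp add: d2_def \<eta>_def)
    also have "\<dots> = l3 br A f x y z - l3 br A (d2 br \<beta>) x y z"
      using closed3_restrict(2)[OF f A that] l3_d2[OF \<beta>(1) A that] by simp
    also have "\<dots> = 0" using \<beta>(2) that ideal_k[OF A] by (simp add: l3_def)
    finally show ?thesis .
  qed
  moreover have "alt2 k \<eta>" unfolding \<eta>_def by (rule alt2_diff_fun[OF l[OF A] alt2_l2[OF \<beta>(1) A]])
  ultimately have "closed2 br k \<eta>" unfolding closed2_def by blast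
  then obtain \<sigma> where \<sigma>: "closed2 br k \<sigma>" and "exact2 br k (\<lambda>x y. \<eta> x y - l2 br A \<sigma> x y)"
    using H2_surjective_of_invariants[OF I2] by blast
  then obtain \<rho> where \<rho>: "lin1 k \<rho>" "\<And>x y. x \<in> k \<Longrightarrow> y \<in> k \<Longrightarrow> \<eta> x y - l2 br A \<sigma> x y = d1 br \<rho> x y"
    unfolding exact2_def by blast
  \<comment> \<open>The sign of \<rho> comes from the minus sign in d (\<sigma>, \<tau>) = (d
    \<sigma>, L_A \<sigma> - d \<tau>).\<close>
  let ?\<phi> = "\<lambda>x y. \<beta> x y + \<sigma> x y" and ?\<psi> = "\<lambda>x. 0 - \<rho> x"
  have \<phi>: "alt2 k ?\<phi>" using alt2_add_fun[OF \<beta>(1) closed2D(1)[OF \<sigma>]] .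
  have \<psi>: "lin1 k ?\<psi>" using lin1_diff_fun[OF lin1_0 \<rho>(1)] .
  have 1: "d2 br ?\<phi> x y z = f x y z" if "x \<in> k" "y \<in> k" "z \<in> k" for x y z
    using closed2D(2)[OF \<sigma> that] \<beta>(2)[OF that] by (simp add: d2_def)
  have 2: "l2 br A ?\<phi> x y - d1 br ?\<psi> x y = f A x y" if "x \<in> k" "y \<in> k" for x y
    using \<rho>(2)[OF that] by (simp add: l2_def d1_def \<eta>_def)
  have "f x y z = d2 br (ext2 ?\<phi> ?\<psi>) x y z" if "x \<in> g" "y \<in> g" "z \<in> g" for x y z
    unfolding d2_ext2[OF \<phi> \<psi> that] alt3_eq_ext3[OF a that] ext3_def using 1 2 p_k that by simp
  then show ?thesis unfolding exact3_def using alt2_ext2[OF \<phi> \<psi>] by blast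
qed

end

lemma (in fd_lie) two_three_trivial_iff:
  assumes "g \<noteq> {0}"
  defines "k \<equiv> derived_algebra br g"
  shows "two_three_trivial br g \<longleftrightarrow>
    solvable_lie br g \<and>
    nilpotent_lie br k \<and> dim g = dim k + 1 \<and>
    invariant_cohomology br g k 1 = {null_class br k 1} \<and>
    invariant_cohomology br g k 2 = {null_class br k 2} \<and>
    invariant_cohomology br g k 3 = {null_class br k 3}"
proof
  have sk: "subspace k" by (simp add: k_def derived_algebra_def subspace_bracket_span)
  have kg: "k \<subseteq> g" unfolding k_def derived_algebra_def by (rule bracket_span_subset[OF subspace closed])
  {
    assume "two_three_trivial br g"
    then have E2: "\<And>f. closed2 br g f \<Longrightarrow> exact2 br g f" and E3: "\<And>f. closed3 br g f \<Longrightarrow> exact3 br g f"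
      unfolding two_three_trivial_def betti_2_eq_0 betti_3_eq_0 by blast+
    have solv: "solvable_lie br g"
    proof (rule solvable_if_3forms_exact)
      fix \<phi> assume "alt3 g \<phi>" "\<And>x y z w. x \<in> g \<Longrightarrow> y \<in> g \<Longrightarrow> z \<in> g \<Longrightarrow> w \<in> g \<Longrightarrow> d3 br \<phi> x y z w = 0"
      then have "closed3 br g \<phi>" by (simp add: closed3_def)
      then show "\<exists>\<beta>. alt2 g \<beta> \<and> (\<forall>x\<in>g. \<forall>y\<in>g. \<forall>z\<in>g. \<phi> x y z = d2 br \<beta> x y z)"
        using E3 unfolding exact3_def by blast
    qed
    have "k \<noteq> g" using solvable_lie_perfect[OF solv] assms(1) unfolding k_def by blast
    then have "k \<subset> g" using kg by blast
    \<comment> \<open>Any hyperplane above [g, g] will do at first; b_2 = 0 then forces it to be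
      [g, g], which is the codimension statement.\<close>
    then obtain M z where M: "subspace M" "k \<subseteq> M" "M \<subseteq> g" "z \<in> g" "z \<notin> M" "\<And>x. x \<in> g \<Longrightarrow> \<exists>c. x - c *\<^sub>R z \<in> M"
      "dim g = dim M + 1"
      by (rule hyperplane_extension[OF sk _ fd]) blast
    obtain \<alpha> p where "codim_one g br M z \<alpha> p" using codim_one_exists[OF _ M(1,3-6)] M(2) unfolding k_def by blast
    then interpret c: codim_one g br M z \<alpha> p .
    have "M = k" using c.ideal_eq_derived_algebra[OF E2] unfolding k_def by simp
    moreover have "invariant_cohomology br g M 1 = {null_class br M 1}"
      by (rule c.invariants_trivial(1)[OF E2 E3])
    moreover have "invariant_cohomology br g M 2 = {null_class br M 2}"
      by (rule c.invariants_trivial(2)[OF E2 E3])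
    moreover have "invariant_cohomology br g M 3 = {null_class br M 3}"
      by (rule c.invariants_trivial(3)[OF E2 E3])
    moreover have "nilpotent_lie br k" unfolding k_def by (rule solvable_derived_nilpotent[OF solv])
    ultimately show "solvable_lie br g \<and> nilpotent_lie br k \<and> dim g = dim k + 1 \<and>
      invariant_cohomology br g k 1 = {null_class br k 1} \<and>
      invariant_cohomology br g k 2 = {null_class br k 2} \<and>
      invariant_cohomology br g k 3 = {null_class br k 3}"
      using solv M(7) by simp
  }
  {
    assume r: "solvable_lie br g \<and> nilpotent_lie br k \<and> dim g = dim k + 1 \<and>
      invariant_cohomology br g k 1 = {null_class br k 1} \<and>
      invariant_cohomology br g k 2 = {null_class br k 2} \<and>
      invariant_cohomology br g k 3 = {null_class br k 3}"
    have "k \<noteq> g" using conjunct1[OF conjunct2[OF conjunct2[OF r]]] by (intro notI) simp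
    then have "k \<subset> g" using kg by blast
    then obtain M z where M: "subspace M" "k \<subseteq> M" "M \<subseteq> g" "z \<in> g" "z \<notin> M" "\<And>x. x \<in> g \<Longrightarrow> \<exists>c. x - c *\<^sub>R z \<in> M"
      "dim g = dim M + 1"
      by (rule hyperplane_extension[OF sk _ fd]) blast
    have "dim M \<le> dim k" using r M(7) by simp
    then have Mk: "k = M"
      using finite_dimensional_dim_eq[OF sk M(2) finite_dimensional_subset[OF M(1,3) fd]] by blast
    obtain \<alpha> p where "codim_one g br M z \<alpha> p" using codim_one_exists[OF _ M(1,3-6)] M(2) unfolding k_def by blast
    then interpret c: codim_one g br M z \<alpha> p .
    show "two_three_trivial br g"
      unfolding two_three_trivial_def betti_2_eq_0 betti_3_eq_0
    proof (intro conjI allI impI)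
      show "exact2 br g f" if "closed2 br g f" for f
        using c.exact2_of_invariants[OF _ _ that] r unfolding Mk by simp
      show "exact3 br g f" if "closed3 br g f" for f
        using c.exact3_of_invariants[OF _ _ that] r unfolding Mk by simp
    qed
  }
qed

section \<open>Dependence of all notions on the bracket through its values on g only\<close>

lemma ce_diff_cong:
  assumes "\<And>x y. x \<in> h \<Longrightarrow> y \<in> h \<Longrightarrow> br x y = br' x y"
  shows "ce_diff br h = ce_diff br' h"
  unfolding ce_diff_def fun_eq_iff
  by (auto intro!: sum.cong simp: assms nth_mem subset_iff)

lemma cocycles_cong:
  assumes "\<And>x y. x \<in> h \<Longrightarrow> y \<in> h \<Longrightarrow> br x y = br' x y"
  shows "cocycles br h n = cocycles br' h n" "coboundaries br h n = coboundaries br' h n"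
  using ce_diff_cong[OF assms] by (simp add: cocycles_def, cases n, simp_all)

lemma form_action_cong:
  assumes "\<And>x. x \<in> k \<Longrightarrow> br X x = br' X x"
  shows "form_action br k X = form_action br' k X"
  unfolding form_action_def fun_eq_iff
  by (auto intro!: sum.cong simp: assms nth_mem subset_iff)

lemma invariant_cohomology_cong:
  assumes "\<And>x y. x \<in> g \<Longrightarrow> y \<in> g \<Longrightarrow> br x y = br' x y" "k \<subseteq> g"
  shows "invariant_cohomology br g k n = invariant_cohomology br' g k n" "null_class br k n = null_class br' k n"
proof -
  have k: "br x y = br' x y" if "x \<in> k" "y \<in> k" for x y using that assms by blast
  have "form_action br k X = form_action br' k X" if "X \<in> g" for X
    by (rule form_action_cong) (use that assms in blast)
  then show "invariant_cohomology br g k n = invariant_cohomology br' g k n" "null_class br k n = null_class br' k n"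
    unfolding invariant_cohomology_def cohomology_def class_action_def null_class_def
    by (simp_all add: cocycles_cong[of k br br', OF k] cong: ball_cong)
qed

lemma nilpotent_lie_cong:
  assumes "\<And>x y. x \<in> k \<Longrightarrow> y \<in> k \<Longrightarrow> br x y = br' x y" "\<And>x y. x \<in> k \<Longrightarrow> y \<in> k \<Longrightarrow> br x y \<in> k" "subspace k"
  shows "nilpotent_lie br k \<longleftrightarrow> nilpotent_lie br' k"
proof -
  have "(bracket_span br k ^^ n) k = (bracket_span br' k ^^ n) k \<and> (bracket_span br k ^^ n) k \<subseteq> k" for n
  proof (induction n)
    case (Suc n)
    let ?C = "(bracket_span br k ^^ n) k"
    have C: "?C \<subseteq> k" using Suc by (rule conjunct2)
    have "{br x y |x y. x \<in> k \<and> y \<in> ?C} = {br' x y |x y. x \<in> k \<and> y \<in> ?C}"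
      using C assms(1) by (metis (no_types, opaque_lifting) subsetD)
    moreover have "bracket_span br k ?C \<subseteq> k"
      by (intro bracket_span_subset assms(2,3)) (simp_all only: subsetD[OF C])
    ultimately show ?case using Suc by (simp add: bracket_span_def)
  qed simp
  then show ?thesis unfolding nilpotent_lie_def by metis
qed

text \<open>Composing with a projection onto \<open>g\<close> makes the bracket bilinear on the whole space.\<close>

lemma bilinear_bracket_exists:
  assumes "real_lie_algebra g br" "finite_dimensional g"
  obtains br' where "fd_lie g br'" "\<And>x y. x \<in> g \<Longrightarrow> y \<in> g \<Longrightarrow> br x y = br' x y"
proof -
  interpret real_lie_algebra g br by fact
  obtain U q where q: "subspace U" "linear q" "\<And>w. w \<in> g \<Longrightarrow> q w = 0" "\<And>v. v - q v \<in> g"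
    by (rule complement_projection[OF subspace subset_UNIV subspace_UNIV]) blast
  define \<pi> where "\<pi> x = x - q x" for x
  have \<pi>: "linear \<pi>" "\<And>x. \<pi> x \<in> g" "\<And>x. x \<in> g \<Longrightarrow> \<pi> x = x"
    unfolding \<pi>_def using linear_compose_sub[OF linear_ident q(2)] q(3,4) by simp_all
  have "fd_lie g (\<lambda>x y. br (\<pi> x) (\<pi> y))"
  proof (intro fd_lie.intro fd_lie_axioms.intro assms(2))
    show "real_lie_algebra g (\<lambda>x y. br (\<pi> x) (\<pi> y))"
      by unfold_locales
        (simp_all add: subspace \<pi>(2,3) closed add_left add_right scale_left scale_right alternating jacobi
          linear_add[OF \<pi>(1)] linear_scale[OF \<pi>(1)])
    show "linear (\<lambda>x. br (\<pi> x) (\<pi> y))" "linear (\<lambda>y. br (\<pi> x) (\<pi> y))" for x y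
      by (auto intro!: linearI simp: linear_add[OF \<pi>(1)] linear_scale[OF \<pi>(1)] \<pi>(2) add_left add_right scale_left scale_right)
  qed
  then show ?thesis using that \<pi>(3) by simp
qed

theorem theorem4p3:
  fixes g k :: "'a::real_vector set" and br :: "'a \<Rightarrow> 'a \<Rightarrow> 'a"
  assumes "real_lie_algebra g br"
    and "finite_dimensional g"
    and "g \<noteq> {0}"
    and "k = derived_algebra br g"
  shows "two_three_trivial br g \<longleftrightarrow>
    solvable_lie br g \<and>
    nilpotent_lie br k \<and> dim g = dim k + 1 \<and>
    invariant_cohomology br g k 1 = {null_class br k 1} \<and>
    invariant_cohomology br g k 2 = {null_class br k 2} \<and>
    invariant_cohomology br g k 3 = {null_class br k 3}"
proof -
  interpret real_lie_algebra g br by fact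
  obtain br' where lie: "fd_lie g br'" and br': "\<And>x y. x \<in> g \<Longrightarrow> y \<in> g \<Longrightarrow> br x y = br' x y"
    by (rule bilinear_bracket_exists[OF assms(1,2)]) blast
  have D: "(derived_algebra br ^^ n) g = (derived_algebra br' ^^ n) g \<and> (derived_algebra br ^^ n) g \<subseteq> g" for n
    by (rule derived_series_cong[OF br' closed subspace])
  have k: "k = derived_algebra br' g" using conjunct1[OF D[of 1]] by (simp add: assms(4))
  have kg: "k \<subseteq> g" using conjunct2[OF D[of 1]] by (simp add: assms(4))
  have brk: "br x y = br' x y" if "x \<in> k" "y \<in> k" for x y using br' kg that by blast
  have k_closed: "br x y \<in> k" if "x \<in> k" "y \<in> k" for x y
    using bracket_in_span[of x g y g br] kg that unfolding assms(4) derived_algebra_def by blast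
  have sk: "subspace k" by (simp add: assms(4) derived_algebra_def subspace_bracket_span)
  have "solvable_lie br g \<longleftrightarrow> solvable_lie br' g" unfolding solvable_lie_def using D by metis
  moreover have "nilpotent_lie br k \<longleftrightarrow> nilpotent_lie br' k" by (rule nilpotent_lie_cong[OF brk k_closed sk])
  moreover have "two_three_trivial br g \<longleftrightarrow> two_three_trivial br' g"
    unfolding two_three_trivial_def betti_def by (simp only: cocycles_cong[of g br br', OF br'])
  ultimately show ?thesis
    using fd_lie.two_three_trivial_iff[OF lie assms(3)] invariant_cohomology_cong[OF br' kg]
    unfolding k[symmetric] by simp
qed

end
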